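(* Assume $\eta<r_a$ and let $\{\varepsilon_n\}$ be a sequence of positive numbers converging to $0$. Then there exist $T>0$, a subsequence $\{\varepsilon_{n'}\}$ of $\{\varepsilon_n\}$, and an $N$-solution $\mu$ of the LS equation on $[0,T]$ with mass $m$ (with initial data $u^{\rm in},\mu^{\rm in}$), such that $f^{\varepsilon_{n'}}\rightharpoonup\mu$ as $n'\to+\infty$ in weak-$*$-$L^\infty(0,T;\mathcal M_f([0,+\infty)))$, where the nucleation rate is, for all $u\ge 0$, $$N(u)=0 .$$
   Context: **Rescaled Becker–Döring (BD) system.** Fix $\eta\ge 0$. For each $\varepsilon>0$ let $\alpha^\varepsilon,\beta^\varepsilon,(a_i^\varepsilon)_{i\ge2},(b_i^\varepsilon)_{i\ge3}$ be positive numbers for which there is a constant $K(\varepsilon)>0$ with $a_{i+1}^\varepsilon-a_i^\varepsilon\le K(\varepsilon)$ ($i\ge2$) and $b_i^\varepsilon-b_{i+1}^\varepsilon\le K(\varepsilon)$ ($i\ge3$). Let $u^\varepsilon$ and $(c_i^\varepsilon)_{i\ge2}$ be non-negative functions in $\mathcal C([0,+\infty))$ forming a global solution of $$\frac{d}{dt}u^\varepsilon=-\varepsilon J_1^\varepsilon-\varepsilon\sum_{i\ge1}J_i^\varepsilon,\qquad \frac{d}{dt}c_i^\varepsilon=\frac1\varepsilon\big[J_{i-1}^\varepsilon-J_i^\varepsilon\big]\quad(i\ge2),$$ $$J_1^\varepsilon=\alpha^\varepsilon(u^\varepsilon)^2-\varepsilon^\eta\beta^\varepsilon c_2^\varepsilon,\qquad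 J_i^\varepsilon=a_i^\varepsilon u^\varepsilon c_i^\varepsilon-b_{i+1}^\varepsilon c_{i+1}^\varepsilon\quad(i\ge2),$$ with non-negative initial data $u^{{\rm in},\varepsilon},(c_i^{{\rm in},\varepsilon})_{i\ge2}$, and satisfying the mass balance $u^\varepsilon(t)+\sum_{i\ge2}\varepsilon^2 i\,c_i^\varepsilon(t)=m^\varepsilon$ for all $t\ge0$, with $m^\varepsilon<\infty$ constant. Put $\Lambda_i^\varepsilon=[(i-\frac12)\varepsilon,(i+\frac12)\varepsilon)$ and $$f^\varepsilon(t,x)=\sum_{i\ge2}c_i^\varepsilon(t)\mathbf 1_{\Lambda_i^\varepsilon}(x),\quad f^{{\rm in},\varepsilon}=f^\varepsilon(0,\cdot),\quad a^\varepsilon(x)=\sum_{i\ge2}a_i^\varepsilon\mathbf 1_{\Lambda_i^\varepsilon}(x),\quad b^\varepsilon(x)=\sum_{i\ge3}b_i^\varepsilon\mathbf 1_{\Lambda_i^\varepsilon}(x).$$ **Assumptions on the rates.** $\alpha,\beta>0$; $a,b$ are non-negative continuous functions on $[0,+\infty)$, positive on $(0,+\infty)$. As $\varepsilon\to0$: $\alpha^\varepsilon\to\alpha$, $\beta^\varepsilon\to\beta$, and $a^\varepsilon\to a$, $b^\varepsilon\to b$ uniformly on compact subsets of $[0,+\infty)$. There are $K_a,K_b>0$ with $a^\varepsilon(x)\le K_a(1+x)$ and $b^\varepsilon(x)\le K_b(1+x)$ for all $x\ge0$, $\varepsilon>0$. There are $r_a\in[0,1)$, $r_b\ge r_a$,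 $\overline a>0$, $\overline b>0$ with $a(x)\sim_{0^+}\overline a x^{r_a}$, $b(x)\sim_{0^+}\overline b x^{r_b}$, and $a^\varepsilon(\varepsilon i)=a(\varepsilon i)+o((\varepsilon i)^{r_a})$, $b^\varepsilon(\varepsilon i)=b(\varepsilon i)+o((\varepsilon i)^{r_b})$, where the Landau symbol refers to $\varepsilon i\to0$ ($i\ge2$ for $a$, $i\ge3$ for $b$). Set $\rho:=\lim_{x\to0^+}b(x)/a(x)=\lim_{x\to 0^+}\frac{\overline b}{\overline a}x^{r_b-r_a}\in[0,+\infty)$. **Assumptions on the initial data.** $\mathcal M_f(U)$ is the set of non-negative finite regular Borel measures on $U$, with the weak-$*$ topology: $\nu^n\to\nu$ iff $\int\varphi\,d\nu^n\to\int\varphi\,d\nu$ for all $\varphi\in\mathcal C_c(U)$; a density $f$ is identified with $f(x)dx$. There are $u^{\rm in}>\rho$ and $\mu^{\rm in}\in\mathcal M_f([0,+\infty))$ such that, as $\varepsilon\to0$, $u^{{\rm in},\varepsilon}\to u^{\rm in}$ and $f^{{\rm in},\varepsilon}\to\mu^{\rm in}$ weak-$*$ in $\mathcal M_f([0,+\infty))$. Let $\mathcal U$ be the set of non-negative convex functions $\Phi\in\mathcal C^1([0,+\infty))$, piecewise $\mathcal C^2$, with $\Phi(0)=0$, $\Phi'$ concave, $\Phi'(0)\ge0$, $\Phi(x)/x\to+\infty$ as $x\to+\infty$. There is $\Phi\in\mathcal U$ with $\sup_{\varepsilon>0}\int_0^\infty\Phi(x)f^{{\rm in},\varepsilon}(x)dx<\infty$.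 For all $z\in(0,1)$, $\sup_{\varepsilon>0}\sum_{i\ge2}\varepsilon^{r_a}c_i^{{\rm in},\varepsilon}e^{-iz}<\infty$. Set $m:=u^{\rm in}+\int_0^\infty x\,\mu^{\rm in}(dx)$. **$N$-solution.** Given $T>0$ and a function $N\in L^\infty_{loc}(\mathbb R_+)$ (nucleation rate), $\mu\in L^\infty([0,T];\mathcal M_f([0,+\infty)))$ is an $N$-solution of the LS equation (in measure) on $[0,T]$ with mass $m$ if: (i) there is a non-negative $u\in\mathcal C([0,T])$ with $u(0)=u^{\rm in}$, $\inf_{[0,T]}u>\rho$, and $u(t)+\int_0^\infty x\,\mu_t(dx)=m$ for all $t\in[0,T]$ (for a suitable representative of $\mu$); (ii) for all $\varphi\in\mathcal C^1_c([0,T)\times[0,+\infty))$, $$\int_0^T\!\!\int_0^\infty\big[\partial_t\varphi(t,x)+(a(x)u(t)-b(x))\partial_x\varphi(t,x)\big]\mu_t(dx)\,dt+\int_0^\infty\varphi(0,x)\mu^{\rm in}(dx)+\int_0^T\varphi(s,0)N(u(s))\,ds=0.$$ The weak-$*$ topology on $L^\infty(0,T;\mathcal M_f([0,+\infty)))$ is the topology of pointwise convergence against test functions in $L^1(0,T;\mathcal C_c([0,+\infty)))$. *)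

theory Defs
  imports "HOL-Analysis.Analysis" "HOL-Library.Landau_Symbols"
begin

definition cell :: "real \<Rightarrow> nat \<Rightarrow> real set" where
  "cell \<epsilon> i = {(real i - 1/2) * \<epsilon> ..< (real i + 1/2) * \<epsilon>}"

text \<open>For \<open>\<epsilon> > 0\<close> the cells are disjoint, so at most one term of the series is nonzero.\<close>

definition step_fun :: "nat \<Rightarrow> real \<Rightarrow> (nat \<Rightarrow> real) \<Rightarrow> real \<Rightarrow> real" where
  "step_fun k \<epsilon> c x = (\<Sum>i. c (i + k) * indicat_real (cell \<epsilon> (i + k)) x)"

text \<open>The flux is only meaningful for \<open>i \<ge> 1\<close>; \<open>u\<close> and \<open>c\<close> are the values at a given time.\<close>

definition BD_flux ::
  "real \<Rightarrow> real \<Rightarrow> real \<Rightarrow> real \<Rightarrow> (nat \<Rightarrow> real) \<Rightarrow> (nat \<Rightarrow> real) \<Rightarrow> real \<Rightarrow> (nat \<Rightarrow> real) \<Rightarrow> nat \<Rightarrow> real"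
where
  "BD_flux \<eta> \<epsilon> \<alpha> \<beta> a b u c i =
     (if i = 1 then \<alpha> * u\<^sup>2 - \<epsilon> powr \<eta> * \<beta> * c 2
      else a i * u * c i - b (i + 1) * c (i + 1))"

definition BD_solution ::
  "real \<Rightarrow> real \<Rightarrow> real \<Rightarrow> real \<Rightarrow> (nat \<Rightarrow> real) \<Rightarrow> (nat \<Rightarrow> real) \<Rightarrow>
   (real \<Rightarrow> real) \<Rightarrow> (nat \<Rightarrow> real \<Rightarrow> real) \<Rightarrow> bool"
where
  "BD_solution \<eta> \<epsilon> \<alpha> \<beta> a b u c \<longleftrightarrow>
     continuous_on {0..} u \<and> (\<forall>t\<ge>0. u t \<ge> 0) \<and>
     (\<forall>i\<ge>2. continuous_on {0..} (c i) \<and> (\<forall>t\<ge>0. c i t \<ge> 0)) \<and>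
     (\<forall>t\<ge>0. let J = BD_flux \<eta> \<epsilon> \<alpha> \<beta> a b (u t) (\<lambda>i. c i t) in
        summable (\<lambda>i. J (i + 1)) \<and>
        (u has_real_derivative (- \<epsilon> * J 1 - \<epsilon> * (\<Sum>i. J (i + 1)))) (at t within {0..}) \<and>
        (\<forall>i\<ge>2. (c i has_real_derivative (1 / \<epsilon> * (J (i - 1) - J i))) (at t within {0..})))"

definition mass_balance ::
  "real \<Rightarrow> (real \<Rightarrow> real) \<Rightarrow> (nat \<Rightarrow> real \<Rightarrow> real) \<Rightarrow> real \<Rightarrow> bool"
where
  "mass_balance \<epsilon> u c m \<longleftrightarrow>
     (\<forall>t\<ge>0. summable (\<lambda>i. \<epsilon>\<^sup>2 * real (i + 2) * c (i + 2) t) \<and>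
            u t + (\<Sum>i. \<epsilon>\<^sup>2 * real (i + 2) * c (i + 2) t) = m)"

text \<open>The filter \<open>\<epsilon> i \<rightarrow> 0\<close> on pairs \<open>(\<epsilon>, i)\<close> with \<open>\<epsilon> > 0\<close> and \<open>i \<ge> k\<close>; \<open>i\<close> need not stay bounded.\<close>

definition small_size :: "nat \<Rightarrow> (real \<times> nat) filter" where
  "small_size k =
     inf (filtercomap (\<lambda>(\<epsilon>, i). \<epsilon> * real i) (nhds 0)) (principal ({0<..} \<times> {k..}))"

text \<open>\<open>\<Phi>\<close> may have infinitely many, but locally finitely many, breakpoints.\<close>

definition U_class :: "(real \<Rightarrow> real) set" where
  "U_class = {\<Phi>. (\<forall>x\<ge>0. \<Phi> x \<ge> 0) \<and> convex_on {0..} \<Phi> \<and> \<Phi> 0 = 0 \<and>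
     (\<exists>\<Phi>'. (\<forall>x\<ge>0. (\<Phi> has_real_derivative \<Phi>' x) (at x within {0..})) \<and>
           continuous_on {0..} \<Phi>' \<and>
           (\<forall>R>0. \<Phi>' piecewise_C1_differentiable_on {0..R}) \<and>
           concave_on {0..} \<Phi>' \<and> \<Phi>' 0 \<ge> 0) \<and>
     filterlim (\<lambda>x. \<Phi> x / x) at_top at_top}"

text \<open>Finite Borel measures on the half-line; regularity is automatic on a Polish space.\<close>

definition Mf :: "real measure set" where
  "Mf = {\<nu>. sets \<nu> = sets (restrict_space borel {0::real..}) \<and> finite_measure \<nu>}"

definition density_measure :: "(real \<Rightarrow> real) \<Rightarrow> real measure" where
  "density_measure g = density (restrict_space lborel {0..}) (\<lambda>x. ennreal (g x))"

text \<open>Functions on the half-line are represented by functions on all reals whose values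
  at negative arguments are irrelevant.\<close>

definition Cc :: "(real \<Rightarrow> real) set" where
  "Cc = {g. continuous_on {0..} g \<and>
            (\<exists>K. compact K \<and> K \<subseteq> {0..} \<and> (\<forall>x\<in>{0..} - K. g x = 0))}"

definition weak_star_Mf :: "('i \<Rightarrow> real measure) \<Rightarrow> real measure \<Rightarrow> 'i filter \<Rightarrow> bool" where
  "weak_star_Mf \<nu> \<mu> F \<longleftrightarrow>
     (\<forall>\<phi>\<in>Cc. ((\<lambda>i. \<integral>x. \<phi> x \<partial>\<nu> i) \<longlongrightarrow> (\<integral>x. \<phi> x \<partial>\<mu>)) F)"

text \<open>Measurability in time is weak-* measurability, as usual for a space of measures.\<close>

definition Linf_Mf :: "real \<Rightarrow> (real \<Rightarrow> real measure) set" where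
  "Linf_Mf T = {\<mu>. (\<forall>t\<in>{0..T}. \<mu> t \<in> Mf) \<and>
     (\<forall>\<phi>\<in>Cc. (\<lambda>t. \<integral>x. \<phi> x \<partial>\<mu> t) \<in> borel_measurable (lebesgue_on {0..T})) \<and>
     (\<exists>C. AE t in lebesgue_on {0..T}. measure (\<mu> t) {0..} \<le> C)}"

definition sup_norm :: "(real \<Rightarrow> real) \<Rightarrow> real" where
  "sup_norm g = (SUP x\<in>{0..}. \<bar>g x\<bar>)"

text \<open>The Bochner space: almost everywhere a sup-norm limit of simple functions, with
  integrable norm. The library's Bochner integral requires a second countable target
  type, so this is spelled out.\<close>

definition L1_Cc :: "real \<Rightarrow> (real \<Rightarrow> real \<Rightarrow> real) set" where
  "L1_Cc T = {\<phi>. (\<forall>t\<in>{0..T}. \<phi> t \<in> Cc) \<and>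
     (\<exists>s :: nat \<Rightarrow> real \<Rightarrow> real \<Rightarrow> real.
        (\<forall>n. simple_function (lebesgue_on {0..T}) (s n) \<and> (\<forall>t\<in>{0..T}. s n t \<in> Cc)) \<and>
        (AE t in lebesgue_on {0..T}. (\<lambda>n. sup_norm (\<lambda>x. s n t x - \<phi> t x)) \<longlonglongrightarrow> 0)) \<and>
     integrable (lebesgue_on {0..T}) (\<lambda>t. sup_norm (\<phi> t))}"

definition weak_star_Linf_Mf ::
  "real \<Rightarrow> (nat \<Rightarrow> real \<Rightarrow> real measure) \<Rightarrow> (real \<Rightarrow> real measure) \<Rightarrow> bool"
where
  "weak_star_Linf_Mf T \<nu> \<mu> \<longleftrightarrow>
     (\<forall>\<phi>\<in>L1_Cc T.
        (\<lambda>n. \<integral>t. (\<integral>x. \<phi> t x \<partial>\<nu> n t) \<partial>lebesgue_on {0..T})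
          \<longlonglongrightarrow> (\<integral>t. (\<integral>x. \<phi> t x \<partial>\<mu> t) \<partial>lebesgue_on {0..T}))"

definition Linf_loc :: "(real \<Rightarrow> real) set" where
  "Linf_loc = {N. N \<in> borel_measurable (lebesgue_on {0..}) \<and>
     (\<forall>R. \<exists>C. AE x in lebesgue_on {0..R}. \<bar>N x\<bar> \<le> C)}"

text \<open>\<open>\<phi>\<close> is continuously differentiable up to the boundary and compactly supported in
  \<open>[0,T) \<times> [0,\<infinity>)\<close>, with partial derivatives \<open>\<phi>t\<close> and \<open>\<phi>x\<close> there.\<close>

definition C1c_test ::
  "real \<Rightarrow> (real \<times> real \<Rightarrow> real) \<Rightarrow> (real \<times> real \<Rightarrow> real) \<Rightarrow> (real \<times> real \<Rightarrow> real) \<Rightarrow> bool"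
where
  "C1c_test T \<phi> \<phi>t \<phi>x \<longleftrightarrow> (let D = {0..<T} \<times> {0..} in
     (\<forall>p\<in>D. (\<phi> has_derivative (\<lambda>(h, k). \<phi>t p * h + \<phi>x p * k)) (at p within D)) \<and>
     continuous_on D \<phi>t \<and> continuous_on D \<phi>x \<and>
     (\<exists>K. compact K \<and> K \<subseteq> D \<and> (\<forall>p\<in>D - K. \<phi> p = 0)))"

text \<open>Here \<open>\<mu>\<close> stands for its almost-everywhere class: the mass constraint is imposed at
  every time on some representative \<open>\<mu>'\<close>.\<close>

definition N_solution ::
  "(real \<Rightarrow> real) \<Rightarrow> (real \<Rightarrow> real) \<Rightarrow> real \<Rightarrow> real \<Rightarrow> real measure \<Rightarrow> real \<Rightarrow>
   real \<Rightarrow> (real \<Rightarrow> real) \<Rightarrow> (real \<Rightarrow> real measure) \<Rightarrow> bool"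
where
  "N_solution a b \<rho> uin \<mu>in m T N \<mu> \<longleftrightarrow>
     T > 0 \<and> N \<in> Linf_loc \<and> \<mu> \<in> Linf_Mf T \<and>
     (\<exists>u. continuous_on {0..T} u \<and> (\<forall>t\<in>{0..T}. u t \<ge> 0) \<and> u 0 = uin \<and>
        (INF t\<in>{0..T}. u t) > \<rho> \<and>
        (\<exists>\<mu>'. (AE t in lebesgue_on {0..T}. \<mu>' t = \<mu> t) \<and>
           (\<forall>t\<in>{0..T}. \<mu>' t \<in> Mf \<and> integrable (\<mu>' t) (\<lambda>x. x) \<and>
                       u t + (\<integral>x. x \<partial>\<mu>' t) = m)) \<and>
        (\<forall>\<phi> \<phi>t \<phi>x. C1c_test T \<phi> \<phi>t \<phi>x \<longrightarrow>
           (\<integral>t. (\<integral>x. \<phi>t (t, x) + (a x * u t - b x) * \<phi>x (t, x) \<partial>\<mu> t) \<partial>lebesgue_on {0..T})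
           + (\<integral>x. \<phi> (0, x) \<partial>\<mu>in)
           + (\<integral>s. \<phi> (s, 0) * N (u s) \<partial>lebesgue_on {0..T}) = 0))"

end

theory Submission
  imports Defs "HOL-Probability.Helly_Selection" "HOL-Complex_Analysis.Great_Picard" "HOL-Real_Asymp.Real_Asymp"
begin

text \<open>
  Give the dimers the detachment rate \<open>\<epsilon> powr \<eta> * \<beta>\<close>, written \<open>back_rate 2\<close> below, so that all
  fluxes have the same form. Summation by parts then shows that a weighted number of clusters
  \<open>\<Sum>i. \<epsilon> * \<phi> i * c i\<close> is the time integral of

    \<open>\<phi> 2 * \<alpha> * u\<^sup>2 + (\<Sum>i. c i * ((\<phi> (i + 1) - \<phi> i) * a i * u - (\<phi> i - \<phi> (i - 1)) * back_rate i))\<close>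

  up to its initial value, if \<open>\<phi> 1 = 0\<close> and the increments of \<open>\<phi>\<close> are bounded (\<open>weak_form\<close>). All estimates come from a choice of \<open>\<phi>\<close>.

  A weight of superlinear growth bounds number and mass of the clusters uniformly in \<open>\<epsilon>\<close> and
  makes the mass carried by large clusters uniformly small (\<open>lyapunov_bound\<close>). It follows that \<open>u\<close>
  is Lipschitz in time uniformly in \<open>\<epsilon>\<close>, so that it stays above some \<open>v > \<rho>\<close> on a short
  interval \<open>[0, T]\<close>.

  The nucleation rate vanishes because dimers break up faster than they grow. At small sizes \<open>b i\<close>
  is at most slightly more than \<open>\<rho> * a i\<close>, so growth dominates as long as \<open>u \<ge> v\<close>, and clusters
  that are already there leave the smallest sizes. The weight \<open>exp (- i * z)\<close> sees this: for small \<open>z\<close>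
  growth and detachment within the range of sizes lower its moment, up to an exponentially small
  error, and the moment starts at order \<open>\<epsilon> powr (1 - ra)\<close>. Taken over all \<open>i \<ge> 2\<close>, it shows that
  not many more dimers can break up than are formed, and this bounds the time integral of
  \<open>\<epsilon> powr \<eta> * c 2\<close>.
  Hence the integral of the growth term \<open>a 2 * u * c 2\<close> is of order \<open>\<epsilon> powr (ra - \<eta>)\<close>, which tends
  to zero because \<open>\<eta> < ra\<close>. Taken over \<open>i \<ge> 3\<close>, the same moment then shows that the integral of \<open>b 3 * c 3\<close>
  tends to zero too (\<open>dimer_integral_bounds\<close>). In the limit nothing enters or leaves the range
  \<open>i \<ge> 3\<close> through its lower end.

  For the compactness, the clusters with \<open>i \<ge> 3\<close> are viewed as atoms of mass \<open>\<epsilon> * c i\<close> at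
  \<open>\<epsilon> * i\<close>. Integrals of Lipschitz functions against these measures are Lipschitz in time up to
  the vanishing flux above. A diagonal argument over rational times and a countable dense family
  of functions gives a subsequence that converges at every time, and Helly's theorem gives the
  limits as measures (\<open>convergent_subsequence\<close>, \<open>limit_measure\<close>). As \<open>u\<close> converges at every
  time as well, the weak form passes to the limit by dominated convergence (\<open>weak_equation\<close>), and
  the mass relation does by the uniform control of large clusters (\<open>limit_mass\<close>). The step
  functions differ from the atoms by the dimers, whose mass \<open>\<epsilon> * c 2\<close> tends to zero for almost
  every time along a further subsequence.
\<close>

section \<open>The rescaled system and its weak form\<close>

lemma flux_summation_by_parts:
  fixes \<phi> g l :: "nat \<Rightarrow> real"
  assumes "\<phi> 1 = 0"
  shows "(\<Sum>i<n. \<phi> (i+2) * ((g (i+1) - l (i+2)) - (g (i+2) - l (i+3)))) =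
     \<phi> 2 * g 1 + (\<Sum>i<n. (\<phi> (i+3) - \<phi> (i+2)) * g (i+2) - (\<phi> (i+2) - \<phi> (i+1)) * l (i+2))
       - \<phi> (n+2) * g (n+1) + \<phi> (n+1) * l (n+2)"
proof (induction n)
  case 0
  show ?case using assms by (simp add: numeral_2_eq_2)
next
  case (Suc n)
  have e: "Suc n + 2 = n + 3" "Suc n + 1 = n + 2" by auto
  show ?case unfolding sum.lessThan_Suc Suc.IH e by (simp add: algebra_simps)
qed

text \<open>It varies only where \<open>i\<close> is of order \<open>N\<close>, with increments of order \<open>1 / N\<close>. Multiplication by it
  therefore keeps the increments of a weight of linear growth bounded, uniformly in \<open>N\<close>.\<close>
definition cutoff :: "nat \<Rightarrow> nat \<Rightarrow> real" where
  "cutoff N i = max 0 (min 1 (2 - real i / real N))"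

lemma cutoff_facts:
  assumes "N > 0"
  shows "0 \<le> cutoff N i" "cutoff N i \<le> 1" "i \<le> N \<Longrightarrow> cutoff N i = 1" "2 * N \<le> i \<Longrightarrow> cutoff N i = 0"
    "\<bar>cutoff N (i + 1) - cutoff N i\<bar> \<le> 1 / real N"
    "\<bar>real i * (cutoff N (i + 1) - cutoff N i)\<bar> \<le> 2"
proof -
  show "0 \<le> cutoff N i" "cutoff N i \<le> 1" by (auto simp: cutoff_def)
  show "i \<le> N \<Longrightarrow> cutoff N i = 1" using assms by (auto simp: cutoff_def field_simps)
  show z: "cutoff N i = 0" if "2 * N \<le> i" for i
  proof -
    have "2 * real N \<le> real i" using that by (metis of_nat_le_iff of_nat_mult of_nat_numeral)
    hence "real i / real N \<ge> 2" using assms by (simp add: field_simps)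
    thus ?thesis by (simp add: cutoff_def)
  qed
  have eq: "real (i + 1) / real N = real i / real N + 1 / real N" by (simp add: add_divide_distrib)
  have p: "1 / real N \<ge> 0" by simp
  show d: "\<bar>cutoff N (i + 1) - cutoff N i\<bar> \<le> 1 / real N"
  proof -
    have "\<bar>max 0 (min 1 (2 - (x + y))) - max 0 (min 1 (2 - x))\<bar> \<le> y" if "0 \<le> y" for x y :: real
      using that by linarith
    from this[OF p] show ?thesis unfolding cutoff_def eq .
  qed
  show "\<bar>real i * (cutoff N (i + 1) - cutoff N i)\<bar> \<le> 2"
  proof (cases "2 * N \<le> i")
    case True
    then show ?thesis using z[of i] z[of "i+1"] by simp
  next
    case False
    have "\<bar>real i * (cutoff N (i + 1) - cutoff N i)\<bar> = real i * \<bar>cutoff N (i + 1) - cutoff N i\<bar>"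
      by (simp add: abs_mult)
    also have "\<dots> \<le> real i * (1 / real N)" by (intro mult_left_mono d) auto
    also have "\<dots> \<le> 2"
    proof -
      have "real i \<le> 2 * real N" using False
        by (metis nat_le_linear of_nat_le_iff of_nat_mult of_nat_numeral)
      thus ?thesis using assms by (simp add: field_simps)
    qed
    finally show ?thesis .
  qed
qed

text \<open>One solution for a fixed \<open>\<epsilon>\<close>. The bounds on the rates are those that the step functions of the
  rates satisfy at the nodes \<open>\<epsilon> * i\<close>.\<close>
locale bd_system =
  fixes \<eta> \<epsilon> \<alpha> \<beta> :: real and a b :: "nat \<Rightarrow> real"
    and u :: "real \<Rightarrow> real" and c :: "nat \<Rightarrow> real \<Rightarrow> real" and m Ka Kb :: real
  assumes eps_pos: "0 < \<epsilon>" and alpha_pos: "0 < \<alpha>" and beta_pos: "0 < \<beta>"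
    and Ka_nonneg: "0 \<le> Ka" and Kb_nonneg: "0 \<le> Kb"
    and a_nonneg: "2 \<le> i \<Longrightarrow> 0 \<le> a i" and a_le: "2 \<le> i \<Longrightarrow> a i \<le> Ka * (1 + \<epsilon> * real i)"
    and b_nonneg: "3 \<le> i \<Longrightarrow> 0 \<le> b i" and b_le: "3 \<le> i \<Longrightarrow> b i \<le> Kb * (1 + \<epsilon> * real i)"
    and solution: "BD_solution \<eta> \<epsilon> \<alpha> \<beta> a b u c"
    and balance: "mass_balance \<epsilon> u c m"
begin

definition back_rate :: "nat \<Rightarrow> real" where
  "back_rate i = (if i = 2 then \<epsilon> powr \<eta> * \<beta> else b i)"

text \<open>The change that one cluster of size \<open>i\<close> makes to a weighted sum per unit of time, by growing to
  \<open>i + 1\<close> or shrinking to \<open>i - 1\<close>. A dimer that breaks up disappears, which is why weights are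
  required to vanish at size one.\<close>
definition drift :: "(nat \<Rightarrow> real \<Rightarrow> real) \<Rightarrow> real \<Rightarrow> nat \<Rightarrow> real" where
  "drift \<phi> t i = (\<phi> (i + 1) t - \<phi> i t) * a i * u t - (\<phi> i t - \<phi> (i - 1) t) * back_rate i"

definition moment :: "(nat \<Rightarrow> real \<Rightarrow> real) \<Rightarrow> real \<Rightarrow> real" where
  "moment \<phi> t = (\<Sum>i. \<epsilon> * \<phi> (i + 2) t * c (i + 2) t)"

text \<open>The time derivative of \<open>moment \<phi>\<close>, where \<open>\<phi>'\<close> stands for the time derivative of the weight.\<close>
definition rate :: "(nat \<Rightarrow> real \<Rightarrow> real) \<Rightarrow> (nat \<Rightarrow> real \<Rightarrow> real) \<Rightarrow> real \<Rightarrow> real" where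
  "rate \<phi> \<phi>' t = \<phi> 2 t * (\<alpha> * (u t)\<^sup>2) +
     (\<Sum>i. \<epsilon> * \<phi>' (i + 2) t * c (i + 2) t + c (i + 2) t * drift \<phi> t (i + 2))"

lemma back_rate_nonneg: "2 \<le> i \<Longrightarrow> 0 \<le> back_rate i"
  using b_nonneg[of i] beta_pos by (auto simp: back_rate_def)

lemma u_nonneg: "0 \<le> t \<Longrightarrow> 0 \<le> u t"
  using solution by (auto simp: BD_solution_def)

lemma c_nonneg: "0 \<le> t \<Longrightarrow> 2 \<le> i \<Longrightarrow> 0 \<le> c i t"
  using solution by (auto simp: BD_solution_def)

lemma u_continuous: "continuous_on {0..} u"
  using solution by (auto simp: BD_solution_def)

lemma c_continuous: "2 \<le> i \<Longrightarrow> continuous_on {0..} (c i)"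
  using solution by (auto simp: BD_solution_def)

lemma mass_summable: "0 \<le> t \<Longrightarrow> summable (\<lambda>i. \<epsilon>\<^sup>2 * real (i + 2) * c (i + 2) t)"
  using balance by (auto simp: mass_balance_def)

lemma mass_eq: "0 \<le> t \<Longrightarrow> u t + (\<Sum>i. \<epsilon>\<^sup>2 * real (i + 2) * c (i + 2) t) = m"
  using balance by (auto simp: mass_balance_def)

lemma mass_term_nonneg: "0 \<le> t \<Longrightarrow> 0 \<le> \<epsilon>\<^sup>2 * real (i + 2) * c (i + 2) t"
  using c_nonneg[of t "i+2"] by auto

lemma mass_le: "0 \<le> t \<Longrightarrow> (\<Sum>i. \<epsilon>\<^sup>2 * real (i + 2) * c (i + 2) t) \<le> m"
  using mass_eq[of t] u_nonneg[of t] by linarith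

lemma u_le: "0 \<le> t \<Longrightarrow> u t \<le> m"
  using mass_eq[of t] suminf_nonneg[OF mass_summable mass_term_nonneg, of t] by linarith

lemma m_nonneg: "0 \<le> m"
  using u_le[of 0] u_nonneg[of 0] by simp

text \<open>Conservation of mass is the only a priori bound at fixed \<open>\<epsilon>\<close>; it controls every series whose
  terms grow at most like \<open>i * c i\<close>.\<close>
lemma summable_linear:
  assumes "0 \<le> t" and D0: "0 \<le> D" and le0: "\<And>i. \<bar>w i\<bar> \<le> D * real (i + 2) * c (i + 2) t"
  shows "summable w" "\<bar>\<Sum>i. w i\<bar> \<le> D / \<epsilon>\<^sup>2 * m"
proof -
  have s: "summable (\<lambda>i. D / \<epsilon>\<^sup>2 * (\<epsilon>\<^sup>2 * real (i + 2) * c (i + 2) t))"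
    by (intro summable_mult mass_summable assms)
  have le: "norm (w i) \<le> D / \<epsilon>\<^sup>2 * (\<epsilon>\<^sup>2 * real (i + 2) * c (i + 2) t)" for i
    using le0[of i] eps_pos by simp
  show "summable w" by (rule summable_comparison_test'[OF s le])
  show "\<bar>\<Sum>i. w i\<bar> \<le> D / \<epsilon>\<^sup>2 * m"
  proof -
    have "norm (\<Sum>i. w i) \<le> (\<Sum>i. D / \<epsilon>\<^sup>2 * (\<epsilon>\<^sup>2 * real (i + 2) * c (i + 2) t))"
      by (rule norm_suminf_le[OF le s])
    also have "\<dots> = D / \<epsilon>\<^sup>2 * (\<Sum>i. \<epsilon>\<^sup>2 * real (i + 2) * c (i + 2) t)"
      by (rule suminf_mult[OF mass_summable[OF assms(1)]])
    also have "\<dots> \<le> D / \<epsilon>\<^sup>2 * m" using D0 mass_le[OF assms(1)] by (intro mult_left_mono) auto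
    finally show ?thesis by simp
  qed
qed

lemma drift_bound:
  assumes t: "0 \<le> t" and L: "0 \<le> L" and \<phi>: "\<And>i. 1 \<le> i \<Longrightarrow> \<bar>\<phi> (i + 1) t - \<phi> i t\<bar> \<le> L" and i: "2 \<le> i"
  shows "\<bar>c i t * drift \<phi> t i\<bar> \<le> L * ((Ka * m + Kb) * (1 + \<epsilon>) + \<epsilon> powr \<eta> * \<beta>) * real i * c i t"
proof -
  have lin: "1 + \<epsilon> * real i \<le> (1 + \<epsilon>) * real i" using i eps_pos by (simp add: algebra_simps)
  have a1: "\<bar>a i * u t\<bar> \<le> Ka * m * (1 + \<epsilon> * real i)"
  proof -
    have "a i * u t \<le> Ka * (1 + \<epsilon> * real i) * m"
      using a_le[OF i] a_nonneg[OF i] u_le[OF t] u_nonneg[OF t] eps_pos Ka_nonneg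
      by (intro mult_mono) auto
    thus ?thesis using a_nonneg[OF i] u_nonneg[OF t] by (simp add: mult_ac)
  qed
  have b1: "\<bar>back_rate i\<bar> \<le> Kb * (1 + \<epsilon> * real i) + \<epsilon> powr \<eta> * \<beta>"
  proof (cases "i = 2")
    case True
    then show ?thesis using beta_pos eps_pos Kb_nonneg by (auto simp: back_rate_def)
  next
    case False
    then have "back_rate i \<le> Kb * (1 + \<epsilon> * real i)" "0 \<le> back_rate i"
      using b_le[of i] i b_nonneg[of i] by (auto simp: back_rate_def)
    moreover have "0 \<le> \<epsilon> powr \<eta> * \<beta>" using beta_pos by auto
    ultimately show ?thesis by auto
  qed
  have p1: "\<bar>\<phi> (i + 1) t - \<phi> i t\<bar> \<le> L" using \<phi>[of i] i by auto
  have p2: "\<bar>\<phi> i t - \<phi> (i - 1) t\<bar> \<le> L" using \<phi>[of "i - 1"] i by (auto simp: numeral_2_eq_2)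
  have "\<bar>drift \<phi> t i\<bar> \<le> \<bar>\<phi> (i + 1) t - \<phi> i t\<bar> * \<bar>a i * u t\<bar> + \<bar>\<phi> i t - \<phi> (i - 1) t\<bar> * \<bar>back_rate i\<bar>"
    unfolding drift_def abs_mult[symmetric] mult.assoc by (rule abs_triangle_ineq4)
  also have "\<dots> \<le> L * (Ka * m * (1 + \<epsilon> * real i)) + L * (Kb * (1 + \<epsilon> * real i) + \<epsilon> powr \<eta> * \<beta>)"
    using p1 p2 a1 b1 L by (intro add_mono mult_mono) auto
  also have "\<dots> = L * ((Ka * m + Kb) * (1 + \<epsilon> * real i) + \<epsilon> powr \<eta> * \<beta>)" by (simp add: algebra_simps)
  also have "\<dots> \<le> L * ((Ka * m + Kb) * ((1 + \<epsilon>) * real i) + \<epsilon> powr \<eta> * \<beta> * real i)"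
  proof -
    have "\<epsilon> powr \<eta> * \<beta> * 1 \<le> \<epsilon> powr \<eta> * \<beta> * real i" using i beta_pos by (intro mult_left_mono) auto
    thus ?thesis using lin L Ka_nonneg Kb_nonneg m_nonneg by (intro mult_left_mono add_mono) auto
  qed
  finally have "\<bar>drift \<phi> t i\<bar> \<le> L * ((Ka * m + Kb) * (1 + \<epsilon>) + \<epsilon> powr \<eta> * \<beta>) * real i"
    by (simp add: algebra_simps)
  then have "\<bar>c i t\<bar> * \<bar>drift \<phi> t i\<bar> \<le> c i t * (L * ((Ka * m + Kb) * (1 + \<epsilon>) + \<epsilon> powr \<eta> * \<beta>) * real i)"
    using c_nonneg[OF t i] by (intro mult_mono) auto
  then show ?thesis by (simp add: abs_mult mult_ac)
qed

lemma c_deriv: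
  assumes t: "0 \<le> t" and i: "2 \<le> i" and S: "S \<subseteq> {0..}"
  shows "(c i has_real_derivative
     (1 / \<epsilon> * (((if i = 2 then \<alpha> * (u t)\<^sup>2 else a (i - 1) * u t * c (i - 1) t) - back_rate i * c i t) -
        (a i * u t * c i t - back_rate (i + 1) * c (i + 1) t)))) (at t within S)"
proof -
  have "(c i has_real_derivative (1 / \<epsilon> * (BD_flux \<eta> \<epsilon> \<alpha> \<beta> a b (u t) (\<lambda>i. c i t) (i - 1)
      - BD_flux \<eta> \<epsilon> \<alpha> \<beta> a b (u t) (\<lambda>i. c i t) i))) (at t within {0..})"
    using solution t i by (auto simp: BD_solution_def Let_def)
  hence "(c i has_real_derivative (1 / \<epsilon> * (BD_flux \<eta> \<epsilon> \<alpha> \<beta> a b (u t) (\<lambda>i. c i t) (i - 1)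
      - BD_flux \<eta> \<epsilon> \<alpha> \<beta> a b (u t) (\<lambda>i. c i t) i))) (at t within S)"
    by (rule DERIV_subset[OF _ S])
  moreover have "BD_flux \<eta> \<epsilon> \<alpha> \<beta> a b (u t) (\<lambda>i. c i t) (i - 1) =
      (if i = 2 then \<alpha> * (u t)\<^sup>2 else a (i - 1) * u t * c (i - 1) t) - back_rate i * c i t"
    using i by (auto simp: BD_flux_def back_rate_def numeral_2_eq_2)
  moreover have "BD_flux \<eta> \<epsilon> \<alpha> \<beta> a b (u t) (\<lambda>i. c i t) i = a i * u t * c i t - back_rate (i + 1) * c (i + 1) t"
    using i by (auto simp: BD_flux_def back_rate_def)
  ultimately show ?thesis by simp
qed

lemma weak_form_finite:
  assumes st: "0 \<le> s" "s \<le> T"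
    and one: "\<And>t. t \<in> {s..T} \<Longrightarrow> \<phi> 1 t = 0"
    and der: "\<And>t i. t \<in> {s..T} \<Longrightarrow> 2 \<le> i \<Longrightarrow> (\<phi> i has_real_derivative \<phi>' i t) (at t within {s..T})"
    and fin: "\<And>t i. n < i \<Longrightarrow> \<phi> i t = 0" "\<And>t i. n < i \<Longrightarrow> \<phi>' i t = 0"
  shows "(rate \<phi> \<phi>' has_integral (moment \<phi> T - moment \<phi> s)) {s..T}"
proof -
  define F where "F t = (\<Sum>i<n. \<epsilon> * \<phi> (i + 2) t * c (i + 2) t)" for t
  have mom: "moment \<phi> t = F t" for t
    unfolding moment_def F_def by (rule suminf_finite) (auto simp: fin)
  have "(F has_real_derivative rate \<phi> \<phi>' t) (at t within {s..T})" if t: "t \<in> {s..T}" for t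
  proof -
    have t0: "0 \<le> t" using t st by auto
    define g where "g i = (if i = 1 then \<alpha> * (u t)\<^sup>2 else a i * u t * c i t)" for i
    define l where "l i = back_rate i * c i t" for i
    have "(c (i+2) has_real_derivative (1 / \<epsilon> * ((g (i+1) - l (i+2)) - (g (i+2) - l (i+3))))) (at t within {s..T})" for i
    proof -
      have e: "i + 2 + 1 = i + 3" "i + 2 - 1 = i + 1" by auto
      show ?thesis using c_deriv[OF t0, of "i+2" "{s..T}"] st unfolding e g_def l_def by (cases i) auto
    qed
    hence "(F has_real_derivative (\<Sum>i<n. \<epsilon> * \<phi>' (i + 2) t * c (i + 2) t +
        \<epsilon> * \<phi> (i + 2) t * (1 / \<epsilon> * ((g (i+1) - l (i+2)) - (g (i+2) - l (i+3)))))) (at t within {s..T})"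
      unfolding F_def by (auto intro!: derivative_eq_intros der t simp: algebra_simps)
    moreover have "(\<Sum>i<n. \<epsilon> * \<phi>' (i + 2) t * c (i + 2) t +
        \<epsilon> * \<phi> (i + 2) t * (1 / \<epsilon> * ((g (i+1) - l (i+2)) - (g (i+2) - l (i+3))))) = rate \<phi> \<phi>' t"
    proof -
      have "(\<Sum>i<n. \<epsilon> * \<phi>' (i + 2) t * c (i + 2) t +
        \<epsilon> * \<phi> (i + 2) t * (1 / \<epsilon> * ((g (i+1) - l (i+2)) - (g (i+2) - l (i+3))))) =
        (\<Sum>i<n. \<epsilon> * \<phi>' (i + 2) t * c (i + 2) t) + (\<Sum>i<n. \<phi> (i + 2) t * ((g (i+1) - l (i+2)) - (g (i+2) - l (i+3))))"
        using eps_pos by (simp add: sum.distrib)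
      also have "(\<Sum>i<n. \<phi> (i + 2) t * ((g (i+1) - l (i+2)) - (g (i+2) - l (i+3)))) =
         \<phi> 2 t * g 1 + (\<Sum>i<n. (\<phi> (i+3) t - \<phi> (i+2) t) * g (i+2) - (\<phi> (i+2) t - \<phi> (i+1) t) * l (i+2))"
        using flux_summation_by_parts[of "\<lambda>i. \<phi> i t" g l n] one[OF t] fin by simp
      also have "(\<Sum>i<n. (\<phi> (i+3) t - \<phi> (i+2) t) * g (i+2) - (\<phi> (i+2) t - \<phi> (i+1) t) * l (i+2)) =
         (\<Sum>i<n. c (i + 2) t * drift \<phi> t (i + 2))"
      proof (intro sum.cong refl)
        fix i :: nat
        have e: "i + 2 + 1 = i + 3" "i + 2 - 1 = i + 1" by auto
        show "(\<phi> (i+3) t - \<phi> (i+2) t) * g (i+2) - (\<phi> (i+2) t - \<phi> (i+1) t) * l (i+2) = c (i + 2) t * drift \<phi> t (i + 2)"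
          unfolding drift_def e g_def l_def by (simp add: algebra_simps)
      qed
      also have "(\<Sum>i<n. \<epsilon> * \<phi>' (i + 2) t * c (i + 2) t) + (\<phi> 2 t * g 1 + (\<Sum>i<n. c (i + 2) t * drift \<phi> t (i + 2))) =
         \<phi> 2 t * g 1 + (\<Sum>i<n. \<epsilon> * \<phi>' (i + 2) t * c (i + 2) t + c (i + 2) t * drift \<phi> t (i + 2))"
        by (simp add: sum.distrib)
      also have "(\<Sum>i<n. \<epsilon> * \<phi>' (i + 2) t * c (i + 2) t + c (i + 2) t * drift \<phi> t (i + 2)) =
         (\<Sum>i. \<epsilon> * \<phi>' (i + 2) t * c (i + 2) t + c (i + 2) t * drift \<phi> t (i + 2))"
        by (rule suminf_finite[symmetric]) (auto simp: fin drift_def)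
      finally show ?thesis unfolding rate_def g_def by simp
    qed
    ultimately show ?thesis by simp
  qed
  hence "(rate \<phi> \<phi>' has_integral (F T - F s)) {s..T}"
    using st by (intro fundamental_theorem_of_calculus) (auto simp: has_real_derivative_iff_has_vector_derivative)
  thus ?thesis by (simp add: mom)
qed

lemma rate_terms_bound:
  assumes t: "0 \<le> t" and L: "0 \<le> L" and i: "2 \<le> i"
    and lip: "\<And>i. 1 \<le> i \<Longrightarrow> \<bar>\<phi> (i + 1) t - \<phi> i t\<bar> \<le> L"
    and der: "\<And>i. 2 \<le> i \<Longrightarrow> \<bar>\<phi>' i t\<bar> \<le> L * real i"
  shows "\<bar>\<epsilon> * \<phi>' i t * c i t + c i t * drift \<phi> t i\<bar>
     \<le> L * (\<epsilon> + (Ka * m + Kb) * (1 + \<epsilon>) + \<epsilon> powr \<eta> * \<beta>) * real i * c i t"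
proof -
  have "\<bar>\<epsilon> * \<phi>' i t * c i t\<bar> = \<epsilon> * c i t * \<bar>\<phi>' i t\<bar>" using c_nonneg[OF t i] eps_pos by (simp add: abs_mult)
  also have "\<dots> \<le> \<epsilon> * c i t * (L * real i)" using c_nonneg[OF t i] eps_pos der[OF i] by (intro mult_left_mono) auto
  finally have 1: "\<bar>\<epsilon> * \<phi>' i t * c i t\<bar> \<le> \<epsilon> * c i t * (L * real i)" .
  have 2: "\<bar>c i t * drift \<phi> t i\<bar> \<le> L * ((Ka * m + Kb) * (1 + \<epsilon>) + \<epsilon> powr \<eta> * \<beta>) * real i * c i t"
    by (rule drift_bound) (use t L lip i in auto)
  have "\<bar>\<epsilon> * \<phi>' i t * c i t + c i t * drift \<phi> t i\<bar> \<le> \<epsilon> * c i t * (L * real i) + L * ((Ka * m + Kb) * (1 + \<epsilon>) + \<epsilon> powr \<eta> * \<beta>) * real i * c i t"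
    using abs_triangle_ineq[of "\<epsilon> * \<phi>' i t * c i t" "c i t * drift \<phi> t i"] 1 2 by linarith
  also have "\<dots> = L * (\<epsilon> + (Ka * m + Kb) * (1 + \<epsilon>) + \<epsilon> powr \<eta> * \<beta>) * real i * c i t" by (simp add: algebra_simps)
  finally show ?thesis .
qed

lemma rate_summable:
  assumes t: "0 \<le> t" and L: "0 \<le> L"
    and lip: "\<And>i. 1 \<le> i \<Longrightarrow> \<bar>\<phi> (i + 1) t - \<phi> i t\<bar> \<le> L"
    and der: "\<And>i. 2 \<le> i \<Longrightarrow> \<bar>\<phi>' i t\<bar> \<le> L * real i"
  shows "summable (\<lambda>i. \<epsilon> * \<phi>' (i + 2) t * c (i + 2) t + c (i + 2) t * drift \<phi> t (i + 2))"
proof (rule summable_linear(1)[OF t])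
  show "0 \<le> L * (\<epsilon> + (Ka * m + Kb) * (1 + \<epsilon>) + \<epsilon> powr \<eta> * \<beta>)"
    using L eps_pos Ka_nonneg Kb_nonneg m_nonneg beta_pos by simp
  show "\<bar>\<epsilon> * \<phi>' (i + 2) t * c (i + 2) t + c (i + 2) t * drift \<phi> t (i + 2)\<bar>
     \<le> L * (\<epsilon> + (Ka * m + Kb) * (1 + \<epsilon>) + \<epsilon> powr \<eta> * \<beta>) * real (i + 2) * c (i + 2) t" for i
    by (rule rate_terms_bound) (use t L lip der in auto)
qed

text \<open>A cutoff reduces the claim to finitely supported weights. The cut-off weights have uniformly
  bounded increments, so the mass dominates the sums at each time and a constant dominates
  them in time.\<close>
theorem weak_form:
  assumes st: "0 \<le> s" "s \<le> T"
    and one: "\<And>t. t \<in> {s..T} \<Longrightarrow> \<phi> 1 t = 0"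
    and der: "\<And>t i. t \<in> {s..T} \<Longrightarrow> 2 \<le> i \<Longrightarrow> (\<phi> i has_real_derivative \<phi>' i t) (at t within {s..T})"
    and lip: "\<And>t i. t \<in> {s..T} \<Longrightarrow> 1 \<le> i \<Longrightarrow> \<bar>\<phi> (i + 1) t - \<phi> i t\<bar> \<le> L"
    and der_le: "\<And>t i. t \<in> {s..T} \<Longrightarrow> 2 \<le> i \<Longrightarrow> \<bar>\<phi>' i t\<bar> \<le> L * real i"
  shows "(rate \<phi> \<phi>' has_integral (moment \<phi> T - moment \<phi> s)) {s..T}"
proof -
  have L: "0 \<le> L" using lip[of s 1] st by force
  define D where "D = 3 * L * (\<epsilon> + (Ka * m + Kb) * (1 + \<epsilon>) + \<epsilon> powr \<eta> * \<beta>)"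
  have D: "0 \<le> D" unfolding D_def using L eps_pos Ka_nonneg Kb_nonneg m_nonneg beta_pos by (intro mult_nonneg_nonneg add_nonneg_nonneg) auto
  have \<phi>_le: "\<bar>\<phi> i t\<bar> \<le> L * real i" if "t \<in> {s..T}" "1 \<le> i" for t i
    using that(2)
  proof (induction i rule: nat_induct_at_least)
    case base
    then show ?case using one[OF that(1)] L by simp
  next
    case (Suc i)
    then show ?case using lip[OF that(1), of i] by (simp add: algebra_simps)
  qed
  define \<psi> where "\<psi> N i t = cutoff (N + 2) i * \<phi> i t" for N i t
  define \<psi>' where "\<psi>' N i t = cutoff (N + 2) i * \<phi>' i t" for N i t
  have cp: "N + 2 > (0::nat)" for N by simp
  note cf = cutoff_facts[OF cp]
  have \<psi>_lip: "\<bar>\<psi> N (i + 1) t - \<psi> N i t\<bar> \<le> 3 * L" if t: "t \<in> {s..T}" and i: "1 \<le> i" for N i t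
  proof -
    have "\<psi> N (i + 1) t - \<psi> N i t = cutoff (N+2) (i+1) * (\<phi> (i+1) t - \<phi> i t) + \<phi> i t * (cutoff (N+2) (i+1) - cutoff (N+2) i)"
      by (simp add: \<psi>_def algebra_simps)
    moreover have "\<bar>cutoff (N+2) (i+1) * (\<phi> (i+1) t - \<phi> i t)\<bar> \<le> 1 * L"
      unfolding abs_mult using cf(1,2)[of N "i+1"] lip[OF t i] by (intro mult_mono) auto
    moreover have "\<bar>\<phi> i t * (cutoff (N+2) (i+1) - cutoff (N+2) i)\<bar> \<le> 2 * L"
    proof -
      have "\<bar>\<phi> i t * (cutoff (N+2) (i+1) - cutoff (N+2) i)\<bar> \<le> (L * real i) * \<bar>cutoff (N+2) (i+1) - cutoff (N+2) i\<bar>"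
        unfolding abs_mult by (intro mult_right_mono \<phi>_le t i) auto
      also have "\<dots> = L * \<bar>real i * (cutoff (N+2) (i+1) - cutoff (N+2) i)\<bar>" by (simp add: abs_mult)
      also have "\<dots> \<le> L * 2" by (intro mult_left_mono cf(6) L)
      finally show ?thesis by simp
    qed
    ultimately show ?thesis by linarith
  qed
  have \<psi>'_le: "\<bar>\<psi>' N i t\<bar> \<le> 3 * L * real i" if t: "t \<in> {s..T}" and i: "2 \<le> i" for N i t
  proof -
    have "\<bar>\<psi>' N i t\<bar> \<le> 1 * (L * real i)"
      unfolding \<psi>'_def abs_mult using cf(1,2)[of N i] der_le[OF t i] by (intro mult_mono) auto
    also have "\<dots> \<le> 3 * L * real i" using L by simp
    finally show ?thesis .
  qed
  have lim1: "(\<lambda>N. cutoff (N+2) i) \<longlonglongrightarrow> 1" for i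
    by (rule tendsto_eventually) (use cf(3) in \<open>auto simp: eventually_sequentially intro!: exI[of _ i]\<close>)
  have \<psi>_lim: "(\<lambda>N. \<psi> N i t) \<longlonglongrightarrow> \<phi> i t" for i t
    using tendsto_mult[OF lim1 tendsto_const, of i "\<phi> i t"] by (simp add: \<psi>_def)
  have \<psi>'_lim: "(\<lambda>N. \<psi>' N i t) \<longlonglongrightarrow> \<phi>' i t" for i t
    using tendsto_mult[OF lim1 tendsto_const, of i "\<phi>' i t"] by (simp add: \<psi>'_def)
  have int: "(rate (\<psi> N) (\<psi>' N) has_integral (moment (\<psi> N) T - moment (\<psi> N) s)) {s..T}" for N
  proof (rule weak_form_finite[OF st, where n = "2 * (N+2)"])
    show "(\<psi> N i has_real_derivative \<psi>' N i t) (at t within {s..T})" if "t \<in> {s..T}" "2 \<le> i" for t i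
    proof -
      have "((\<lambda>t. cutoff (N + 2) i * \<phi> i t) has_real_derivative cutoff (N + 2) i * \<phi>' i t) (at t within {s..T})"
        by (rule DERIV_cmult) (rule der[OF that])
      thus ?thesis by (simp add: \<psi>_def[abs_def] \<psi>'_def)
    qed
    show "\<psi> N 1 t = 0" if "t \<in> {s..T}" for t using one[OF that] by (simp add: \<psi>_def del: One_nat_def)
    show "\<psi> N i t = 0" "\<psi>' N i t = 0" if "2 * (N + 2) < i" for t i
      using cf(4)[of N i] that by (simp_all add: \<psi>_def \<psi>'_def)
  qed
  have mom_lim: "(\<lambda>N. moment (\<psi> N) t) \<longlonglongrightarrow> moment \<phi> t" if t: "t \<in> {s..T}" for t
    unfolding moment_def
  proof (rule conjunct2[OF conjunct2[OF tannerys_theorem[where M = "\<lambda>k. L / \<epsilon> * (\<epsilon>\<^sup>2 * real (k + 2) * c (k + 2) t)"]]])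
    have t0: "0 \<le> t" using t st by auto
    show "summable (\<lambda>k. L / \<epsilon> * (\<epsilon>\<^sup>2 * real (k + 2) * c (k + 2) t))"
      by (intro summable_mult mass_summable t0)
    show "(\<lambda>N. \<epsilon> * \<psi> N (k + 2) t * c (k + 2) t) \<longlonglongrightarrow> \<epsilon> * \<phi> (k + 2) t * c (k + 2) t" for k
      by (intro tendsto_intros \<psi>_lim)
    have "norm (\<epsilon> * \<psi> N (k + 2) t * c (k + 2) t) \<le> L / \<epsilon> * (\<epsilon>\<^sup>2 * real (k + 2) * c (k + 2) t)" for k N
    proof -
      have "\<bar>\<psi> N (k + 2) t\<bar> \<le> 1 * (L * real (k + 2))"
        unfolding \<psi>_def abs_mult using cf(1,2)[of N "k+2"] \<phi>_le[OF t, of "k+2"] by (intro mult_mono) auto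
      hence "\<epsilon> * c (k + 2) t * \<bar>\<psi> N (k + 2) t\<bar> \<le> \<epsilon> * c (k + 2) t * (1 * (L * real (k + 2)))"
        using c_nonneg[OF t0, of "k+2"] eps_pos by (intro mult_left_mono) auto
      thus ?thesis using c_nonneg[OF t0, of "k+2"] eps_pos by (simp add: abs_mult power2_eq_square mult_ac)
    qed
    thus "\<forall>\<^sub>F (k, N) in sequentially \<times>\<^sub>F sequentially.
       norm (\<epsilon> * \<psi> N (k + 2) t * c (k + 2) t) \<le> L / \<epsilon> * (\<epsilon>\<^sup>2 * real (k + 2) * c (k + 2) t)"
      by (intro always_eventually) auto
  qed auto
  let ?w = "\<lambda>N t k. \<epsilon> * \<psi>' N (k + 2) t * c (k + 2) t + c (k + 2) t * drift (\<psi> N) t (k + 2)"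
  have term_le: "\<bar>?w N t k\<bar> \<le> D * real (k + 2) * c (k + 2) t" if t: "t \<in> {s..T}" for N t k
    unfolding D_def by (rule rate_terms_bound) (use t st L \<psi>_lip \<psi>'_le in auto)
  have rate_lim: "(\<lambda>N. rate (\<psi> N) (\<psi>' N) t) \<longlonglongrightarrow> rate \<phi> \<phi>' t" if t: "t \<in> {s..T}" for t
  proof -
    have t0: "0 \<le> t" using t st by auto
    have "(\<lambda>N. \<Sum>k. ?w N t k) \<longlonglongrightarrow>
       (\<Sum>k. \<epsilon> * \<phi>' (k + 2) t * c (k + 2) t + c (k + 2) t * drift \<phi> t (k + 2))"
    proof (rule conjunct2[OF conjunct2[OF tannerys_theorem[where M = "\<lambda>k. D / \<epsilon>\<^sup>2 * (\<epsilon>\<^sup>2 * real (k + 2) * c (k + 2) t)"]]])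
      show "summable (\<lambda>k. D / \<epsilon>\<^sup>2 * (\<epsilon>\<^sup>2 * real (k + 2) * c (k + 2) t))"
        by (intro summable_mult mass_summable t0)
      show "(\<lambda>N. ?w N t k) \<longlonglongrightarrow> \<epsilon> * \<phi>' (k + 2) t * c (k + 2) t + c (k + 2) t * drift \<phi> t (k + 2)" for k
        unfolding drift_def by (intro tendsto_intros \<psi>_lim \<psi>'_lim)
      show "\<forall>\<^sub>F (k, N) in sequentially \<times>\<^sub>F sequentially. norm (?w N t k) \<le> D / \<epsilon>\<^sup>2 * (\<epsilon>\<^sup>2 * real (k + 2) * c (k + 2) t)"
        using term_le[OF t] eps_pos by (intro always_eventually) (auto simp: mult.assoc)
    qed auto
    thus ?thesis unfolding rate_def by (intro tendsto_intros \<psi>_lim)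
  qed
  have rate_le: "norm (rate (\<psi> N) (\<psi>' N) t) \<le> 2 * L * (\<alpha> * m\<^sup>2) + D / \<epsilon>\<^sup>2 * m" if t: "t \<in> {s..T}" for N t
  proof -
    have t0: "0 \<le> t" using t st by auto
    have 1: "\<bar>\<Sum>k. ?w N t k\<bar> \<le> D / \<epsilon>\<^sup>2 * m"
      by (rule summable_linear(2)[OF t0 D]) (rule term_le[OF t])
    have "\<bar>\<psi> N 2 t\<bar> \<le> 1 * (L * real 2)"
      unfolding \<psi>_def abs_mult using cf(1,2)[of N 2] \<phi>_le[OF t, of 2] by (intro mult_mono) auto
    moreover have "\<alpha> * (u t)\<^sup>2 \<le> \<alpha> * m\<^sup>2" using u_nonneg[OF t0] u_le[OF t0] alpha_pos by (intro mult_left_mono power_mono) auto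
    ultimately have "\<bar>\<psi> N 2 t\<bar> * (\<alpha> * (u t)\<^sup>2) \<le> (1 * (L * real 2)) * (\<alpha> * m\<^sup>2)"
      using alpha_pos by (intro mult_mono) auto
    hence 2: "\<bar>\<psi> N 2 t * (\<alpha> * (u t)\<^sup>2)\<bar> \<le> 2 * L * (\<alpha> * m\<^sup>2)" using alpha_pos by (simp add: abs_mult mult_ac)
    show ?thesis unfolding rate_def real_norm_def using 1 2 by linarith
  qed
  have I: "rate \<phi> \<phi>' integrable_on {s..T}" and lim: "(\<lambda>N. integral {s..T} (rate (\<psi> N) (\<psi>' N))) \<longlonglongrightarrow> integral {s..T} (rate \<phi> \<phi>')"
    using dominated_convergence[of "\<lambda>N. rate (\<psi> N) (\<psi>' N)" "{s..T}" "\<lambda>_. 2 * L * (\<alpha> * m\<^sup>2) + D / \<epsilon>\<^sup>2 * m" "rate \<phi> \<phi>'"]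
      int rate_le rate_lim by (auto simp: integrable_on_def)
  have "(\<lambda>N. integral {s..T} (rate (\<psi> N) (\<psi>' N))) \<longlonglongrightarrow> moment \<phi> T - moment \<phi> s"
    using st by (simp add: integral_unique[OF int] tendsto_diff mom_lim)
  with lim have "integral {s..T} (rate \<phi> \<phi>') = moment \<phi> T - moment \<phi> s" by (rule LIMSEQ_unique)
  with I show ?thesis by (metis integrable_integral)
qed

end

section \<open>Moment bounds that are uniform in the scaling\<close>

context bd_system begin

lemma u_sq_le: "0 \<le> t \<Longrightarrow> \<alpha> * (u t)\<^sup>2 \<le> \<alpha> * m\<^sup>2"
  using u_nonneg u_le alpha_pos by (intro mult_left_mono power_mono) auto

text \<open>Growth of clusters raises the weighted sum by at most a constant multiple of itself, formation of
  dimers raises it by a bounded amount, and detachment lowers it. The factor \<open>exp (- B * t)\<close> in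
  the weight takes the place of Gronwall's inequality.\<close>
theorem lyapunov_bound:
  assumes W: "\<And>i. 2 \<le> i \<Longrightarrow> 0 \<le> W i" "\<And>i. 2 \<le> i \<Longrightarrow> W i \<le> W (i + 1)"
      "\<And>i. 2 \<le> i \<Longrightarrow> (W (i + 1) - W i) * (1 + \<epsilon> * real i) \<le> C * \<epsilon> * (1 + W i)"
    and C: "0 \<le> C"
    and init: "\<And>N. (\<Sum>i<N. \<epsilon> * (1 + W (i + 2)) * c (i + 2) 0) \<le> H0"
    and T: "0 \<le> T"
  shows "(\<Sum>i<N. \<epsilon> * (1 + W (i + 2)) * c (i + 2) T) \<le> (H0 + (1 + W 2) * (\<alpha> * m\<^sup>2) * T) * exp (Ka * m * C * T)"
proof -
  \<comment> \<open>Frozen beyond \<open>N + 2\<close> the weight is bounded and the weak form applies; it still satisfies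
    the growth condition, with the same constant.\<close>
  define V where "V i = W (min i (N + 2))" for i
  define B where "B = Ka * m * C"
  have B: "0 \<le> B" unfolding B_def using Ka_nonneg m_nonneg C by auto
  have W_mono: "W i \<le> W j" if "2 \<le> i" "i \<le> j" for i j
    using that(2)
  proof (induction j rule: dec_induct)
    case (step n)
    then show ?case using W(2)[of n] that(1) by auto
  qed auto
  have V0: "0 \<le> V i" if "2 \<le> i" for i unfolding V_def using that by (intro W(1)) auto
  have V_le: "V i \<le> W i" if "2 \<le> i" for i unfolding V_def using that by (intro W_mono) auto
  have V_top: "V i \<le> W (N + 2)" if "2 \<le> i" for i unfolding V_def using that by (intro W_mono) auto
  have V_mono: "V i \<le> V (i + 1)" if "2 \<le> i" for i unfolding V_def using that by (intro W_mono) auto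
  have V_lyap: "(V (i + 1) - V i) * (1 + \<epsilon> * real i) \<le> C * \<epsilon> * (1 + V i)" if "2 \<le> i" for i
  proof (cases "i < N + 2")
    case True
    then have "min i (N+2) = i" "min (i+1) (N+2) = i+1" by auto
    then show ?thesis unfolding V_def using W(3)[OF that] by simp
  next
    case False
    then have "min i (N+2) = N+2" "min (i+1) (N+2) = N+2" by auto
    then show ?thesis unfolding V_def using C eps_pos W(1)[of "N+2"] by simp
  qed
  define \<phi> where "\<phi> i t = (if i < 2 then 0 else exp (- B * t) * (1 + V i))" for i :: nat and t :: real
  define \<phi>' where "\<phi>' i t = - B * \<phi> i t" for i t
  have WN: "0 \<le> W (N+2)" by (rule W(1)) auto
  define L where "L = (1 + W (N+2)) * (1 + B)"
  have L: "1 + W (N+2) \<le> L" "B * (1 + W (N+2)) \<le> L"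
    unfolding L_def using WN B by (auto simp: algebra_simps)
  have L0: "0 \<le> L" using L(1) WN by linarith
  have \<phi>0: "0 \<le> \<phi> i t" for i t unfolding \<phi>_def using V0[of i] by auto
  have \<phi>_le: "\<phi> i t \<le> 1 + W (N+2)" if "0 \<le> t" for i t
  proof (cases "i < 2")
    case True then show ?thesis using WN by (simp add: \<phi>_def)
  next
    case False
    have "exp (- B * t) * (1 + V i) \<le> 1 * (1 + W (N+2))"
      using that B V_top[of i] V0[of i] False by (intro mult_mono) auto
    then show ?thesis using False by (simp add: \<phi>_def)
  qed
  have lip: "\<bar>\<phi> (i + 1) t - \<phi> i t\<bar> \<le> L" if "t \<in> {0..T}" for i t
    using \<phi>0[of i t] \<phi>0[of "i+1" t] \<phi>_le[of t i] \<phi>_le[of t "i+1"] that L(1) by auto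
  have der_le: "\<bar>\<phi>' i t\<bar> \<le> L * real i" if t: "t \<in> {0..T}" and i: "2 \<le> i" for i t
  proof -
    have "\<bar>\<phi>' i t\<bar> = B * \<phi> i t" using B \<phi>0[of i t] by (simp add: \<phi>'_def abs_mult)
    also have "\<dots> \<le> B * (1 + W (N+2))" using \<phi>_le[of t i] t B by (intro mult_left_mono) auto
    also have "\<dots> \<le> L * 1" using L(2) by simp
    also have "\<dots> \<le> L * real i" using i L0 by (intro mult_left_mono) auto
    finally show ?thesis .
  qed
  have int: "(rate \<phi> \<phi>' has_integral (moment \<phi> T - moment \<phi> 0)) {0..T}"
  proof (rule weak_form[OF order_refl T, where L = L])
    show "(\<phi> i has_real_derivative \<phi>' i t) (at t within {0..T})" if "2 \<le> i" for i t
    proof -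
      have "((\<lambda>t. exp (- B * t) * (1 + V i)) has_real_derivative - B * (exp (- B * t) * (1 + V i))) (at t within {0..T})"
        by (auto intro!: derivative_eq_intros)
      thus ?thesis using that by (simp add: \<phi>_def[abs_def] \<phi>'_def)
    qed
    show "\<phi> 1 t = 0" for t by (simp add: \<phi>_def)
  qed (use lip der_le in auto)
  have rate_le: "rate \<phi> \<phi>' t \<le> (1 + W 2) * (\<alpha> * m\<^sup>2)" if t: "t \<in> {0..T}" for t
  proof -
    have t0: "0 \<le> t" using t by auto
    have sm: "summable (\<lambda>i. \<epsilon> * \<phi>' (i + 2) t * c (i + 2) t + c (i + 2) t * drift \<phi> t (i + 2))"
      by (rule rate_summable[OF t0 L0]) (use t lip der_le in auto)
    have "\<epsilon> * \<phi>' i t * c i t + c i t * drift \<phi> t i \<le> 0" if i: "2 \<le> i" for i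
    proof -
      have "(V (i+1) - V i) * (a i * u t) \<le> (V (i+1) - V i) * (Ka * (1 + \<epsilon> * real i) * m)"
        using a_le[OF i] a_nonneg[OF i] u_le[OF t0] u_nonneg[OF t0] eps_pos Ka_nonneg V_mono[OF i]
        by (intro mult_left_mono mult_mono) auto
      also have "\<dots> = Ka * m * ((V (i+1) - V i) * (1 + \<epsilon> * real i))" by (simp add: mult_ac)
      also have "\<dots> \<le> Ka * m * (C * \<epsilon> * (1 + V i))" using Ka_nonneg m_nonneg by (intro mult_left_mono V_lyap i) auto
      also have "\<dots> = \<epsilon> * B * (1 + V i)" by (simp add: B_def mult_ac)
      finally have 1: "(V (i+1) - V i) * (a i * u t) \<le> \<epsilon> * B * (1 + V i)" .
      have "\<phi> (i - 1) t \<le> \<phi> i t"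
      proof (cases "i = 2")
        case True
        then show ?thesis using \<phi>0[of 2 t] by (simp add: \<phi>_def)
      next
        case False
        hence "2 \<le> i - 1" "i - 1 + 1 = i" using i by auto
        with V_mono[of "i - 1"] show ?thesis using i by (simp add: \<phi>_def)
      qed
      hence 2: "0 \<le> (\<phi> i t - \<phi> (i - 1) t) * back_rate i" using back_rate_nonneg[OF i] by auto
      have "drift \<phi> t i \<le> exp (- B * t) * ((V (i+1) - V i) * (a i * u t))"
        unfolding drift_def using 2 i by (simp add: \<phi>_def algebra_simps)
      also have "\<dots> \<le> exp (- B * t) * (\<epsilon> * B * (1 + V i))" using 1 by (intro mult_left_mono) auto
      also have "\<dots> = - \<epsilon> * \<phi>' i t" using i by (simp add: \<phi>'_def \<phi>_def)
      finally have "c i t * (\<epsilon> * \<phi>' i t + drift \<phi> t i) \<le> 0"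
        using c_nonneg[OF t0 i] by (intro mult_nonneg_nonpos) auto
      thus ?thesis by (simp add: algebra_simps)
    qed
    hence "(\<Sum>i. \<epsilon> * \<phi>' (i + 2) t * c (i + 2) t + c (i + 2) t * drift \<phi> t (i + 2)) \<le> (\<Sum>i. 0)"
      by (intro suminf_le sm) auto
    moreover have "\<phi> 2 t * (\<alpha> * (u t)\<^sup>2) \<le> (1 + W 2) * (\<alpha> * m\<^sup>2)"
    proof (rule mult_mono)
      have "exp (- B * t) * (1 + V 2) \<le> 1 * (1 + W 2)"
        using t0 B V0[of 2] V_le[of 2] W(1)[of 2] by (intro mult_mono) auto
      thus "\<phi> 2 t \<le> 1 + W 2" by (simp add: \<phi>_def)
    qed (use u_sq_le[OF t0] W(1)[of 2] alpha_pos in auto)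
    ultimately show ?thesis by (simp add: rate_def)
  qed
  have "moment \<phi> T - moment \<phi> 0 \<le> (1 + W 2) * (\<alpha> * m\<^sup>2) * T"
  proof -
    have "((\<lambda>t. (1 + W 2) * (\<alpha> * m\<^sup>2)) has_integral (T - 0) *\<^sub>R ((1 + W 2) * (\<alpha> * m\<^sup>2))) {0..T}"
      using T by (intro has_integral_const_real[THEN has_integral_eq_rhs]) auto
    from has_integral_le[OF int this rate_le] show ?thesis by (simp add: mult_ac)
  qed
  moreover have "moment \<phi> 0 \<le> H0"
    unfolding moment_def
  proof (rule suminf_le_const)
    show "summable (\<lambda>i. \<epsilon> * \<phi> (i + 2) 0 * c (i + 2) 0)"
    proof (rule summable_linear(1)[OF order_refl, where D = "\<epsilon> * L"])
      show "\<bar>\<epsilon> * \<phi> (i + 2) 0 * c (i + 2) 0\<bar> \<le> \<epsilon> * L * real (i + 2) * c (i + 2) 0" for i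
      proof -
        have "\<phi> (i+2) 0 \<le> L * 1" using \<phi>_le[of 0 "i+2"] L(1) by simp
        also have "\<dots> \<le> L * real (i+2)" using L0 by (intro mult_left_mono) auto
        finally have "\<epsilon> * c (i+2) 0 * \<phi> (i+2) 0 \<le> \<epsilon> * c (i+2) 0 * (L * real (i+2))"
          using c_nonneg[of 0 "i+2"] eps_pos by (intro mult_left_mono) auto
        thus ?thesis using c_nonneg[of 0 "i+2"] eps_pos \<phi>0[of "i+2" 0] by (simp add: abs_mult mult_ac)
      qed
    qed (use L0 eps_pos in auto)
    show "sum (\<lambda>i. \<epsilon> * \<phi> (i + 2) 0 * c (i + 2) 0) {..<n} \<le> H0" for n
    proof (rule order_trans[OF _ init[of n]], intro sum_mono)
      fix i
      show "\<epsilon> * \<phi> (i + 2) 0 * c (i + 2) 0 \<le> \<epsilon> * (1 + W (i + 2)) * c (i + 2) 0"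
        using V_le[of "i+2"] c_nonneg[of 0 "i+2"] eps_pos by (intro mult_right_mono mult_left_mono) (auto simp: \<phi>_def)
    qed
  qed
  moreover have "exp (- B * T) * (\<Sum>i<N. \<epsilon> * (1 + W (i + 2)) * c (i + 2) T) \<le> moment \<phi> T"
  proof -
    have "exp (- B * T) * (\<Sum>i<N. \<epsilon> * (1 + W (i + 2)) * c (i + 2) T) = (\<Sum>i<N. \<epsilon> * \<phi> (i + 2) T * c (i + 2) T)"
      unfolding sum_distrib_left by (intro sum.cong refl) (auto simp: \<phi>_def V_def)
    also have "\<dots> \<le> moment \<phi> T" unfolding moment_def
    proof (rule sum_le_suminf)
      show "summable (\<lambda>i. \<epsilon> * \<phi> (i + 2) T * c (i + 2) T)"
      proof (rule summable_linear(1)[OF T, where D = "\<epsilon> * L"])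
        show "\<bar>\<epsilon> * \<phi> (i + 2) T * c (i + 2) T\<bar> \<le> \<epsilon> * L * real (i + 2) * c (i + 2) T" for i
        proof -
          have "\<phi> (i+2) T \<le> L * 1" using \<phi>_le[OF T, of "i+2"] L(1) by simp
          also have "\<dots> \<le> L * real (i+2)" using L0 by (intro mult_left_mono) auto
          finally have "\<epsilon> * c (i+2) T * \<phi> (i+2) T \<le> \<epsilon> * c (i+2) T * (L * real (i+2))"
            using c_nonneg[OF T, of "i+2"] eps_pos by (intro mult_left_mono) auto
          thus ?thesis using c_nonneg[OF T, of "i+2"] eps_pos \<phi>0[of "i+2" T] by (simp add: abs_mult mult_ac)
        qed
      qed (use L0 eps_pos in auto)
      show "0 \<le> \<epsilon> * \<phi> (n + 2) T * c (n + 2) T" for n using c_nonneg[OF T, of "n+2"] eps_pos \<phi>0[of "n+2" T] by auto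
    qed auto
    finally show ?thesis .
  qed
  ultimately have "exp (- B * T) * (\<Sum>i<N. \<epsilon> * (1 + W (i + 2)) * c (i + 2) T) \<le> H0 + (1 + W 2) * (\<alpha> * m\<^sup>2) * T"
    by linarith
  hence "exp (B * T) * (exp (- B * T) * (\<Sum>i<N. \<epsilon> * (1 + W (i + 2)) * c (i + 2) T)) \<le> exp (B * T) * (H0 + (1 + W 2) * (\<alpha> * m\<^sup>2) * T)"
    by (intro mult_left_mono) auto
  moreover have "exp (B * T) * exp (- B * T) = 1" by (simp add: exp_minus)
  ultimately have "(\<Sum>i<N. \<epsilon> * (1 + W (i + 2)) * c (i + 2) T) \<le> exp (B * T) * (H0 + (1 + W 2) * (\<alpha> * m\<^sup>2) * T)"
    by (simp only: mult.assoc[symmetric] mult_1_left)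
  thus ?thesis by (simp only: B_def mult.commute)
qed

text \<open>The natural bound for sums that involve the rates, which grow at most affinely in the size.\<close>
definition count_and_mass :: "real \<Rightarrow> real" where
  "count_and_mass t = (\<Sum>i. \<epsilon> * (1 + \<epsilon> * real (i + 2)) * c (i + 2) t)"

lemma count_and_mass_summable: "0 \<le> t \<Longrightarrow> summable (\<lambda>i. \<epsilon> * (1 + \<epsilon> * real (i + 2)) * c (i + 2) t)"
proof (rule summable_linear(1)[where D = "\<epsilon> * (1 + \<epsilon>)"])
  fix i assume t: "0 \<le> t"
  have "1 + \<epsilon> * real (i+2) \<le> (1 + \<epsilon>) * real (i+2)" by (simp add: algebra_simps)
  hence "\<epsilon> * c (i+2) t * (1 + \<epsilon> * real (i+2)) \<le> \<epsilon> * c (i+2) t * ((1 + \<epsilon>) * real (i+2))"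
    using c_nonneg[OF t, of "i+2"] eps_pos by (intro mult_left_mono) auto
  thus "\<bar>\<epsilon> * (1 + \<epsilon> * real (i + 2)) * c (i + 2) t\<bar> \<le> \<epsilon> * (1 + \<epsilon>) * real (i + 2) * c (i + 2) t"
    using c_nonneg[OF t, of "i+2"] eps_pos by (simp add: abs_mult mult_ac)
qed (use eps_pos in auto)

lemma count_and_mass_dominates:
  assumes t: "0 \<le> t" and K: "0 \<le> K" and le: "\<And>i. \<bar>w i\<bar> \<le> K * (\<epsilon> * (1 + \<epsilon> * real (i + 2)) * c (i + 2) t)"
  shows "summable w" "\<bar>\<Sum>i. w i\<bar> \<le> K * count_and_mass t"
proof -
  have s: "summable (\<lambda>i. K * (\<epsilon> * (1 + \<epsilon> * real (i + 2)) * c (i + 2) t))"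
    by (intro summable_mult count_and_mass_summable t)
  have le': "norm (w i) \<le> K * (\<epsilon> * (1 + \<epsilon> * real (i + 2)) * c (i + 2) t)" for i using le[of i] by simp
  show "summable w" by (rule summable_comparison_test'[OF s le'])
  have "norm (\<Sum>i. w i) \<le> (\<Sum>i. K * (\<epsilon> * (1 + \<epsilon> * real (i + 2)) * c (i + 2) t))"
    by (rule norm_suminf_le[OF le' s])
  also have "\<dots> = K * count_and_mass t" unfolding count_and_mass_def by (rule suminf_mult[OF count_and_mass_summable[OF t]])
  finally show "\<bar>\<Sum>i. w i\<bar> \<le> K * count_and_mass t" by simp
qed

lemma count_and_mass_nonneg: "0 \<le> t \<Longrightarrow> 0 \<le> count_and_mass t"
  unfolding count_and_mass_def by (intro suminf_nonneg count_and_mass_summable) (use c_nonneg eps_pos in auto)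

lemma au_le: "0 \<le> t \<Longrightarrow> 2 \<le> i \<Longrightarrow> a i * u t \<le> Ka * m * (1 + \<epsilon> * real i)" "0 \<le> t \<Longrightarrow> 2 \<le> i \<Longrightarrow> 0 \<le> a i * u t"
proof -
  assume t: "0 \<le> t" and i: "2 \<le> i"
  have "a i * u t \<le> Ka * (1 + \<epsilon> * real i) * m"
    using a_le[OF i] a_nonneg[OF i] u_le[OF t] u_nonneg[OF t] eps_pos Ka_nonneg by (intro mult_mono) auto
  thus "a i * u t \<le> Ka * m * (1 + \<epsilon> * real i)" by (simp add: mult_ac)
  show "0 \<le> a i * u t" using a_nonneg[OF i] u_nonneg[OF t] by simp
qed

text \<open>By conservation of mass, \<open>u\<close> is a constant minus the mass of all clusters, which has the bounded
  increments \<open>\<epsilon>\<close> as a weight. So its drift is controlled by \<open>count_and_mass\<close>.\<close>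
theorem u_lipschitz:
  assumes st: "0 \<le> s" "s \<le> T" and M: "\<And>t. t \<in> {s..T} \<Longrightarrow> count_and_mass t \<le> M" and e1: "\<epsilon> \<le> 1" and eta: "0 \<le> \<eta>"
  shows "\<bar>u T - u s\<bar> \<le> (2 * \<alpha> * m\<^sup>2 + (Ka * m + Kb + 2 * \<beta>) * M) * (T - s)"
proof -
  define \<phi> where "\<phi> i t = (if i < 2 then 0 else \<epsilon> * real i)" for i :: nat and t :: real
  define \<phi>' where "\<phi>' i t = (0::real)" for i :: nat and t :: real
  have bt2: "back_rate 2 \<le> \<beta>" "0 \<le> back_rate 2"
  proof -
    have "\<epsilon> powr \<eta> \<le> 1" using powr_mono2[OF eta, of \<epsilon> 1] eps_pos e1 by simp
    from mult_right_mono[OF this, of \<beta>] show "back_rate 2 \<le> \<beta>" using beta_pos by (simp add: back_rate_def)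
    show "0 \<le> back_rate 2" by (rule back_rate_nonneg) auto
  qed
  have int: "(rate \<phi> \<phi>' has_integral (moment \<phi> T - moment \<phi> s)) {s..T}"
    by (rule weak_form[OF st, where L = "2 * \<epsilon>"])
      (use eps_pos in \<open>auto simp: \<phi>_def[abs_def] \<phi>'_def[abs_def] algebra_simps\<close>)
  have mom: "moment \<phi> t = m - u t" if "0 \<le> t" for t
  proof -
    have "moment \<phi> t = (\<Sum>i. \<epsilon>\<^sup>2 * real (i + 2) * c (i + 2) t)"
      unfolding moment_def by (rule suminf_cong) (simp add: \<phi>_def power2_eq_square mult_ac)
    thus ?thesis using mass_eq[OF that] by simp
  qed
  define B where "B = 2 * \<alpha> * m\<^sup>2 + (Ka * m + Kb + 2 * \<beta>) * M"
  have le: "\<bar>rate \<phi> \<phi>' t\<bar> \<le> B" if t: "t \<in> {s..T}" for t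
  proof -
    have t0: "0 \<le> t" using t st by auto
    have tm: "\<bar>\<epsilon> * \<phi>' i t * c i t + c i t * drift \<phi> t i\<bar> \<le> (Ka * m + Kb + 2 * \<beta>) * (\<epsilon> * (1 + \<epsilon> * real i) * c i t)" if i: "2 \<le> i" for i
    proof -
      have "\<bar>drift \<phi> t i\<bar> \<le> \<epsilon> * ((Ka * m + Kb + 2 * \<beta>) * (1 + \<epsilon> * real i))"
      proof (cases "i = 2")
        case True
        have "drift \<phi> t i = \<epsilon> * (a i * u t - 2 * back_rate i)" using True unfolding drift_def \<phi>_def by (simp add: algebra_simps)
        moreover have "\<bar>a i * u t - 2 * back_rate i\<bar> \<le> Ka * m * (1 + \<epsilon> * real i) + 2 * \<beta>"
          using au_le[OF t0 i] bt2 True by auto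
        moreover have "2 * \<beta> * 1 \<le> 2 * \<beta> * (1 + \<epsilon> * real i)" "0 \<le> Kb * (1 + \<epsilon> * real i)"
          using beta_pos Kb_nonneg eps_pos by (auto intro!: mult_left_mono)
        ultimately have "\<bar>a i * u t - 2 * back_rate i\<bar> \<le> (Ka * m + Kb + 2 * \<beta>) * (1 + \<epsilon> * real i)"
          unfolding distrib_right by linarith
        thus ?thesis using eps_pos \<open>drift \<phi> t i = _\<close> by (simp add: abs_mult)
      next
        case False
        hence i3: "3 \<le> i" using i by auto
        have "drift \<phi> t i = \<epsilon> * (a i * u t - b i)" using i3 unfolding drift_def \<phi>_def back_rate_def by (simp add: algebra_simps of_nat_diff)
        moreover have "\<bar>a i * u t - b i\<bar> \<le> Ka * m * (1 + \<epsilon> * real i) + Kb * (1 + \<epsilon> * real i)"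
          using au_le[OF t0 i] b_le[OF i3] b_nonneg[OF i3] by auto
        moreover have "0 \<le> 2 * \<beta> * (1 + \<epsilon> * real i)" using beta_pos eps_pos by auto
        ultimately have "\<bar>a i * u t - b i\<bar> \<le> (Ka * m + Kb + 2 * \<beta>) * (1 + \<epsilon> * real i)"
          unfolding distrib_right by linarith
        thus ?thesis using eps_pos \<open>drift \<phi> t i = _\<close> by (simp add: abs_mult)
      qed
      hence "c i t * \<bar>drift \<phi> t i\<bar> \<le> c i t * (\<epsilon> * ((Ka * m + Kb + 2 * \<beta>) * (1 + \<epsilon> * real i)))"
        using c_nonneg[OF t0 i] by (intro mult_left_mono) auto
      thus ?thesis using c_nonneg[OF t0 i] by (simp add: \<phi>'_def abs_mult mult_ac)
    qed
    have K0: "0 \<le> Ka * m + Kb + 2 * \<beta>" using Ka_nonneg Kb_nonneg m_nonneg beta_pos by auto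
    have "\<bar>\<Sum>i. \<epsilon> * \<phi>' (i+2) t * c (i+2) t + c (i+2) t * drift \<phi> t (i+2)\<bar> \<le> (Ka * m + Kb + 2 * \<beta>) * count_and_mass t"
      by (rule count_and_mass_dominates(2)[OF t0 K0]) (rule tm, simp)
    also have "\<dots> \<le> (Ka * m + Kb + 2 * \<beta>) * M" by (intro mult_left_mono M t K0)
    finally have 1: "\<bar>\<Sum>i. \<epsilon> * \<phi>' (i+2) t * c (i+2) t + c (i+2) t * drift \<phi> t (i+2)\<bar> \<le> (Ka * m + Kb + 2 * \<beta>) * M" .
    have "\<epsilon> * (\<alpha> * (u t)\<^sup>2) \<le> 1 * (\<alpha> * m\<^sup>2)"
      using e1 eps_pos alpha_pos u_sq_le[OF t0] by (intro mult_mono) auto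
    hence "\<bar>\<phi> 2 t * (\<alpha> * (u t)\<^sup>2)\<bar> \<le> 2 * \<alpha> * m\<^sup>2" using eps_pos alpha_pos by (simp add: \<phi>_def abs_mult)
    with 1 show ?thesis unfolding rate_def B_def by linarith
  qed
  have B: "0 \<le> B" using le[of s] st by fastforce
  have "norm (moment \<phi> T - moment \<phi> s) \<le> B * measure lborel {s..T}"
    using has_integral_bound_real[OF B finite.emptyI int] le by simp
  then show ?thesis using mom[of T] mom[of s] st by (simp add: B_def)
qed

end

context bd_system begin

text \<open>A bound for a weight \<open>W\<close> that dominates the identity controls \<open>count_and_mass\<close>; if \<open>W\<close> is
  superlinear, the coefficient \<open>\<delta>\<close> can be made small by increasing \<open>R\<close>.\<close>
lemma weighted_bound_consequences:
  assumes t: "0 \<le> t" and W: "\<And>x. 0 \<le> x \<Longrightarrow> 0 \<le> W x"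
    and H: "\<And>N. (\<Sum>i<N. \<epsilon> * (1 + W (\<epsilon> * real (i + 2))) * c (i + 2) t) \<le> H"
  shows "(\<And>x. 0 \<le> x \<Longrightarrow> 1 + x \<le> K * (1 + W x)) \<Longrightarrow> 0 \<le> K \<Longrightarrow> count_and_mass t \<le> K * H"
    and "(\<And>x. 0 \<le> x \<Longrightarrow> R < x \<Longrightarrow> x \<le> \<delta> * (1 + W x)) \<Longrightarrow> 0 \<le> \<delta> \<Longrightarrow>
       (\<Sum>i. if R < \<epsilon> * real (i + 2) then \<epsilon> * c (i + 2) t * (\<epsilon> * real (i + 2)) else 0) \<le> \<delta> * H"
    and "(\<And>x. 0 \<le> x \<Longrightarrow> R < x \<Longrightarrow> x \<le> \<delta> * (1 + W x)) \<Longrightarrow> 0 \<le> \<delta> \<Longrightarrow>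
       (\<Sum>i. if R < \<epsilon> * real (i + 3) then \<epsilon> * c (i + 3) t * (\<epsilon> * real (i + 3)) else 0) \<le> \<delta> * H"
proof -
  have nn: "0 \<le> \<epsilon> * real j" for j using eps_pos by simp
  have c0: "0 \<le> c (i + 2) t" for i by (rule c_nonneg[OF t]) simp
  have ec: "0 \<le> \<epsilon> * c (i + 2) t" for i using c0[of i] eps_pos by simp
  have gen: "summable w \<and> (\<Sum>i. w i) \<le> K * H" if K: "0 \<le> K" and w: "\<And>i. 0 \<le> w i" "\<And>i. w i \<le> K * (\<epsilon> * (1 + W (\<epsilon> * real (i + 2))) * c (i + 2) t)" for w K
  proof -
    have le: "(\<Sum>i<N. w i) \<le> K * H" for N
    proof -
      have "(\<Sum>i<N. w i) \<le> (\<Sum>i<N. K * (\<epsilon> * (1 + W (\<epsilon> * real (i + 2))) * c (i + 2) t))" by (rule sum_mono) (rule w)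
      also have "\<dots> = K * (\<Sum>i<N. \<epsilon> * (1 + W (\<epsilon> * real (i + 2))) * c (i + 2) t)" by (rule sum_distrib_left[symmetric])
      also have "\<dots> \<le> K * H" by (rule mult_left_mono[OF H K])
      finally show ?thesis .
    qed
    have "summable w" by (rule summableI_nonneg_bounded[OF w(1) le])
    thus ?thesis using suminf_le_const[OF _ le] by blast
  qed
  show "count_and_mass t \<le> K * H" if K: "\<And>x. 0 \<le> x \<Longrightarrow> 1 + x \<le> K * (1 + W x)" "0 \<le> K"
    unfolding count_and_mass_def
  proof (rule conjunct2[OF gen[OF K(2)]])
    fix i
    show "0 \<le> \<epsilon> * (1 + \<epsilon> * real (i + 2)) * c (i + 2) t" by (intro mult_nonneg_nonneg add_nonneg_nonneg nn c0) (use eps_pos in auto)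
    have "\<epsilon> * c (i + 2) t * (1 + \<epsilon> * real (i + 2)) \<le> \<epsilon> * c (i + 2) t * (K * (1 + W (\<epsilon> * real (i + 2))))"
      by (intro mult_left_mono K nn ec)
    thus "\<epsilon> * (1 + \<epsilon> * real (i + 2)) * c (i + 2) t \<le> K * (\<epsilon> * (1 + W (\<epsilon> * real (i + 2))) * c (i + 2) t)" by (simp only: mult_ac)
  qed
  assume \<delta>: "\<And>x. 0 \<le> x \<Longrightarrow> R < x \<Longrightarrow> x \<le> \<delta> * (1 + W x)" "0 \<le> \<delta>"
  define w where "w i = (if R < \<epsilon> * real (i + 2) then \<epsilon> * c (i + 2) t * (\<epsilon> * real (i + 2)) else 0)" for i
  have w0: "0 \<le> w i" for i unfolding w_def using mult_nonneg_nonneg[OF ec nn, of i "i+2"] by simp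
  have wle: "w i \<le> \<delta> * (\<epsilon> * (1 + W (\<epsilon> * real (i + 2))) * c (i + 2) t)" for i
  proof (cases "R < \<epsilon> * real (i + 2)")
    case True
    have "\<epsilon> * c (i + 2) t * (\<epsilon> * real (i + 2)) \<le> \<epsilon> * c (i + 2) t * (\<delta> * (1 + W (\<epsilon> * real (i + 2))))"
      by (intro mult_left_mono \<delta>(1) nn ec True)
    thus ?thesis using True unfolding w_def by (simp only: if_True mult_ac)
  next
    case False
    have "0 \<le> \<epsilon> * c (i + 2) t * (1 + W (\<epsilon> * real (i + 2)))" by (rule mult_nonneg_nonneg[OF ec add_nonneg_nonneg[OF zero_le_one W[OF nn]]])
    hence "0 \<le> \<delta> * (\<epsilon> * c (i + 2) t * (1 + W (\<epsilon> * real (i + 2))))" using \<delta>(2) by (rule mult_nonneg_nonneg[rotated])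
    thus ?thesis using False unfolding w_def by (simp only: if_False mult_ac)
  qed
  have sw: "summable w" and le: "(\<Sum>i. w i) \<le> \<delta> * H" using gen[OF \<delta>(2) w0 wle] by auto
  show "(\<Sum>i. if R < \<epsilon> * real (i + 2) then \<epsilon> * c (i + 2) t * (\<epsilon> * real (i + 2)) else 0) \<le> \<delta> * H" using le by (simp add: w_def)
  have "(\<Sum>i. w (Suc i)) \<le> \<delta> * H" using suminf_split_head[OF sw] w0[of 0] le by simp
  moreover have "w (Suc i) = (if R < \<epsilon> * real (i + 3) then \<epsilon> * c (i + 3) t * (\<epsilon> * real (i + 3)) else 0)" for i
    by (simp add: w_def numeral_eq_Suc)
  ultimately show "(\<Sum>i. if R < \<epsilon> * real (i + 3) then \<epsilon> * c (i + 3) t * (\<epsilon> * real (i + 3)) else 0) \<le> \<delta> * H" by simp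
qed

end

section \<open>Depletion of the smallest clusters\<close>

context bd_system begin

text \<open>The two terms of the flux from size two to size three, added rather than subtracted: it bounds
  everything that crosses the lower end of the range \<open>i \<ge> 3\<close>.\<close>
definition entry_flux :: "real \<Rightarrow> real" where
  "entry_flux t = a 2 * u t * c 2 t + b 3 * c 3 t"

lemma entry_flux_nonneg: "0 \<le> t \<Longrightarrow> 0 \<le> entry_flux t"
  using a_nonneg[of 2] b_nonneg[of 3] u_nonneg[of t] c_nonneg[of t 2] c_nonneg[of t 3] by (simp add: entry_flux_def)

lemma entry_flux_continuous: "continuous_on {0..} entry_flux"
  unfolding entry_flux_def[abs_def] by (intro continuous_intros u_continuous c_continuous) auto

lemma entry_flux_integrable: "0 \<le> s \<Longrightarrow> entry_flux integrable_on {s..t}"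
  by (rule integrable_continuous_real, rule continuous_on_subset[OF entry_flux_continuous]) auto

end

context bd_system begin

text \<open>The left-hand side is the drift of \<open>exp (- i * z)\<close>, which factors as
  \<open>(1 - exp (- z)) * exp (- i * z) * (exp z * b i - a i * u)\<close>. At small sizes the last factor is
  not positive; at sizes beyond \<open>x0 / \<epsilon>\<close> the exponential is tiny.\<close>
lemma exp_drift_le:
  assumes t: "0 \<le> t" and i: "3 \<le> i" and z: "0 < z" and v: "v \<le> u t"
    and small: "\<epsilon> * real i \<le> x0 \<Longrightarrow> exp z * b i \<le> v * a i"
  shows "(exp (- (real i + 1) * z) - exp (- real i * z)) * a i * u t - (exp (- real i * z) - exp (- (real i - 1) * z)) * b i
     \<le> exp z * Kb * exp (- z * x0 / \<epsilon>) * (1 + \<epsilon> * real i)"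
proof -
  have e1: "exp (- (real i + 1) * z) = exp (- real i * z) * exp (- z)" by (simp add: exp_add[symmetric] algebra_simps)
  have e2: "exp (- (real i - 1) * z) = exp (- real i * z) * exp z" by (simp add: exp_add[symmetric] algebra_simps)
  have ez: "exp z * exp (- z) = 1" by (simp add: exp_minus)
  have "(exp (- (real i + 1) * z) - exp (- real i * z)) * a i * u t - (exp (- real i * z) - exp (- (real i - 1) * z)) * b i
     = (1 - exp (- z)) * exp (- real i * z) * (exp z * b i - a i * u t)"
    unfolding e1 e2 using ez by algebra
  also have "\<dots> \<le> exp z * Kb * exp (- z * x0 / \<epsilon>) * (1 + \<epsilon> * real i)"
  proof (cases "\<epsilon> * real i \<le> x0")
    case True
    have "exp z * b i \<le> a i * u t" using small[OF True] mult_left_mono[OF v a_nonneg[of i]] i by (simp add: mult_ac)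
    hence "(1 - exp (- z)) * exp (- real i * z) * (exp z * b i - a i * u t) \<le> 0"
      using z by (intro mult_nonneg_nonpos) auto
    also have "0 \<le> exp z * Kb * exp (- z * x0 / \<epsilon>) * (1 + \<epsilon> * real i)" using Kb_nonneg eps_pos by auto
    finally show ?thesis .
  next
    case False
    hence "x0 / \<epsilon> \<le> real i" using eps_pos by (simp add: field_simps)
    hence "z * (x0 / \<epsilon>) \<le> z * real i" using z by (intro mult_left_mono) auto
    hence le: "exp (- real i * z) \<le> exp (- z * x0 / \<epsilon>)" by (simp add: mult.commute)
    have au: "0 \<le> a i * u t" using au_le(2)[OF t] i by simp
    have "(1 - exp (- z)) * exp (- real i * z) * (exp z * b i - a i * u t) \<le> (1 - exp (- z)) * exp (- real i * z) * (exp z * b i)"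
      using z au by (intro mult_left_mono) auto
    also have "\<dots> \<le> 1 * exp (- z * x0 / \<epsilon>) * (exp z * (Kb * (1 + \<epsilon> * real i)))"
      using z le b_le[OF i] b_nonneg[OF i] by (intro mult_mono) auto
    finally show ?thesis by (simp add: mult_ac)
  qed
  finally show ?thesis .
qed

text \<open>The moment of the weight \<open>exp (- i * z)\<close> restricted to \<open>i \<ge> k\<close> stays nonnegative, so what
  leaves it through its lower end is bounded by what it contained and received. The function
  \<open>g\<close> is the exchange at the lower end: formation and break-up of dimers for \<open>k = 2\<close>, the flux
  between sizes two and three for \<open>k = 3\<close>.\<close>
lemma exp_moment_bound:
  fixes k :: nat
  assumes T: "0 \<le> T" and z: "0 < z" and k: "k = 2 \<or> k = 3"
    and v: "\<And>t. t \<in> {0..T} \<Longrightarrow> v \<le> u t" and M: "\<And>t. t \<in> {0..T} \<Longrightarrow> count_and_mass t \<le> M"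
    and small: "\<And>i. 3 \<le> i \<Longrightarrow> \<epsilon> * real i \<le> x0 \<Longrightarrow> exp z * b i \<le> v * a i"
    and E0: "(\<Sum>i. \<epsilon> * exp (- real (i + 2) * z) * c (i + 2) 0) \<le> E0"
    and g: "g = (if k = 2 then (\<lambda>t. exp (- 2 * z) * (\<alpha> * m\<^sup>2 - back_rate 2 * c 2 t)) else (\<lambda>t. exp (- 3 * z) * (a 2 * u t * c 2 t - b 3 * c 3 t)))"
  shows "0 \<le> E0 + integral {0..T} g + T * (exp z * Kb * exp (- z * x0 / \<epsilon>) * M / \<epsilon>)"
proof -
  define q where "q = exp z * Kb * exp (- z * x0 / \<epsilon>)"
  have q0: "0 \<le> q" unfolding q_def using Kb_nonneg by auto
  define \<phi> where "\<phi> i t = (if i < k then 0 else exp (- real i * z))" for i :: nat and t :: real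
  define \<phi>' where "\<phi>' i t = (0::real)" for i :: nat and t :: real
  have \<phi>1: "0 \<le> \<phi> i t" "\<phi> i t \<le> 1" "\<phi> i t \<le> exp (- real i * z)" for i t unfolding \<phi>_def using z by auto
  have lip: "\<bar>\<phi> (i + 1) t - \<phi> i t\<bar> \<le> 1" for i t using \<phi>1(1,2)[of i t] \<phi>1(1,2)[of "i+1" t] by linarith
  have int: "(rate \<phi> \<phi>' has_integral (moment \<phi> T - moment \<phi> 0)) {0..T}"
  proof (rule weak_form[OF order_refl T, where L = 1])
    show "\<phi> 1 t = 0" for t using k by (auto simp: \<phi>_def)
    show "(\<phi> i has_real_derivative \<phi>' i t) (at t within {0..T})" for i t
      unfolding \<phi>_def[abs_def] \<phi>'_def by (rule DERIV_const)
  qed (use lip in \<open>auto simp: \<phi>'_def\<close>)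
  have sm: "summable (\<lambda>i. \<epsilon> * \<phi> (i + 2) t * c (i + 2) t)" if t: "0 \<le> t" for t
  proof (rule count_and_mass_dominates(1)[OF t, of 1])
    fix i
    have "\<phi> (i+2) t \<le> 1 + \<epsilon> * real (i+2)" using \<phi>1(2)[of "i+2" t] eps_pos by (intro order_trans[OF \<phi>1(2)]) auto
    hence "\<epsilon> * c (i+2) t * \<phi> (i+2) t \<le> \<epsilon> * c (i+2) t * (1 + \<epsilon> * real (i+2))"
      using c_nonneg[OF t, of "i+2"] eps_pos by (intro mult_left_mono) auto
    thus "\<bar>\<epsilon> * \<phi> (i + 2) t * c (i + 2) t\<bar> \<le> 1 * (\<epsilon> * (1 + \<epsilon> * real (i + 2)) * c (i + 2) t)"
      using c_nonneg[OF t, of "i+2"] eps_pos \<phi>1(1)[of "i+2" t] by (simp add: abs_mult mult_ac)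
  qed auto
  have sme: "summable (\<lambda>i. \<epsilon> * exp (- real (i + 2) * z) * c (i + 2) t)" if t: "0 \<le> t" for t
  proof (rule count_and_mass_dominates(1)[OF t, of 1])
    fix i
    have "- real (i + 2) * z \<le> 0" using z by (intro mult_nonpos_nonneg) auto
    hence "exp (- real (i + 2) * z) \<le> 1" by simp
    moreover have "0 \<le> \<epsilon> * real (i + 2)" using eps_pos by simp
    ultimately have "exp (- real (i + 2) * z) \<le> 1 + \<epsilon> * real (i+2)" by linarith
    hence "\<epsilon> * c (i+2) t * exp (- real (i + 2) * z) \<le> \<epsilon> * c (i+2) t * (1 + \<epsilon> * real (i+2))"
      using c_nonneg[OF t, of "i+2"] eps_pos by (intro mult_left_mono) auto
    thus "\<bar>\<epsilon> * exp (- real (i + 2) * z) * c (i + 2) t\<bar> \<le> 1 * (\<epsilon> * (1 + \<epsilon> * real (i + 2)) * c (i + 2) t)"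
      using c_nonneg[OF t, of "i+2"] eps_pos by (simp add: abs_mult mult_ac)
  qed auto
  have g_cont: "continuous_on {0..T} g"
  proof -
    have "continuous_on {0..T} u" "continuous_on {0..T} (c 2)" "continuous_on {0..T} (c 3)"
      by (auto intro: continuous_on_subset[OF u_continuous] continuous_on_subset[OF c_continuous])
    thus ?thesis unfolding g by (auto intro!: continuous_intros)
  qed
  have g_int: "(g has_integral integral {0..T} g) {0..T}"
    using integrable_integral[OF integrable_continuous_real[OF g_cont]] .
  have rate_le: "rate \<phi> \<phi>' t \<le> g t + q * M / \<epsilon>" if t: "t \<in> {0..T}" for t
  proof -
    have t0: "0 \<le> t" using t by auto
    have D3: "drift \<phi> t i \<le> q * (1 + \<epsilon> * real i)" if i: "3 \<le> i" "k < i" for i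
    proof -
      have r: "real (i - 1) = real i - 1" using i by (simp add: of_nat_diff)
      have "drift \<phi> t i = (exp (- (real i + 1) * z) - exp (- real i * z)) * a i * u t - (exp (- real i * z) - exp (- (real i - 1) * z)) * b i"
        unfolding drift_def \<phi>_def back_rate_def using i r by (simp add: add.commute)
      thus ?thesis unfolding q_def using exp_drift_le[OF t0 i(1) z v[OF t] small[OF i(1)]] by simp
    qed
    \<comment> \<open>The exchange at the lower end; all remaining drift is covered by \<open>exp_drift_le\<close>.\<close>
    define p where "p i = (if k = 2 then (if i = 2 then - exp (- 2 * z) * back_rate 2 * c 2 t else 0) else
      (if i = 2 then exp (- 3 * z) * a 2 * u t * c 2 t else if i = 3 then - exp (- 3 * z) * b 3 * c 3 t else 0))" for i :: nat
    have tm: "\<epsilon> * \<phi>' i t * c i t + c i t * drift \<phi> t i \<le> p i + q / \<epsilon> * (\<epsilon> * (1 + \<epsilon> * real i) * c i t)" if i: "2 \<le> i" for i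
    proof -
      have pos: "0 \<le> q / \<epsilon> * (\<epsilon> * (1 + \<epsilon> * real i) * c i t)" using q0 eps_pos c_nonneg[OF t0 i] by auto
      consider "k = 2" "i = 2" | "k = 3" "i = 2" | "k = 3" "i = 3" | "3 \<le> i" "k < i"
        using k i by linarith
      then show ?thesis
      proof cases
        case 1
        have "drift \<phi> t 2 = (exp (- 3 * z) - exp (- 2 * z)) * (a 2 * u t) - exp (- 2 * z) * back_rate 2"
          using 1 unfolding drift_def \<phi>_def by (simp add: algebra_simps)
        moreover have "(exp (- 3 * z) - exp (- 2 * z)) * (a 2 * u t) \<le> 0"
          using z au_le(2)[OF t0, of 2] by (intro mult_nonpos_nonneg) auto
        ultimately have "drift \<phi> t 2 \<le> - exp (- 2 * z) * back_rate 2" by linarith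
        hence "c 2 t * drift \<phi> t 2 \<le> c 2 t * (- exp (- 2 * z) * back_rate 2)" using c_nonneg[OF t0, of 2] by (intro mult_left_mono) auto
        thus ?thesis using pos 1 by (simp add: p_def \<phi>'_def mult_ac)
      next
        case 2
        have "drift \<phi> t 2 = exp (- 3 * z) * (a 2 * u t)" using 2 unfolding drift_def \<phi>_def by simp
        thus ?thesis using pos 2 by (simp add: p_def \<phi>'_def mult_ac)
      next
        case 3
        have "drift \<phi> t 3 = (exp (- 4 * z) - exp (- 3 * z)) * (a 3 * u t) - exp (- 3 * z) * b 3"
          using 3 unfolding drift_def \<phi>_def back_rate_def by (simp add: algebra_simps)
        moreover have "(exp (- 4 * z) - exp (- 3 * z)) * (a 3 * u t) \<le> 0"
          using z au_le(2)[OF t0, of 3] by (intro mult_nonpos_nonneg) auto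
        ultimately have "drift \<phi> t 3 \<le> - exp (- 3 * z) * b 3" by linarith
        hence "c 3 t * drift \<phi> t 3 \<le> c 3 t * (- exp (- 3 * z) * b 3)" using c_nonneg[OF t0, of 3] by (intro mult_left_mono) auto
        thus ?thesis using pos 3 by (simp add: p_def \<phi>'_def mult_ac)
      next
        case 4
        have "p i = 0" using 4 k by (auto simp: p_def)
        moreover have "c i t * drift \<phi> t i \<le> c i t * (q * (1 + \<epsilon> * real i))"
          using D3[OF 4] c_nonneg[OF t0 i] by (intro mult_left_mono) auto
        ultimately show ?thesis using eps_pos by (simp add: \<phi>'_def mult_ac)
      qed
    qed
    have p0: "p (i + 2) = 0" if "i \<notin> {0, 1}" for i using that by (auto simp: p_def)
    have sp: "summable (\<lambda>i. p (i + 2))" by (rule summable_finite[of "{0,1}"], simp, rule p0)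
    have sump: "(\<Sum>i. p (i + 2)) = p 2 + p 3"
    proof -
      have "(\<Sum>i. p (i + 2)) = (\<Sum>i\<in>{0,1}. p (i + 2))" by (rule suminf_finite, simp, rule p0)
      thus ?thesis by (simp add: numeral_eq_Suc)
    qed
    have s1: "summable (\<lambda>i. q / \<epsilon> * (\<epsilon> * (1 + \<epsilon> * real (i+2)) * c (i+2) t))"
      by (intro summable_mult count_and_mass_summable t0)
    have sl: "summable (\<lambda>i. \<epsilon> * \<phi>' (i + 2) t * c (i + 2) t + c (i + 2) t * drift \<phi> t (i + 2))"
      by (rule rate_summable[OF t0, of 1]) (use lip in \<open>auto simp: \<phi>'_def\<close>)
    have "(\<Sum>i. \<epsilon> * \<phi>' (i + 2) t * c (i + 2) t + c (i + 2) t * drift \<phi> t (i + 2)) \<le>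
       (\<Sum>i. p (i + 2) + q / \<epsilon> * (\<epsilon> * (1 + \<epsilon> * real (i+2)) * c (i+2) t))"
      by (intro suminf_le sl summable_add sp s1) (rule tm, simp)
    also have "\<dots> = p 2 + p 3 + q / \<epsilon> * count_and_mass t"
      unfolding suminf_add[OF sp s1, symmetric] sump count_and_mass_def suminf_mult[OF count_and_mass_summable[OF t0]] ..
    also have "\<dots> \<le> p 2 + p 3 + q / \<epsilon> * M" using M[OF t] q0 eps_pos by (intro add_left_mono mult_left_mono) auto
    finally have 1: "(\<Sum>i. \<epsilon> * \<phi>' (i + 2) t * c (i + 2) t + c (i + 2) t * drift \<phi> t (i + 2)) \<le> p 2 + p 3 + q * M / \<epsilon>" by simp
    have "\<phi> 2 t * (\<alpha> * (u t)\<^sup>2) + p 2 + p 3 \<le> g t"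
    proof (cases "k = 2")
      case True
      then show ?thesis using mult_left_mono[OF u_sq_le[OF t0], of "exp (- 2 * z)"] by (simp add: g p_def \<phi>_def algebra_simps)
    next
      case False
      then show ?thesis using k by (simp add: g p_def \<phi>_def algebra_simps)
    qed
    with 1 show ?thesis unfolding rate_def by linarith
  qed
  have "((\<lambda>t. g t + q * M / \<epsilon>) has_integral (integral {0..T} g + T * (q * M / \<epsilon>))) {0..T}"
  proof -
    have "((\<lambda>t. q * M / \<epsilon>) has_integral (T * (q * M / \<epsilon>))) {0..T}"
      using has_integral_const_real[of "q * M / \<epsilon>" 0 T] T by simp
    from has_integral_add[OF g_int this] show ?thesis .
  qed
  from has_integral_le[OF int this rate_le] have "moment \<phi> T - moment \<phi> 0 \<le> integral {0..T} g + T * (q * M / \<epsilon>)" .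
  moreover have "0 \<le> moment \<phi> T" unfolding moment_def
    by (intro suminf_nonneg sm T) (use \<phi>1(1) c_nonneg T eps_pos in auto)
  moreover have "moment \<phi> 0 \<le> E0"
  proof -
    have "moment \<phi> 0 \<le> (\<Sum>i. \<epsilon> * exp (- real (i + 2) * z) * c (i + 2) 0)" unfolding moment_def
    proof (intro suminf_le sm sme order_refl)
      fix i
      show "\<epsilon> * \<phi> (i + 2) 0 * c (i + 2) 0 \<le> \<epsilon> * exp (- real (i + 2) * z) * c (i + 2) 0"
        using \<phi>1(3)[of "i+2" 0] c_nonneg[of 0 "i+2"] eps_pos by (intro mult_right_mono mult_left_mono) auto
    qed
    with E0 show ?thesis by linarith
  qed
  ultimately show ?thesis unfolding q_def by linarith
qed

end

context bd_system begin

text \<open>The case \<open>k = 2\<close> bounds the dimers, hence the growth from size two to size three. With this, the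
  case \<open>k = 3\<close> bounds the detachment from size three.\<close>
lemma dimer_integral_bounds:
  assumes T: "0 \<le> T" and z: "0 < z"
    and v: "\<And>t. t \<in> {0..T} \<Longrightarrow> v \<le> u t" and M: "\<And>t. t \<in> {0..T} \<Longrightarrow> count_and_mass t \<le> M"
    and small: "\<And>i. 3 \<le> i \<Longrightarrow> \<epsilon> * real i \<le> x0 \<Longrightarrow> exp z * b i \<le> v * a i"
    and E0: "(\<Sum>i. \<epsilon> * exp (- real (i + 2) * z) * c (i + 2) 0) \<le> E0"
  defines "\<tau> \<equiv> T * (exp z * Kb * exp (- z * x0 / \<epsilon>) * M / \<epsilon>)"
  shows "back_rate 2 * integral {0..T} (c 2) \<le> exp (2 * z) * (E0 + \<tau>) + T * (\<alpha> * m\<^sup>2)"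
    and "integral {0..T} entry_flux \<le> exp (3 * z) * (E0 + \<tau>) + 2 * (a 2 * m * integral {0..T} (c 2))"
proof -
  have Ic: "c i integrable_on {0..T}" if "2 \<le> i" for i
    by (rule integrable_continuous_real, rule continuous_on_subset[OF c_continuous]) (use that in auto)
  have ee: "exp (2 * z) * exp (- 2 * z) = 1" "exp (3 * z) * exp (- 3 * z) = 1" by (simp_all add: exp_add[symmetric])
  define g2 where "g2 t = exp (- 2 * z) * (\<alpha> * m\<^sup>2 - back_rate 2 * c 2 t)" for t
  have "0 \<le> E0 + integral {0..T} g2 + \<tau>" unfolding \<tau>_def
    by (rule exp_moment_bound[where k = 2, OF T z _ v M small E0]) (auto simp: g2_def)
  moreover have "(g2 has_integral exp (- 2 * z) * (T * (\<alpha> * m\<^sup>2) - back_rate 2 * integral {0..T} (c 2))) {0..T}"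
    unfolding g2_def[abs_def]
    by (intro has_integral_mult_right has_integral_diff integrable_integral Ic order_refl)
      (use has_integral_const_real[of "\<alpha> * m\<^sup>2" 0 T] T in simp)
  ultimately have "0 \<le> E0 + exp (- 2 * z) * (T * (\<alpha> * m\<^sup>2) - back_rate 2 * integral {0..T} (c 2)) + \<tau>" by (simp add: integral_unique)
  hence "exp (2 * z) * 0 \<le> exp (2 * z) * (E0 + exp (- 2 * z) * (T * (\<alpha> * m\<^sup>2) - back_rate 2 * integral {0..T} (c 2)) + \<tau>)" by (intro mult_left_mono) auto
  also have "\<dots> = exp (2 * z) * (E0 + \<tau>) + (exp (2 * z) * exp (- 2 * z)) * (T * (\<alpha> * m\<^sup>2) - back_rate 2 * integral {0..T} (c 2))" by (simp only: distrib_left mult.assoc add_ac)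
  finally show "back_rate 2 * integral {0..T} (c 2) \<le> exp (2 * z) * (E0 + \<tau>) + T * (\<alpha> * m\<^sup>2)" unfolding ee by simp
  have cu: "continuous_on {0..T} u" "continuous_on {0..T} (c 2)"
    by (auto intro: continuous_on_subset[OF u_continuous] continuous_on_subset[OF c_continuous])
  have Ia: "(\<lambda>t. a 2 * u t * c 2 t) integrable_on {0..T}"
    by (rule integrable_continuous_real) (intro continuous_intros cu)
  define A where "A = integral {0..T} (\<lambda>t. a 2 * u t * c 2 t)"
  define g3 where "g3 t = exp (- 3 * z) * (a 2 * u t * c 2 t - b 3 * c 3 t)" for t
  have "0 \<le> E0 + integral {0..T} g3 + \<tau>" unfolding \<tau>_def
    by (rule exp_moment_bound[where k = 3, OF T z _ v M small E0]) (auto simp: g3_def)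
  moreover have "(g3 has_integral exp (- 3 * z) * (A - b 3 * integral {0..T} (c 3))) {0..T}"
    unfolding g3_def[abs_def] A_def
    by (intro has_integral_mult_right has_integral_diff integrable_integral Ic Ia) auto
  ultimately have "0 \<le> E0 + exp (- 3 * z) * (A - b 3 * integral {0..T} (c 3)) + \<tau>" by (simp add: integral_unique)
  hence "exp (3 * z) * 0 \<le> exp (3 * z) * (E0 + exp (- 3 * z) * (A - b 3 * integral {0..T} (c 3)) + \<tau>)" by (intro mult_left_mono) auto
  also have "\<dots> = exp (3 * z) * (E0 + \<tau>) + (exp (3 * z) * exp (- 3 * z)) * (A - b 3 * integral {0..T} (c 3))" by (simp only: distrib_left mult.assoc add_ac)
  finally have b3: "b 3 * integral {0..T} (c 3) \<le> exp (3 * z) * (E0 + \<tau>) + A" unfolding ee by simp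
  have "A \<le> integral {0..T} (\<lambda>t. a 2 * m * c 2 t)" unfolding A_def
  proof (rule integral_le[OF Ia])
    show "(\<lambda>t. a 2 * m * c 2 t) integrable_on {0..T}" by (rule integrable_continuous_real) (intro continuous_intros cu)
    show "a 2 * u t * c 2 t \<le> a 2 * m * c 2 t" if "t \<in> {0..T}" for t
      using u_le[of t] c_nonneg[of t 2] a_nonneg[of 2] that by (intro mult_right_mono mult_left_mono) auto
  qed
  also have "\<dots> = a 2 * m * integral {0..T} (c 2)" by simp
  finally have A: "A \<le> a 2 * m * integral {0..T} (c 2)" .
  have "(entry_flux has_integral (A + b 3 * integral {0..T} (c 3))) {0..T}"
    unfolding entry_flux_def[abs_def] A_def by (intro has_integral_mult_right has_integral_add integrable_integral Ic Ia) auto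
  thus "integral {0..T} entry_flux \<le> exp (3 * z) * (E0 + \<tau>) + 2 * (a 2 * m * integral {0..T} (c 2))"
    using b3 A by (simp add: integral_unique)
qed

end

section \<open>Smooth test functions\<close>

context bd_system begin

text \<open>The drift of a function of the size \<open>\<epsilon> * i\<close> that also depends on time: a finite difference
  form of \<open>\<epsilon>\<close> times the transport operator of the limit equation.\<close>
definition transport :: "(real \<Rightarrow> real \<Rightarrow> real) \<Rightarrow> (real \<Rightarrow> real \<Rightarrow> real) \<Rightarrow> real \<Rightarrow> nat \<Rightarrow> real" where
  "transport \<phi> \<phi>' t i = \<epsilon> * \<phi>' t (\<epsilon> * real i) + (\<phi> t (\<epsilon> * real (i + 1)) - \<phi> t (\<epsilon> * real i)) * a i * u t
     - (\<phi> t (\<epsilon> * real i) - \<phi> t (\<epsilon> * real (i - 1))) * b i"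

lemma transport_bound:
  assumes t: "0 \<le> t" and i: "3 \<le> i" and L: "0 \<le> L"
    and lip: "\<And>x y. 0 \<le> x \<Longrightarrow> 0 \<le> y \<Longrightarrow> \<bar>\<phi> t x - \<phi> t y\<bar> \<le> L * \<bar>x - y\<bar>"
    and der: "\<And>x. 0 \<le> x \<Longrightarrow> \<bar>\<phi>' t x\<bar> \<le> L"
  shows "\<bar>c i t * transport \<phi> \<phi>' t i\<bar> \<le> L * (1 + Ka * m + Kb) * (\<epsilon> * (1 + \<epsilon> * real i) * c i t)"
proof -
  have nn: "0 \<le> \<epsilon> * real j" for j using eps_pos by simp
  have i2: "2 \<le> i" using i by simp
  have d: "\<bar>\<epsilon> * real (i + 1) - \<epsilon> * real i\<bar> = \<epsilon>" "\<bar>\<epsilon> * real i - \<epsilon> * real (i - 1)\<bar> = \<epsilon>"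
    using i eps_pos by (auto simp: algebra_simps of_nat_diff)
  have "\<bar>\<epsilon> * \<phi>' t (\<epsilon> * real i)\<bar> \<le> \<epsilon> * L"
    unfolding abs_mult using der[OF nn, of i] eps_pos by (intro mult_mono) auto
  moreover have "\<epsilon> * L * 1 \<le> \<epsilon> * L * (1 + \<epsilon> * real i)" using eps_pos L by (intro mult_left_mono) auto
  moreover have "\<bar>(\<phi> t (\<epsilon> * real (i + 1)) - \<phi> t (\<epsilon> * real i)) * a i * u t\<bar> \<le> (\<epsilon> * L) * (Ka * m * (1 + \<epsilon> * real i))"
    unfolding mult.assoc[of _ "a i" "u t"] abs_mult[of _ "a i * u t"]
    using lip[OF nn nn, of "i+1" i] d(1) au_le[OF t i2] L eps_pos by (intro mult_mono) (auto simp: mult.commute mult.left_commute)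
  moreover have "\<bar>(\<phi> t (\<epsilon> * real i) - \<phi> t (\<epsilon> * real (i - 1))) * b i\<bar> \<le> (\<epsilon> * L) * (Kb * (1 + \<epsilon> * real i))"
    unfolding abs_mult
    using lip[OF nn nn, of i "i-1"] d(2) b_le[OF i] b_nonneg[OF i] L eps_pos by (intro mult_mono) (auto simp: mult.commute)
  ultimately have "\<bar>transport \<phi> \<phi>' t i\<bar> \<le> \<epsilon> * L * (1 + \<epsilon> * real i) + (\<epsilon> * L) * (Ka * m * (1 + \<epsilon> * real i)) + (\<epsilon> * L) * (Kb * (1 + \<epsilon> * real i))"
    unfolding transport_def by linarith
  also have "\<dots> = L * (1 + Ka * m + Kb) * (\<epsilon> * (1 + \<epsilon> * real i))" by (simp add: algebra_simps)
  finally have "c i t * \<bar>transport \<phi> \<phi>' t i\<bar> \<le> c i t * (L * (1 + Ka * m + Kb) * (\<epsilon> * (1 + \<epsilon> * real i)))"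
    using c_nonneg[OF t i2] by (intro mult_left_mono) auto
  thus ?thesis using c_nonneg[OF t i2] by (simp add: abs_mult mult_ac)
qed

text \<open>The integral of \<open>\<psi>\<close> against atoms of mass \<open>\<epsilon> * c i\<close> at \<open>\<epsilon> * i\<close>. Sizes start at three, so that the
  large exchange between monomers and dimers does not appear.\<close>
definition atoms :: "(real \<Rightarrow> real) \<Rightarrow> real \<Rightarrow> real" where
  "atoms \<psi> t = (\<Sum>i. \<epsilon> * c (i + 3) t * \<psi> (\<epsilon> * real (i + 3)))"

lemma count_and_mass_dominates3:
  assumes t: "0 \<le> t" and K: "0 \<le> K" and le: "\<And>i. \<bar>w i\<bar> \<le> K * (\<epsilon> * (1 + \<epsilon> * real (i + 3)) * c (i + 3) t)"
  shows "summable w" "\<bar>\<Sum>i. w i\<bar> \<le> K * count_and_mass t"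
proof -
  define w' where "w' i = (case i of 0 \<Rightarrow> 0 | Suc j \<Rightarrow> w j)" for i
  have le': "\<bar>w' i\<bar> \<le> K * (\<epsilon> * (1 + \<epsilon> * real (i + 2)) * c (i + 2) t)" for i
  proof (cases i)
    case 0
    then show ?thesis using K eps_pos c_nonneg[OF t, of 2] by (simp add: w'_def numeral_2_eq_2)
  next
    case (Suc j)
    hence "i + 2 = j + 3" by simp
    then show ?thesis using le[of j] Suc unfolding w'_def by (simp only: \<open>i + 2 = j + 3\<close>) simp
  qed
  have eq: "w' (i + 1) = w i" for i by (simp add: w'_def)
  note S = count_and_mass_dominates[OF t K le']
  from summable_iff_shift[of w' 1] S(1) show sw: "summable w" unfolding eq by blast
  from suminf_split_head[OF S(1)] have "(\<Sum>i. w i) = (\<Sum>i. w' i)" by (simp add: w'_def)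
  with S(2) show "\<bar>\<Sum>i. w i\<bar> \<le> K * count_and_mass t" by simp
qed

text \<open>The sum over \<open>i \<ge> 3\<close> changes by transport inside this range and by exchange with size two. At
  \<open>i = 3\<close> the drift contains \<open>\<phi> t (3 * \<epsilon>)\<close> where \<open>transport\<close> has
  \<open>\<phi> t (3 * \<epsilon>) - \<phi> t (2 * \<epsilon>)\<close>; the difference is the second boundary term.\<close>
theorem weak_form_transport:
  assumes st: "0 \<le> s" "s \<le> T" and L: "0 \<le> L"
    and der: "\<And>t x. t \<in> {s..T} \<Longrightarrow> 0 \<le> x \<Longrightarrow> ((\<lambda>t. \<phi> t x) has_real_derivative \<phi>' t x) (at t within {s..T})"
    and lip: "\<And>t x y. t \<in> {s..T} \<Longrightarrow> 0 \<le> x \<Longrightarrow> 0 \<le> y \<Longrightarrow> \<bar>\<phi> t x - \<phi> t y\<bar> \<le> L * \<bar>x - y\<bar>"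
    and bd: "\<And>t x. t \<in> {s..T} \<Longrightarrow> 0 \<le> x \<Longrightarrow> \<bar>\<phi> t x\<bar> \<le> L"
    and der_le: "\<And>t x. t \<in> {s..T} \<Longrightarrow> 0 \<le> x \<Longrightarrow> \<bar>\<phi>' t x\<bar> \<le> L"
  shows "((\<lambda>t. \<phi> t (3 * \<epsilon>) * (a 2 * u t * c 2 t) - \<phi> t (2 * \<epsilon>) * (b 3 * c 3 t) +
      (\<Sum>i. c (i + 3) t * transport \<phi> \<phi>' t (i + 3))) has_integral (atoms (\<phi> T) T - atoms (\<phi> s) s)) {s..T}"
proof -
  define \<psi> where "\<psi> i t = (if i < 3 then 0 else \<phi> t (\<epsilon> * real i))" for i :: nat and t
  define \<psi>' where "\<psi>' i t = (if i < 3 then 0 else \<phi>' t (\<epsilon> * real i))" for i :: nat and t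
  have nn: "0 \<le> \<epsilon> * real j" for j using eps_pos by simp
  have \<psi>lip: "\<bar>\<psi> (i + 1) t - \<psi> i t\<bar> \<le> L * (1 + \<epsilon>)" if t: "t \<in> {s..T}" for i t
  proof -
    consider "i + 1 < 3" | "i = 2" | "3 \<le> i" by linarith
    then show ?thesis
    proof cases
      case 2
      have "\<bar>\<phi> t (\<epsilon> * real 3)\<bar> \<le> L * 1" using bd[OF t nn, of 3] by simp
      also have "\<dots> \<le> L * (1 + \<epsilon>)" using L eps_pos by (intro mult_left_mono) auto
      finally show ?thesis using 2 by (simp add: \<psi>_def)
    next
      case 3
      have "\<bar>\<phi> t (\<epsilon> * real (i+1)) - \<phi> t (\<epsilon> * real i)\<bar> \<le> L * \<bar>\<epsilon> * real (i+1) - \<epsilon> * real i\<bar>" by (rule lip[OF t nn nn])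
      also have "\<dots> = L * \<epsilon>" using eps_pos by (simp add: algebra_simps)
      also have "\<dots> \<le> L * (1 + \<epsilon>)" using L by (simp add: algebra_simps)
      finally show ?thesis using 3 by (simp add: \<psi>_def)
    qed (use L eps_pos in \<open>auto simp: \<psi>_def\<close>)
  qed
  have \<psi>der: "\<bar>\<psi>' i t\<bar> \<le> L * (1 + \<epsilon>) * real i" if t: "t \<in> {s..T}" and i: "2 \<le> i" for i t
  proof (cases "i < 3")
    case True
    then show ?thesis using L eps_pos by (simp add: \<psi>'_def)
  next
    case False
    have "\<bar>\<phi>' t (\<epsilon> * real i)\<bar> \<le> L * 1 * 1" using der_le[OF t nn, of i] by simp
    also have "\<dots> \<le> L * (1 + \<epsilon>) * real i" using L eps_pos i by (intro mult_mono) auto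
    finally show ?thesis using False by (simp add: \<psi>'_def)
  qed
  have int: "(rate \<psi> \<psi>' has_integral (moment \<psi> T - moment \<psi> s)) {s..T}"
  proof (rule weak_form[OF st, where L = "L * (1 + \<epsilon>)"])
    show "(\<psi> i has_real_derivative \<psi>' i t) (at t within {s..T})" if t: "t \<in> {s..T}" for i t
      using der[OF t nn, of i] by (cases "i < 3") (auto simp: \<psi>_def[abs_def] \<psi>'_def)
  qed (use \<psi>lip \<psi>der in \<open>auto simp: \<psi>_def\<close>)
  have mom: "moment \<psi> t = atoms (\<phi> t) t" if t: "t \<in> {s..T}" for t
  proof -
    have t0: "0 \<le> t" using t st by auto
    have "summable (\<lambda>i. \<epsilon> * \<psi> (i + 2) t * c (i + 2) t)"
    proof (rule count_and_mass_dominates(1)[OF t0 L])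
      fix i
      have "\<bar>\<psi> (i+2) t\<bar> \<le> L * 1" using bd[OF t nn, of "i+2"] L by (simp add: \<psi>_def)
      also have "\<dots> \<le> L * (1 + \<epsilon> * real (i+2))" using L eps_pos by (intro mult_left_mono) auto
      finally have "\<epsilon> * c (i+2) t * \<bar>\<psi> (i+2) t\<bar> \<le> \<epsilon> * c (i+2) t * (L * (1 + \<epsilon> * real (i+2)))"
        using eps_pos c_nonneg[OF t0, of "i+2"] by (intro mult_left_mono) auto
      thus "\<bar>\<epsilon> * \<psi> (i + 2) t * c (i + 2) t\<bar> \<le> L * (\<epsilon> * (1 + \<epsilon> * real (i + 2)) * c (i + 2) t)"
        using eps_pos c_nonneg[OF t0, of "i+2"] by (simp add: abs_mult mult_ac)
    qed
    from suminf_split_head[OF this] show ?thesis unfolding moment_def atoms_def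
      by (simp add: \<psi>_def numeral_eq_Suc mult_ac)
  qed
  have rate_eq: "rate \<psi> \<psi>' t = \<phi> t (3 * \<epsilon>) * (a 2 * u t * c 2 t) - \<phi> t (2 * \<epsilon>) * (b 3 * c 3 t) +
      (\<Sum>i. c (i + 3) t * transport \<phi> \<phi>' t (i + 3))" if t: "t \<in> {s..T}" for t
  proof -
    have t0: "0 \<le> t" using t st by auto
    define w where "w i = \<epsilon> * \<psi>' i t * c i t + c i t * drift \<psi> t i" for i
    have sw: "summable (\<lambda>i. w (i + 2))" unfolding w_def
      by (rule rate_summable[OF t0, of "L * (1 + \<epsilon>)"]) (use t L eps_pos \<psi>lip \<psi>der in auto)
    have st': "summable (\<lambda>i. c (i + 3) t * transport \<phi> \<phi>' t (i + 3))"
      by (rule count_and_mass_dominates3(1)[OF t0, where K = "L * (1 + Ka * m + Kb)"])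
        (use L Ka_nonneg Kb_nonneg m_nonneg in simp, rule transport_bound, use t t0 L lip der_le in auto)
    define p where "p i = (if i = 0 then - \<phi> t (2 * \<epsilon>) * (b 3 * c 3 t) else 0)" for i :: nat
    have sp: "summable p" by (rule summable_finite[of "{0}"]) (auto simp: p_def)
    have sump: "(\<Sum>i. p i) = - \<phi> t (2 * \<epsilon>) * (b 3 * c 3 t)"
    proof -
      have "(\<Sum>i. p i) = sum p {0}" by (rule suminf_finite) (auto simp: p_def)
      also have "\<dots> = - \<phi> t (2 * \<epsilon>) * (b 3 * c 3 t)" by (simp add: p_def)
      finally show ?thesis .
    qed
    have "(\<Sum>i. w (i + 2)) = w 2 + (\<Sum>i. w (i + 3))"
      using suminf_split_head[OF sw] by (simp add: numeral_eq_Suc)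
    also have "w 2 = \<phi> t (3 * \<epsilon>) * (a 2 * u t * c 2 t)"
      by (simp add: w_def \<psi>'_def \<psi>_def drift_def mult_ac)
    also have "(\<Sum>i. w (i + 3)) = (\<Sum>i. c (i + 3) t * transport \<phi> \<phi>' t (i + 3) + p i)"
    proof (rule suminf_cong)
      fix i
      show "w (i + 3) = c (i + 3) t * transport \<phi> \<phi>' t (i + 3) + p i"
      proof (cases "i = 0")
        case True
        then show ?thesis by (simp add: w_def p_def \<psi>_def \<psi>'_def drift_def transport_def back_rate_def algebra_simps)
      next
        case False
        have cs: "(i + 3 < 3) = False" "(i + 3 + 1 < 3) = False" "(i + 3 - 1 < 3) = False" "(i + 3 = 2) = False"
          using False by auto
        have "w (i + 3) = c (i + 3) t * transport \<phi> \<phi>' t (i + 3)"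
          unfolding w_def \<psi>_def \<psi>'_def drift_def transport_def back_rate_def cs if_False by (simp add: algebra_simps)
        thus ?thesis using False by (simp add: p_def)
      qed
    qed
    also have "\<dots> = (\<Sum>i. c (i + 3) t * transport \<phi> \<phi>' t (i + 3)) - \<phi> t (2 * \<epsilon>) * (b 3 * c 3 t)"
      unfolding suminf_add[OF st' sp, symmetric] sump by simp
    finally show ?thesis by (simp add: rate_def w_def \<psi>_def)
  qed
  show ?thesis using has_integral_eq[OF rate_eq int] mom[of T] mom[of s] st by simp
qed

end

context bd_system begin

lemma bracket_bound:
  assumes t: "0 \<le> t" and "\<bar>p\<bar> \<le> L" "\<bar>q\<bar> \<le> L"
  shows "\<bar>p * (a 2 * u t * c 2 t) - q * (b 3 * c 3 t)\<bar> \<le> L * entry_flux t"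
proof -
  have 1: "0 \<le> a 2 * u t * c 2 t" "0 \<le> b 3 * c 3 t"
    using a_nonneg[of 2] b_nonneg[of 3] u_nonneg[of t] c_nonneg[of t 2] c_nonneg[of t 3] t by auto
  have "\<bar>p * (a 2 * u t * c 2 t)\<bar> \<le> L * (a 2 * u t * c 2 t)" "\<bar>q * (b 3 * c 3 t)\<bar> \<le> L * (b 3 * c 3 t)"
    unfolding abs_mult[of p] abs_mult[of q] using 1 assms by (auto intro!: mult_right_mono)
  thus ?thesis unfolding entry_flux_def distrib_left by linarith
qed

lemma transport_sum_bound:
  assumes t: "0 \<le> t" and L: "0 \<le> L"
    and lip: "\<And>x y. 0 \<le> x \<Longrightarrow> 0 \<le> y \<Longrightarrow> \<bar>\<phi> t x - \<phi> t y\<bar> \<le> L * \<bar>x - y\<bar>"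
    and der: "\<And>x. 0 \<le> x \<Longrightarrow> \<bar>\<phi>' t x\<bar> \<le> L"
  shows "summable (\<lambda>i. c (i + 3) t * transport \<phi> \<phi>' t (i + 3))"
    "\<bar>\<Sum>i. c (i + 3) t * transport \<phi> \<phi>' t (i + 3)\<bar> \<le> L * (1 + Ka * m + Kb) * count_and_mass t"
proof -
  have K: "0 \<le> L * (1 + Ka * m + Kb)" using L Ka_nonneg Kb_nonneg m_nonneg by simp
  have le: "\<bar>c (i + 3) t * transport \<phi> \<phi>' t (i + 3)\<bar> \<le> L * (1 + Ka * m + Kb) * (\<epsilon> * (1 + \<epsilon> * real (i + 3)) * c (i + 3) t)" for i
    by (rule transport_bound) (use t L lip der in auto)
  show "summable (\<lambda>i. c (i + 3) t * transport \<phi> \<phi>' t (i + 3))"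
    "\<bar>\<Sum>i. c (i + 3) t * transport \<phi> \<phi>' t (i + 3)\<bar> \<le> L * (1 + Ka * m + Kb) * count_and_mass t"
    using count_and_mass_dominates3[OF t K le] by auto
qed

text \<open>Transport is bounded, so it moves the integral of a Lipschitz function at bounded speed; the
  remaining change is bounded by the time integral of the entry flux.\<close>
lemma atoms_lipschitz:
  assumes st: "0 \<le> s" "s \<le> t" "t \<le> T" and L: "0 \<le> L"
    and lip: "\<And>x y. 0 \<le> x \<Longrightarrow> 0 \<le> y \<Longrightarrow> \<bar>g x - g y\<bar> \<le> L * \<bar>x - y\<bar>" and bd: "\<And>x. 0 \<le> x \<Longrightarrow> \<bar>g x\<bar> \<le> L"
    and M: "\<And>t. t \<in> {0..T} \<Longrightarrow> count_and_mass t \<le> M"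
  shows "\<bar>atoms g t - atoms g s\<bar> \<le> L * (1 + Ka * m + Kb) * M * (t - s) + L * integral {0..T} entry_flux"
proof -
  define F where "F r = g (3 * \<epsilon>) * (a 2 * u r * c 2 r) - g (2 * \<epsilon>) * (b 3 * c 3 r) +
      (\<Sum>i. c (i + 3) r * transport (\<lambda>_. g) (\<lambda>_ _. 0) r (i + 3))" for r
  have F: "(F has_integral (atoms g t - atoms g s)) {s..t}"
    unfolding F_def[abs_def] by (rule weak_form_transport[OF st(1,2) L]) (use lip bd L in auto)
  have K: "0 \<le> L * (1 + Ka * m + Kb)" using L Ka_nonneg Kb_nonneg m_nonneg by simp
  have le: "norm (F r) \<le> L * entry_flux r + L * (1 + Ka * m + Kb) * M" if r: "r \<in> {s..t}" for r
  proof -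
    have r0: "0 \<le> r" using r st by auto
    have "\<bar>\<Sum>i. c (i + 3) r * transport (\<lambda>_. g) (\<lambda>_ _. 0) r (i + 3)\<bar> \<le> L * (1 + Ka * m + Kb) * count_and_mass r"
      by (rule transport_sum_bound(2)[OF r0 L]) (use lip L in auto)
    also have "\<dots> \<le> L * (1 + Ka * m + Kb) * M" using r st by (intro mult_left_mono M K) auto
    finally have 1: "\<bar>\<Sum>i. c (i + 3) r * transport (\<lambda>_. g) (\<lambda>_ _. 0) r (i + 3)\<bar> \<le> L * (1 + Ka * m + Kb) * M" .
    have "\<bar>g (3 * \<epsilon>) * (a 2 * u r * c 2 r) - g (2 * \<epsilon>) * (b 3 * c 3 r)\<bar> \<le> L * entry_flux r"
      by (rule bracket_bound[OF r0]) (use bd eps_pos in auto)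
    with 1 show ?thesis unfolding F_def real_norm_def by linarith
  qed
  have I: "((\<lambda>r. L * entry_flux r + L * (1 + Ka * m + Kb) * M) has_integral
      (L * integral {s..t} entry_flux + (t - s) *\<^sub>R (L * (1 + Ka * m + Kb) * M))) {s..t}"
    by (intro has_integral_add has_integral_mult_right integrable_integral entry_flux_integrable st(1))
      (use has_integral_const_real[of "L * (1 + Ka * m + Kb) * M" s t] st in simp)
  have "norm (integral {s..t} F) \<le> integral {s..t} (\<lambda>r. L * entry_flux r + L * (1 + Ka * m + Kb) * M)"
    by (rule integral_norm_bound_integral) (use F I le in \<open>auto simp: integrable_on_def\<close>)
  also have "\<dots> = L * integral {s..t} entry_flux + (t - s) * (L * (1 + Ka * m + Kb) * M)"
    using integral_unique[OF I] by simp
  finally have "\<bar>atoms g t - atoms g s\<bar> \<le> L * integral {s..t} entry_flux + (t - s) * (L * (1 + Ka * m + Kb) * M)"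
    using integral_unique[OF F] by simp
  moreover have "integral {s..t} entry_flux \<le> integral {0..T} entry_flux"
    by (rule integral_subset_le) (use st entry_flux_integrable entry_flux_nonneg in auto)
  hence "L * integral {s..t} entry_flux \<le> L * integral {0..T} entry_flux" using L by (rule mult_left_mono)
  ultimately show ?thesis by (simp add: mult.commute[of "t - s"])
qed

end

section \<open>Test functions and measures on the half-line\<close>

lemma Cc_continuous: "g \<in> Cc \<Longrightarrow> continuous_on {0..} g"
  by (simp add: Cc_def)

lemma continuous_bounded_on_Icc:
  fixes h :: "real \<Rightarrow> real"
  assumes "continuous_on {0..} h" obtains C where "0 < C" "\<And>x. 0 \<le> x \<Longrightarrow> x \<le> R \<Longrightarrow> \<bar>h x\<bar> \<le> C"
proof -
  have "compact (h ` {0..R})" by (intro compact_continuous_image continuous_on_subset[OF assms]) auto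
  then obtain C where "0 < C" "\<forall>y\<in>h ` {0..R}. norm y \<le> C" using compact_imp_bounded bounded_pos by blast
  thus ?thesis by (intro that[of C]) auto
qed

lemma Cc_support:
  assumes "g \<in> Cc" obtains R where "0 < R" "\<And>x. R \<le> x \<Longrightarrow> g x = 0"
proof -
  obtain K where K: "compact K" "\<forall>x\<in>{0..} - K. g x = 0" using assms by (auto simp: Cc_def)
  obtain B where B: "0 < B" "\<forall>x\<in>K. norm x \<le> B" using compact_imp_bounded[OF K(1)] bounded_pos by blast
  show ?thesis
  proof (rule that[of "B + 1"])
    fix x assume "B + 1 \<le> x"
    hence "x \<in> {0..} - K" using B by force
    thus "g x = 0" using K(2) by auto
  qed (use B in auto)
qed

lemma Cc_I:
  assumes "continuous_on {0..} g" "\<And>x. R \<le> x \<Longrightarrow> g x = 0"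
  shows "g \<in> Cc"
  unfolding Cc_def using assms by (auto intro!: exI[of _ "{0..R}"])

lemma Cc_bounded:
  assumes "g \<in> Cc" obtains B where "0 < B" "\<And>x. 0 \<le> x \<Longrightarrow> \<bar>g x\<bar> \<le> B"
proof -
  obtain R where R: "0 < R" "\<And>x. R \<le> x \<Longrightarrow> g x = 0" using Cc_support[OF assms] by blast
  have "compact (g ` {0..R})"
    by (intro compact_continuous_image continuous_on_subset[OF Cc_continuous[OF assms]]) auto
  then obtain B where B: "0 < B" "\<forall>x\<in>g ` {0..R}. norm x \<le> B" using compact_imp_bounded bounded_pos by blast
  show ?thesis
  proof (rule that[OF B(1)])
    fix x :: real assume x: "0 \<le> x"
    show "\<bar>g x\<bar> \<le> B"
    proof (cases "x \<le> R")
      case True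
      hence "g x \<in> g ` {0..R}" using x by auto
      thus ?thesis using B(2) by (metis real_norm_def)
    qed (use R B in auto)
  qed
qed

lemma Cc_uniform:
  assumes "g \<in> Cc" "0 < \<delta>"
  obtains d where "0 < d" "\<And>x y. 0 \<le> x \<Longrightarrow> 0 \<le> y \<Longrightarrow> \<bar>x - y\<bar> < d \<Longrightarrow> \<bar>g x - g y\<bar> < \<delta>"
proof -
  obtain R where R: "0 < R" "\<And>x. R \<le> x \<Longrightarrow> g x = 0" using Cc_support[OF assms(1)] by blast
  have "uniformly_continuous_on {0..R+1} g"
    by (intro compact_uniformly_continuous continuous_on_subset[OF Cc_continuous[OF assms(1)]]) auto
  then obtain d where d: "0 < d" "\<And>x y. x \<in> {0..R+1} \<Longrightarrow> y \<in> {0..R+1} \<Longrightarrow> dist y x < d \<Longrightarrow> dist (g y) (g x) < \<delta>"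
    using assms(2) unfolding uniformly_continuous_on_def by blast
  show ?thesis
  proof (rule that[of "min d 1"])
    fix x y :: real assume xy: "0 \<le> x" "0 \<le> y" "\<bar>x - y\<bar> < min d 1"
    show "\<bar>g x - g y\<bar> < \<delta>"
    proof (cases "x \<le> R + 1 \<and> y \<le> R + 1")
      case True
      then show ?thesis using d(2)[of y x] xy by (auto simp: dist_real_def)
    next
      case False
      hence "R \<le> x" "R \<le> y" using xy by auto
      thus ?thesis using R assms(2) by simp
    qed
  qed (use d in auto)
qed

lemma Cc_diff: "g \<in> Cc \<Longrightarrow> h \<in> Cc \<Longrightarrow> (\<lambda>x. g x - h x) \<in> Cc"
proof -
  assume g: "g \<in> Cc" and h: "h \<in> Cc"
  obtain R where R: "\<And>x. R \<le> x \<Longrightarrow> g x = 0" using Cc_support[OF g] by blast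
  obtain S where S: "\<And>x. S \<le> x \<Longrightarrow> h x = 0" using Cc_support[OF h] by blast
  show ?thesis
    by (rule Cc_I[where R = "max R S"]) (use R S continuous_on_diff[OF Cc_continuous[OF g] Cc_continuous[OF h]] in auto)
qed

lemma Mf_space: "\<nu> \<in> Mf \<Longrightarrow> space \<nu> = {0..}"
  by (auto simp: Mf_def dest: sets_eq_imp_space_eq simp: space_restrict_space)

lemma Mf_measurable_continuous:
  assumes "\<nu> \<in> Mf" "continuous_on {0..} g"
  shows "g \<in> borel_measurable \<nu>"
proof -
  have "g \<in> borel_measurable (restrict_space borel {0..})"
    by (rule borel_measurable_continuous_on_restrict[OF assms(2)])
  moreover have "sets \<nu> = sets (restrict_space borel {0::real..})" using assms(1) by (simp add: Mf_def)
  ultimately show ?thesis using measurable_cong_sets by blast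
qed

lemma Cc_integrable:
  assumes "\<nu> \<in> Mf" "g \<in> Cc"
  shows "integrable \<nu> g"
proof -
  interpret finite_measure \<nu> using assms(1) by (simp add: Mf_def)
  obtain B where B: "\<And>x. 0 \<le> x \<Longrightarrow> \<bar>g x\<bar> \<le> B" using Cc_bounded[OF assms(2)] by blast
  show ?thesis
    by (rule integrable_const_bound[of _ B])
      (use B Mf_space[OF assms(1)] Mf_measurable_continuous[OF assms(1) Cc_continuous[OF assms(2)]] in auto)
qed

lemma Mf_integral_bound:
  assumes "\<nu> \<in> Mf" "measure \<nu> {0..} \<le> M" "g \<in> Cc" "\<And>x. 0 \<le> x \<Longrightarrow> \<bar>g x\<bar> \<le> B"
  shows "\<bar>\<integral>x. g x \<partial>\<nu>\<bar> \<le> B * M"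
proof -
  interpret finite_measure \<nu> using assms(1) by (simp add: Mf_def)
  have B0: "0 \<le> B" using assms(4)[of 0] by auto
  have "\<bar>\<integral>x. g x \<partial>\<nu>\<bar> \<le> (\<integral>x. \<bar>g x\<bar> \<partial>\<nu>)" by (rule integral_abs_bound)
  also have "\<dots> \<le> (\<integral>x. B \<partial>\<nu>)"
    by (rule integral_mono) (use Cc_integrable[OF assms(1,3)] Mf_space[OF assms(1)] assms(4) in auto)
  also have "\<dots> = B * measure \<nu> {0..}" using Mf_space[OF assms(1)] by simp
  also have "\<dots> \<le> B * M" by (intro mult_left_mono assms B0)
  finally show ?thesis .
qed

lemma sup_norm_ge:
  assumes "g \<in> Cc" "0 \<le> x" shows "\<bar>g x\<bar> \<le> sup_norm g"
proof -
  obtain B where B: "\<And>x. 0 \<le> x \<Longrightarrow> \<bar>g x\<bar> \<le> B" using Cc_bounded[OF assms(1)] by blast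
  show ?thesis unfolding sup_norm_def
    by (rule cSUP_upper) (use assms B in \<open>auto intro!: bdd_aboveI[of _ B]\<close>)
qed

section \<open>Compactness of discrete measures\<close>

lemma nat_weights_distribution:
  fixes p y :: "nat \<Rightarrow> real"
  assumes p: "\<And>i. 0 \<le> p i" "p sums 1"
  defines "\<nu> \<equiv> distr (density (count_space UNIV) (\<lambda>i. ennreal (p i))) borel y"
  shows "real_distribution \<nu>"
    and "\<And>h B. h \<in> borel_measurable borel \<Longrightarrow> (\<And>x. \<bar>h x\<bar> \<le> B) \<Longrightarrow> (\<integral>x. h x \<partial>\<nu>) = (\<Sum>i. p i * h (y i))"
proof -
  have "emeasure (density (count_space UNIV) (\<lambda>i. ennreal (p i))) UNIV = (\<integral>\<^sup>+i. ennreal (p i) \<partial>count_space UNIV)"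
    by (subst emeasure_density) auto
  also have "\<dots> = (\<Sum>i. ennreal (p i))" by (rule nn_integral_count_space_nat)
  also have "\<dots> = ennreal (\<Sum>i. p i)" by (rule suminf_ennreal2) (use p sums_summable in auto)
  also have "\<dots> = 1" using p(2) by (simp add: sums_iff)
  finally have "prob_space (density (count_space UNIV) (\<lambda>i. ennreal (p i)))" by (intro prob_spaceI) auto
  hence "prob_space \<nu>" unfolding \<nu>_def by (rule prob_space.prob_space_distr) auto
  thus "real_distribution \<nu>" by (simp add: real_distribution_def real_distribution_axioms_def \<nu>_def)
  fix h :: "real \<Rightarrow> real" and B assume h: "h \<in> borel_measurable borel" and B: "\<And>x. \<bar>h x\<bar> \<le> B"
  have "(\<integral>x. h x \<partial>\<nu>) = (\<integral>i. h (y i) \<partial>density (count_space UNIV) (\<lambda>i. ennreal (p i)))"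
    unfolding \<nu>_def by (rule integral_distr) (use h in auto)
  also have "\<dots> = (\<integral>i. p i *\<^sub>R h (y i) \<partial>count_space UNIV)" by (rule integral_density) (use p in auto)
  also have "\<dots> = (\<Sum>i. p i *\<^sub>R h (y i))"
  proof (rule integral_count_space_nat)
    show "integrable (count_space UNIV) (\<lambda>i. p i *\<^sub>R h (y i))"
      unfolding integrable_count_space_nat_iff
    proof (rule summable_comparison_test')
      show "summable (\<lambda>i. B * p i)" by (intro summable_mult sums_summable[OF p(2)])
      show "norm (norm (p i *\<^sub>R h (y i))) \<le> B * p i" for i
        using mult_right_mono[OF B[of "y i"] p(1)[of i]] p(1)[of i] by (simp add: abs_mult mult.commute)
    qed
  qed
  finally show "(\<integral>x. h x \<partial>\<nu>) = (\<Sum>i. p i * h (y i))" by simp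
qed

text \<open>Helly selection for discrete measures on the half-line with bounded mass and first moment.\<close>
theorem atomic_compactness:
  fixes w x :: "nat \<Rightarrow> nat \<Rightarrow> real"
  assumes w: "\<And>n i. 0 \<le> w n i" and x: "\<And>n i. 0 \<le> x n i" and C: "0 < C"
    and sw: "\<And>n. summable (w n)" "\<And>n. (\<Sum>i. w n i) \<le> C"
    and swx: "\<And>n. summable (\<lambda>i. w n i * x n i)" "\<And>n. (\<Sum>i. w n i * x n i) \<le> C"
  shows "\<exists>r \<mu>. strict_mono (r :: nat \<Rightarrow> nat) \<and> \<mu> \<in> Mf \<and> measure \<mu> {0..} \<le> C \<and>
    (\<forall>g\<in>Cc. (\<lambda>k. \<Sum>i. w (r k) i * g (x (r k) i)) \<longlonglongrightarrow> (\<integral>x. g x \<partial>\<mu>))"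
proof -
  \<comment> \<open>The missing mass is placed at \<open>-1\<close>, off the half-line. This makes every measure a probability
    measure, and the first moments keep mass from escaping to infinity.\<close>
  define p where "p n i = (case i of 0 \<Rightarrow> 1 - (\<Sum>i. w n i) / C | Suc j \<Rightarrow> w n j / C)" for n i
  define y where "y n i = (case i of 0 \<Rightarrow> -1 | Suc j \<Rightarrow> x n j)" for n i
  define \<nu> where "\<nu> n = distr (density (count_space UNIV) (\<lambda>i. ennreal (p n i))) borel (y n)" for n
  have p0: "0 \<le> p n i" for n i
    using w[of n] C sw(2)[of n] by (auto simp: p_def split: nat.split)
  have ps: "p n sums 1" for n
  proof -
    have "(\<lambda>i. w n i / C) sums ((\<Sum>i. w n i) / C)" by (intro sums_divide summable_sums sw)
    hence "(\<lambda>i. p n (Suc i)) sums ((\<Sum>i. w n i) / C)" by (simp add: p_def)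
    from sums_Suc[OF this] show ?thesis by (simp add: p_def[of n 0])
  qed
  have rd: "real_distribution (\<nu> n)" for n unfolding \<nu>_def by (rule nat_weights_distribution(1)[OF p0 ps])
  have int: "(\<integral>x. h x \<partial>\<nu> n) = (\<Sum>i. p n i * h (y n i))" if "h \<in> borel_measurable borel" "\<And>x. \<bar>h x\<bar> \<le> B" for h n B
    unfolding \<nu>_def by (rule nat_weights_distribution(2)[OF p0 ps that])
  have shift: "(\<Sum>i. p n i * h (y n i)) = p n 0 * h (-1) + (\<Sum>i. w n i * h (x n i)) / C" if B: "\<And>x. \<bar>h x\<bar> \<le> B" for h n B
  proof -
    have s: "summable (\<lambda>i. w n i * h (x n i))"
    proof (rule summable_comparison_test')
      show "summable (\<lambda>i. B * w n i)" by (intro summable_mult sw)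
      show "norm (w n i * h (x n i)) \<le> B * w n i" for i
        using mult_right_mono[OF B[of "x n i"] w[of n i]] w[of n i] by (simp add: abs_mult mult.commute)
    qed
    have "(\<lambda>i. w n i * h (x n i) / C) sums ((\<Sum>i. w n i * h (x n i)) / C)" by (intro sums_divide summable_sums s)
    hence "(\<lambda>i. p n (Suc i) * h (y n (Suc i))) sums ((\<Sum>i. w n i * h (x n i)) / C)" by (simp add: p_def y_def)
    from sums_Suc[OF this] show ?thesis by (simp add: sums_iff y_def add.commute)
  qed
  have tight: "tight \<nu>"
    unfolding tight_def
  proof (intro conjI allI impI rd)
    fix e :: real assume e: "0 < e"
    define b where "b = 2 / e"
    have b: "0 < b" using e by (simp add: b_def)
    have "measure (\<nu> n) {-2<..b} > 1 - e" for n
    proof -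
      let ?h = "indicat_real {-2<..b}"
      have "measure (\<nu> n) {-2<..b} = (\<integral>x. ?h x \<partial>\<nu> n)"
        by (simp add: \<nu>_def)
      also have "\<dots> = (\<Sum>i. p n i * ?h (y n i))" by (rule int[where B = 1]) (auto simp: indicator_def)
      also have "\<dots> = p n 0 * ?h (-1) + (\<Sum>i. w n i * ?h (x n i)) / C" by (rule shift[where B = 1]) (auto simp: indicator_def)
      also have "?h (-1) = 1" using b by (simp add: indicator_def)
      finally have meas: "measure (\<nu> n) {-2<..b} = 1 - (\<Sum>i. w n i) / C + (\<Sum>i. w n i * ?h (x n i)) / C" by (simp add: p_def)
      have s1: "summable (\<lambda>i. w n i * ?h (x n i))"
        by (rule summable_comparison_test'[OF sw(1)[of n]]) (use w in \<open>auto simp: indicator_def\<close>)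
      have s2: "summable (\<lambda>i. w n i * x n i / b)" by (intro summable_divide swx)
      have "(\<Sum>i. w n i) \<le> (\<Sum>i. w n i * ?h (x n i) + w n i * x n i / b)"
      proof (intro suminf_le sw summable_add s1 s2)
        fix i
        show "w n i \<le> w n i * ?h (x n i) + w n i * x n i / b"
        proof (cases "x n i \<le> b")
          case True
          then show ?thesis using w[of n i] x[of n i] b by (simp add: indicator_def)
        next
          case False
          hence "1 \<le> x n i / b" using b by simp
          from mult_left_mono[OF this w[of n i]] show ?thesis using w[of n i] by (simp add: indicator_def)
        qed
      qed
      also have "\<dots> = (\<Sum>i. w n i * ?h (x n i)) + (\<Sum>i. w n i * x n i) / b"
        unfolding suminf_add[OF s1 s2, symmetric] suminf_divide[OF swx(1)] ..
      also have "(\<Sum>i. w n i * x n i) / b \<le> C / b" using swx(2)[of n] b by (intro divide_right_mono) auto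
      finally have "(\<Sum>i. w n i) / C \<le> ((\<Sum>i. w n i * ?h (x n i)) + C / b) / C" using C by (intro divide_right_mono) auto
      hence "(\<Sum>i. w n i) / C \<le> (\<Sum>i. w n i * ?h (x n i)) / C + 1 / b" using C by (simp add: add_divide_distrib)
      moreover have "1 / b < e" using e by (simp add: b_def)
      ultimately show ?thesis using meas by linarith
    qed
    thus "\<exists>a b. a < b \<and> (\<forall>n. 1 - e < measure (\<nu> n) {a<..b})" using b by (intro exI[of _ "-2"] exI[of _ b]) auto
  qed
  obtain r M where r: "strict_mono (r::nat\<Rightarrow>nat)" and M: "real_distribution M" and conv: "weak_conv_m (\<nu> \<circ> id \<circ> r) M"
    using tight_imp_convergent_subsubsequence[OF tight strict_mono_id] by blast
  interpret M: real_distribution M by fact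
  have lim: "(\<lambda>k. \<integral>x. h x \<partial>\<nu> (r k)) \<longlonglongrightarrow> (\<integral>x. h x \<partial>M)" if "\<And>x. isCont h x" "\<And>x. \<bar>h x\<bar> \<le> B" for h :: "real \<Rightarrow> real" and B
    using weak_conv_imp_integral_bdd_continuous_conv[of "\<lambda>k. \<nu> (r k)" M h B] rd M conv that by (simp add: o_def)
  \<comment> \<open>A test function on \<open>(-1, 0)\<close> shows that the limit has no mass there, so it can be restricted to the
    half-line without changing integrals of functions that vanish at \<open>-1\<close>.\<close>
  define bump where "bump x = max 0 (min (x + 1) (- x))" for x :: real
  have bump: "isCont bump x" "\<bar>bump x\<bar> \<le> 1" "0 \<le> bump x" for x
    unfolding bump_def by (auto intro!: continuous_intros)
  have mb: "bump \<in> borel_measurable borel" by (intro borel_measurable_continuous_onI continuous_at_imp_continuous_on ballI bump)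
  have "(\<integral>x. bump x \<partial>\<nu> n) = 0" for n
  proof -
    have "(\<integral>x. bump x \<partial>\<nu> n) = p n 0 * bump (-1) + (\<Sum>i. w n i * bump (x n i)) / C"
      unfolding int[OF mb bump(2)] by (rule shift[OF bump(2)])
    also have "\<dots> = 0" using x by (simp add: bump_def)
    finally show ?thesis .
  qed
  with lim[of bump 1] bump have "(\<integral>x. bump x \<partial>M) = 0" by (simp add: LIMSEQ_const_iff)
  moreover have "integrable M bump"
    by (rule M.integrable_const_bound[of _ 1]) (use bump mb in auto)
  ultimately have AE0: "AE x in M. bump x = 0"
    using integral_nonneg_eq_0_iff_AE[of M bump] bump(3) by auto
  define \<mu> where "\<mu> = density (restrict_space M {0..}) (\<lambda>_. ennreal C)"
  have sets_r: "sets (restrict_space M {0..}) = sets (restrict_space borel {0::real..})"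
    by (rule sets_restrict_space_cong) simp
  have sets_\<mu>: "sets \<mu> = sets (restrict_space borel {0::real..})"
    unfolding \<mu>_def by (simp add: sets_r)
  have em: "emeasure \<mu> {0..} = ennreal (C * measure M {0..})"
  proof -
    have "{0..} \<in> sets (restrict_space M {0..})" by (simp add: sets_restrict_space_iff)
    thus ?thesis unfolding \<mu>_def using C
      by (simp add: emeasure_density_const emeasure_restrict_space M.emeasure_eq_measure ennreal_mult)
  qed
  have space_\<mu>: "space \<mu> = {0..}" using sets_eq_imp_space_eq[OF sets_\<mu>] by (simp add: space_restrict_space)
  have fin: "finite_measure \<mu>" by (rule finite_measureI) (simp add: space_\<mu> em)
  have \<mu>: "\<mu> \<in> Mf" using sets_\<mu> fin by (simp add: Mf_def)
  have le: "measure \<mu> {0..} \<le> C"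
  proof -
    have "measure \<mu> {0..} = C * measure M {0..}" using em C by (simp add: measure_def)
    also have "\<dots> \<le> C * 1" using C by (intro mult_left_mono) auto
    finally show ?thesis by simp
  qed
  have "(\<lambda>k. \<Sum>i. w (r k) i * g (x (r k) i)) \<longlonglongrightarrow> (\<integral>x. g x \<partial>\<mu>)" if g: "g \<in> Cc" for g
  proof -
    obtain B where B: "0 < B" "\<And>x. 0 \<le> x \<Longrightarrow> \<bar>g x\<bar> \<le> B" using Cc_bounded[OF g] by blast
    define h where "h x = g (max 0 x) * max 0 (min 1 (1 + 2 * x))" for x
    have contg: "continuous_on UNIV (\<lambda>x. g (max 0 x))"
      by (rule continuous_on_compose2[OF Cc_continuous[OF g]]) (auto intro!: continuous_intros)
    have conth: "continuous_on UNIV h" unfolding h_def by (intro continuous_intros contg)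
    have hB: "\<bar>h x\<bar> \<le> B" for x
    proof -
      have "\<bar>h x\<bar> \<le> B * 1" unfolding h_def abs_mult by (intro mult_mono B) (use B in auto)
      thus ?thesis by simp
    qed
    have hc: "isCont h x" for x using conth by (simp add: continuous_on_eq_continuous_at)
    have mh: "h \<in> borel_measurable borel" by (rule borel_measurable_continuous_onI[OF conth])
    have hg: "h x = g x" if "0 \<le> x" for x using that by (simp add: h_def)
    have h1: "h (-1) = 0" by (simp add: h_def)
    have "(\<integral>x. h x \<partial>\<nu> n) = (\<Sum>i. w n i * g (x n i)) / C" for n
    proof -
      have "(\<integral>x. h x \<partial>\<nu> n) = (\<Sum>i. p n i * h (y n i))" by (rule int[OF mh hB])
      also have "\<dots> = p n 0 * h (-1) + (\<Sum>i. w n i * h (x n i)) / C" by (rule shift[OF hB])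
      finally show ?thesis using x by (simp add: hg h1)
    qed
    with lim[OF hc hB] have "(\<lambda>k. (\<Sum>i. w (r k) i * g (x (r k) i)) / C) \<longlonglongrightarrow> (\<integral>x. h x \<partial>M)" by simp
    from tendsto_mult_left[OF this, of C] have L: "(\<lambda>k. \<Sum>i. w (r k) i * g (x (r k) i)) \<longlonglongrightarrow> C * (\<integral>x. h x \<partial>M)"
      using C by simp
    have "(\<integral>x. g x \<partial>\<mu>) = C * (\<integral>x. g x \<partial>restrict_space M {0..})"
    proof -
      have "g \<in> borel_measurable (restrict_space M {0..})"
        using borel_measurable_continuous_on_restrict[OF Cc_continuous[OF g]] measurable_cong_sets[OF sets_r refl] by blast
      thus ?thesis unfolding \<mu>_def using integral_density[of g "restrict_space M {0..}" "\<lambda>_. C"] C by simp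
    qed
    also have "(\<integral>x. g x \<partial>restrict_space M {0..}) = (\<integral>x. indicator {0..} x *\<^sub>R g x \<partial>M)"
      by (rule integral_restrict_space) simp
    also have "\<dots> = (\<integral>x. h x \<partial>M)"
    proof (rule integral_cong_AE)
      have "(\<lambda>x. indicator {0..} x *\<^sub>R h x) \<in> borel_measurable M" using mh by auto
      moreover have "(\<lambda>x. indicator {0..} x *\<^sub>R h x) = (\<lambda>x. indicator {0..} x *\<^sub>R g x)"
        by (auto simp: indicator_def hg)
      ultimately show "(\<lambda>x. indicator {0..} x *\<^sub>R g x) \<in> borel_measurable M" by simp
      show "h \<in> borel_measurable M" using mh by auto
      show "AE x in M. indicator {0..} x *\<^sub>R g x = h x"
        using AE0
      proof eventually_elim
        case (elim x)
        show ?case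
        proof (cases "0 \<le> x")
          case True then show ?thesis by (simp add: hg)
        next
          case False
          hence "x \<le> -1" using elim by (auto simp: bump_def max_def min_def split: if_splits)
          then show ?thesis using False by (simp add: h_def)
        qed
      qed
    qed
    finally show ?thesis using L by simp
  qed
  with r \<mu> le show ?thesis by blast
qed

section \<open>A countable family that determines limits\<close>

text \<open>Up to binomial factors, the Bernstein polynomials in the variable \<open>exp (- x)\<close>. These functions
  are countably many, bounded and Lipschitz.\<close>
definition expfam :: "nat \<Rightarrow> nat \<Rightarrow> real \<Rightarrow> real" where
  "expfam k l x = exp (- x) ^ k * (1 - exp (- x)) ^ l"

lemma expfam_bounds:
  assumes "0 \<le> x" shows "0 \<le> expfam k l x" "expfam k l x \<le> 1"
proof -
  have e: "0 \<le> exp (- x)" "exp (- x) \<le> 1" using assms by auto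
  show "0 \<le> expfam k l x" unfolding expfam_def using e by auto
  have "exp (- x) ^ k * (1 - exp (- x)) ^ l \<le> 1 * 1"
    using e by (intro mult_mono power_le_one) auto
  thus "expfam k l x \<le> 1" by (simp add: expfam_def)
qed

lemma expfam_lipschitz:
  assumes "0 \<le> x" "0 \<le> y"
  shows "\<bar>expfam k l x - expfam k l y\<bar> \<le> real (k + l) * \<bar>x - y\<bar>"
proof -
  define d where "d x = real k * exp (-x) ^ (k-1) * (- exp (-x)) * (1 - exp (-x)) ^ l +
     exp (-x) ^ k * (real l * (1 - exp (-x)) ^ (l-1) * exp (-x))" for x
  have der: "(expfam k l has_real_derivative d x) (at x within {0..})" for x
    unfolding expfam_def[abs_def] d_def by (auto intro!: derivative_eq_intros)
  have d_le: "norm (d x) \<le> real (k + l)" if "x \<in> {0..}" for x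
  proof -
    have e: "0 \<le> exp (- x)" "exp (- x) \<le> 1" "0 \<le> 1 - exp (-x)" "1 - exp (-x) \<le> 1" using that by auto
    have p: "exp (-x) ^ j \<le> 1" "0 \<le> exp (-x) ^ j" "(1 - exp (-x)) ^ j \<le> 1" "0 \<le> (1 - exp (-x)) ^ j" for j
      using e by (auto intro: power_le_one)
    have "\<bar>real k * exp (-x) ^ (k-1) * (- exp (-x)) * (1 - exp (-x)) ^ l\<bar> \<le> real k * 1 * 1 * 1"
      unfolding abs_mult using p e by (intro mult_mono) auto
    moreover have "\<bar>exp (-x) ^ k * (real l * (1 - exp (-x)) ^ (l-1) * exp (-x))\<bar> \<le> 1 * (real l * 1 * 1)"
      unfolding abs_mult using p e by (intro mult_mono) auto
    ultimately show ?thesis unfolding d_def real_norm_def by linarith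
  qed
  have "norm (expfam k l x - expfam k l y) \<le> real (k + l) * norm (x - y)"
    by (rule field_differentiable_bound[of "{0..}" _ d]) (use der d_le assms in auto)
  thus ?thesis by simp
qed

text \<open>The substitution \<open>y = exp (- x)\<close> turns a function in \<open>Cc\<close> into a continuous function on the unit
  interval, zero near \<open>y = 0\<close>, and Bernstein's approximation applies.\<close>
lemma expfam_dense:
  assumes g: "g \<in> Cc" and \<delta>: "0 < \<delta>"
  obtains n :: nat and q :: "nat \<Rightarrow> real" where "\<And>x. 0 \<le> x \<Longrightarrow> \<bar>g x - (\<Sum>k\<le>n. q k * expfam k (n - k) x)\<bar> < \<delta>"
proof -
  obtain R where R: "0 < R" "\<And>x. R \<le> x \<Longrightarrow> g x = 0" using Cc_support[OF g] by blast
  define f where "f y = g (- ln (max y (exp (- R))))" for y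
  have pos: "0 < max y (exp (- R))" for y by (simp add: less_max_iff_disj)
  have "continuous_on {0..1} f"
    unfolding f_def
  proof (rule continuous_on_compose2[OF Cc_continuous[OF g]])
    show "continuous_on {0..1} (\<lambda>y. - ln (max y (exp (- R))))"
      by (intro continuous_intros ballI) (rule less_imp_neq[THEN not_sym], rule pos)
    show "(\<lambda>y. - ln (max y (exp (- R)))) ` {0..1} \<subseteq> {0..}"
    proof
      fix z assume "z \<in> (\<lambda>y. - ln (max y (exp (- R)))) ` {0..1}"
      then obtain y where y: "y \<in> {0..1}" "z = - ln (max y (exp (- R)))" by auto
      have "max y (exp (- R)) \<le> 1" using y R by auto
      hence "ln (max y (exp (- R))) \<le> 0" using pos[of y] by (simp add: ln_le_zero_iff)
      thus "z \<in> {0..}" using y by simp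
    qed
  qed
  from Bernstein_Weierstrass[OF this \<delta>] obtain n where
    n: "\<And>y. y \<in> {0..1} \<Longrightarrow> \<bar>f y - (\<Sum>k\<le>n. f (k / n) * Bernstein n k y)\<bar> < \<delta>" by blast
  show ?thesis
  proof (rule that[where n = n and q = "\<lambda>k. f (k / n) * (n choose k)"])
    fix x :: real assume x: "0 \<le> x"
    have "f (exp (- x)) = g x"
    proof (cases "x \<le> R")
      case True then show ?thesis by (simp add: f_def max_def)
    next
      case False
      hence "max (exp (- x)) (exp (- R)) = exp (- R)" by (simp add: max_def)
      thus ?thesis using R(2)[of x] R(2)[of R] False by (simp add: f_def)
    qed
    moreover have "\<bar>f (exp (- x)) - (\<Sum>k\<le>n. f (k / n) * Bernstein n k (exp (- x)))\<bar> < \<delta>" using x by (intro n) auto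
    moreover have "f (k / n) * Bernstein n k (exp (- x)) = f (k / n) * (n choose k) * expfam k (n - k) x" for k
      by (simp add: Bernstein_def expfam_def)
    ultimately show "\<bar>g x - (\<Sum>k\<le>n. f (k / n) * (n choose k) * expfam k (n - k) x)\<bar> < \<delta>" by simp
  qed
qed

section \<open>Convergence of first moments\<close>

definition ramp :: "real \<Rightarrow> real \<Rightarrow> real" where
  "ramp R x = max 0 (min 1 (R + 1 - x))"

lemma ramp_facts: "0 \<le> ramp R x" "ramp R x \<le> 1" "x \<le> R \<Longrightarrow> ramp R x = 1" "R + 1 \<le> x \<Longrightarrow> ramp R x = 0"
  "continuous_on S (ramp R)" "R \<le> R' \<Longrightarrow> ramp R x \<le> ramp R' x"
  unfolding ramp_def by (auto intro!: continuous_intros)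

lemma ramp_Cc: "ramp R \<in> Cc" "(\<lambda>x. x * ramp R x) \<in> Cc"
  by (rule Cc_I[where R = "R+1"]; auto simp: ramp_facts(4) intro!: continuous_on_mult continuous_on_id ramp_facts(5))+

text \<open>The identity is not a test function; its truncations are. The uniform bound on the tails makes
  the error of the truncation uniform along the sequence, and monotone convergence removes the
  truncation from the limit.\<close>
theorem first_moment_limit:
  fixes w x :: "nat \<Rightarrow> nat \<Rightarrow> real"
  assumes w: "\<And>n i. 0 \<le> w n i" and x: "\<And>n i. 0 \<le> x n i"
    and sum: "\<And>n. summable (\<lambda>i. w n i * x n i)" "\<And>n. (\<Sum>i. w n i * x n i) \<le> C"
    and \<mu>: "\<mu> \<in> Mf"
    and lim: "\<And>g. g \<in> Cc \<Longrightarrow> (\<lambda>n. \<Sum>i. w n i * g (x n i)) \<longlonglongrightarrow> (\<integral>x. g x \<partial>\<mu>)"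
    and tail: "\<And>\<delta>. 0 < \<delta> \<Longrightarrow> \<exists>R. \<forall>n. (\<Sum>i. if R < x n i then w n i * x n i else 0) \<le> \<delta>"
  shows "integrable \<mu> (\<lambda>x. x)" "(\<lambda>n. \<Sum>i. w n i * x n i) \<longlonglongrightarrow> (\<integral>x. x \<partial>\<mu>)"
proof -
  define f where "f k x = x * ramp (real k) x" for k :: nat and x
  have fC: "f k \<in> Cc" for k unfolding f_def[abs_def] by (rule ramp_Cc)
  have f0: "0 \<le> f k x" "f k x \<le> x" if "0 \<le> x" for k x
    using that ramp_facts(1,2)[of k x] by (auto simp: f_def mult_left_le)
  have sf: "summable (\<lambda>i. w n i * f k (x n i))" for n k
  proof (rule summable_comparison_test'[OF sum(1)])
    show "norm (w n i * f k (x n i)) \<le> w n i * x n i" for i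
      using f0[OF x, of k n i] w[of n i] by (simp add: abs_mult mult_left_mono)
  qed
  have If: "integrable \<mu> (f k)" for k by (rule Cc_integrable[OF \<mu> fC])
  have Ile: "(\<integral>x. f k x \<partial>\<mu>) \<le> C" for k
  proof (rule LIMSEQ_le_const2[OF lim[OF fC[of k]]], intro exI allI impI)
    fix n
    have "(\<Sum>i. w n i * f k (x n i)) \<le> (\<Sum>i. w n i * x n i)"
      by (intro suminf_le sf sum mult_left_mono f0 w x)
    with sum(2)[of n] show "(\<Sum>i. w n i * f k (x n i)) \<le> C" by linarith
  qed
  have sp: "space \<mu> = {0..}" by (rule Mf_space[OF \<mu>])
  have mono: "mono (\<lambda>k. f k x)" if "0 \<le> x" for x
    by (rule monoI) (use that in \<open>auto simp: f_def intro!: mult_left_mono ramp_facts(6)\<close>)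
  have "incseq (\<lambda>k. \<integral>x. f k x \<partial>\<mu>)"
    by (rule incseq_SucI, rule integral_mono[OF If If]) (use sp in \<open>auto simp: f_def intro!: mult_left_mono ramp_facts(6)\<close>)
  from incseq_convergent[OF this, of C] Ile obtain l where l: "(\<lambda>k. \<integral>x. f k x \<partial>\<mu>) \<longlonglongrightarrow> l" by blast
  have plim: "(\<lambda>k. f k x) \<longlonglongrightarrow> x" if "0 \<le> x" for x
  proof (rule tendsto_eventually)
    obtain k0 :: nat where k0: "x \<le> real k0" using real_arch_simple by blast
    show "\<forall>\<^sub>F k in sequentially. f k x = x"
      unfolding eventually_sequentially
      by (intro exI[of _ k0] allI impI) (use k0 in \<open>auto simp: f_def ramp_facts(3)\<close>)
  qed
  have mx: "(\<lambda>x. x) \<in> borel_measurable \<mu>" by (rule Mf_measurable_continuous[OF \<mu>]) (auto intro!: continuous_intros)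
  note mc = integrable_monotone_convergence[OF If _ _ l mx] integral_monotone_convergence[OF If _ _ l mx]
  show I: "integrable \<mu> (\<lambda>x. x)" by (rule mc(1)) (use mono plim sp in auto)
  have "(\<integral>x. x \<partial>\<mu>) = l" by (rule mc(2)) (use mono plim sp in auto)
  with l have l: "(\<lambda>k. \<integral>x. f k x \<partial>\<mu>) \<longlonglongrightarrow> (\<integral>x. x \<partial>\<mu>)" by simp
  show "(\<lambda>n. \<Sum>i. w n i * x n i) \<longlonglongrightarrow> (\<integral>x. x \<partial>\<mu>)"
  proof (rule LIMSEQ_I)
    fix r :: real assume r: "0 < r"
    obtain R where R: "\<And>n. (\<Sum>i. if R < x n i then w n i * x n i else 0) \<le> r / 4" using tail[of "r/4"] r by auto
    obtain k1 where k1: "\<And>k. k \<ge> k1 \<Longrightarrow> norm ((\<integral>x. f k x \<partial>\<mu>) - (\<integral>x. x \<partial>\<mu>)) < r / 4"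
      using LIMSEQ_D[OF l, of "r/4"] r by auto
    obtain k0 :: nat where k0: "R \<le> real k0" using real_arch_simple by blast
    define k where "k = max k0 k1"
    have kR: "R \<le> real k" using k0 by (simp add: k_def)
    obtain n0 where n0: "\<And>n. n \<ge> n0 \<Longrightarrow> norm ((\<Sum>i. w n i * f k (x n i)) - (\<integral>x. f k x \<partial>\<mu>)) < r / 4"
      using LIMSEQ_D[OF lim[OF fC[of k]], of "r/4"] r by auto
    have "norm ((\<Sum>i. w n i * x n i) - (\<integral>x. x \<partial>\<mu>)) < r" if "n \<ge> n0" for n
    proof -
      have s3: "summable (\<lambda>i. if R < x n i then w n i * x n i else 0)"
        by (rule summable_comparison_test'[OF sum(1)[of n]]) (use w x in auto)
      have "(\<Sum>i. w n i * x n i) - (\<Sum>i. w n i * f k (x n i)) = (\<Sum>i. w n i * x n i - w n i * f k (x n i))"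
        by (rule suminf_diff[OF sum(1) sf])
      also have "\<dots> \<le> (\<Sum>i. if R < x n i then w n i * x n i else 0)"
      proof (intro suminf_le summable_diff sum sf s3)
        fix i
        show "w n i * x n i - w n i * f k (x n i) \<le> (if R < x n i then w n i * x n i else 0)"
          using w[of n i] f0[OF x, of k n i] kR by (auto simp: f_def ramp_facts(3) mult_nonneg_nonneg)
      qed
      also have "\<dots> \<le> r / 4" by (rule R)
      finally have "(\<Sum>i. w n i * x n i) - (\<Sum>i. w n i * f k (x n i)) \<le> r / 4" .
      moreover have "(\<Sum>i. w n i * f k (x n i)) \<le> (\<Sum>i. w n i * x n i)"
        by (intro suminf_le sf sum mult_left_mono f0 w x)
      moreover have "norm ((\<integral>x. f k x \<partial>\<mu>) - (\<integral>x. x \<partial>\<mu>)) < r / 4" by (rule k1) (simp add: k_def)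
      ultimately show ?thesis using n0[OF that] r unfolding real_norm_def by linarith
    qed
    thus "\<exists>n0. \<forall>n\<ge>n0. norm ((\<Sum>i. w n i * x n i) - (\<integral>x. x \<partial>\<mu>)) < r" by blast
  qed
qed

section \<open>Weak-* convergence of time-dependent measures\<close>

lemma borel_measurable_AE_lebesgue_on:
  fixes f g :: "real \<Rightarrow> real"
  assumes S: "S \<in> sets lebesgue" and f: "f \<in> borel_measurable (lebesgue_on S)" and ae: "AE x in lebesgue_on S. f x = g x"
  shows "g \<in> borel_measurable (lebesgue_on S)"
proof -
  have "(\<lambda>x. if x \<in> S then f x else 0) \<in> borel_measurable lebesgue"
    using f S by (simp add: borel_measurable_if)
  moreover have "AE x in lebesgue. (if x \<in> S then f x else 0) = (if x \<in> S then g x else 0)"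
    using ae S by (subst (asm) AE_restrict_space_iff) (auto elim!: eventually_mono)
  ultimately have "(\<lambda>x. if x \<in> S then g x else 0) \<in> borel_measurable lebesgue" by (rule borel_measurable_AE)
  thus ?thesis using S by (simp add: borel_measurable_if)
qed

text \<open>For a simple function of time the pairing is a finite sum of measurable functions. The general
  case follows because the pairing is continuous in the supremum norm.\<close>
lemma bochner_pairing_measurable:
  assumes \<nu>: "\<And>t. t \<in> {0..T} \<Longrightarrow> \<nu> t \<in> Mf" "\<And>t. t \<in> {0..T} \<Longrightarrow> measure (\<nu> t) {0..} \<le> M"
    and meas: "\<And>g. g \<in> Cc \<Longrightarrow> (\<lambda>t. \<integral>x. g x \<partial>\<nu> t) \<in> borel_measurable (lebesgue_on {0..T})"
    and \<Phi>: "\<Phi> \<in> L1_Cc T"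
  shows "(\<lambda>t. \<integral>x. \<Phi> t x \<partial>\<nu> t) \<in> borel_measurable (lebesgue_on {0..T})"
proof -
  obtain s :: "nat \<Rightarrow> real \<Rightarrow> real \<Rightarrow> real" where
    s: "\<And>n. simple_function (lebesgue_on {0..T}) (s n)" "\<And>n t. t \<in> {0..T} \<Longrightarrow> s n t \<in> Cc"
    and conv: "AE t in lebesgue_on {0..T}. (\<lambda>n. sup_norm (\<lambda>x. s n t x - \<Phi> t x)) \<longlonglongrightarrow> 0"
    and \<Phi>C: "\<And>t. t \<in> {0..T} \<Longrightarrow> \<Phi> t \<in> Cc"
    using \<Phi> unfolding L1_Cc_def by blast
  let ?L = "lebesgue_on {0..T}"
  have sp: "space ?L = {0..T}" by (simp add: space_restrict_space)
  define F where "F n t = (\<integral>x. s n t x \<partial>\<nu> t)" for n t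
  have F: "F n \<in> borel_measurable ?L" for n
  proof -
    have fin: "finite (s n ` {0..T})" using s(1)[of n] sp by (simp add: simple_function_def)
    have "(\<lambda>t. \<Sum>g\<in>s n ` {0..T}. indicat_real (s n -` {g} \<inter> {0..T}) t * (\<integral>x. g x \<partial>\<nu> t)) \<in> borel_measurable ?L"
    proof (intro borel_measurable_sum borel_measurable_times borel_measurable_indicator)
      fix g assume g: "g \<in> s n ` {0..T}"
      show "s n -` {g} \<inter> {0..T} \<in> sets ?L" using simple_functionD(2)[OF s(1), of n "{g}"] sp by simp
      show "(\<lambda>t. \<integral>x. g x \<partial>\<nu> t) \<in> borel_measurable ?L" using g s(2) by (intro meas) auto
    qed
    moreover have "(\<Sum>g\<in>s n ` {0..T}. indicat_real (s n -` {g} \<inter> {0..T}) t * (\<integral>x. g x \<partial>\<nu> t)) = F n t" if t: "t \<in> space ?L" for t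
    proof -
      have t': "t \<in> {0..T}" using t sp by simp
      have "(\<Sum>g\<in>s n ` {0..T}. indicat_real (s n -` {g} \<inter> {0..T}) t * (\<integral>x. g x \<partial>\<nu> t)) =
        (\<Sum>g\<in>s n ` {0..T}. if g = s n t then (\<integral>x. g x \<partial>\<nu> t) else 0)"
        by (intro sum.cong refl) (use t' in \<open>auto simp: indicator_def\<close>)
      also have "\<dots> = F n t" using fin t' by (simp add: F_def)
      finally show ?thesis .
    qed
    ultimately show ?thesis by (rule measurable_cong[THEN iffD1, rotated])
  qed
  have "(\<lambda>t. lim (\<lambda>n. F n t)) \<in> borel_measurable ?L"
    by (rule borel_measurable_lim_metric) (rule F)
  moreover have "AE t in ?L. lim (\<lambda>n. F n t) = (\<integral>x. \<Phi> t x \<partial>\<nu> t)"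
    using conv AE_space[of ?L]
  proof eventually_elim
    case (elim t)
    have t: "t \<in> {0..T}" using elim(2) sp by simp
    have "(\<lambda>n. F n t) \<longlonglongrightarrow> (\<integral>x. \<Phi> t x \<partial>\<nu> t)"
    proof (rule LIM_zero_cancel, rule Lim_null_comparison)
      show "(\<lambda>n. sup_norm (\<lambda>x. s n t x - \<Phi> t x) * M) \<longlonglongrightarrow> 0" using tendsto_mult_right[OF elim(1), of M] by simp
      show "\<forall>\<^sub>F n in sequentially. norm (F n t - (\<integral>x. \<Phi> t x \<partial>\<nu> t)) \<le> sup_norm (\<lambda>x. s n t x - \<Phi> t x) * M"
      proof (intro always_eventually allI)
        fix n
        have d: "(\<lambda>x. s n t x - \<Phi> t x) \<in> Cc" by (intro Cc_diff s \<Phi>C t)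
        have "F n t - (\<integral>x. \<Phi> t x \<partial>\<nu> t) = (\<integral>x. s n t x - \<Phi> t x \<partial>\<nu> t)"
          unfolding F_def by (rule Bochner_Integration.integral_diff[symmetric]) (intro Cc_integrable \<nu> t s \<Phi>C)+
        also have "\<bar>\<dots>\<bar> \<le> sup_norm (\<lambda>x. s n t x - \<Phi> t x) * M"
          by (rule Mf_integral_bound[OF \<nu>(1)[OF t] \<nu>(2)[OF t] d]) (rule sup_norm_ge[OF d])
        finally show "norm (F n t - (\<integral>x. \<Phi> t x \<partial>\<nu> t)) \<le> sup_norm (\<lambda>x. s n t x - \<Phi> t x) * M" by simp
      qed
    qed
    thus ?case by (rule limI)
  qed
  ultimately show ?thesis by (rule borel_measurable_AE_lebesgue_on[rotated]) simp
qed

text \<open>Dominated convergence in time, with the integrable bound \<open>M * sup_norm (\<Phi> t)\<close>.\<close>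
theorem weak_star_of_AE:
  assumes \<nu>: "\<And>n t. t \<in> {0..T} \<Longrightarrow> \<nu> n t \<in> Mf" "\<And>n t. t \<in> {0..T} \<Longrightarrow> measure (\<nu> n t) {0..} \<le> M"
      "\<And>n g. g \<in> Cc \<Longrightarrow> (\<lambda>t. \<integral>x. g x \<partial>\<nu> n t) \<in> borel_measurable (lebesgue_on {0..T})"
    and \<mu>: "\<And>t. t \<in> {0..T} \<Longrightarrow> \<mu> t \<in> Mf" "\<And>t. t \<in> {0..T} \<Longrightarrow> measure (\<mu> t) {0..} \<le> M"
      "\<And>g. g \<in> Cc \<Longrightarrow> (\<lambda>t. \<integral>x. g x \<partial>\<mu> t) \<in> borel_measurable (lebesgue_on {0..T})"
    and lim: "AE t in lebesgue_on {0..T}. \<forall>g\<in>Cc. (\<lambda>n. \<integral>x. g x \<partial>\<nu> n t) \<longlonglongrightarrow> (\<integral>x. g x \<partial>\<mu> t)"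
  shows "weak_star_Linf_Mf T \<nu> \<mu>"
  unfolding weak_star_Linf_Mf_def
proof
  fix \<Phi> assume \<Phi>: "\<Phi> \<in> L1_Cc T"
  have \<Phi>C: "\<Phi> t \<in> Cc" if "t \<in> {0..T}" for t using \<Phi> that by (auto simp: L1_Cc_def)
  have I: "integrable (lebesgue_on {0..T}) (\<lambda>t. sup_norm (\<Phi> t))" using \<Phi> by (auto simp: L1_Cc_def)
  have sp: "space (lebesgue_on {0..T}) = {0..T}" by (simp add: space_restrict_space)
  show "(\<lambda>n. \<integral>t. (\<integral>x. \<Phi> t x \<partial>\<nu> n t) \<partial>lebesgue_on {0..T}) \<longlonglongrightarrow> (\<integral>t. (\<integral>x. \<Phi> t x \<partial>\<mu> t) \<partial>lebesgue_on {0..T})"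
  proof (rule integral_dominated_convergence[where w = "\<lambda>t. sup_norm (\<Phi> t) * M"])
    show "(\<lambda>t. \<integral>x. \<Phi> t x \<partial>\<mu> t) \<in> borel_measurable (lebesgue_on {0..T})"
      by (rule bochner_pairing_measurable[OF \<mu> \<Phi>])
    show "(\<lambda>t. \<integral>x. \<Phi> t x \<partial>\<nu> n t) \<in> borel_measurable (lebesgue_on {0..T})" for n
      by (rule bochner_pairing_measurable[OF \<nu> \<Phi>])
    show "integrable (lebesgue_on {0..T}) (\<lambda>t. sup_norm (\<Phi> t) * M)" using I by simp
    show "AE t in lebesgue_on {0..T}. (\<lambda>n. \<integral>x. \<Phi> t x \<partial>\<nu> n t) \<longlonglongrightarrow> (\<integral>x. \<Phi> t x \<partial>\<mu> t)"
      using lim AE_space[of "lebesgue_on {0..T}"] by eventually_elim (use \<Phi>C sp in auto)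
    show "AE t in lebesgue_on {0..T}. norm (\<integral>x. \<Phi> t x \<partial>\<nu> n t) \<le> sup_norm (\<Phi> t) * M" for n
    proof (rule AE_I2)
      fix t assume "t \<in> space (lebesgue_on {0..T})"
      hence t: "t \<in> {0..T}" using sp by simp
      show "norm (\<integral>x. \<Phi> t x \<partial>\<nu> n t) \<le> sup_norm (\<Phi> t) * M"
        unfolding real_norm_def
        by (rule Mf_integral_bound[OF \<nu>(1)[OF t] \<nu>(2)[OF t] \<Phi>C[OF t]]) (rule sup_norm_ge[OF \<Phi>C[OF t]])
    qed
  qed
qed

section \<open>Step functions as measures\<close>

lemma cell_facts:
  assumes "0 < \<epsilon>"
  shows "cell \<epsilon> i \<in> sets borel" "1 \<le> i \<Longrightarrow> cell \<epsilon> i \<subseteq> {0..}" "emeasure lborel (cell \<epsilon> i) = ennreal \<epsilon>"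
    "x \<in> cell \<epsilon> i \<Longrightarrow> \<bar>x - \<epsilon> * real i\<bar> \<le> \<epsilon> / 2"
proof -
  show "cell \<epsilon> i \<in> sets borel" by (simp add: cell_def)
  show "cell \<epsilon> i \<subseteq> {0..}" if "1 \<le> i"
  proof
    fix x assume "x \<in> cell \<epsilon> i"
    hence "(real i - 1/2) * \<epsilon> \<le> x" by (simp add: cell_def)
    moreover have "0 \<le> (real i - 1/2) * \<epsilon>" using that assms by (intro mult_nonneg_nonneg) auto
    ultimately show "x \<in> {0..}" by simp
  qed
  have "(real i + 1/2) * \<epsilon> - (real i - 1/2) * \<epsilon> = \<epsilon>" by (simp add: algebra_simps)
  thus "emeasure lborel (cell \<epsilon> i) = ennreal \<epsilon>" using assms by (simp add: cell_def algebra_simps)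
  show "\<bar>x - \<epsilon> * real i\<bar> \<le> \<epsilon> / 2" if "x \<in> cell \<epsilon> i"
  proof -
    have "\<epsilon> * real i - \<epsilon> / 2 \<le> x" "x < \<epsilon> * real i + \<epsilon> / 2" using that by (auto simp: cell_def algebra_simps)
    thus ?thesis by linarith
  qed
qed

lemma cell_finite:
  assumes "0 < \<epsilon>" shows "finite {i. x \<in> cell \<epsilon> (i + k)}"
proof -
  obtain n :: nat where n: "x / \<epsilon> + 1 \<le> real n" using real_arch_simple by blast
  have "{i. x \<in> cell \<epsilon> (i + k)} \<subseteq> {..n}"
  proof
    fix i assume "i \<in> {i. x \<in> cell \<epsilon> (i + k)}"
    hence "(real (i + k) - 1/2) * \<epsilon> \<le> x" by (simp add: cell_def)
    hence "real (i + k) - 1/2 \<le> x / \<epsilon>" using assms by (simp add: field_simps)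
    hence "real i \<le> real n" using n by simp
    thus "i \<in> {..n}" by simp
  qed
  thus ?thesis by (rule finite_subset) simp
qed

lemma step_fun_summable:
  assumes "0 < \<epsilon>" shows "summable (\<lambda>i. c (i + k) * indicat_real (cell \<epsilon> (i + k)) x)"
  by (rule summable_finite[OF cell_finite[OF assms, of x k]]) (auto simp: indicator_def)

lemma step_fun_at_node:
  assumes e: "0 < \<epsilon>" and i: "k \<le> i" shows "step_fun k \<epsilon> c (\<epsilon> * real i) = c i"
proof -
  have "step_fun k \<epsilon> c (\<epsilon> * real i) = (\<Sum>j\<in>{i - k}. c (j + k) * indicat_real (cell \<epsilon> (j + k)) (\<epsilon> * real i))"
    unfolding step_fun_def
  proof (rule suminf_finite)
    fix j assume j: "j \<notin> {i - k}"
    have "\<epsilon> * real i \<notin> cell \<epsilon> (j + k)"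
    proof
      assume "\<epsilon> * real i \<in> cell \<epsilon> (j + k)"
      hence "(real (j + k) - 1/2) * \<epsilon> \<le> real i * \<epsilon>" "real i * \<epsilon> < (real (j + k) + 1/2) * \<epsilon>" by (auto simp: cell_def mult.commute)
      hence "real (j + k) - 1/2 \<le> real i" "real i < real (j + k) + 1/2" using e by auto
      hence "j + k = i" by linarith
      thus False using j by auto
    qed
    thus "c (j + k) * indicat_real (cell \<epsilon> (j + k)) (\<epsilon> * real i) = 0" by simp
  qed simp
  moreover have "\<epsilon> * real i \<in> cell \<epsilon> i" using e by (auto simp: cell_def algebra_simps)
  ultimately show ?thesis using i by simp
qed

lemma cell_integral:
  assumes e: "0 < \<epsilon>" and i: "1 \<le> i" and g: "g \<in> Cc"
    and w: "\<And>x y. 0 \<le> x \<Longrightarrow> 0 \<le> y \<Longrightarrow> \<bar>x - y\<bar> \<le> \<epsilon> / 2 \<Longrightarrow> \<bar>g x - g y\<bar> \<le> \<omega>"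
  shows "integrable lborel (\<lambda>x. indicat_real (cell \<epsilon> i) x * g x)"
    "\<bar>(\<integral>x. indicat_real (cell \<epsilon> i) x * g x \<partial>lborel) - \<epsilon> * g (\<epsilon> * real i)\<bar> \<le> \<epsilon> * \<omega>"
proof -
  obtain B where B: "0 < B" "\<And>x. 0 \<le> x \<Longrightarrow> \<bar>g x\<bar> \<le> B" using Cc_bounded[OF g] by blast
  have ic: "integrable lborel (\<lambda>x. indicat_real (cell \<epsilon> i) x * B')" for B' :: real
    using cell_facts[OF e, of i] by (intro integrable_mult_left) auto
  have mc: "(\<lambda>x. indicat_real (cell \<epsilon> i) x * g x) \<in> borel_measurable lborel"
  proof -
    have "(\<lambda>x. indicat_real {0..} x *\<^sub>R g x) \<in> borel_measurable borel"
      by (rule borel_measurable_continuous_on_indicator) (use Cc_continuous[OF g] in auto)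
    hence "(\<lambda>x. indicat_real (cell \<epsilon> i) x * (indicat_real {0..} x *\<^sub>R g x)) \<in> borel_measurable borel"
      using cell_facts(1)[OF e, of i] by measurable
    moreover have "(\<lambda>x. indicat_real (cell \<epsilon> i) x * (indicat_real {0..} x *\<^sub>R g x)) = (\<lambda>x. indicat_real (cell \<epsilon> i) x * g x)"
      using cell_facts(2)[OF e i] by (auto simp: indicator_def fun_eq_iff)
    ultimately show ?thesis by simp
  qed
  show I: "integrable lborel (\<lambda>x. indicat_real (cell \<epsilon> i) x * g x)"
    by (rule Bochner_Integration.integrable_bound[OF ic[of B] mc])
      (use B cell_facts(2)[OF e i] in \<open>auto simp: indicator_def\<close>)
  have m: "(\<integral>x. indicat_real (cell \<epsilon> i) x * B' \<partial>lborel) = \<epsilon> * B'" for B'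
    using cell_facts(3)[OF e, of i] cell_facts(1)[OF e, of i] e by (simp add: measure_def)
  have "\<bar>(\<integral>x. indicat_real (cell \<epsilon> i) x * g x \<partial>lborel) - \<epsilon> * g (\<epsilon> * real i)\<bar> =
     \<bar>\<integral>x. indicat_real (cell \<epsilon> i) x * g x - indicat_real (cell \<epsilon> i) x * g (\<epsilon> * real i) \<partial>lborel\<bar>"
    unfolding Bochner_Integration.integral_diff[OF I ic] m ..
  also have "\<dots> \<le> (\<integral>x. \<bar>indicat_real (cell \<epsilon> i) x * g x - indicat_real (cell \<epsilon> i) x * g (\<epsilon> * real i)\<bar> \<partial>lborel)"
    by (rule integral_abs_bound)
  also have "\<dots> \<le> (\<integral>x. indicat_real (cell \<epsilon> i) x * \<omega> \<partial>lborel)"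
  proof (rule integral_mono)
    show "integrable lborel (\<lambda>x. \<bar>indicat_real (cell \<epsilon> i) x * g x - indicat_real (cell \<epsilon> i) x * g (\<epsilon> * real i)\<bar>)"
      by (intro integrable_abs Bochner_Integration.integrable_diff I ic)
    show "\<bar>indicat_real (cell \<epsilon> i) x * g x - indicat_real (cell \<epsilon> i) x * g (\<epsilon> * real i)\<bar> \<le> indicat_real (cell \<epsilon> i) x * \<omega>" for x
    proof (cases "x \<in> cell \<epsilon> i")
      case True
      have "0 \<le> x" using cell_facts(2)[OF e i] True by auto
      thus ?thesis using w[of x "\<epsilon> * real i"] cell_facts(4)[OF e True] True e by simp
    qed simp
  qed (rule ic)
  also have "\<dots> = \<epsilon> * \<omega>" by (rule m)
  finally show "\<bar>(\<integral>x. indicat_real (cell \<epsilon> i) x * g x \<partial>lborel) - \<epsilon> * g (\<epsilon> * real i)\<bar> \<le> \<epsilon> * \<omega>" .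
qed

lemma step_fun_measurable: "0 < \<epsilon> \<Longrightarrow> step_fun k \<epsilon> c \<in> borel_measurable borel"
  unfolding step_fun_def[abs_def] using cell_facts(1) by (intro borel_measurable_suminf borel_measurable_times borel_measurable_indicator) auto

lemma step_fun_nonneg: "0 < \<epsilon> \<Longrightarrow> (\<And>i. k \<le> i \<Longrightarrow> 0 \<le> c i) \<Longrightarrow> 0 \<le> step_fun k \<epsilon> c x"
  unfolding step_fun_def by (intro suminf_nonneg step_fun_summable) auto

lemma density_measure_Mf:
  assumes e: "0 < \<epsilon>" and c: "\<And>i. 2 \<le> i \<Longrightarrow> 0 \<le> c i"
    and s: "summable (\<lambda>i. \<epsilon> * c (i + 2))" "(\<Sum>i. \<epsilon> * c (i + 2)) \<le> M"
  shows "density_measure (step_fun 2 \<epsilon> c) \<in> Mf" "measure (density_measure (step_fun 2 \<epsilon> c)) {0..} \<le> M"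
proof -
  define f where "f = step_fun 2 \<epsilon> c"
  have mf: "f \<in> borel_measurable borel" unfolding f_def by (rule step_fun_measurable[OF e])
  have sets: "sets (density_measure f) = sets (restrict_space borel {0..})"
    unfolding density_measure_def sets_density by (rule sets_restrict_space_cong) simp
  have sp: "space (density_measure f) = {0..}" using sets_eq_imp_space_eq[OF sets] by (simp add: space_restrict_space)
  have "0 \<le> (\<Sum>i. \<epsilon> * c (i + 2))" by (intro suminf_nonneg s(1) mult_nonneg_nonneg) (use c e in auto)
  with s(2) have M: "0 \<le> M" by linarith
  have mfr: "(\<lambda>x. ennreal (f x)) \<in> borel_measurable (restrict_space lborel {0..})"
    by (rule measurable_restrict_space1) (use mf in measurable)
  have "emeasure (density_measure f) {0..} = (\<integral>\<^sup>+x. ennreal (f x) * indicator {0..} x \<partial>restrict_space lborel {0..})"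
    unfolding density_measure_def by (rule emeasure_density[OF mfr]) (simp add: sets_restrict_space_iff)
  also have "\<dots> = (\<integral>\<^sup>+x. ennreal (f x) * indicator {0..} x * indicator {0..} x \<partial>lborel)"
    by (rule nn_integral_restrict_space) simp
  also have "\<dots> \<le> (\<integral>\<^sup>+x. (\<Sum>i. ennreal (c (i + 2)) * indicator (cell \<epsilon> (i + 2)) x) \<partial>lborel)"
  proof (rule nn_integral_mono)
    fix x
    have "ennreal (f x) * indicator {0..} x * indicator {0..} x \<le> ennreal (f x)" by (auto simp: indicator_def)
    also have "ennreal (f x) = (\<Sum>i. ennreal (c (i + 2) * indicat_real (cell \<epsilon> (i + 2)) x))"
      unfolding f_def step_fun_def by (rule suminf_ennreal2[symmetric], use c in simp, rule step_fun_summable[OF e])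
    also have "\<dots> = (\<Sum>i. ennreal (c (i + 2)) * indicator (cell \<epsilon> (i + 2)) x)"
      by (intro suminf_cong) (auto simp: indicator_def)
    finally show "ennreal (f x) * indicator {0..} x * indicator {0..} x \<le> (\<Sum>i. ennreal (c (i + 2)) * indicator (cell \<epsilon> (i + 2)) x)" .
  qed
  also have "\<dots> = (\<Sum>i. \<integral>\<^sup>+x. ennreal (c (i + 2)) * indicator (cell \<epsilon> (i + 2)) x \<partial>lborel)"
    using cell_facts(1)[OF e] by (intro nn_integral_suminf) auto
  also have "\<dots> = (\<Sum>i. ennreal (\<epsilon> * c (i + 2)))"
  proof (rule suminf_cong)
    fix i
    have "(\<integral>\<^sup>+x. ennreal (c (i + 2)) * indicator (cell \<epsilon> (i + 2)) x \<partial>lborel) = ennreal (c (i + 2)) * emeasure lborel (cell \<epsilon> (i + 2))"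
      using cell_facts(1)[OF e, of "i+2"] by (intro nn_integral_cmult_indicator) simp
    also have "\<dots> = ennreal (\<epsilon> * c (i + 2))" using cell_facts(3)[OF e, of "i+2"] c[of "i+2"] e by (simp add: ennreal_mult mult.commute)
    finally show "(\<integral>\<^sup>+x. ennreal (c (i + 2)) * indicator (cell \<epsilon> (i + 2)) x \<partial>lborel) = ennreal (\<epsilon> * c (i + 2))" .
  qed
  also have "\<dots> = ennreal (\<Sum>i. \<epsilon> * c (i + 2))" by (rule suminf_ennreal2) (use c e s in auto)
  also have "\<dots> \<le> ennreal M" using s(2) by (rule ennreal_leI)
  finally have le: "emeasure (density_measure f) {0..} \<le> ennreal M" .
  have "finite_measure (density_measure f)" by (rule finite_measureI) (use le sp in \<open>auto simp: top_unique\<close>)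
  thus "density_measure (step_fun 2 \<epsilon> c) \<in> Mf" using sets by (simp add: Mf_def f_def)
  show "measure (density_measure (step_fun 2 \<epsilon> c)) {0..} \<le> M"
    using enn2real_mono[OF le] M by (simp add: measure_def f_def)
qed

text \<open>Only the cells that meet the support of \<open>g\<close> contribute. The finite sum makes the integral a
  continuous function of the coefficients.\<close>
lemma step_integral:
  assumes e: "0 < \<epsilon>" and c: "\<And>i. 2 \<le> i \<Longrightarrow> 0 \<le> c i" and g: "g \<in> Cc"
    and R: "\<And>x. R \<le> x \<Longrightarrow> g x = 0" and N: "R \<le> \<epsilon> * real N"
  shows "(\<integral>x. g x \<partial>density_measure (step_fun 2 \<epsilon> c)) = (\<Sum>i<N. c (i + 2) * (\<integral>x. indicat_real (cell \<epsilon> (i + 2)) x * g x \<partial>lborel))"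
proof -
  define f where "f = step_fun 2 \<epsilon> c"
  have mf: "f \<in> borel_measurable borel" unfolding f_def by (rule step_fun_measurable[OF e])
  have mfr: "f \<in> borel_measurable (restrict_space lborel {0..})"
    by (rule measurable_restrict_space1) (use mf in measurable)
  have "sets (restrict_space lborel {0..}) = sets (restrict_space borel {0::real..})"
    by (rule sets_restrict_space_cong) simp
  hence mg: "g \<in> borel_measurable (restrict_space lborel {0..})"
    using borel_measurable_continuous_on_restrict[OF Cc_continuous[OF g]] measurable_cong_sets by blast
  have I: "integrable lborel (\<lambda>x. indicat_real (cell \<epsilon> (i + 2)) x * g x)" for i
  proof -
    obtain B where B: "0 < B" "\<And>x. 0 \<le> x \<Longrightarrow> \<bar>g x\<bar> \<le> B" using Cc_bounded[OF g] by blast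
    have "\<bar>g x - g y\<bar> \<le> 2 * B" if "0 \<le> x" "0 \<le> y" for x y using B(2)[OF that(1)] B(2)[OF that(2)] by linarith
    from cell_integral(1)[OF e _ g this] show ?thesis by auto
  qed
  have "(\<integral>x. g x \<partial>density_measure f) = (\<integral>x. f x *\<^sub>R g x \<partial>restrict_space lborel {0..})"
    unfolding density_measure_def by (rule integral_density[OF mg mfr]) (use step_fun_nonneg[OF e, of 2 c] c in \<open>auto simp: f_def\<close>)
  also have "\<dots> = (\<integral>x. indicator {0..} x *\<^sub>R (f x *\<^sub>R g x) \<partial>lborel)" by (rule integral_restrict_space) simp
  also have "\<dots> = (\<integral>x. (\<Sum>i<N. c (i + 2) * (indicat_real (cell \<epsilon> (i + 2)) x * g x)) \<partial>lborel)"
  proof (rule Bochner_Integration.integral_cong[OF refl])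
    fix x :: real
    show "indicator {0..} x *\<^sub>R (f x *\<^sub>R g x) = (\<Sum>i<N. c (i + 2) * (indicat_real (cell \<epsilon> (i + 2)) x * g x))"
    proof (cases "0 \<le> x \<and> x < R")
      case True
      have "f x = (\<Sum>i<N. c (i + 2) * indicat_real (cell \<epsilon> (i + 2)) x)"
        unfolding f_def step_fun_def
      proof (rule suminf_finite)
        fix i assume "i \<notin> {..<N}"
        hence "\<epsilon> * real N \<le> \<epsilon> * real i" using e by (intro mult_left_mono) auto
        hence "x < \<epsilon> * real i" using N True by linarith
        moreover have "\<epsilon> * real i \<le> (real (i + 2) - 1/2) * \<epsilon>" using e by (simp add: algebra_simps)
        ultimately have "x \<notin> cell \<epsilon> (i + 2)" by (simp add: cell_def)
        thus "c (i + 2) * indicat_real (cell \<epsilon> (i + 2)) x = 0" by simp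
      qed simp
      hence "f x * g x = (\<Sum>i<N. c (i + 2) * (indicat_real (cell \<epsilon> (i + 2)) x * g x))"
        by (simp only: sum_distrib_right mult.assoc)
      moreover have "indicator {0..} x *\<^sub>R (f x *\<^sub>R g x) = f x * g x" using True by simp
      ultimately show ?thesis by (rule trans[rotated])
    next
      case False
      have "indicat_real (cell \<epsilon> (i + 2)) x * g x = 0" for i
      proof (cases "0 \<le> x")
        case True then show ?thesis using R[of x] False by auto
      next
        case neg: False
        hence "x \<notin> cell \<epsilon> (i + 2)" using cell_facts(2)[OF e, of "i+2"] by auto
        then show ?thesis by simp
      qed
      moreover have "indicator {0..} x *\<^sub>R (f x *\<^sub>R g x) = 0" using False R[of x] by (auto simp: indicator_def)
      ultimately show ?thesis by (simp only: mult_zero_right sum.neutral_const)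
    qed
  qed
  also have "\<dots> = (\<Sum>i<N. \<integral>x. c (i + 2) * (indicat_real (cell \<epsilon> (i + 2)) x * g x) \<partial>lborel)"
    by (rule Bochner_Integration.integral_sum) (intro integrable_mult_right I)
  finally show ?thesis by (simp add: f_def)
qed

text \<open>Replacing each cell by an atom at its centre costs at most the oscillation of \<open>g\<close> at distance
  \<open>\<epsilon> / 2\<close>.\<close>
lemma step_integral_atoms:
  assumes e: "0 < \<epsilon>" and c: "\<And>i. 2 \<le> i \<Longrightarrow> 0 \<le> c i" and g: "g \<in> Cc"
    and R: "\<And>x. R \<le> x \<Longrightarrow> g x = 0"
    and s: "\<And>N. \<epsilon> * real N \<le> R + 2 \<Longrightarrow> (\<Sum>i<N. \<epsilon> * c (i + 2)) \<le> M" and e1: "\<epsilon> \<le> 1" and R0: "0 \<le> R"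
    and w: "\<And>x y. 0 \<le> x \<Longrightarrow> 0 \<le> y \<Longrightarrow> \<bar>x - y\<bar> \<le> \<epsilon> / 2 \<Longrightarrow> \<bar>g x - g y\<bar> \<le> \<omega>"
  shows "\<bar>(\<integral>x. g x \<partial>density_measure (step_fun 2 \<epsilon> c)) - (\<Sum>i. \<epsilon> * c (i + 2) * g (\<epsilon> * real (i + 2)))\<bar> \<le> \<omega> * M"
proof -
  define N where "N = nat \<lceil>R / \<epsilon>\<rceil>"
  have c0: "0 \<le> \<lceil>R / \<epsilon>\<rceil>" using R0 e by (simp add: le_ceiling_iff order_less_le_trans[of _ 0])
  have rN: "real N = of_int \<lceil>R / \<epsilon>\<rceil>" using c0 by (simp add: N_def)
  have "R / \<epsilon> \<le> real N" unfolding rN by (rule le_of_int_ceiling)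
  hence N1: "R \<le> \<epsilon> * real N" using e by (simp add: field_simps)
  have "real N \<le> R / \<epsilon> + 1" unfolding rN by linarith
  hence "\<epsilon> * real N \<le> \<epsilon> * (R / \<epsilon> + 1)" using e by (intro mult_left_mono) auto
  also have "\<dots> \<le> R + 2" using e e1 by (simp add: algebra_simps)
  finally have N2: "\<epsilon> * real N \<le> R + 2" .
  have w0: "0 \<le> \<omega>" using w[of 0 0] e by simp
  have "(\<Sum>i. \<epsilon> * c (i + 2) * g (\<epsilon> * real (i + 2))) = (\<Sum>i<N. \<epsilon> * c (i + 2) * g (\<epsilon> * real (i + 2)))"
  proof (rule suminf_finite)
    fix i assume "i \<notin> {..<N}"
    hence "\<epsilon> * real N \<le> \<epsilon> * real (i + 2)" using e by (intro mult_left_mono) auto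
    thus "\<epsilon> * c (i + 2) * g (\<epsilon> * real (i + 2)) = 0" using R N1 by (simp del: of_nat_add)
  qed simp
  note fin = this
  have eq: "(\<integral>x. g x \<partial>density_measure (step_fun 2 \<epsilon> c)) = (\<Sum>i<N. c (i + 2) * (\<integral>x. indicat_real (cell \<epsilon> (i + 2)) x * g x \<partial>lborel))"
    by (rule step_integral[where R = R]) (use e c g R N1 in auto)
  have "(\<integral>x. g x \<partial>density_measure (step_fun 2 \<epsilon> c)) - (\<Sum>i. \<epsilon> * c (i + 2) * g (\<epsilon> * real (i + 2))) =
     (\<Sum>i<N. c (i + 2) * ((\<integral>x. indicat_real (cell \<epsilon> (i + 2)) x * g x \<partial>lborel) - \<epsilon> * g (\<epsilon> * real (i + 2))))"
    unfolding eq fin sum_subtractf[symmetric]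
    by (intro sum.cong refl) (simp only: right_diff_distrib mult_ac)
  also have "\<bar>\<dots>\<bar> \<le> (\<Sum>i<N. \<bar>c (i + 2) * ((\<integral>x. indicat_real (cell \<epsilon> (i + 2)) x * g x \<partial>lborel) - \<epsilon> * g (\<epsilon> * real (i + 2)))\<bar>)"
    by (rule sum_abs)
  also have "\<dots> \<le> (\<Sum>i<N. \<omega> * (\<epsilon> * c (i + 2)))"
  proof (rule sum_mono)
    fix i
    have "\<bar>c (i + 2)\<bar> * \<bar>(\<integral>x. indicat_real (cell \<epsilon> (i + 2)) x * g x \<partial>lborel) - \<epsilon> * g (\<epsilon> * real (i + 2))\<bar> \<le> c (i + 2) * (\<epsilon> * \<omega>)"
    proof (rule mult_mono)
      show "\<bar>(\<integral>x. indicat_real (cell \<epsilon> (i + 2)) x * g x \<partial>lborel) - \<epsilon> * g (\<epsilon> * real (i + 2))\<bar> \<le> \<epsilon> * \<omega>"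
        by (rule cell_integral(2)[OF e _ g w]) auto
    qed (use c[of "i+2"] in auto)
    thus "\<bar>c (i + 2) * ((\<integral>x. indicat_real (cell \<epsilon> (i + 2)) x * g x \<partial>lborel) - \<epsilon> * g (\<epsilon> * real (i + 2)))\<bar> \<le> \<omega> * (\<epsilon> * c (i + 2))"
      by (simp add: abs_mult mult_ac)
  qed
  also have "\<dots> = \<omega> * (\<Sum>i<N. \<epsilon> * c (i + 2))" by (simp add: sum_distrib_left)
  also have "\<dots> \<le> \<omega> * M" by (intro mult_left_mono s w0 N2)
  finally show ?thesis .
qed

section \<open>Extraction of a convergent subsequence\<close>

text \<open>Functions that are Lipschitz in time up to vanishing errors form a Cauchy sequence at every time
  once they converge at the rational times.\<close>
lemma equilipschitz_convergent:
  fixes f :: "nat \<Rightarrow> real \<Rightarrow> real"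
  assumes T: "0 < T" and L: "0 \<le> L"
    and lip: "\<And>n s t. s \<in> {0..T} \<Longrightarrow> t \<in> {0..T} \<Longrightarrow> \<bar>f n t - f n s\<bar> \<le> L * \<bar>t - s\<bar> + \<delta> n"
    and \<delta>: "\<delta> \<longlonglongrightarrow> 0" and conv: "\<And>q. q \<in> \<rat> \<Longrightarrow> q \<in> {0..T} \<Longrightarrow> convergent (\<lambda>n. f n q)" and t: "t \<in> {0..T}"
  shows "convergent (\<lambda>n. f n t)"
  unfolding Cauchy_convergent_iff[symmetric]
proof (rule CauchyI)
  fix r :: real assume r: "0 < r"
  define h where "h = r / (6 * (L + 1))"
  have h: "0 < h" using r L by (simp add: h_def)
  have "max 0 (t - h) < min T (t + h)" using T t h by auto
  then obtain q where q: "q \<in> \<rat>" "max 0 (t - h) < q" "q < min T (t + h)" using Rats_dense_in_real by blast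
  have qT: "q \<in> {0..T}" and qt: "\<bar>t - q\<bar> \<le> h" using q by auto
  have "L * \<bar>t - q\<bar> \<le> (L + 1) * h" using qt L by (intro mult_mono) auto
  moreover have "(L + 1) * h = r / 6" using L by (simp add: h_def field_simps)
  ultimately have Lq: "L * \<bar>t - q\<bar> \<le> r / 6" by linarith
  obtain N1 where N1: "\<And>n. n \<ge> N1 \<Longrightarrow> \<bar>\<delta> n\<bar> < r / 6" using LIMSEQ_D[OF \<delta>, of "r/6"] r by auto
  have "Cauchy (\<lambda>n. f n q)" using conv[OF q(1) qT] by (rule convergent_Cauchy)
  then obtain N2 where N2: "\<And>m n. m \<ge> N2 \<Longrightarrow> n \<ge> N2 \<Longrightarrow> norm (f m q - f n q) < r / 6"
    using CauchyD[of "\<lambda>n. f n q" "r/6"] r by auto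
  have "norm (f m t - f n t) < r" if "m \<ge> max N1 N2" "n \<ge> max N1 N2" for m n
  proof -
    have "\<bar>\<delta> m\<bar> < r / 6" "\<bar>\<delta> n\<bar> < r / 6" "norm (f m q - f n q) < r / 6" using N1[of m] N1[of n] N2[of m n] that by auto
    thus ?thesis using lip[OF qT t, of m] lip[OF qT t, of n] Lq unfolding real_norm_def by linarith
  qed
  thus "\<exists>N. \<forall>m\<ge>N. \<forall>n\<ge>N. norm (f m t - f n t) < r" by blast
qed

text \<open>What the limit passage needs along a sequence of scalings: uniform bounds on a fixed time
  interval, vanishing entry flux and dimer mass, and convergence of rates and initial data.\<close>
locale bd_sequence =
  fixes \<eta> Ka Kb T M Mm \<Lambda> m uin v \<rho> :: real and e \<alpha>n \<beta>n mn :: "nat \<Rightarrow> real"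
    and an bn :: "nat \<Rightarrow> nat \<Rightarrow> real" and un :: "nat \<Rightarrow> real \<Rightarrow> real" and cn :: "nat \<Rightarrow> nat \<Rightarrow> real \<Rightarrow> real"
    and a b :: "real \<Rightarrow> real" and \<mu>in :: "real measure"
  assumes sys: "\<And>n. bd_system \<eta> (e n) (\<alpha>n n) (\<beta>n n) (an n) (bn n) (un n) (cn n) (mn n) Ka Kb"
    and e_lim: "e \<longlonglongrightarrow> 0" and e_le: "\<And>n. e n \<le> 1" and T: "0 < T" and M: "0 < M"
    and mn_le: "\<And>n. mn n \<le> Mm"
    and size: "\<And>n t. t \<in> {0..T} \<Longrightarrow> bd_system.count_and_mass (e n) (cn n) t \<le> M"
    and tail: "\<And>\<delta>. 0 < \<delta> \<Longrightarrow> \<exists>R. \<forall>n. \<forall>t\<in>{0..T}.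
       (\<Sum>i. if R < e n * real (i + 3) then e n * cn n (i + 3) t * (e n * real (i + 3)) else 0) \<le> \<delta>"
    and u_lip: "\<And>n s t. s \<in> {0..T} \<Longrightarrow> t \<in> {0..T} \<Longrightarrow> \<bar>un n t - un n s\<bar> \<le> \<Lambda> * \<bar>t - s\<bar>"
    and entry: "(\<lambda>n. integral {0..T} (bd_system.entry_flux (an n) (bn n) (un n) (cn n))) \<longlonglongrightarrow> 0"
    and dimers: "AE t in lebesgue_on {0..T}. (\<lambda>n. e n * cn n 2 t) \<longlonglongrightarrow> 0"
    and a_cont: "continuous_on {0..} a" and b_cont: "continuous_on {0..} b"
    and a_lim: "\<And>R \<delta>. 0 < \<delta> \<Longrightarrow> \<forall>\<^sub>F n in sequentially. \<forall>i\<ge>3. e n * real i \<le> R \<longrightarrow> \<bar>an n i - a (e n * real i)\<bar> < \<delta>"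
    and b_lim: "\<And>R \<delta>. 0 < \<delta> \<Longrightarrow> \<forall>\<^sub>F n in sequentially. \<forall>i\<ge>3. e n * real i \<le> R \<longrightarrow> \<bar>bn n i - b (e n * real i)\<bar> < \<delta>"
    and init: "\<And>g. g \<in> Cc \<Longrightarrow> (\<lambda>n. bd_system.atoms (e n) (cn n) g 0) \<longlonglongrightarrow> (\<integral>x. g x \<partial>\<mu>in)"
    and u_init: "(\<lambda>n. un n 0) \<longlonglongrightarrow> uin" and m_lim: "mn \<longlonglongrightarrow> m"
    and u_low: "\<And>n t. t \<in> {0..T} \<Longrightarrow> v \<le> un n t" and v: "\<rho> < v"
begin

text \<open>The sum in \<open>atoms\<close>, split into weights and sites as \<open>atomic_compactness\<close> expects them.\<close>
definition weight :: "nat \<Rightarrow> real \<Rightarrow> nat \<Rightarrow> real" where "weight n t i = e n * cn n (i + 3) t"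
definition site :: "nat \<Rightarrow> nat \<Rightarrow> real" where "site n i = e n * real (i + 3)"
definition pairing :: "nat \<Rightarrow> (real \<Rightarrow> real) \<Rightarrow> real \<Rightarrow> real" where "pairing n g t = (\<Sum>i. weight n t i * g (site n i))"

lemma e_pos: "0 < e n"
proof -
  interpret S: bd_system \<eta> "e n" "\<alpha>n n" "\<beta>n n" "an n" "bn n" "un n" "cn n" "mn n" Ka Kb by (rule sys)
  show ?thesis by (rule S.eps_pos)
qed

lemma site_nonneg: "0 \<le> site n i" using e_pos[of n] by (simp add: site_def)

lemma pairing_atoms: "bd_system.atoms (e n) (cn n) g t = pairing n g t"
proof -
  interpret S: bd_system \<eta> "e n" "\<alpha>n n" "\<beta>n n" "an n" "bn n" "un n" "cn n" "mn n" Ka Kb by (rule sys)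
  show ?thesis unfolding S.atoms_def pairing_def weight_def site_def ..
qed

lemma weights:
  assumes t: "t \<in> {0..T}"
  shows "0 \<le> weight n t i" "summable (weight n t)" "(\<Sum>i. weight n t i) \<le> M" "summable (\<lambda>i. weight n t i * site n i)" "(\<Sum>i. weight n t i * site n i) \<le> M"
proof -
  interpret S: bd_system \<eta> "e n" "\<alpha>n n" "\<beta>n n" "an n" "bn n" "un n" "cn n" "mn n" Ka Kb by (rule sys)
  have t0: "0 \<le> t" using t by auto
  have c0: "0 \<le> cn n (i + 3) t" for i by (rule S.c_nonneg[OF t0]) simp
  show w0: "0 \<le> weight n t i" for i unfolding weight_def using c0 e_pos[of n] by auto
  have le1: "\<bar>weight n t i\<bar> \<le> 1 * (e n * (1 + e n * real (i + 3)) * cn n (i + 3) t)" for i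
    using w0[of i] mult_nonneg_nonneg[OF w0[of i] site_nonneg[of n i]] by (simp add: weight_def site_def algebra_simps)
  have le2: "\<bar>weight n t i * site n i\<bar> \<le> 1 * (e n * (1 + e n * real (i + 3)) * cn n (i + 3) t)" for i
    using w0[of i] mult_nonneg_nonneg[OF w0[of i] site_nonneg[of n i]] by (simp add: weight_def site_def algebra_simps)
  note D1 = S.count_and_mass_dominates3[OF t0 zero_le_one le1] and D2 = S.count_and_mass_dominates3[OF t0 zero_le_one le2]
  show "summable (weight n t)" "summable (\<lambda>i. weight n t i * site n i)" using D1(1) D2(1) by auto
  show "(\<Sum>i. weight n t i) \<le> M" "(\<Sum>i. weight n t i * site n i) \<le> M" using D1(2) D2(2) size[OF t, of n] by auto
qed

lemma pairing_bound:
  assumes t: "t \<in> {0..T}" and g: "\<And>y. 0 \<le> y \<Longrightarrow> \<bar>g y\<bar> \<le> B"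
  shows "summable (\<lambda>i. weight n t i * g (site n i))" "\<bar>pairing n g t\<bar> \<le> B * M"
proof -
  note W = weights[OF t, of n]
  have B: "0 \<le> B" using g[of 0] by auto
  have le: "norm (weight n t i * g (site n i)) \<le> B * weight n t i" for i
    using mult_left_mono[OF g[OF site_nonneg[of n i]] W(1)[of i]] W(1)[of i] by (simp add: abs_mult mult.commute)
  have s: "summable (\<lambda>i. B * weight n t i)" by (intro summable_mult W)
  show "summable (\<lambda>i. weight n t i * g (site n i))" by (rule summable_comparison_test'[OF s le])
  have "norm (pairing n g t) \<le> (\<Sum>i. B * weight n t i)" unfolding pairing_def by (rule norm_suminf_le[OF le s])
  also have "\<dots> = B * (\<Sum>i. weight n t i)" by (rule suminf_mult[OF W(2)])
  also have "\<dots> \<le> B * M" by (intro mult_left_mono W B)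
  finally show "\<bar>pairing n g t\<bar> \<le> B * M" by simp
qed

lemma pairing_diff:
  assumes t: "t \<in> {0..T}" and g: "\<And>y. 0 \<le> y \<Longrightarrow> \<bar>g y\<bar> \<le> B" and h: "\<And>y. 0 \<le> y \<Longrightarrow> \<bar>h y\<bar> \<le> B'"
  shows "pairing n (\<lambda>y. g y - h y) t = pairing n g t - pairing n h t"
  unfolding pairing_def right_diff_distrib
  by (rule suminf_diff[symmetric]) (rule pairing_bound(1)[OF t g], assumption, rule pairing_bound(1)[OF t h], assumption)

lemma pairing_expfam_lipschitz:
  assumes s: "s \<in> {0..T}" and t: "t \<in> {0..T}"
  shows "\<bar>pairing n (expfam k l) t - pairing n (expfam k l) s\<bar> \<le> real (k + l + 1) * (1 + Ka * Mm + Kb) * M * \<bar>t - s\<bar>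
     + real (k + l + 1) * integral {0..T} (bd_system.entry_flux (an n) (bn n) (un n) (cn n))"
proof -
  interpret S: bd_system \<eta> "e n" "\<alpha>n n" "\<beta>n n" "an n" "bn n" "un n" "cn n" "mn n" Ka Kb by (rule sys)
  let ?L = "real (k + l + 1)"
  have lip: "\<bar>expfam k l x - expfam k l y\<bar> \<le> ?L * \<bar>x - y\<bar>" if "0 \<le> x" "0 \<le> y" for x y
    by (rule order_trans[OF expfam_lipschitz[OF that]]) (simp add: mult_right_mono)
  have bd: "\<bar>expfam k l x\<bar> \<le> ?L" if "0 \<le> x" for x using expfam_bounds[OF that, of k l] by simp
  have *: "\<bar>pairing n (expfam k l) t - pairing n (expfam k l) s\<bar> \<le> ?L * (1 + Ka * Mm + Kb) * M * (t - s)
     + ?L * integral {0..T} S.entry_flux" if "0 \<le> s" "s \<le> t" "t \<le> T" for s t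
  proof -
    have "\<bar>pairing n (expfam k l) t - pairing n (expfam k l) s\<bar> \<le> ?L * (1 + Ka * mn n + Kb) * M * (t - s) + ?L * integral {0..T} S.entry_flux"
      unfolding pairing_atoms[symmetric] by (rule S.atoms_lipschitz[OF that]) (use lip bd size in auto)
    also have "?L * (1 + Ka * mn n + Kb) * M * (t - s) \<le> ?L * (1 + Ka * Mm + Kb) * M * (t - s)"
      using that M mn_le[of n] S.Ka_nonneg by (intro mult_right_mono mult_left_mono add_mono) auto
    finally show ?thesis by simp
  qed
  show ?thesis
  proof (cases "s \<le> t")
    case True then show ?thesis using *[of s t] s t by simp
  next
    case False then show ?thesis using *[of t s] s t by (simp add: abs_minus_commute)
  qed
qed

text \<open>One diagonal sequence serves \<open>u\<close> and all functions of the family at all rational times; the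
  Lipschitz bounds extend the convergence to all times.\<close>
lemma convergent_subsequence:
  obtains r :: "nat \<Rightarrow> nat" where "strict_mono r" "\<And>t. t \<in> {0..T} \<Longrightarrow> convergent (\<lambda>k. un (r k) t)"
    "\<And>t k l. t \<in> {0..T} \<Longrightarrow> convergent (\<lambda>j. pairing (r j) (expfam k l) t)"
proof -
  define S where "S = (\<rat> \<inter> {0..T}) \<times> (UNIV :: (nat \<times> nat) option set)"
  define f where "f n p = (case snd p of None \<Rightarrow> un n (fst p) | Some (k, l) \<Rightarrow> pairing n (expfam k l) (fst p))" for n and p :: "real \<times> (nat \<times> nat) option"
  have cS: "countable S" unfolding S_def by (intro countable_SIGMA countable_Int1 countable_rat) auto
  have ub: "\<bar>un n t\<bar> \<le> Mm" if "t \<in> {0..T}" for n t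
  proof -
    interpret S: bd_system \<eta> "e n" "\<alpha>n n" "\<beta>n n" "an n" "bn n" "un n" "cn n" "mn n" Ka Kb by (rule sys)
    show ?thesis using S.u_nonneg[of t] S.u_le[of t] mn_le[of n] that by auto
  qed
  have Ab: "\<bar>pairing n (expfam k l) t\<bar> \<le> M" if "t \<in> {0..T}" for n k l t
    using pairing_bound(2)[OF that, of "expfam k l" 1 n] expfam_bounds[of _ k l] by force
  have fb: "norm (f n p) \<le> max Mm M" if "p \<in> S" for n p
  proof (cases "snd p")
    case None
    then show ?thesis using ub[of "fst p" n] that by (auto simp: f_def S_def)
  next
    case (Some kl)
    then show ?thesis using Ab[of "fst p" n "fst kl" "snd kl"] that by (auto simp: f_def S_def split: prod.split)
  qed
  obtain r where r: "strict_mono (r :: nat \<Rightarrow> nat)"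
    and conv: "\<And>p. p \<in> S \<Longrightarrow> \<exists>l. (\<lambda>n. f (r n) p) \<longlonglongrightarrow> l"
    by (rule function_convergent_subsequence[of S f "max Mm M"]) (use cS fb in blast)+
  show ?thesis
  proof (rule that[OF r])
    fix t assume t: "t \<in> {0..T}"
    have L0: "0 \<le> \<Lambda>"
    proof -
      have "0 \<le> \<Lambda> * \<bar>T - 0\<bar>" using u_lip[of 0 T 0] T by (intro order_trans[OF abs_ge_zero]) auto
      thus ?thesis using T by (simp add: zero_le_mult_iff)
    qed
    show "convergent (\<lambda>k. un (r k) t)"
    proof (rule equilipschitz_convergent[OF T L0, where \<delta> = "\<lambda>_. 0"])
      show "convergent (\<lambda>n. un (r n) q)" if "q \<in> \<rat>" "q \<in> {0..T}" for q
        using conv[of "(q, None)"] that by (auto simp: f_def S_def convergent_def)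
    qed (use u_lip t in auto)
    fix k l
    have K: "0 \<le> real (k + l + 1) * (1 + Ka * Mm + Kb) * M"
    proof -
      interpret S: bd_system \<eta> "e 0" "\<alpha>n 0" "\<beta>n 0" "an 0" "bn 0" "un 0" "cn 0" "mn 0" Ka Kb by (rule sys)
      show ?thesis using S.Ka_nonneg S.Kb_nonneg S.m_nonneg mn_le[of 0] M by (intro mult_nonneg_nonneg add_nonneg_nonneg) auto
    qed
    show "convergent (\<lambda>j. pairing (r j) (expfam k l) t)"
    proof (rule equilipschitz_convergent[OF T K])
      show "(\<lambda>j. real (k + l + 1) * integral {0..T} (bd_system.entry_flux (an (r j)) (bn (r j)) (un (r j)) (cn (r j)))) \<longlonglongrightarrow> 0"
        using tendsto_mult_right_zero[OF LIMSEQ_subseq_LIMSEQ[OF entry r]] by (simp add: o_def)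
      show "convergent (\<lambda>n. pairing (r n) (expfam k l) q)" if "q \<in> \<rat>" "q \<in> {0..T}" for q
        using conv[of "(q, Some (k, l))"] that by (auto simp: f_def S_def convergent_def)
      show "\<bar>pairing (r n) (expfam k l) t - pairing (r n) (expfam k l) s\<bar> \<le> real (k + l + 1) * (1 + Ka * Mm + Kb) * M * \<bar>t - s\<bar>
        + real (k + l + 1) * integral {0..T} (bd_system.entry_flux (an (r n)) (bn (r n)) (un (r n)) (cn (r n)))"
        if "s \<in> {0..T}" "t \<in> {0..T}" for n s t by (rule pairing_expfam_lipschitz[OF that])
    qed (rule t)
  qed
qed

lemma convergent_Cc:
  assumes t: "t \<in> {0..T}" and g: "g \<in> Cc" and conv: "\<And>k l. convergent (\<lambda>j. pairing (r j) (expfam k l) t)"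
  shows "convergent (\<lambda>j. pairing (r j) g t)"
  unfolding Cauchy_convergent_iff[symmetric]
proof (rule CauchyI)
  fix \<delta> :: real assume \<delta>: "0 < \<delta>"
  obtain B where B: "0 < B" "\<And>x. 0 \<le> x \<Longrightarrow> \<bar>g x\<bar> \<le> B" using Cc_bounded[OF g] by blast
  have "0 < \<delta> / (3 * M)" using \<delta> M by simp
  from expfam_dense[OF g this] obtain n q where
    nq: "\<And>x. 0 \<le> x \<Longrightarrow> \<bar>g x - (\<Sum>k\<le>n. q k * expfam k (n - k) x)\<bar> < \<delta> / (3 * M)" by blast
  define h where "h x = (\<Sum>k\<le>n. q k * expfam k (n - k) x)" for x
  have hB: "\<bar>h x\<bar> \<le> B + \<delta> / (3 * M)" if "0 \<le> x" for x using nq[OF that] B(2)[OF that] by (simp add: h_def)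
  have d: "\<bar>pairing j g t - pairing j h t\<bar> \<le> \<delta> / 3" for j
  proof -
    have "\<bar>pairing j (\<lambda>y. g y - h y) t\<bar> \<le> \<delta> / (3 * M) * M"
      by (rule pairing_bound(2)[OF t]) (use nq in \<open>auto simp: h_def intro: less_imp_le\<close>)
    thus ?thesis using pairing_diff[OF t B(2) hB] M by simp
  qed
  have Ah: "pairing j h t = (\<Sum>k\<le>n. q k * pairing j (expfam k (n - k)) t)" for j
  proof -
    have s: "summable (\<lambda>i. weight j t i * expfam k l (site j i))" for k l
      by (rule pairing_bound(1)[OF t, of "expfam k l" 1]) (use expfam_bounds in auto)
    have "pairing j h t = (\<Sum>i. \<Sum>k\<le>n. q k * (weight j t i * expfam k (n - k) (site j i)))"
      unfolding pairing_def h_def sum_distrib_left by (intro suminf_cong sum.cong refl) (simp add: mult_ac)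
    also have "\<dots> = (\<Sum>k\<le>n. \<Sum>i. q k * (weight j t i * expfam k (n - k) (site j i)))"
      by (rule suminf_sum) (intro summable_mult s)
    also have "\<dots> = (\<Sum>k\<le>n. q k * pairing j (expfam k (n - k)) t)"
      unfolding pairing_def by (intro sum.cong refl suminf_mult s)
    finally show ?thesis .
  qed
  have "convergent (\<lambda>j. pairing (r j) h t)" unfolding Ah by (intro convergent_sum convergent_mult convergent_const conv)
  hence "Cauchy (\<lambda>j. pairing (r j) h t)" by (rule convergent_Cauchy)
  then obtain N where N: "\<And>m n. m \<ge> N \<Longrightarrow> n \<ge> N \<Longrightarrow> norm (pairing (r m) h t - pairing (r n) h t) < \<delta> / 3"
    using CauchyD[of "\<lambda>j. pairing (r j) h t" "\<delta>/3"] \<delta> by auto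
  have "norm (pairing (r m) g t - pairing (r n) g t) < \<delta>" if "m \<ge> N" "n \<ge> N" for m n
    using N[OF that] d[of "r m"] d[of "r n"] unfolding real_norm_def by linarith
  thus "\<exists>N. \<forall>m\<ge>N. \<forall>n\<ge>N. norm (pairing (r m) g t - pairing (r n) g t) < \<delta>" by blast
qed

text \<open>Compactness at a fixed time gives a limit along a further subsequence. Since integrals
  of functions in \<open>Cc\<close> converge already, passing to it does not change their limits.\<close>
lemma limit_measure:
  assumes t: "t \<in> {0..T}" and conv: "\<And>k l. convergent (\<lambda>j. pairing (r j) (expfam k l) t)"
  shows "\<exists>\<mu>. \<mu> \<in> Mf \<and> measure \<mu> {0..} \<le> M \<and> (\<forall>g\<in>Cc. (\<lambda>j. pairing (r j) g t) \<longlonglongrightarrow> (\<integral>x. g x \<partial>\<mu>))"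
proof -
  obtain s \<mu> where s: "strict_mono (s :: nat \<Rightarrow> nat)" and \<mu>: "\<mu> \<in> Mf" "measure \<mu> {0..} \<le> M"
    and lim: "\<forall>g\<in>Cc. (\<lambda>k. \<Sum>i. weight (r (s k)) t i * g (site (r (s k)) i)) \<longlonglongrightarrow> (\<integral>x. g x \<partial>\<mu>)"
    using atomic_compactness[of "\<lambda>n. weight (r n) t" "\<lambda>n. site (r n)" M, OF weights(1)[OF t] site_nonneg M weights(2-5)[OF t]] by blast
  have "(\<lambda>j. pairing (r j) g t) \<longlonglongrightarrow> (\<integral>x. g x \<partial>\<mu>)" if g: "g \<in> Cc" for g
  proof -
    obtain L where L: "(\<lambda>j. pairing (r j) g t) \<longlonglongrightarrow> L" using convergent_Cc[OF t g conv] by (auto simp: convergent_def)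
    have "(\<lambda>k. pairing (r (s k)) g t) \<longlonglongrightarrow> L" using LIMSEQ_subseq_LIMSEQ[OF L s] by (simp add: o_def)
    moreover have "(\<lambda>k. pairing (r (s k)) g t) \<longlonglongrightarrow> (\<integral>x. g x \<partial>\<mu>)" using lim g by (simp add: pairing_def)
    ultimately have "L = (\<integral>x. g x \<partial>\<mu>)" by (rule LIMSEQ_unique)
    with L show ?thesis by simp
  qed
  with \<mu> show ?thesis by blast
qed

end

section \<open>Test functions for the limit equation\<close>

lemma derivative_zero_of_locally_zero:
  fixes f :: "real \<Rightarrow> real"
  assumes d: "(f has_real_derivative d) (at x within S)" and x: "x \<in> S" and nt: "at x within S \<noteq> bot"
    and z: "0 < \<delta>" "\<And>y. y \<in> S \<Longrightarrow> dist y x < \<delta> \<Longrightarrow> f y = 0"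
  shows "d = 0"
proof -
  have "((\<lambda>_. 0) has_real_derivative d) (at x within S)"
    by (rule has_field_derivative_transform_within[OF d z(1) x]) (use z(2) in auto)
  hence 1: "((\<lambda>_. 0) has_vector_derivative d) (at x within S)" by (simp add: has_real_derivative_iff_has_vector_derivative)
  show ?thesis by (rule vector_derivative_unique_within[OF nt 1 has_vector_derivative_const])
qed

text \<open>A first-order Taylor estimate by the oscillation of the derivative, valid up to the endpoint
  of the half-line.\<close>
lemma increment_bound:
  fixes g g' :: "real \<Rightarrow> real"
  assumes der: "\<And>x. 0 \<le> x \<Longrightarrow> (g has_real_derivative g' x) (at x within {0..})"
    and yz: "0 \<le> y" "0 \<le> z" and le: "\<And>\<xi>. 0 \<le> \<xi> \<Longrightarrow> \<bar>\<xi> - y\<bar> \<le> \<bar>z - y\<bar> \<Longrightarrow> \<bar>g' \<xi> - g' y\<bar> \<le> \<delta>"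
  shows "\<bar>g z - g y - (z - y) * g' y\<bar> \<le> \<delta> * \<bar>z - y\<bar>"
proof -
  define f where "f x = g x - x * g' y" for x
  define S where "S = closed_segment y z"
  have S: "0 \<le> x \<and> \<bar>x - y\<bar> \<le> \<bar>z - y\<bar>" if "x \<in> S" for x
    using that yz unfolding S_def closed_segment_eq_real_ivl by (auto split: if_splits)
  have "norm (f z - f y) \<le> \<delta> * norm (z - y)"
  proof (rule field_differentiable_bound[of S f "\<lambda>x. g' x - g' y"])
    show "(f has_real_derivative g' x - g' y) (at x within S)" if "x \<in> S" for x
    proof -
      have "(g has_real_derivative g' x) (at x within S)" by (rule DERIV_subset[OF der]) (use S that in auto)
      thus ?thesis unfolding f_def[abs_def] by (auto intro!: derivative_eq_intros)
    qed
    show "norm (g' x - g' y) \<le> \<delta>" if "x \<in> S" for x using S[OF that] le by simp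
  qed (auto simp: S_def)
  thus ?thesis by (simp add: f_def algebra_simps)
qed

text \<open>The support of a test function is a compact subset of a set that is open at \<open>T\<close> but contains its
  other edges. Hence the function and its derivatives vanish for times beyond some \<open>t1 < T\<close> and
  for large sizes, and they are bounded.\<close>
lemma C1c_test_facts:
  assumes test: "C1c_test T \<phi> \<phi>t \<phi>x" and T: "0 < T"
  obtains t1 R B where "0 \<le> t1" "t1 < T" "0 < R" "0 < B"
    "\<And>t x. t \<in> {0..<T} \<Longrightarrow> 0 \<le> x \<Longrightarrow> t1 < t \<or> R \<le> x \<Longrightarrow> \<phi> (t, x) = 0 \<and> \<phi>t (t, x) = 0 \<and> \<phi>x (t, x) = 0"
    "\<And>t x. t \<in> {0..<T} \<Longrightarrow> 0 \<le> x \<Longrightarrow> ((\<lambda>t. \<phi> (t, x)) has_real_derivative \<phi>t (t, x)) (at t within {0..<T})"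
    "\<And>t x. t \<in> {0..<T} \<Longrightarrow> 0 \<le> x \<Longrightarrow> ((\<lambda>x. \<phi> (t, x)) has_real_derivative \<phi>x (t, x)) (at x within {0..})"
    "\<And>t x. t \<in> {0..<T} \<Longrightarrow> 0 \<le> x \<Longrightarrow> \<bar>\<phi> (t, x)\<bar> \<le> B \<and> \<bar>\<phi>t (t, x)\<bar> \<le> B \<and> \<bar>\<phi>x (t, x)\<bar> \<le> B"
proof -
  define D where "D = {0..<T} \<times> {0::real..}"
  have der: "\<And>p. p \<in> D \<Longrightarrow> (\<phi> has_derivative (\<lambda>(h, k). \<phi>t p * h + \<phi>x p * k)) (at p within D)"
    and ct: "continuous_on D \<phi>t" and cx: "continuous_on D \<phi>x"
    and "\<exists>K. compact K \<and> K \<subseteq> D \<and> (\<forall>p\<in>D - K. \<phi> p = 0)"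
    using test unfolding C1c_test_def Let_def D_def by auto
  then obtain K where K: "compact K" "K \<subseteq> D" "\<And>p. p \<in> D - K \<Longrightarrow> \<phi> p = 0" by blast
  have cf: "continuous_on D \<phi>" using der has_derivative_continuous continuous_on_eq_continuous_within by blast
  obtain R0 where R0: "0 < R0" "\<And>p. p \<in> K \<Longrightarrow> norm p \<le> R0" using compact_imp_bounded[OF K(1)] bounded_pos by blast
  obtain t1 where t1: "0 \<le> t1" "t1 < T" "\<And>p. p \<in> K \<Longrightarrow> fst p \<le> t1"
  proof (cases "K = {}")
    case True
    thus ?thesis using that[of 0] T by auto
  next
    case False
    have "compact (fst ` K)" by (intro compact_continuous_image K continuous_intros)
    from compact_attains_sup[OF this] False obtain s where s: "s \<in> fst ` K" "\<forall>t\<in>fst ` K. t \<le> s" by auto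
    have "0 \<le> s" "s < T" using s(1) K(2) by (auto simp: D_def)
    thus ?thesis using that[of s] s by auto
  qed
  have zero: "\<phi> (t, x) = 0" if "t \<in> {0..<T}" "0 \<le> x" "t1 < t \<or> R0 < x" for t x
  proof (rule K(3))
    have "(t, x) \<notin> K"
    proof
      assume k: "(t, x) \<in> K"
      have "norm x \<le> norm (t, x)" by (rule norm_snd_le)
      hence "x \<le> R0" using R0(2)[OF k] by simp
      thus False using t1(3)[OF k] that by auto
    qed
    thus "(t, x) \<in> D - K" using that by (auto simp: D_def)
  qed
  have dt: "((\<lambda>t. \<phi> (t, x)) has_real_derivative \<phi>t (t, x)) (at t within {0..<T})" if t: "t \<in> {0..<T}" "0 \<le> x" for t x
  proof -
    have "((\<lambda>t. (t, x)) has_derivative (\<lambda>h. (h, 0))) (at t within {0..<T})" by (auto intro!: derivative_eq_intros)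
    moreover have "(\<lambda>t. (t, x)) ` {0..<T} \<subseteq> D" using t by (auto simp: D_def)
    ultimately have "((\<lambda>t. \<phi> (t, x)) has_derivative (\<lambda>h. \<phi>t (t, x) * h)) (at t within {0..<T})"
      using has_derivative_in_compose2[of D \<phi> "\<lambda>p (h, k). \<phi>t p * h + \<phi>x p * k" "\<lambda>t. (t, x)" "{0..<T}" t "\<lambda>h. (h, 0)", OF der _ t(1)]
      by simp
    thus ?thesis by (simp add: has_field_derivative_def)
  qed
  have dx: "((\<lambda>x. \<phi> (t, x)) has_real_derivative \<phi>x (t, x)) (at x within {0..})" if t: "t \<in> {0..<T}" "0 \<le> x" for t x
  proof -
    have "((\<lambda>x. (t, x)) has_derivative (\<lambda>k. (0, k))) (at x within {0..})" by (auto intro!: derivative_eq_intros)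
    moreover have "(\<lambda>x. (t, x)) ` {0..} \<subseteq> D" using t by (auto simp: D_def)
    ultimately have "((\<lambda>x. \<phi> (t, x)) has_derivative (\<lambda>k. \<phi>x (t, x) * k)) (at x within {0..})"
      using has_derivative_in_compose2[of D \<phi> "\<lambda>p (h, k). \<phi>t p * h + \<phi>x p * k" "\<lambda>x. (t, x)" "{0..}" x "\<lambda>k. (0, k)", OF der] t(2)
      by simp
    thus ?thesis by (simp add: has_field_derivative_def)
  qed
  have nt: "at t within {0..<T} \<noteq> bot" if "t \<in> {0..<T}" for t
    using that by (auto simp: trivial_limit_within)
  have nx: "at x within {0..} \<noteq> bot" if "0 \<le> x" for x :: real
  proof -
    have "x islimpt {x..<x+1}" by simp
    hence "x islimpt {0..}" by (rule islimpt_subset) (use that in auto)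
    thus ?thesis by (simp add: trivial_limit_within)
  qed
  have zt: "\<phi>t (t, x) = 0" if t: "t \<in> {0..<T}" "0 \<le> x" "t1 < t \<or> R0 + 1 \<le> x" for t x
  proof (rule derivative_zero_of_locally_zero[OF dt[OF t(1,2)] t(1) nt[OF t(1)]])
    show "0 < (if t1 < t then t - t1 else 1)" by simp
    show "\<phi> (y, x) = 0" if "y \<in> {0..<T}" "dist y t < (if t1 < t then t - t1 else 1)" for y
    proof -
      have "t1 < y \<or> R0 < x" using that t by (cases "t1 < t") (auto simp: dist_real_def abs_less_iff)
      thus ?thesis using zero[of y x] that t by auto
    qed
  qed
  have zx: "\<phi>x (t, x) = 0" if t: "t \<in> {0..<T}" "0 \<le> x" "t1 < t \<or> R0 + 1 \<le> x" for t x
  proof (rule derivative_zero_of_locally_zero[OF dx[OF t(1,2)] _ nx[OF t(2)]])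
    show "\<phi> (t, y) = 0" if "y \<in> {0..}" "dist y x < 1" for y
      using zero[of t y] that t by (auto simp: dist_real_def abs_less_iff)
  qed (use t in auto)
  define C where "C = {0..t1} \<times> {0..R0+1}"
  have C: "compact C" "C \<subseteq> D" using t1 by (auto simp: C_def D_def intro: compact_Times)
  have bdd: "\<exists>B>0. \<forall>p\<in>C. \<bar>h p\<bar> \<le> B" if "continuous_on D h" for h :: "real \<times> real \<Rightarrow> real"
    using compact_imp_bounded[OF compact_continuous_image[OF continuous_on_subset[OF that C(2)] C(1)]]
    by (auto simp: bounded_pos)
  obtain B1 B2 B3 where B: "0 < B1" "0 < B2" "0 < B3" "\<forall>p\<in>C. \<bar>\<phi> p\<bar> \<le> B1" "\<forall>p\<in>C. \<bar>\<phi>t p\<bar> \<le> B2" "\<forall>p\<in>C. \<bar>\<phi>x p\<bar> \<le> B3"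
    using bdd[OF cf] bdd[OF ct] bdd[OF cx] by blast
  show ?thesis
  \<comment> \<open>The partial derivatives vanish where the function does so in a neighbourhood, hence \<open>R0 + 1\<close>.\<close>
  proof (rule that[of t1 "R0 + 1" "B1 + B2 + B3"])
    show "\<phi> (t, x) = 0 \<and> \<phi>t (t, x) = 0 \<and> \<phi>x (t, x) = 0" if "t \<in> {0..<T}" "0 \<le> x" "t1 < t \<or> R0 + 1 \<le> x" for t x
      using zero[of t x] zt[OF that] zx[OF that] that by auto
    show "\<bar>\<phi> (t, x)\<bar> \<le> B1 + B2 + B3 \<and> \<bar>\<phi>t (t, x)\<bar> \<le> B1 + B2 + B3 \<and> \<bar>\<phi>x (t, x)\<bar> \<le> B1 + B2 + B3"
      if t: "t \<in> {0..<T}" "0 \<le> x" for t x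
    proof (cases "t1 < t \<or> R0 + 1 \<le> x")
      case True
      then show ?thesis using zero[of t x] zt[OF t True] zx[OF t True] t B by auto
    next
      case False
      hence "(t, x) \<in> C" using t by (auto simp: C_def)
      hence "\<bar>\<phi> (t, x)\<bar> \<le> B1" "\<bar>\<phi>t (t, x)\<bar> \<le> B2" "\<bar>\<phi>x (t, x)\<bar> \<le> B3" using B by auto
      thus ?thesis using B(1-3) by auto
    qed
  qed (use t1 R0 B dt dx in auto)
qed

text \<open>One term of \<open>transport\<close> compared with the transport operator of the limit equation: both
  difference quotients are close to the derivative, and the rates and \<open>u\<close> are close to their limits.\<close>
lemma generator_consistency:
  fixes g g' :: "real \<Rightarrow> real" and e y ai bi ui ay b_y uy \<tau> \<delta> Ca Cb U B :: real
  assumes der: "\<And>x. 0 \<le> x \<Longrightarrow> (g has_real_derivative g' x) (at x within {0..})"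
    and e: "0 < e" "e \<le> y" and osc: "\<And>z. 0 \<le> z \<Longrightarrow> \<bar>z - y\<bar> \<le> e \<Longrightarrow> \<bar>g' z - g' y\<bar> \<le> \<delta>"
    and \<delta>: "0 \<le> \<delta>" "\<delta> \<le> 1" and close: "\<bar>ai - ay\<bar> \<le> \<delta>" "\<bar>bi - b_y\<bar> \<le> \<delta>" "\<bar>ui - uy\<bar> \<le> \<delta>"
    and bd: "\<bar>ay\<bar> \<le> Ca" "\<bar>b_y\<bar> \<le> Cb" "\<bar>ui\<bar> \<le> U" "\<bar>g' y\<bar> \<le> B"
  shows "\<bar>e * \<tau> + (g (y + e) - g y) * ai * ui - (g y - g (y - e)) * bi - e * (\<tau> + (ay * uy - b_y) * g' y)\<bar>
    \<le> e * (\<delta> * ((Ca + 1) * U + B * U + B * Ca + (Cb + 1) + B))"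
proof -
  define P where "P = g (y + e) - g y - e * g' y"
  define Q where "Q = g (y - e) - g y + e * g' y"
  have P: "\<bar>P\<bar> \<le> \<delta> * e"
  proof -
    have "\<bar>g (y + e) - g y - ((y + e) - y) * g' y\<bar> \<le> \<delta> * \<bar>(y + e) - y\<bar>"
      by (rule increment_bound[OF der _ _ osc]) (use e in auto)
    thus ?thesis using e unfolding P_def by simp
  qed
  have Q: "\<bar>Q\<bar> \<le> \<delta> * e"
  proof -
    have "\<bar>g (y - e) - g y - ((y - e) - y) * g' y\<bar> \<le> \<delta> * \<bar>(y - e) - y\<bar>"
      by (rule increment_bound[OF der _ _ osc]) (use e in auto)
    thus ?thesis using e unfolding Q_def by simp
  qed
  have nn: "0 \<le> Ca" "0 \<le> Cb" "0 \<le> U" "0 \<le> B" using bd by linarith+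
  have a1: "\<bar>ai\<bar> \<le> Ca + 1" and b1: "\<bar>bi\<bar> \<le> Cb + 1" using close bd \<delta> by linarith+
  have "e * \<tau> + (g (y + e) - g y) * ai * ui - (g y - g (y - e)) * bi - e * (\<tau> + (ay * uy - b_y) * g' y)
     = P * (ai * ui) + e * g' y * ((ai - ay) * ui + ay * (ui - uy)) + Q * bi - e * g' y * (bi - b_y)"
    unfolding P_def Q_def by (simp add: algebra_simps)
  moreover have "\<bar>P * (ai * ui)\<bar> \<le> (\<delta> * e) * ((Ca + 1) * U)"
    unfolding abs_mult by (intro mult_mono P a1 bd mult_nonneg_nonneg abs_ge_zero) (use nn e \<delta> in linarith)+
  moreover have "\<bar>e * g' y * ((ai - ay) * ui + ay * (ui - uy))\<bar> \<le> (e * B) * (\<delta> * U + Ca * \<delta>)"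
  proof -
    have "\<bar>(ai - ay) * ui\<bar> \<le> \<delta> * U"
      unfolding abs_mult by (intro mult_mono close bd abs_ge_zero \<delta>)
    moreover have "\<bar>ay * (ui - uy)\<bar> \<le> Ca * \<delta>"
      unfolding abs_mult by (intro mult_mono close bd abs_ge_zero nn)
    ultimately have 1: "\<bar>(ai - ay) * ui + ay * (ui - uy)\<bar> \<le> \<delta> * U + Ca * \<delta>" by linarith
    have 2: "\<bar>e * g' y\<bar> \<le> e * B" using e bd(4) by (simp add: abs_mult)
    show ?thesis unfolding abs_mult[of "e * g' y"]
      by (intro mult_mono 1 2 mult_nonneg_nonneg abs_ge_zero) (use e nn in linarith)+
  qed
  moreover have "\<bar>Q * bi\<bar> \<le> (\<delta> * e) * (Cb + 1)"
    unfolding abs_mult by (intro mult_mono Q b1 mult_nonneg_nonneg abs_ge_zero) (use nn e \<delta> in linarith)+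
  moreover have "\<bar>e * g' y * (bi - b_y)\<bar> \<le> (e * B) * \<delta>"
  proof -
    have 2: "\<bar>e * g' y\<bar> \<le> e * B" using e bd(4) by (simp add: abs_mult)
    show ?thesis unfolding abs_mult[of "e * g' y"]
      by (intro mult_mono 2 close mult_nonneg_nonneg abs_ge_zero) (use e nn in linarith)+
  qed
  ultimately have "\<bar>e * \<tau> + (g (y + e) - g y) * ai * ui - (g y - g (y - e)) * bi - e * (\<tau> + (ay * uy - b_y) * g' y)\<bar>
     \<le> (\<delta> * e) * ((Ca + 1) * U) + (e * B) * (\<delta> * U + Ca * \<delta>) + (\<delta> * e) * (Cb + 1) + (e * B) * \<delta>" by linarith
  also have "\<dots> = e * (\<delta> * ((Ca + 1) * U + B * U + B * Ca + (Cb + 1) + B))" by (simp add: algebra_simps)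
  finally show ?thesis .
qed

section \<open>Passage to the limit\<close>

locale bd_limit = bd_sequence +
  fixes r :: "nat \<Rightarrow> nat" and \<mu> :: "real \<Rightarrow> real measure" and u :: "real \<Rightarrow> real"
  assumes r: "strict_mono r"
    and u_conv: "\<And>t. t \<in> {0..T} \<Longrightarrow> (\<lambda>k. un (r k) t) \<longlonglongrightarrow> u t"
    and \<mu>_Mf: "\<And>t. t \<in> {0..T} \<Longrightarrow> \<mu> t \<in> Mf" and \<mu>_le: "\<And>t. t \<in> {0..T} \<Longrightarrow> measure (\<mu> t) {0..} \<le> M"
    and pairing_conv: "\<And>t g. t \<in> {0..T} \<Longrightarrow> g \<in> Cc \<Longrightarrow> (\<lambda>k. pairing (r k) g t) \<longlonglongrightarrow> (\<integral>x. g x \<partial>\<mu> t)"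
begin

lemma e_r: "(\<lambda>k. e (r k)) \<longlonglongrightarrow> 0"
  using LIMSEQ_subseq_LIMSEQ[OF e_lim r] by (simp add: o_def)

lemma cn_nonneg:
  assumes t: "t \<in> {0..T}" and i: "2 \<le> i"
  shows "0 \<le> cn n i t"
proof -
  interpret S: bd_system \<eta> "e n" "\<alpha>n n" "\<beta>n n" "an n" "bn n" "un n" "cn n" "mn n" Ka Kb by (rule sys)
  show ?thesis by (rule S.c_nonneg) (use t i in auto)
qed

lemma number_bounds:
  assumes t: "t \<in> {0..T}"
  shows "\<And>i. 0 \<le> cn n (i + 2) t" "summable (\<lambda>i. e n * cn n (i + 2) t)" "(\<Sum>i. e n * cn n (i + 2) t) \<le> M"
    "(\<Sum>i<N. e n * cn n (i + 2) t) \<le> M"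
proof -
  interpret S: bd_system \<eta> "e n" "\<alpha>n n" "\<beta>n n" "an n" "bn n" "un n" "cn n" "mn n" Ka Kb by (rule sys)
  have t0: "0 \<le> t" using t by auto
  show c0: "0 \<le> cn n (i + 2) t" for i by (rule S.c_nonneg[OF t0]) simp
  have le: "\<bar>e n * cn n (i + 2) t\<bar> \<le> 1 * (e n * (1 + e n * real (i + 2)) * cn n (i + 2) t)" for i
  proof -
    have "0 \<le> e n * (e n * real (i + 2)) * cn n (i + 2) t" using c0[of i] e_pos[of n] by auto
    thus ?thesis using c0[of i] e_pos[of n] by (simp add: algebra_simps)
  qed
  note D = S.count_and_mass_dominates[OF t0 zero_le_one le]
  show s: "summable (\<lambda>i. e n * cn n (i + 2) t)" by (rule D(1))
  show le: "(\<Sum>i. e n * cn n (i + 2) t) \<le> M" using D(2) size[OF t, of n] by auto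
  have "(\<Sum>i<N. e n * cn n (i + 2) t) \<le> (\<Sum>i. e n * cn n (i + 2) t)"
    by (rule sum_le_suminf[OF s]) (use c0 e_pos[of n] in auto)
  with le show "(\<Sum>i<N. e n * cn n (i + 2) t) \<le> M" by linarith
qed

definition step_measure :: "nat \<Rightarrow> real \<Rightarrow> real measure" where
  "step_measure n t = density_measure (step_fun 2 (e n) (\<lambda>i. cn n i t))"

lemma step_measure_Mf: "t \<in> {0..T} \<Longrightarrow> step_measure n t \<in> Mf" "t \<in> {0..T} \<Longrightarrow> measure (step_measure n t) {0..} \<le> M"
proof -
  assume t: "t \<in> {0..T}"
  have c: "0 \<le> cn n i t" if "2 \<le> i" for i by (rule cn_nonneg[OF t that])
  show "step_measure n t \<in> Mf" "measure (step_measure n t) {0..} \<le> M"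
    unfolding step_measure_def using density_measure_Mf[OF e_pos c number_bounds(2,3)[OF t]] by auto
qed

lemma step_measure_measurable:
  assumes g: "g \<in> Cc" shows "(\<lambda>t. \<integral>x. g x \<partial>step_measure n t) \<in> borel_measurable (lebesgue_on {0..T})"
proof -
  interpret S: bd_system \<eta> "e n" "\<alpha>n n" "\<beta>n n" "an n" "bn n" "un n" "cn n" "mn n" Ka Kb by (rule sys)
  obtain R where R: "0 < R" "\<And>x. R \<le> x \<Longrightarrow> g x = 0" using Cc_support[OF g] by blast
  obtain N :: nat where N: "R / e n \<le> real N" using real_arch_simple by blast
  hence N: "R \<le> e n * real N" using e_pos[of n] by (simp add: field_simps)
  have eq: "(\<integral>x. g x \<partial>step_measure n t) = (\<Sum>i<N. cn n (i + 2) t * (\<integral>x. indicat_real (cell (e n) (i + 2)) x * g x \<partial>lborel))" if t: "t \<in> {0..T}" for t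
    unfolding step_measure_def by (rule step_integral[OF e_pos _ g R(2) N]) (use S.c_nonneg t in auto)
  have "continuous_on {0..T} (\<lambda>t. \<Sum>i<N. cn n (i + 2) t * (\<integral>x. indicat_real (cell (e n) (i + 2)) x * g x \<partial>lborel))"
    by (intro continuous_intros continuous_on_subset[OF S.c_continuous]) auto
  hence "continuous_on {0..T} (\<lambda>t. \<integral>x. g x \<partial>step_measure n t)" by (rule continuous_on_eq) (rule eq[symmetric])
  thus ?thesis by (rule continuous_imp_measurable_on_sets_lebesgue) auto
qed

lemma pairing_measurable:
  assumes g: "g \<in> Cc" shows "pairing n g \<in> borel_measurable (lebesgue_on {0..T})"
proof -
  interpret S: bd_system \<eta> "e n" "\<alpha>n n" "\<beta>n n" "an n" "bn n" "un n" "cn n" "mn n" Ka Kb by (rule sys)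
  obtain R where R: "0 < R" "\<And>x. R \<le> x \<Longrightarrow> g x = 0" using Cc_support[OF g] by blast
  obtain N :: nat where N: "R / e n \<le> real N" using real_arch_simple by blast
  hence N: "R \<le> e n * real N" using e_pos[of n] by (simp add: field_simps)
  have eq: "pairing n g t = (\<Sum>i<N. weight n t i * g (site n i))" for t
    unfolding pairing_def
  proof (rule suminf_finite)
    fix i assume "i \<notin> {..<N}"
    hence "e n * real N \<le> e n * real (i + 3)" using e_pos[of n] by (intro mult_left_mono) auto
    thus "weight n t i * g (site n i) = 0" using R N unfolding site_def by (simp del: of_nat_add)
  qed simp
  have "continuous_on {0..T} (\<lambda>t. \<Sum>i<N. weight n t i * g (site n i))"
    unfolding weight_def by (intro continuous_intros continuous_on_subset[OF S.c_continuous]) auto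
  hence "continuous_on {0..T} (pairing n g)" by (rule continuous_on_eq) (rule eq[symmetric])
  thus ?thesis by (rule continuous_imp_measurable_on_sets_lebesgue) auto
qed

lemma \<mu>_measurable:
  assumes g: "g \<in> Cc" shows "(\<lambda>t. \<integral>x. g x \<partial>\<mu> t) \<in> borel_measurable (lebesgue_on {0..T})"
  by (rule borel_measurable_LIMSEQ_real[where u = "\<lambda>k. pairing (r k) g"])
    (use pairing_conv[OF _ g] pairing_measurable[OF g] in \<open>auto simp: space_restrict_space\<close>)

text \<open>The integral against the step function differs from the sum over the atoms by the oscillation of
  \<open>g\<close> and by the term of the dimers.\<close>
lemma step_measure_conv:
  assumes t: "t \<in> {0..T}" and d: "(\<lambda>n. e n * cn n 2 t) \<longlonglongrightarrow> 0" and g: "g \<in> Cc"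
  shows "(\<lambda>k. \<integral>x. g x \<partial>step_measure (r k) t) \<longlonglongrightarrow> (\<integral>x. g x \<partial>\<mu> t)"
proof -
  obtain R where R: "0 < R" "\<And>x. R \<le> x \<Longrightarrow> g x = 0" using Cc_support[OF g] by blast
  obtain B where B: "0 < B" "\<And>x. 0 \<le> x \<Longrightarrow> \<bar>g x\<bar> \<le> B" using Cc_bounded[OF g] by blast
  define s where "s n = (\<Sum>i. e n * cn n (i + 2) t * g (e n * real (i + 2)))" for n
  have ss: "s n = e n * cn n 2 t * g (e n * 2) + pairing n g t" for n
  proof -
    have sm: "summable (\<lambda>i. e n * cn n (i + 2) t * g (e n * real (i + 2)))"
    proof (rule summable_comparison_test'[OF summable_mult[OF number_bounds(2)[OF t, of n], of B]])
      show "norm (e n * cn n (i + 2) t * g (e n * real (i + 2))) \<le> B * (e n * cn n (i + 2) t)" for i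
        using mult_left_mono[OF B(2)[of "e n * real (i+2)"], of "e n * cn n (i + 2) t"] number_bounds(1)[OF t, of n i] e_pos[of n]
        by (simp add: abs_mult mult_ac)
    qed
    from suminf_split_head[OF sm] show ?thesis by (simp add: s_def pairing_def weight_def site_def numeral_eq_Suc)
  qed
  have lim_s: "(\<lambda>k. s (r k)) \<longlonglongrightarrow> (\<integral>x. g x \<partial>\<mu> t)"
  proof -
    have "(\<lambda>n. e n * cn n 2 t * g (e n * 2)) \<longlonglongrightarrow> 0"
    proof (rule Lim_null_comparison)
      show "(\<lambda>n. e n * cn n 2 t * B) \<longlonglongrightarrow> 0" using tendsto_mult_left_zero[OF d] .
      show "\<forall>\<^sub>F n in sequentially. norm (e n * cn n 2 t * g (e n * 2)) \<le> e n * cn n 2 t * B"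
      proof (intro always_eventually allI)
        fix n
        have "0 \<le> e n * cn n 2 t" using number_bounds(1)[OF t, of n 0] e_pos[of n] by (simp add: numeral_2_eq_2)
        thus "norm (e n * cn n 2 t * g (e n * 2)) \<le> e n * cn n 2 t * B"
          using B(2)[of "e n * 2"] e_pos[of n] by (simp add: abs_mult[of "e n * cn n 2 t"] mult_left_mono)
      qed
    qed
    from LIMSEQ_subseq_LIMSEQ[OF this r] have "(\<lambda>k. e (r k) * cn (r k) 2 t * g (e (r k) * 2)) \<longlonglongrightarrow> 0" by (simp add: o_def)
    from tendsto_add[OF this pairing_conv[OF t g]] show ?thesis by (simp add: ss)
  qed
  have "(\<lambda>k. (\<integral>x. g x \<partial>step_measure (r k) t) - s (r k)) \<longlonglongrightarrow> 0"
  proof (rule LIMSEQ_I)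
    fix \<delta> :: real assume \<delta>: "0 < \<delta>"
    have "0 < \<delta> / (2 * M)" using \<delta> M by simp
    from Cc_uniform[OF g this] obtain d where dd: "0 < d"
      "\<And>x y. 0 \<le> x \<Longrightarrow> 0 \<le> y \<Longrightarrow> \<bar>x - y\<bar> < d \<Longrightarrow> \<bar>g x - g y\<bar> < \<delta> / (2 * M)" by blast
    obtain k0 where k0: "\<And>k. k \<ge> k0 \<Longrightarrow> norm (e (r k) - 0) < d" using LIMSEQ_D[OF e_r dd(1)] by blast
    have "norm ((\<integral>x. g x \<partial>step_measure (r k) t) - s (r k) - 0) < \<delta>" if "k \<ge> k0" for k
    proof -
      have ek: "e (r k) < d" using k0[OF that] by auto
      have "\<bar>(\<integral>x. g x \<partial>step_measure (r k) t) - s (r k)\<bar> \<le> \<delta> / (2 * M) * M"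
        unfolding step_measure_def s_def
      proof (rule step_integral_atoms[where R = R, OF e_pos _ g])
        show "0 \<le> cn (r k) i t" if "2 \<le> i" for i by (rule cn_nonneg[OF t that])
        show "\<bar>g x - g y\<bar> \<le> \<delta> / (2 * M)" if "0 \<le> x" "0 \<le> y" "\<bar>x - y\<bar> \<le> e (r k) / 2" for x y
          using dd(2)[OF that(1,2)] that(3) ek e_pos[of "r k"] by (intro less_imp_le) auto
      qed (use R e_le number_bounds(4)[OF t] in auto)
      also have "\<dots> < \<delta>" using M \<delta> by simp
      finally show ?thesis by simp
    qed
    thus "\<exists>k0. \<forall>k\<ge>k0. norm ((\<integral>x. g x \<partial>step_measure (r k) t) - s (r k) - 0) < \<delta>" by blast
  qed
  from tendsto_add[OF this lim_s] show ?thesis by simp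
qed

lemma weak_star_conv: "weak_star_Linf_Mf T (\<lambda>k. step_measure (r k)) \<mu>"
proof (rule weak_star_of_AE[where M = M])
  show "AE t in lebesgue_on {0..T}. \<forall>g\<in>Cc. (\<lambda>n. \<integral>x. g x \<partial>step_measure (r n) t) \<longlonglongrightarrow> (\<integral>x. g x \<partial>\<mu> t)"
    using dimers AE_space[of "lebesgue_on {0..T}"]
    by eventually_elim (use step_measure_conv in \<open>auto simp: space_restrict_space\<close>)
qed (use step_measure_Mf step_measure_measurable \<mu>_Mf \<mu>_le \<mu>_measurable in auto)

text \<open>The relation between \<open>u\<close> and the first moment of the atoms is exact up to the mass
  \<open>2 * \<epsilon>\<^sup>2 * c 2\<close> of the dimers, which is at most of order \<open>\<epsilon>\<close>.\<close>
lemma limit_mass: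
  assumes t: "t \<in> {0..T}"
  shows "integrable (\<mu> t) (\<lambda>x. x)" "u t + (\<integral>x. x \<partial>\<mu> t) = m"
proof -
  have tl: "\<exists>R. \<forall>n. (\<Sum>i. if R < site (r n) i then weight (r n) t i * site (r n) i else 0) \<le> \<delta>" if "0 < \<delta>" for \<delta>
    using tail[OF that] t unfolding site_def weight_def by blast
  note F = first_moment_limit[of "\<lambda>k. weight (r k) t" "\<lambda>k. site (r k)" M "\<mu> t", OF weights(1)[OF t] site_nonneg weights(4,5)[OF t] \<mu>_Mf[OF t] pairing_conv[OF t, unfolded pairing_def] tl]
  show "integrable (\<mu> t) (\<lambda>x. x)" by (rule F(1))
  have eq: "(\<Sum>i. weight n t i * site n i) = mn n - un n t - 2 * (e n * (e n * cn n 2 t))" for n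
  proof -
    interpret S: bd_system \<eta> "e n" "\<alpha>n n" "\<beta>n n" "an n" "bn n" "un n" "cn n" "mn n" Ka Kb by (rule sys)
    have t0: "0 \<le> t" using t by auto
    have "(\<Sum>i. (e n)\<^sup>2 * real (i + 2) * cn n (i + 2) t) = (e n)\<^sup>2 * 2 * cn n 2 t + (\<Sum>i. (e n)\<^sup>2 * real (i + 3) * cn n (i + 3) t)"
      using suminf_split_head[OF S.mass_summable[OF t0]] by (simp add: numeral_eq_Suc)
    moreover have "(\<Sum>i. (e n)\<^sup>2 * real (i + 3) * cn n (i + 3) t) = (\<Sum>i. weight n t i * site n i)"
      by (rule suminf_cong) (simp add: weight_def site_def power2_eq_square mult_ac)
    ultimately show ?thesis using S.mass_eq[OF t0] by (simp add: power2_eq_square)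
  qed
  have "(\<lambda>n. e n * (e n * cn n 2 t)) \<longlonglongrightarrow> 0"
  proof (rule Lim_null_comparison)
    show "(\<lambda>n. e n * M) \<longlonglongrightarrow> 0" using tendsto_mult_left_zero[OF e_lim] .
    show "\<forall>\<^sub>F n in sequentially. norm (e n * (e n * cn n 2 t)) \<le> e n * M"
    proof (intro always_eventually allI)
      fix n
      have "0 \<le> cn n 2 t" using number_bounds(1)[OF t, of n 0] by (simp add: numeral_2_eq_2)
      moreover have "e n * cn n 2 t \<le> M" using number_bounds(4)[OF t, where N = 1 and n = n] by (simp add: numeral_2_eq_2)
      ultimately show "norm (e n * (e n * cn n 2 t)) \<le> e n * M" using e_pos[of n] by (simp add: abs_mult)
    qed
  qed
  from LIMSEQ_subseq_LIMSEQ[OF this r] have 0: "(\<lambda>k. e (r k) * (e (r k) * cn (r k) 2 t)) \<longlonglongrightarrow> 0" by (simp add: o_def)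
  have 1: "(\<lambda>k. mn (r k)) \<longlonglongrightarrow> m" using LIMSEQ_subseq_LIMSEQ[OF m_lim r] by (simp add: o_def)
  have "(\<lambda>k. \<Sum>i. weight (r k) t i * site (r k) i) \<longlonglongrightarrow> m - u t - 2 * 0"
    unfolding eq by (intro tendsto_intros 0 1 u_conv t)
  from LIMSEQ_unique[OF this F(2)] show "u t + (\<integral>x. x \<partial>\<mu> t) = m" by simp
qed

lemma limit_u:
  shows "continuous_on {0..T} u" "\<And>t. t \<in> {0..T} \<Longrightarrow> 0 \<le> u t" "u 0 = uin" "\<rho> < (INF t\<in>{0..T}. u t)"
    "\<And>t. t \<in> {0..T} \<Longrightarrow> u t \<le> Mm"
proof -
  have lip: "\<bar>u t - u s\<bar> \<le> \<Lambda> * \<bar>t - s\<bar>" if "s \<in> {0..T}" "t \<in> {0..T}" for s t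
  proof (rule LIMSEQ_le_const2)
    show "(\<lambda>k. \<bar>un (r k) t - un (r k) s\<bar>) \<longlonglongrightarrow> \<bar>u t - u s\<bar>" by (intro tendsto_intros u_conv that)
  qed (use u_lip[OF that] in auto)
  show "continuous_on {0..T} u"
  proof (rule lipschitz_on_continuous_on)
    have "0 \<le> \<Lambda>"
    proof -
      have "0 \<le> \<Lambda> * \<bar>T - 0\<bar>" using u_lip[of 0 T 0] T by (intro order_trans[OF abs_ge_zero]) auto
      thus ?thesis using T by (simp add: zero_le_mult_iff)
    qed
    thus "\<Lambda>-lipschitz_on {0..T} u" unfolding lipschitz_on_def using lip by (auto simp: dist_real_def)
  qed
  fix t assume t: "t \<in> {0..T}"
  show "0 \<le> u t"
  proof (rule LIMSEQ_le_const[OF u_conv[OF t]], intro exI allI impI)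
    fix n
    interpret S: bd_system \<eta> "e (r n)" "\<alpha>n (r n)" "\<beta>n (r n)" "an (r n)" "bn (r n)" "un (r n)" "cn (r n)" "mn (r n)" Ka Kb by (rule sys)
    show "0 \<le> un (r n) t" using t by (intro S.u_nonneg) auto
  qed
  show "u t \<le> Mm"
  proof (rule LIMSEQ_le_const2[OF u_conv[OF t]], intro exI allI impI)
    fix n
    interpret S: bd_system \<eta> "e (r n)" "\<alpha>n (r n)" "\<beta>n (r n)" "an (r n)" "bn (r n)" "un (r n)" "cn (r n)" "mn (r n)" Ka Kb by (rule sys)
    show "un (r n) t \<le> Mm" using S.u_le[of t] mn_le[of "r n"] t by auto
  qed
next
  have "(\<lambda>k. un (r k) 0) \<longlonglongrightarrow> uin" using LIMSEQ_subseq_LIMSEQ[OF u_init r] by (simp add: o_def)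
  thus "u 0 = uin" using u_conv[of 0] T by (intro LIMSEQ_unique[of "\<lambda>k. un (r k) 0"]) auto
  have "v \<le> u t" if t: "t \<in> {0..T}" for t
    by (rule LIMSEQ_le_const[OF u_conv[OF t]]) (use u_low t in auto)
  hence "v \<le> (INF t\<in>{0..T}. u t)" using T by (intro cINF_greatest) auto
  with v show "\<rho> < (INF t\<in>{0..T}. u t)" by linarith
qed

end

context bd_limit begin

text \<open>On \<open>[0, T1]\<close>, where \<open>T1\<close> lies beyond the support in time, the weak form says that the integral
  of the transport sum is minus the initial term, up to a boundary term that the entry flux
  bounds. The transport sum converges at every time and is bounded.\<close>
theorem weak_equation:
  assumes test: "C1c_test T \<phi> \<phi>t \<phi>x"
  shows "(\<integral>t. (\<integral>x. \<phi>t (t, x) + (a x * u t - b x) * \<phi>x (t, x) \<partial>\<mu> t) \<partial>lebesgue_on {0..T}) + (\<integral>x. \<phi> (0, x) \<partial>\<mu>in) = 0"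
proof -
  obtain t1 R B where t1: "0 \<le> t1" "t1 < T" and R: "0 < R" and B: "0 < B"
    and zero: "\<And>t x. t \<in> {0..<T} \<Longrightarrow> 0 \<le> x \<Longrightarrow> t1 < t \<or> R \<le> x \<Longrightarrow> \<phi> (t, x) = 0 \<and> \<phi>t (t, x) = 0 \<and> \<phi>x (t, x) = 0"
    and dt: "\<And>t x. t \<in> {0..<T} \<Longrightarrow> 0 \<le> x \<Longrightarrow> ((\<lambda>t. \<phi> (t, x)) has_real_derivative \<phi>t (t, x)) (at t within {0..<T})"
    and dx: "\<And>t x. t \<in> {0..<T} \<Longrightarrow> 0 \<le> x \<Longrightarrow> ((\<lambda>x. \<phi> (t, x)) has_real_derivative \<phi>x (t, x)) (at x within {0..})"
    and bd: "\<And>t x. t \<in> {0..<T} \<Longrightarrow> 0 \<le> x \<Longrightarrow> \<bar>\<phi> (t, x)\<bar> \<le> B \<and> \<bar>\<phi>t (t, x)\<bar> \<le> B \<and> \<bar>\<phi>x (t, x)\<bar> \<le> B"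
    using C1c_test_facts[OF test T] by blast
  have ct: "continuous_on ({0..<T} \<times> {0..}) \<phi>t" and cx: "continuous_on ({0..<T} \<times> {0..}) \<phi>x"
    using test unfolding C1c_test_def Let_def by auto
  define T1 where "T1 = (t1 + T) / 2"
  have T1: "t1 < T1" "T1 < T" "0 \<le> T1" using t1 by (auto simp: T1_def)
  have in1: "t \<in> {0..<T}" "t \<in> {0..T}" if "t \<in> {0..T1}" for t using that T1 by auto
  define G where "G t x = \<phi>t (t, x) + (a x * u t - b x) * \<phi>x (t, x)" for t x
  have cslice: "continuous_on {0..} (\<lambda>x. h (t, x))" if "continuous_on ({0..<T} \<times> {0..}) h" "t \<in> {0..<T}" for h :: "real \<times> real \<Rightarrow> real" and t
    by (rule continuous_on_compose2[OF that(1)]) (use that(2) in \<open>auto intro!: continuous_intros\<close>)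
  have \<phi>xC: "(\<lambda>x. \<phi>x (t, x)) \<in> Cc" if "t \<in> {0..<T}" for t
    by (rule Cc_I[OF cslice[OF cx that], where R = R]) (use zero that R in auto)
  have \<phi>0C: "(\<lambda>x. \<phi> (0, x)) \<in> Cc"
  proof (rule Cc_I[where R = R])
    show "continuous_on {0..} (\<lambda>x. \<phi> (0, x))"
      by (rule DERIV_continuous_on[where D = "\<lambda>x. \<phi>x (0, x)"]) (use dx T in auto)
  qed (use zero T R in auto)
  have GC: "G t \<in> Cc" if "t \<in> {0..<T}" for t
  proof (rule Cc_I[where R = R])
    show "continuous_on {0..} (G t)" unfolding G_def[abs_def] by (intro continuous_intros a_cont b_cont cslice ct cx that)
  qed (use zero that R in \<open>auto simp: G_def\<close>)
  obtain Ca where Ca: "0 < Ca" "\<And>x. 0 \<le> x \<Longrightarrow> x \<le> R + 1 \<Longrightarrow> \<bar>a x\<bar> \<le> Ca" using continuous_bounded_on_Icc[OF a_cont] by blast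
  obtain Cb where Cb: "0 < Cb" "\<And>x. 0 \<le> x \<Longrightarrow> x \<le> R + 1 \<Longrightarrow> \<bar>b x\<bar> \<le> Cb" using continuous_bounded_on_Icc[OF b_cont] by blast
  have Mm: "0 \<le> Mm" using limit_u(2,5)[of 0] T by auto
  have G_bd: "\<bar>G t x\<bar> \<le> B + (Ca * Mm + Cb) * B" if t: "t \<in> {0..<T}" and x: "0 \<le> x" for t x
  proof (cases "R \<le> x")
    case True
    then show ?thesis using zero[OF t x] Ca Cb Mm B by (auto simp: G_def)
  next
    case False
    have "\<bar>a x * u t\<bar> \<le> Ca * Mm" unfolding abs_mult using Ca(2)[of x] limit_u(2,5)[of t] x False t Ca(1) by (intro mult_mono) auto
    hence "\<bar>a x * u t - b x\<bar> \<le> Ca * Mm + Cb" using Cb(2)[of x] x False by auto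
    hence "\<bar>(a x * u t - b x) * \<phi>x (t, x)\<bar> \<le> (Ca * Mm + Cb) * B"
      unfolding abs_mult using bd[OF t x] Ca Cb Mm by (intro mult_mono) auto
    thus ?thesis using bd[OF t x] unfolding G_def by linarith
  qed
  define I where "I t = (\<integral>x. G t x \<partial>\<mu> t)" for t
  have I_bd: "\<bar>I t\<bar> \<le> (B + (Ca * Mm + Cb) * B) * M" if t: "t \<in> {0..<T}" for t
    unfolding I_def by (rule Mf_integral_bound[OF \<mu>_Mf \<mu>_le GC]) (use G_bd t in auto)
  define tr where "tr n t i = e n * \<phi>t (t, e n * real i) + (\<phi> (t, e n * real (i + 1)) - \<phi> (t, e n * real i)) * an n i * un n t
     - (\<phi> (t, e n * real i) - \<phi> (t, e n * real (i - 1))) * bn n i" for n t i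
  define H where "H n t = (\<Sum>i. cn n (i + 3) t * tr n t (i + 3))" for n t
  define br where "br n t = \<phi> (t, 3 * e n) * (an n 2 * un n t * cn n 2 t) - \<phi> (t, 2 * e n) * (bn n 3 * cn n 3 t)" for n t
  have lip: "\<bar>\<phi> (t, x) - \<phi> (t, y)\<bar> \<le> B * \<bar>x - y\<bar>" if "t \<in> {0..<T}" "0 \<le> x" "0 \<le> y" for t x y
    using field_differentiable_bound[of "{0..}" "\<lambda>x. \<phi> (t, x)" "\<lambda>x. \<phi>x (t, x)" B x y] dx bd that by auto
  have transport_eq: "bd_system.transport (e n) (an n) (bn n) (un n) (\<lambda>t x. \<phi> (t, x)) (\<lambda>t x. \<phi>t (t, x)) t i = tr n t i" for n t i
  proof -
    interpret S: bd_system \<eta> "e n" "\<alpha>n n" "\<beta>n n" "an n" "bn n" "un n" "cn n" "mn n" Ka Kb by (rule sys)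
    show ?thesis unfolding S.transport_def tr_def ..
  qed
  have H_facts: "summable (\<lambda>i. cn n (i + 3) t * tr n t (i + 3))" "\<bar>H n t\<bar> \<le> B * (1 + Ka * Mm + Kb) * M" if t: "t \<in> {0..T1}" for n t
  proof -
    interpret S: bd_system \<eta> "e n" "\<alpha>n n" "\<beta>n n" "an n" "bn n" "un n" "cn n" "mn n" Ka Kb by (rule sys)
    have t0: "0 \<le> t" using t by auto
    have B0: "0 \<le> B" using B by simp
    have sm: "summable (\<lambda>i. cn n (i + 3) t * S.transport (\<lambda>t x. \<phi> (t, x)) (\<lambda>t x. \<phi>t (t, x)) t (i + 3))"
      by (rule S.transport_sum_bound(1)[OF t0 B0]) (use lip[OF in1(1)[OF t]] bd[OF in1(1)[OF t]] in auto)
    have le: "\<bar>\<Sum>i. cn n (i + 3) t * S.transport (\<lambda>t x. \<phi> (t, x)) (\<lambda>t x. \<phi>t (t, x)) t (i + 3)\<bar> \<le> B * (1 + Ka * mn n + Kb) * S.count_and_mass t"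
      by (rule S.transport_sum_bound(2)[OF t0 B0]) (use lip[OF in1(1)[OF t]] bd[OF in1(1)[OF t]] in auto)
    show "summable (\<lambda>i. cn n (i + 3) t * tr n t (i + 3))" using sm by (simp add: transport_eq)
    have "B * (1 + Ka * mn n + Kb) * S.count_and_mass t \<le> B * (1 + Ka * Mm + Kb) * M"
      using B0 S.Ka_nonneg S.Kb_nonneg S.m_nonneg mn_le[of n] Mm size[OF in1(2)[OF t], of n] S.count_and_mass_nonneg[OF t0] M
      by (intro mult_mono add_mono) auto
    with le show "\<bar>H n t\<bar> \<le> B * (1 + Ka * Mm + Kb) * M" by (simp add: H_def transport_eq)
  qed
  have H_int: "(H n has_integral (- pairing n (\<lambda>x. \<phi> (0, x)) 0 - integral {0..T1} (br n))) {0..T1}"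
    and br_le: "\<bar>integral {0..T1} (br n)\<bar> \<le> B * integral {0..T} (bd_system.entry_flux (an n) (bn n) (un n) (cn n))" for n
  proof -
    interpret S: bd_system \<eta> "e n" "\<alpha>n n" "\<beta>n n" "an n" "bn n" "un n" "cn n" "mn n" Ka Kb by (rule sys)
    have e0: "0 < e n" by (rule e_pos)
    have c\<phi>: "continuous_on {0..T1} (\<lambda>t. \<phi> (t, x))" if "0 \<le> x" for x
    proof -
      have "continuous_on {0..<T} (\<lambda>t. \<phi> (t, x))"
        by (rule DERIV_continuous_on[where D = "\<lambda>t. \<phi>t (t, x)"]) (use dt that in auto)
      thus ?thesis by (rule continuous_on_subset) (use T1 in auto)
    qed
    have "continuous_on {0..T1} (br n)"
      unfolding br_def[abs_def]
      by (intro continuous_intros c\<phi> continuous_on_subset[OF S.u_continuous] continuous_on_subset[OF S.c_continuous]) (use e0 in auto)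
    hence brI: "br n integrable_on {0..T1}" by (rule integrable_continuous_real)
    have brb: "\<bar>br n t\<bar> \<le> B * S.entry_flux t" if t: "t \<in> {0..T1}" for t
      unfolding br_def by (rule S.bracket_bound) (use t bd[OF in1(1)[OF t]] e0 in auto)
    have "norm (integral {0..T1} (br n)) \<le> integral {0..T1} (\<lambda>t. B * S.entry_flux t)"
      by (rule integral_norm_bound_integral[OF brI has_integral_integrable[OF
            has_integral_mult_right[OF integrable_integral[OF S.entry_flux_integrable[OF order_refl]]]]]) (use brb in auto)
    also have "\<dots> = B * integral {0..T1} S.entry_flux" by simp
    also have "\<dots> \<le> B * integral {0..T} S.entry_flux"
      using B T1 S.entry_flux_integrable S.entry_flux_nonneg by (intro mult_left_mono integral_subset_le) auto
    finally show "\<bar>integral {0..T1} (br n)\<bar> \<le> B * integral {0..T} S.entry_flux" by simp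
    have "((\<lambda>t. br n t + H n t) has_integral (S.atoms (\<lambda>x. \<phi> (T1, x)) T1 - S.atoms (\<lambda>x. \<phi> (0, x)) 0)) {0..T1}"
      unfolding br_def H_def transport_eq[symmetric]
    proof (rule S.weak_form_transport[where \<phi> = "\<lambda>t x. \<phi> (t, x)" and \<phi>' = "\<lambda>t x. \<phi>t (t, x)" and L = B])
      show "((\<lambda>t. \<phi> (t, x)) has_real_derivative \<phi>t (t, x)) (at t within {0..T1})" if "t \<in> {0..T1}" "0 \<le> x" for t x
        by (rule DERIV_subset[OF dt]) (use that T1 in auto)
    qed (use T1 B lip bd in1 in auto)
    moreover have "S.atoms (\<lambda>x. \<phi> (T1, x)) T1 = 0"
      unfolding pairing_atoms pairing_def using zero[of T1 "site n _"] T1 site_nonneg by simp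
    ultimately have "((\<lambda>t. br n t + H n t) has_integral - pairing n (\<lambda>x. \<phi> (0, x)) 0) {0..T1}" by (simp add: pairing_atoms)
    from has_integral_diff[OF this integrable_integral[OF brI]]
    show "(H n has_integral (- pairing n (\<lambda>x. \<phi> (0, x)) 0 - integral {0..T1} (br n))) {0..T1}" by simp
  qed
  have ptw: "(\<lambda>k. H (r k) t) \<longlonglongrightarrow> I t" if t: "t \<in> {0..T1}" for t
  proof -
    note tT = in1[OF t]
    have "(\<lambda>k. H (r k) t - pairing (r k) (G t) t) \<longlonglongrightarrow> 0"
    proof (rule LIMSEQ_I)
      fix \<delta> :: real assume \<delta>: "0 < \<delta>"
      define C0 where "C0 = (Ca + 1) * Mm + B * Mm + B * Ca + (Cb + 1) + B"
      have C0: "0 \<le> C0" unfolding C0_def using Ca Cb B Mm by auto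
      define \<delta>1 where "\<delta>1 = min 1 (\<delta> / (2 * M * (C0 + 1)))"
      have \<delta>1: "0 < \<delta>1" "\<delta>1 \<le> 1" "\<delta>1 * C0 * M \<le> \<delta> / 2"
      proof -
        show "0 < \<delta>1" "\<delta>1 \<le> 1" using \<delta> M C0 by (auto simp: \<delta>1_def)
        have "\<delta>1 * (C0 * M) \<le> \<delta> / (2 * M * (C0 + 1)) * ((C0 + 1) * M)"
          unfolding \<delta>1_def using \<delta> M C0 by (intro mult_mono) auto
        also have "\<dots> = \<delta> / 2" using M C0 by simp
        finally show "\<delta>1 * C0 * M \<le> \<delta> / 2" by (simp add: mult.assoc)
      qed
      obtain d where d: "0 < d" "\<And>x y. 0 \<le> x \<Longrightarrow> 0 \<le> y \<Longrightarrow> \<bar>x - y\<bar> < d \<Longrightarrow> \<bar>\<phi>x (t, x) - \<phi>x (t, y)\<bar> < \<delta>1"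
        using Cc_uniform[OF \<phi>xC[OF tT(1)] \<delta>1(1)] by blast
      have E1: "\<forall>\<^sub>F k in sequentially. e (r k) < d" using order_tendstoD(2)[OF e_r d(1)] .
      have E2: "\<forall>\<^sub>F k in sequentially. \<forall>i\<ge>3. e (r k) * real i \<le> R + 1 \<longrightarrow> \<bar>an (r k) i - a (e (r k) * real i)\<bar> < \<delta>1"
        by (rule eventually_subseq[OF r a_lim[OF \<delta>1(1)]])
      have E3: "\<forall>\<^sub>F k in sequentially. \<forall>i\<ge>3. e (r k) * real i \<le> R + 1 \<longrightarrow> \<bar>bn (r k) i - b (e (r k) * real i)\<bar> < \<delta>1"
        by (rule eventually_subseq[OF r b_lim[OF \<delta>1(1)]])
      have E4: "\<forall>\<^sub>F k in sequentially. \<bar>un (r k) t - u t\<bar> < \<delta>1"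
        using tendstoD[OF u_conv[OF tT(2)] \<delta>1(1)] by (simp add: dist_real_def)
      have "\<forall>\<^sub>F k in sequentially. norm (H (r k) t - pairing (r k) (G t) t - 0) < \<delta>"
        using E1 E2 E3 E4
      proof eventually_elim
        case (elim k)
        define n where "n = r k"
        have e0: "0 < e n" by (rule e_pos)
        interpret S: bd_system \<eta> "e n" "\<alpha>n n" "\<beta>n n" "an n" "bn n" "un n" "cn n" "mn n" Ka Kb by (rule sys)
        have tm: "\<bar>tr n t (i + 3) - e n * G t (site n i)\<bar> \<le> e n * (\<delta>1 * C0)" for i
        proof -
          define y where "y = site n i"
          have ye: "e n * real (i + 3) = y" "e n * real (i + 3 + 1) = y + e n" "e n * real (i + 3 - 1) = y - e n" "3 * e n \<le> y"
            using e0 by (auto simp: y_def site_def algebra_simps of_nat_diff)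
          have y0: "0 \<le> y" "0 \<le> y - e n" using ye(4) e0 by auto
          show ?thesis
          proof (cases "R + 1 \<le> y")
            case True
            have "R \<le> y - e n" using True e_le[of n] by simp
            hence "tr n t (i + 3) = 0" unfolding tr_def ye
              using zero[OF tT(1), of y] zero[OF tT(1), of "y - e n"] zero[OF tT(1), of "y + e n"] y0 e0 by auto
            moreover have "G t y = 0" using zero[OF tT(1) y0(1)] True by (simp add: G_def)
            ultimately show ?thesis using e0 \<delta>1 C0 by (simp add: y_def)
          next
            case False
            have "\<bar>an n (i + 3) - a y\<bar> < \<delta>1" "\<bar>bn n (i + 3) - b y\<bar> < \<delta>1"
              using elim(2)[rule_format, of "i+3"] elim(3)[rule_format, of "i+3"] ye(1) False by (auto simp: n_def)
            hence "\<bar>e n * \<phi>t (t, y) + (\<phi> (t, y + e n) - \<phi> (t, y)) * an n (i + 3) * un n t - (\<phi> (t, y) - \<phi> (t, y - e n)) * bn n (i + 3)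
               - e n * (\<phi>t (t, y) + (a y * u t - b y) * \<phi>x (t, y))\<bar> \<le> e n * (\<delta>1 * C0)"
              unfolding C0_def
            proof (intro generator_consistency[where g = "\<lambda>x. \<phi> (t, x)" and g' = "\<lambda>x. \<phi>x (t, x)" and U = Mm])
              show "\<bar>\<phi>x (t, z) - \<phi>x (t, y)\<bar> \<le> \<delta>1" if "0 \<le> z" "\<bar>z - y\<bar> \<le> e n" for z
                using d(2)[OF that(1) y0(1)] that(2) elim(1) by (auto simp: n_def)
              show "\<bar>un n t\<bar> \<le> Mm" using S.u_nonneg[of t] S.u_le[of t] mn_le[of n] t by auto
              show "\<bar>un n t - u t\<bar> \<le> \<delta>1" using elim(4) by (simp add: n_def)
            qed (use dx[OF tT(1)] e0 ye(4) \<delta>1 Ca(2)[of y] Cb(2)[of y] bd[OF tT(1) y0(1)] y0 False in auto)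
            thus ?thesis unfolding tr_def ye G_def y_def[symmetric] .
          qed
        qed
        have sG: "summable (\<lambda>i. weight n t i * G t (site n i))" by (rule pairing_bound(1)[OF tT(2) G_bd[OF tT(1)]])
        have "H n t - pairing n (G t) t = (\<Sum>i. cn n (i + 3) t * tr n t (i + 3) - weight n t i * G t (site n i))"
          unfolding H_def pairing_def by (rule suminf_diff[OF H_facts(1)[OF t] sG])
        also have "norm \<dots> \<le> (\<Sum>i. \<delta>1 * C0 * weight n t i)"
        proof (rule norm_suminf_le)
          fix i
          have c0: "0 \<le> cn n (i + 3) t" by (rule cn_nonneg[OF tT(2)]) simp
          have "cn n (i + 3) t * tr n t (i + 3) - weight n t i * G t (site n i) = cn n (i + 3) t * (tr n t (i + 3) - e n * G t (site n i))"
            by (simp add: weight_def algebra_simps)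
          hence "\<bar>cn n (i + 3) t * tr n t (i + 3) - weight n t i * G t (site n i)\<bar> = cn n (i + 3) t * \<bar>tr n t (i + 3) - e n * G t (site n i)\<bar>"
            using c0 by (simp only: abs_mult abs_of_nonneg)
          also have "\<dots> \<le> cn n (i + 3) t * (e n * (\<delta>1 * C0))" by (intro mult_left_mono tm c0)
          finally show "norm (cn n (i + 3) t * tr n t (i + 3) - weight n t i * G t (site n i)) \<le> \<delta>1 * C0 * weight n t i"
            by (simp add: weight_def mult_ac)
        qed (intro summable_mult weights tT)
        also have "\<dots> = \<delta>1 * C0 * (\<Sum>i. weight n t i)" by (intro suminf_mult weights tT)
        also have "\<dots> \<le> \<delta>1 * C0 * M" using \<delta>1 C0 by (intro mult_left_mono weights tT) auto
        also have "\<dots> \<le> \<delta> / 2" by (rule \<delta>1)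
        also have "\<dots> < \<delta>" using \<delta> by simp
        finally show ?case by (simp add: n_def)
      qed
      thus "\<exists>k0. \<forall>k\<ge>k0. norm (H (r k) t - pairing (r k) (G t) t - 0) < \<delta>" by (simp add: eventually_sequentially)
    qed
    from tendsto_add[OF this pairing_conv[OF tT(2) GC[OF tT(1)]]] show ?thesis by (simp add: I_def)
  qed
  have lim: "(\<lambda>k. integral {0..T1} (H (r k))) \<longlonglongrightarrow> - (\<integral>x. \<phi> (0, x) \<partial>\<mu>in)"
  proof -
    have 1: "(\<lambda>n. pairing n (\<lambda>x. \<phi> (0, x)) 0) \<longlonglongrightarrow> (\<integral>x. \<phi> (0, x) \<partial>\<mu>in)" using init[OF \<phi>0C] by (simp add: pairing_atoms)
    have 2: "(\<lambda>n. integral {0..T1} (br n)) \<longlonglongrightarrow> 0"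
      by (rule Lim_null_comparison[OF _ tendsto_mult_right_zero[OF entry, of B]]) (use br_le in auto)
    have "(\<lambda>n. - pairing n (\<lambda>x. \<phi> (0, x)) 0 - integral {0..T1} (br n)) \<longlonglongrightarrow> - (\<integral>x. \<phi> (0, x) \<partial>\<mu>in) - 0"
      by (intro tendsto_intros 1 2)
    from LIMSEQ_subseq_LIMSEQ[OF this r] show ?thesis by (simp add: o_def integral_unique[OF H_int])
  qed
  have I_int: "(I has_integral - (\<integral>x. \<phi> (0, x) \<partial>\<mu>in)) {0..T1}"
  proof -
    note DC = dominated_convergence[of "\<lambda>k. H (r k)" "{0..T1}" "\<lambda>_. B * (1 + Ka * Mm + Kb) * M" I]
    have "I integrable_on {0..T1}" "(\<lambda>k. integral {0..T1} (H (r k))) \<longlonglongrightarrow> integral {0..T1} I"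
      using DC H_int H_facts(2) ptw by (auto simp: integrable_on_def)
    with LIMSEQ_unique[OF lim this(2)] show ?thesis by (metis integrable_integral)
  qed
  \<comment> \<open>The value of the test function at time \<open>T\<close> is arbitrary, so the integrand is replaced there.\<close>
  define I' where "I' t = (if t < T then I t else 0)" for t
  have "(I' has_integral (- (\<integral>x. \<phi> (0, x) \<partial>\<mu>in) + 0)) {0..T}"
  proof (rule has_integral_combine[of 0 T1 T])
    show "(I' has_integral - (\<integral>x. \<phi> (0, x) \<partial>\<mu>in)) {0..T1}"
      by (rule has_integral_eq[OF _ I_int]) (use T1 in \<open>auto simp: I'_def\<close>)
    have "I' t = 0" if t: "t \<in> {T1..T}" for t
    proof (cases "t < T")
      case True
      have "I t = (\<integral>x. 0 \<partial>\<mu> t)" unfolding I_def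
      proof (rule Bochner_Integration.integral_cong[OF refl])
        fix x assume "x \<in> space (\<mu> t)"
        hence "0 \<le> x" using Mf_space[OF \<mu>_Mf, of t] t T1 by auto
        thus "G t x = 0" using zero[of t x] t T1 True by (simp add: G_def)
      qed
      thus ?thesis by (simp add: I'_def)
    qed (simp add: I'_def)
    thus "(I' has_integral 0) {T1..T}" by (rule has_integral_is_0)
  qed (use T1 in auto)
  hence I'_int: "(I' has_integral (- (\<integral>x. \<phi> (0, x) \<partial>\<mu>in))) {0..T}" by simp
  have "I' absolutely_integrable_on {0..T}"
  proof (rule absolutely_integrable_integrable_bound)
    show "norm (I' t) \<le> (B + (Ca * Mm + Cb) * B) * M" if "t \<in> {0..T}" for t
      using I_bd[of t] that B Ca Cb Mm M by (auto simp: I'_def)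
  qed (use I'_int in \<open>auto simp: integrable_on_def\<close>)
  hence I'_leb: "integrable (lebesgue_on {0..T}) I'" by (simp add: integrable_restrict_space set_integrable_def)
  have AE: "AE t in lebesgue_on {0..T}. I' t = I t"
  proof -
    have "AE t in lebesgue. t \<noteq> T" using AE_completion[OF AE_lborel_singleton[of T]] .
    hence "AE t in lebesgue_on {0..T}. t \<noteq> T" by (auto simp: AE_restrict_space_iff elim: eventually_mono)
    thus ?thesis using AE_space[of "lebesgue_on {0..T}"]
      by eventually_elim (auto simp: I'_def space_restrict_space)
  qed
  have m1: "I' \<in> borel_measurable (lebesgue_on {0..T})" using I'_leb by auto
  have m2: "I \<in> borel_measurable (lebesgue_on {0..T})"
    by (rule borel_measurable_AE_lebesgue_on[OF _ m1 AE]) simp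
  have "(\<integral>t. I t \<partial>lebesgue_on {0..T}) = (\<integral>t. I' t \<partial>lebesgue_on {0..T})"
    by (rule integral_cong_AE[OF m2 m1]) (use AE in auto)
  also have "\<dots> = integral {0..T} I'" by (rule lebesgue_integral_eq_integral[OF I'_leb]) simp
  also have "\<dots> = - (\<integral>x. \<phi> (0, x) \<partial>\<mu>in)" by (rule integral_unique[OF I'_int])
  finally show ?thesis unfolding I_def G_def by simp
qed

lemma N_solution_limit: "N_solution a b \<rho> uin \<mu>in m T (\<lambda>u. 0) \<mu>"
  unfolding N_solution_def
proof (intro conjI exI[of _ u] exI[of _ \<mu>] allI impI ballI)
  show "(\<lambda>u. 0) \<in> Linf_loc" by (auto simp: Linf_loc_def intro!: exI[of _ 0])
  show "\<mu> \<in> Linf_Mf T" unfolding Linf_Mf_def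
    using \<mu>_Mf \<mu>_measurable \<mu>_le by (auto intro!: exI[of _ M] AE_I2 simp: space_restrict_space)
  fix \<phi> \<phi>t \<phi>x assume "C1c_test T \<phi> \<phi>t \<phi>x"
  from weak_equation[OF this]
  show "(\<integral>t. (\<integral>x. \<phi>t (t, x) + (a x * u t - b x) * \<phi>x (t, x) \<partial>\<mu> t) \<partial>lebesgue_on {0..T}) + (\<integral>x. \<phi> (0, x) \<partial>\<mu>in)
     + (\<integral>s. \<phi> (s, 0) * 0 \<partial>lebesgue_on {0..T}) = 0" by simp
qed (use T limit_u limit_mass \<mu>_Mf in auto)

end

theorem (in bd_sequence) limit_solution_exists:
  "\<exists>r \<mu>. strict_mono r \<and> N_solution a b \<rho> uin \<mu>in m T (\<lambda>u. 0) \<mu> \<and>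
     weak_star_Linf_Mf T (\<lambda>k t. density_measure (step_fun 2 (e (r k)) (\<lambda>i. cn (r k) i t))) \<mu>"
proof -
  obtain r where r: "strict_mono r" and cu: "\<And>t. t \<in> {0..T} \<Longrightarrow> convergent (\<lambda>k. un (r k) t)"
    and cA: "\<And>t k l. t \<in> {0..T} \<Longrightarrow> convergent (\<lambda>j. pairing (r j) (expfam k l) t)" using convergent_subsequence by blast
  have "\<forall>t\<in>{0..T}. \<exists>\<mu>. \<mu> \<in> Mf \<and> measure \<mu> {0..} \<le> M \<and> (\<forall>g\<in>Cc. (\<lambda>j. pairing (r j) g t) \<longlonglongrightarrow> (\<integral>x. g x \<partial>\<mu>))"
    by (intro ballI limit_measure cA)
  from bchoice[OF this] obtain \<mu> where \<mu>: "\<forall>t\<in>{0..T}. \<mu> t \<in> Mf \<and> measure (\<mu> t) {0..} \<le> M \<and> (\<forall>g\<in>Cc. (\<lambda>j. pairing (r j) g t) \<longlonglongrightarrow> (\<integral>x. g x \<partial>\<mu> t))" ..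
  define u where "u t = lim (\<lambda>k. un (r k) t)" for t
  interpret L: bd_limit \<eta> Ka Kb T M Mm \<Lambda> m uin v \<rho> e \<alpha>n \<beta>n mn an bn un cn a b \<mu>in r \<mu> u
    by unfold_locales (simp_all add: r \<mu> u_def cu convergent_LIMSEQ_iff[symmetric])
  show ?thesis using r L.N_solution_limit L.weak_star_conv[unfolded L.step_measure_def] by (intro exI conjI)
qed

section \<open>The rates at small sizes\<close>

text \<open>The filter lets \<open>\<epsilon> * i\<close> tend to zero with \<open>i\<close> unrestricted, so eventual statements hold for all
  pairs with \<open>\<epsilon> * i\<close> below a single threshold.\<close>
lemma eventually_small_size:
  assumes "eventually P (small_size k)"
  obtains d where "0 < d" "\<And>\<epsilon> i. 0 < \<epsilon> \<Longrightarrow> k \<le> i \<Longrightarrow> \<epsilon> * real i < d \<Longrightarrow> P (\<epsilon>, i)"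
proof -
  have "eventually (\<lambda>p. p \<in> {0<..} \<times> {k..} \<longrightarrow> P p) (filtercomap (\<lambda>(\<epsilon>, i). \<epsilon> * real i) (nhds 0))"
    using assms by (simp add: small_size_def eventually_inf_principal)
  then obtain Q where Q: "eventually Q (nhds (0::real))"
    and PQ: "\<And>p. Q (case p of (\<epsilon>, i) \<Rightarrow> \<epsilon> * real i) \<Longrightarrow> p \<in> {0<..} \<times> {k..} \<longrightarrow> P p"
    unfolding eventually_filtercomap by blast
  obtain d where d: "0 < d" "\<And>x. dist x 0 < d \<Longrightarrow> Q x" using Q unfolding eventually_nhds_metric by blast
  show ?thesis
  proof (rule that[OF d(1)])
    fix \<epsilon> :: real and i :: nat assume "0 < \<epsilon>" "k \<le> i" "\<epsilon> * real i < d"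
    moreover have "Q (\<epsilon> * real i)" using calculation by (intro d(2)) (simp add: dist_real_def)
    ultimately show "P (\<epsilon>, i)" using PQ[of "(\<epsilon>, i)"] by simp
  qed
qed

lemma small_size_bound:
  assumes "(\<lambda>(\<epsilon>, i). g \<epsilon> (\<epsilon> * real i) - h (\<epsilon> * real i)) \<in> o[small_size k](\<lambda>(\<epsilon>, i). (\<epsilon> * real i) powr r)" and "0 < (\<delta>::real)"
  obtains d where "0 < d" "\<And>\<epsilon> i. 0 < \<epsilon> \<Longrightarrow> k \<le> i \<Longrightarrow> \<epsilon> * real i < d \<Longrightarrow> \<bar>g \<epsilon> (\<epsilon> * real i) - h (\<epsilon> * real i)\<bar> \<le> \<delta> * (\<epsilon> * real i) powr r"
proof -
  have "eventually (\<lambda>p. norm ((\<lambda>(\<epsilon>, i). g \<epsilon> (\<epsilon> * real i) - h (\<epsilon> * real i)) p) \<le> \<delta> * norm ((\<lambda>(\<epsilon>, i). (\<epsilon> * real i) powr r) p)) (small_size k)"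
    by (rule landau_o.smallD[OF assms])
  from eventually_small_size[OF this] obtain d where d: "0 < d"
    "\<And>\<epsilon> i. 0 < \<epsilon> \<Longrightarrow> k \<le> i \<Longrightarrow> \<epsilon> * real i < d \<Longrightarrow> norm ((\<lambda>(\<epsilon>, i). g \<epsilon> (\<epsilon> * real i) - h (\<epsilon> * real i)) (\<epsilon>, i)) \<le> \<delta> * norm ((\<lambda>(\<epsilon>, i). (\<epsilon> * real i) powr r) (\<epsilon>, i))"
    by blast
  show ?thesis by (rule that[OF d(1)]) (use d(2) in auto)
qed

lemma asymp_power_bounds:
  fixes a :: "real \<Rightarrow> real"
  assumes "a \<sim>[at_right 0] (\<lambda>x. A * x powr r)" and A: "0 < A"
  obtains d where "0 < d" "\<And>x. 0 < x \<Longrightarrow> x < d \<Longrightarrow> A / 2 * x powr r \<le> a x \<and> a x \<le> 2 * A * x powr r"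
proof -
  have "((\<lambda>x. a x / (A * x powr r)) \<longlongrightarrow> 1) (at_right 0)"
  proof (rule asymp_equivD_strong[OF assms(1)])
    show "\<forall>\<^sub>F x in at_right 0. a x \<noteq> 0 \<or> A * x powr r \<noteq> 0"
      using A by (auto simp: eventually_at_right_field intro!: exI[of _ 1])
  qed
  hence "\<forall>\<^sub>F x in at_right 0. a x / (A * x powr r) > 1/2 \<and> a x / (A * x powr r) < 2"
    by (intro eventually_conj order_tendstoD[where y = 1]) auto
  then obtain d where d: "0 < d" "\<And>x. 0 < x \<Longrightarrow> x < d \<Longrightarrow> a x / (A * x powr r) > 1/2 \<and> a x / (A * x powr r) < 2"
    unfolding eventually_at_right_field by auto
  show ?thesis
  proof (rule that[OF d(1)])
    fix x :: real assume x: "0 < x" "x < d"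
    have p: "0 < A * x powr r" using x A by simp
    show "A / 2 * x powr r \<le> a x \<and> a x \<le> 2 * A * x powr r" using d(2)[OF x] p by (simp add: field_simps)
  qed
qed

text \<open>The ratio of the limit rates is below \<open>(\<rho> + \<rho>') / 2\<close> near zero. The errors of the discrete rates are
  small multiples of \<open>x powr ra\<close>, because \<open>rb \<ge> ra\<close>, and hence of \<open>a x\<close>.\<close>
lemma rate_ratio_bound:
  fixes a b :: "real \<Rightarrow> real"
  assumes a_pos: "\<And>x. x > 0 \<Longrightarrow> a x > 0" and abar: "0 < abar" and r: "ra \<le> rb" and rho: "((\<lambda>x. b x / a x) \<longlongrightarrow> \<rho>) (at_right 0)"
    and rho0: "0 \<le> \<rho>" and rr: "\<rho> < \<rho>'"
    and equiv: "a \<sim>[at_right 0] (\<lambda>x. abar * x powr ra)"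
    and small_a: "(\<lambda>(\<epsilon>, i). ga \<epsilon> (\<epsilon> * real i) - a (\<epsilon> * real i)) \<in> o[small_size 2](\<lambda>(\<epsilon>, i). (\<epsilon> * real i) powr ra)"
    and small_b: "(\<lambda>(\<epsilon>, i). gb \<epsilon> (\<epsilon> * real i) - b (\<epsilon> * real i)) \<in> o[small_size 3](\<lambda>(\<epsilon>, i). (\<epsilon> * real i) powr rb)"
  obtains x0 where "0 < x0" "\<And>\<epsilon> i. 0 < \<epsilon> \<Longrightarrow> 3 \<le> i \<Longrightarrow> \<epsilon> * real i \<le> x0 \<Longrightarrow> gb \<epsilon> (\<epsilon> * real i) \<le> \<rho>' * ga \<epsilon> (\<epsilon> * real i)"
proof -
  define s where "s = (\<rho> + \<rho>') / 2"
  have s: "\<rho> < s" "s < \<rho>'" using rr by (auto simp: s_def)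
  define \<delta> where "\<delta> = (\<rho>' - s) * abar / (2 * (1 + \<rho>'))"
  have \<rho>': "0 < 1 + \<rho>'" using rho0 rr by simp
  have \<delta>: "0 < \<delta>" unfolding \<delta>_def using s \<rho>' abar by (intro divide_pos_pos mult_pos_pos) auto
  have \<delta>eq: "\<delta> * (1 + \<rho>') = (\<rho>' - s) * (abar / 2)" unfolding \<delta>_def using \<rho>' by (simp add: field_simps)
  obtain d1 where d1: "0 < d1" "\<And>x. 0 < x \<Longrightarrow> x < d1 \<Longrightarrow> abar / 2 * x powr ra \<le> a x \<and> a x \<le> 2 * abar * x powr ra"
    using asymp_power_bounds[OF equiv abar] by blast
  obtain d2 where d2: "0 < d2" "\<And>\<epsilon> i. 0 < \<epsilon> \<Longrightarrow> 2 \<le> i \<Longrightarrow> \<epsilon> * real i < d2 \<Longrightarrow> \<bar>ga \<epsilon> (\<epsilon> * real i) - a (\<epsilon> * real i)\<bar> \<le> \<delta> * (\<epsilon> * real i) powr ra"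
    using small_size_bound[OF small_a \<delta>] by blast
  obtain d3 where d3: "0 < d3" "\<And>\<epsilon> i. 0 < \<epsilon> \<Longrightarrow> 3 \<le> i \<Longrightarrow> \<epsilon> * real i < d3 \<Longrightarrow> \<bar>gb \<epsilon> (\<epsilon> * real i) - b (\<epsilon> * real i)\<bar> \<le> \<delta> * (\<epsilon> * real i) powr rb"
    using small_size_bound[OF small_b \<delta>] by blast
  have "\<forall>\<^sub>F x in at_right 0. b x / a x < s" by (rule order_tendstoD(2)[OF rho s(1)])
  then obtain d4 where d4: "0 < d4" "\<And>x. 0 < x \<Longrightarrow> x < d4 \<Longrightarrow> b x / a x < s" unfolding eventually_at_right_field by auto
  define x0 where "x0 = Min {d1, d2, d3, d4, 1} / 2"
  have x0: "0 < x0" "x0 < d1" "x0 < d2" "x0 < d3" "x0 < d4" "x0 < 1" using d1 d2 d3 d4 by (auto simp: x0_def min_def)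
  show ?thesis
  proof (rule that[OF x0(1)])
    fix \<epsilon> :: real and i :: nat assume e: "0 < \<epsilon>" and i: "3 \<le> i" and le: "\<epsilon> * real i \<le> x0"
    define x where "x = \<epsilon> * real i"
    have x: "0 < x" "x < d1" "x < d2" "x < d3" "x < d4" "x < 1" using e i le x0 by (auto simp: x_def)
    have A: "abar / 2 * x powr ra \<le> a x" using d1(2) x by auto
    have B: "b x \<le> s * a x" using d4(2)[OF x(1,5)] a_pos[OF x(1)] by (simp add: field_simps)
    have "x powr rb \<le> x powr ra" using x r by (intro powr_mono') auto
    hence "\<delta> * x powr rb \<le> \<delta> * x powr ra" using \<delta> by simp
    hence 1: "gb \<epsilon> x \<le> s * a x + \<delta> * x powr ra" using d3(2)[OF e i] x(4) B unfolding x_def[symmetric] by linarith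
    have "a x - \<delta> * x powr ra \<le> ga \<epsilon> x" using d2(2)[OF e, of i] i x(3) unfolding x_def[symmetric] by linarith
    hence 2: "\<rho>' * (a x - \<delta> * x powr ra) \<le> \<rho>' * ga \<epsilon> x" using rho0 rr by (intro mult_left_mono) auto
    have "\<delta> * (1 + \<rho>') * x powr ra = (\<rho>' - s) * (abar / 2 * x powr ra)" unfolding \<delta>eq by simp
    also have "\<dots> \<le> (\<rho>' - s) * a x" using A s by (intro mult_left_mono) auto
    finally have "s * a x + \<delta> * x powr ra \<le> \<rho>' * (a x - \<delta> * x powr ra)" by (simp add: algebra_simps)
    with 1 2 show "gb \<epsilon> (\<epsilon> * real i) \<le> \<rho>' * ga \<epsilon> (\<epsilon> * real i)" unfolding x_def[symmetric] by linarith
  qed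
qed

section \<open>Convex weights of superlinear growth\<close>

lemma U_class_mono:
  assumes \<Phi>: "\<Phi> \<in> U_class" and xy: "0 \<le> x" "x \<le> y" shows "\<Phi> x \<le> \<Phi> y"
proof (cases "y = 0")
  case True then show ?thesis using xy by simp
next
  case False
  hence y: "0 < y" using xy by simp
  have c: "convex_on {0..} \<Phi>" and z: "\<Phi> 0 = 0" and p: "0 \<le> \<Phi> y" using \<Phi> y by (auto simp: U_class_def)
  have "\<Phi> ((1 - x / y) *\<^sub>R 0 + (x / y) *\<^sub>R y) \<le> (1 - x / y) * \<Phi> 0 + (x / y) * \<Phi> y"
    by (rule convex_onD[OF c]) (use xy y in auto)
  hence "\<Phi> x \<le> (x / y) * \<Phi> y" using y z by simp
  also have "\<dots> \<le> 1 * \<Phi> y" using xy y p by (intro mult_right_mono) auto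
  finally show ?thesis by simp
qed

lemma U_class_superlinear:
  assumes \<Phi>: "\<Phi> \<in> U_class" obtains R where "1 \<le> R" "\<And>x. R \<le> x \<Longrightarrow> K * x \<le> \<Phi> x"
proof -
  have "filterlim (\<lambda>x. \<Phi> x / x) at_top at_top" using \<Phi> by (simp add: U_class_def)
  hence "\<forall>\<^sub>F x in at_top. K \<le> \<Phi> x / x" by (simp add: filterlim_at_top)
  then obtain R where R: "\<And>x. R \<le> x \<Longrightarrow> K \<le> \<Phi> x / x" unfolding eventually_at_top_linorder by blast
  show ?thesis
  proof (rule that[of "max 1 R"])
    fix x assume x: "max 1 R \<le> x"
    hence "0 < x" by simp
    thus "K * x \<le> \<Phi> x" using R[of x] x by (simp add: field_simps)
  qed simp
qed

text \<open>Concavity of the derivative, with a nonnegative value at zero, makes it at most doubled when its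
  argument is doubled. This gives \<open>y * \<Phi>' y \<le> 4 * \<Phi> y\<close>, and it allows the derivative at \<open>y\<close>
  to bound the increment up to \<open>y + h\<close>.\<close>
lemma U_class_increment:
  assumes \<Phi>: "\<Phi> \<in> U_class"
  obtains C where "0 \<le> C" "\<And>y h. 0 < h \<Longrightarrow> 2 * h \<le> y \<Longrightarrow> (\<Phi> (y + h) - \<Phi> y) * (1 + y) \<le> C * h * (1 + \<Phi> y)"
proof -
  obtain \<Phi>' where der: "\<And>x. 0 \<le> x \<Longrightarrow> (\<Phi> has_real_derivative \<Phi>' x) (at x within {0..})"
    and cont: "continuous_on {0..} \<Phi>'" and conc: "concave_on {0..} \<Phi>'" and z: "0 \<le> \<Phi>' 0"
    and \<Phi>0: "\<And>x. 0 \<le> x \<Longrightarrow> 0 \<le> \<Phi> x"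
    using \<Phi> unfolding U_class_def by blast
  have scale: "(x / y) * \<Phi>' y \<le> \<Phi>' x" if "0 \<le> x" "x \<le> y" "0 < y" for x y
  proof -
    have "convex_on {0..} (\<lambda>x. - \<Phi>' x)" using conc by (simp add: concave_on_def)
    from convex_onD[OF this, of "x / y" 0 y] that
    have "- \<Phi>' x \<le> (1 - x / y) * - \<Phi>' 0 + (x / y) * - \<Phi>' y" by simp
    moreover have "0 \<le> (1 - x / y) * \<Phi>' 0" using that z by (intro mult_nonneg_nonneg) auto
    ultimately show ?thesis by simp
  qed
  have mvt: "\<exists>\<xi>. x < \<xi> \<and> \<xi> < y \<and> \<Phi> y - \<Phi> x = (y - x) * \<Phi>' \<xi>" if "0 \<le> x" "x < y" for x y
  proof -
    have "\<exists>\<xi>\<in>{x<..<y}. \<Phi> y - \<Phi> x = (*) (\<Phi>' \<xi>) (y - x)"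
    proof (rule mvt_simple[OF that(2)])
      show "(\<Phi> has_derivative (*) (\<Phi>' \<xi>)) (at \<xi> within {x..y})" if "x \<le> \<xi>" "\<xi> \<le> y" for \<xi>
        using DERIV_subset[OF der, of \<xi> "{x..y}"] that \<open>0 \<le> x\<close> by (auto simp: has_field_derivative_def)
    qed
    thus ?thesis by (auto simp: mult.commute)
  qed
  obtain D where D: "0 < D" "\<And>x. 0 \<le> x \<Longrightarrow> x \<le> 1 \<Longrightarrow> \<bar>\<Phi>' x\<bar> \<le> D" using continuous_bounded_on_Icc[OF cont] by blast
  have half: "y * \<Phi>' y \<le> 4 * \<Phi> y" if y: "0 < y" for y
  proof -
    obtain \<xi> where \<xi>: "y / 2 < \<xi>" "\<xi> < y" "\<Phi> y - \<Phi> (y / 2) = (y - y / 2) * \<Phi>' \<xi>" using mvt[of "y/2" y] y by auto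
    have p: "0 \<le> \<Phi> (y / 2)" "0 \<le> \<Phi> y" using \<Phi>0 y by auto
    show ?thesis
    proof (cases "0 \<le> \<Phi>' y")
      case True
      have "1 / 2 * \<Phi>' y \<le> (\<xi> / y) * \<Phi>' y" using True \<xi> y by (intro mult_right_mono) (auto simp: field_simps)
      also have "\<dots> \<le> \<Phi>' \<xi>" using \<xi> y by (intro scale) auto
      finally have "(y / 2) * (1 / 2 * \<Phi>' y) \<le> (y / 2) * \<Phi>' \<xi>" using y by (intro mult_left_mono) auto
      thus ?thesis using \<xi>(3) p by simp
    next
      case False
      hence "y * \<Phi>' y \<le> 0" using y by (intro mult_nonneg_nonpos) auto
      thus ?thesis using p by simp
    qed
  qed
  have growth: "(1 + y) * max 0 (\<Phi>' y) \<le> 8 * \<Phi> y + 2 * D" if y: "0 < y" for y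
  proof (cases "0 \<le> \<Phi>' y")
    case True
    show ?thesis
    proof (cases "y \<le> 1")
      case le: True
      have "(1 + y) * \<Phi>' y \<le> 2 * D" using D(2)[of y] le y True by (intro mult_mono) auto
      thus ?thesis using True \<Phi>0[of y] y by (simp add: max_def)
    next
      case False
      hence "(1 + y) * \<Phi>' y \<le> (2 * y) * \<Phi>' y" using True by (intro mult_right_mono) auto
      thus ?thesis using half[OF y] True D by (simp add: max_def)
    qed
  next
    case False
    then show ?thesis using \<Phi>0[of y] y D by (simp add: max_def)
  qed
  show ?thesis
  proof (rule that[of "12 + 3 * D"])
    fix y h :: real assume h: "0 < h" and y: "2 * h \<le> y"
    have y0: "0 < y" using h y by simp
    obtain \<xi> where \<xi>: "y < \<xi>" "\<xi> < y + h" "\<Phi> (y + h) - \<Phi> y = (y + h - y) * \<Phi>' \<xi>" using mvt[of y "y + h"] y0 h by auto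
    have "(y / \<xi>) * \<Phi>' \<xi> \<le> \<Phi>' y" using \<xi> y0 by (intro scale) auto
    hence "\<Phi>' \<xi> \<le> (\<xi> / y) * \<Phi>' y" using \<xi> y0 by (simp add: field_simps)
    also have "\<dots> \<le> (\<xi> / y) * max 0 (\<Phi>' y)" using \<xi> y0 by (intro mult_left_mono) auto
    also have "\<dots> \<le> (3 / 2) * max 0 (\<Phi>' y)" using \<xi> y y0 by (intro mult_right_mono) (auto simp: field_simps)
    finally have "\<Phi> (y + h) - \<Phi> y \<le> h * ((3 / 2) * max 0 (\<Phi>' y))" unfolding \<xi>(3) using h by simp
    hence "(\<Phi> (y + h) - \<Phi> y) * (1 + y) \<le> h * ((3 / 2) * max 0 (\<Phi>' y)) * (1 + y)" using y0 by (intro mult_right_mono) auto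
    also have "\<dots> = (3 / 2) * h * ((1 + y) * max 0 (\<Phi>' y))" by (simp only: mult_ac)
    also have "\<dots> \<le> (3 / 2) * h * (8 * \<Phi> y + 2 * D)" using h by (intro mult_left_mono growth y0) auto
    also have "\<dots> \<le> (12 + 3 * D) * h * (1 + \<Phi> y)"
    proof -
      have "0 \<le> D * \<Phi> y" using D \<Phi>0[of y] y0 by auto
      hence "(3 / 2) * (8 * \<Phi> y + 2 * D) \<le> (12 + 3 * D) * (1 + \<Phi> y)" by (simp add: algebra_simps)
      from mult_left_mono[OF this, of h] h show ?thesis by (simp add: mult_ac)
    qed
    finally show "(\<Phi> (y + h) - \<Phi> y) * (1 + y) \<le> (12 + 3 * D) * h * (1 + \<Phi> y)" .
  qed (use D in auto)
qed

section \<open>Bounds on the initial data\<close>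

text \<open>A weight in \<open>U_class\<close> is nondecreasing, so on the right half of each cell it is at least its
  value at the node.\<close>
lemma step_fun_weighted_sum_le:
  assumes e: "0 < \<epsilon>" and c: "\<And>i. 2 \<le> i \<Longrightarrow> 0 \<le> c i" and \<Phi>: "\<Phi> \<in> U_class"
    and S: "(\<integral>\<^sup>+x\<in>{0..}. ennreal (\<Phi> x * step_fun 2 \<epsilon> c x) \<partial>lborel) \<le> ennreal S" and S0: "0 \<le> S"
  shows "(\<Sum>i<N. \<epsilon> * \<Phi> (\<epsilon> * real (i + 2)) * c (i + 2)) \<le> 2 * S"
proof -
  have \<Phi>0: "0 \<le> \<Phi> x" if "0 \<le> x" for x using \<Phi> that by (simp add: U_class_def)
  define h where "h i = {\<epsilon> * real (i + 2) ..< \<epsilon> * real (i + 2) + \<epsilon> / 2}" for i :: nat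
  define k where "k i = \<Phi> (\<epsilon> * real (i + 2)) * c (i + 2)" for i
  have nn: "0 \<le> \<epsilon> * real j" for j using e by simp
  have k0: "0 \<le> k i" for i unfolding k_def by (intro mult_nonneg_nonneg \<Phi>0 nn c) simp
  have sub: "x \<in> cell \<epsilon> (i + 2)" if "x \<in> h i" for x i using that e by (auto simp: h_def cell_def algebra_simps)
  have "ennreal (\<Sum>i<N. k i * (\<epsilon> / 2)) = (\<Sum>i<N. ennreal (k i) * ennreal (\<epsilon> / 2))"
  proof -
    have "ennreal (\<Sum>i<N. k i * (\<epsilon> / 2)) = (\<Sum>i<N. ennreal (k i * (\<epsilon> / 2)))"
      by (rule sum_ennreal[symmetric]) (use k0 e in simp)
    also have "\<dots> = (\<Sum>i<N. ennreal (k i) * ennreal (\<epsilon> / 2))"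
      by (intro sum.cong refl ennreal_mult) (use k0 e in auto)
    finally show ?thesis .
  qed
  also have "\<dots> = (\<Sum>i<N. \<integral>\<^sup>+x. ennreal (k i) * indicator (h i) x \<partial>lborel)"
  proof (rule sum.cong[OF refl])
    fix i
    have "emeasure lborel (h i) = ennreal (\<epsilon> / 2)" using e by (simp add: h_def)
    thus "ennreal (k i) * ennreal (\<epsilon> / 2) = (\<integral>\<^sup>+x. ennreal (k i) * indicator (h i) x \<partial>lborel)"
      by (subst nn_integral_cmult_indicator) (auto simp: h_def)
  qed
  also have "\<dots> = (\<integral>\<^sup>+x. (\<Sum>i<N. ennreal (k i) * indicator (h i) x) \<partial>lborel)"
    by (rule nn_integral_sum[symmetric]) (auto simp: h_def)
  also have "\<dots> \<le> (\<integral>\<^sup>+x. ennreal (\<Phi> x * step_fun 2 \<epsilon> c x) * indicator {0..} x \<partial>lborel)"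
  proof (rule nn_integral_mono)
    fix x :: real
    show "(\<Sum>i<N. ennreal (k i) * indicator (h i) x) \<le> ennreal (\<Phi> x * step_fun 2 \<epsilon> c x) * indicator {0..} x"
    proof (cases "0 \<le> x")
      case True
      have "(\<Sum>i<N. ennreal (k i) * indicator (h i) x) = ennreal (\<Sum>i<N. k i * indicat_real (h i) x)"
        using k0 by (subst sum_ennreal[symmetric]) (auto simp: indicator_def)
      also have "\<dots> \<le> ennreal (\<Phi> x * step_fun 2 \<epsilon> c x)"
      proof (rule ennreal_leI)
        have "(\<Sum>i<N. k i * indicat_real (h i) x) \<le> (\<Sum>i<N. \<Phi> x * (c (i + 2) * indicat_real (cell \<epsilon> (i + 2)) x))"
        proof (rule sum_mono)
          fix i
          show "k i * indicat_real (h i) x \<le> \<Phi> x * (c (i + 2) * indicat_real (cell \<epsilon> (i + 2)) x)"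
          proof (cases "x \<in> h i")
            case hx: True
            have "\<Phi> (\<epsilon> * real (i + 2)) \<le> \<Phi> x" by (rule U_class_mono[OF \<Phi> nn]) (use hx in \<open>simp add: h_def\<close>)
            hence "\<Phi> (\<epsilon> * real (i + 2)) * c (i + 2) \<le> \<Phi> x * c (i + 2)" by (rule mult_right_mono) (use c in auto)
            thus ?thesis using hx sub[OF hx] by (simp add: k_def)
          next
            case False
            then show ?thesis using \<Phi>0[OF True] c[of "i+2"] by (simp add: indicator_def)
          qed
        qed
        also have "\<dots> = \<Phi> x * (\<Sum>i<N. c (i + 2) * indicat_real (cell \<epsilon> (i + 2)) x)" by (simp only: sum_distrib_left)
        also have "\<dots> \<le> \<Phi> x * step_fun 2 \<epsilon> c x"
          unfolding step_fun_def
          by (intro mult_left_mono sum_le_suminf step_fun_summable[OF e] \<Phi>0[OF True]) (use c in auto)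
        finally show "(\<Sum>i<N. k i * indicat_real (h i) x) \<le> \<Phi> x * step_fun 2 \<epsilon> c x" .
      qed
      finally show ?thesis using True by simp
    next
      case False
      have "indicator (h i) x = (0 :: ennreal)" for i using False nn[of "i+2"] by (auto simp: h_def indicator_def)
      thus ?thesis by simp
    qed
  qed
  also have "\<dots> \<le> ennreal S" by (rule S)
  finally have "(\<Sum>i<N. k i * (\<epsilon> / 2)) \<le> S" using S0 by simp
  moreover have "(\<Sum>i<N. \<epsilon> * \<Phi> (\<epsilon> * real (i + 2)) * c (i + 2)) = 2 * (\<Sum>i<N. k i * (\<epsilon> / 2))"
    unfolding sum_distrib_left k_def by (intro sum.cong refl) simp
  ultimately show ?thesis by simp
qed

text \<open>Weak-* convergence of the initial data bounds the right-hand side, and so the number of small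
  clusters at time zero.\<close>
lemma step_fun_small_sizes_le:
  assumes e: "0 < \<epsilon>" "\<epsilon> \<le> 1" and c: "\<And>i. 2 \<le> i \<Longrightarrow> 0 \<le> c i" and R: "0 \<le> R"
  shows "(\<Sum>i<N. if \<epsilon> * real (i + 2) \<le> R then \<epsilon> * c (i + 2) else 0) \<le> (\<integral>x. ramp (R + 1) x \<partial>density_measure (step_fun 2 \<epsilon> c))"
proof -
  obtain N1 :: nat where N1: "(R + 2) / \<epsilon> \<le> real N1" using real_arch_simple by blast
  define N' where "N' = max N N1"
  have "(R + 2) / \<epsilon> \<le> real N'" using N1 by (simp add: N'_def)
  hence N': "R + 2 \<le> \<epsilon> * real N'" using e by (simp add: field_simps)
  define J where "J i = (\<integral>x. indicat_real (cell \<epsilon> (i + 2)) x * ramp (R + 1) x \<partial>lborel)" for i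
  have J0: "0 \<le> J i" for i unfolding J_def by (intro integral_nonneg_AE AE_I2 mult_nonneg_nonneg ramp_facts) auto
  have J1: "J i = \<epsilon>" if "\<epsilon> * real (i + 2) \<le> R" for i
  proof -
    have "indicat_real (cell \<epsilon> (i + 2)) x * ramp (R + 1) x = indicat_real (cell \<epsilon> (i + 2)) x" for x
    proof (cases "x \<in> cell \<epsilon> (i + 2)")
      case True
      have "x \<le> R + 1" using cell_facts(4)[OF e(1) True] that e(2) by linarith
      thus ?thesis by (simp add: ramp_facts(3))
    qed simp
    hence "J i = (\<integral>x. indicat_real (cell \<epsilon> (i + 2)) x \<partial>lborel)" unfolding J_def by (simp only:)
    hence "J i = measure lborel (cell \<epsilon> (i + 2))" using cell_facts(1)[OF e(1), of "i+2"] by simp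
    thus ?thesis using cell_facts(3)[OF e(1), of "i+2"] e by (simp add: measure_def)
  qed
  have "(\<Sum>i<N. if \<epsilon> * real (i + 2) \<le> R then \<epsilon> * c (i + 2) else 0) \<le> (\<Sum>i<N'. if \<epsilon> * real (i + 2) \<le> R then \<epsilon> * c (i + 2) else 0)"
    by (rule sum_mono2) (use c e in \<open>auto simp: N'_def\<close>)
  also have "\<dots> \<le> (\<Sum>i<N'. c (i + 2) * J i)"
    by (rule sum_mono) (use J0 J1 c in \<open>auto simp: mult.commute\<close>)
  also have "\<dots> = (\<integral>x. ramp (R + 1) x \<partial>density_measure (step_fun 2 \<epsilon> c))"
    unfolding J_def by (rule step_integral[where R = "R + 2", symmetric]) (use e c ramp_Cc ramp_facts(4)[of "R+1"] N' in auto)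
  finally show ?thesis .
qed

lemma atoms_limit_of_density_limit:
  fixes e :: "nat \<Rightarrow> real" and c :: "nat \<Rightarrow> nat \<Rightarrow> real"
  assumes e: "\<And>n. 0 < e n" "\<And>n. e n \<le> 1" "e \<longlonglongrightarrow> 0" and c: "\<And>n i. 2 \<le> i \<Longrightarrow> 0 \<le> c n i"
    and M: "\<And>n N. (\<Sum>i<N. e n * c n (i + 2)) \<le> M" and g: "g \<in> Cc"
    and lim: "(\<lambda>n. \<integral>x. g x \<partial>density_measure (step_fun 2 (e n) (c n))) \<longlonglongrightarrow> l"
  shows "(\<lambda>n. \<Sum>i. e n * c n (i + 2) * g (e n * real (i + 2))) \<longlonglongrightarrow> l"
proof -
  let ?s = "\<lambda>n. \<Sum>i. e n * c n (i + 2) * g (e n * real (i + 2))" and ?d = "\<lambda>n. \<integral>x. g x \<partial>density_measure (step_fun 2 (e n) (c n))"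
  have M0: "0 \<le> M" using M[of 0 0] by simp
  obtain R where R: "0 < R" "\<And>x. R \<le> x \<Longrightarrow> g x = 0" using Cc_support[OF g] by blast
  have "(\<lambda>n. ?d n - ?s n) \<longlonglongrightarrow> 0"
  proof (rule LIMSEQ_I)
    fix \<delta> :: real assume \<delta>: "0 < \<delta>"
    have "0 < \<delta> / (2 * (M + 1))" using \<delta> M0 by simp
    from Cc_uniform[OF g this] obtain d where d: "0 < d"
      "\<And>x y. 0 \<le> x \<Longrightarrow> 0 \<le> y \<Longrightarrow> \<bar>x - y\<bar> < d \<Longrightarrow> \<bar>g x - g y\<bar> < \<delta> / (2 * (M + 1))" by blast
    obtain n0 where n0: "\<And>n. n \<ge> n0 \<Longrightarrow> norm (e n - 0) < d" using LIMSEQ_D[OF e(3) d(1)] by blast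
    have "norm (?d n - ?s n - 0) < \<delta>" if "n \<ge> n0" for n
    proof -
      have en: "e n < d" using n0[OF that] by auto
      have "\<bar>?d n - ?s n\<bar> \<le> \<delta> / (2 * (M + 1)) * M"
      proof (rule step_integral_atoms[where R = R, OF e(1) _ g])
        show "\<bar>g x - g y\<bar> \<le> \<delta> / (2 * (M + 1))" if "0 \<le> x" "0 \<le> y" "\<bar>x - y\<bar> \<le> e n / 2" for x y
          using d(2)[OF that(1,2)] that(3) en e(1)[of n] by (intro less_imp_le) auto
      qed (use R e c M in auto)
      also have "\<dots> \<le> \<delta> / (2 * (M + 1)) * (M + 1)" using M0 \<delta> by (intro mult_left_mono) auto
      also have "\<dots> = \<delta> / 2"
      proof -
        have "M + 1 \<noteq> 0" using M0 by simp
        thus ?thesis unfolding times_divide_eq_left by (rule nonzero_mult_divide_mult_cancel_right)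
      qed
      also have "\<dots> < \<delta>" using \<delta> by simp
      finally show ?thesis by simp
    qed
    thus "\<exists>n0. \<forall>n\<ge>n0. norm (?d n - ?s n - 0) < \<delta>" by blast
  qed
  from tendsto_diff[OF lim this] show ?thesis by simp
qed

lemma finite_SUP_bound:
  fixes g :: "'a \<Rightarrow> ennreal"
  assumes "(SUP x\<in>A. g x) < \<infinity>" obtains S where "0 \<le> S" "\<And>x. x \<in> A \<Longrightarrow> g x \<le> ennreal S"
proof (rule that[of "enn2real (SUP x\<in>A. g x)"])
  show "g x \<le> ennreal (enn2real (SUP x\<in>A. g x))" if "x \<in> A" for x
    using SUP_upper[OF that, of g] assms by (simp add: ennreal_enn2real)
qed simp

lemma suminf_le_of_ennreal:
  fixes h :: "nat \<Rightarrow> real"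
  assumes "\<And>i. 0 \<le> h i" "0 \<le> E" "(\<Sum>i. ennreal (h i)) \<le> ennreal E"
  shows "summable h" "(\<Sum>i. h i) \<le> E" "h i \<le> E"
proof -
  have le: "(\<Sum>i<N. h i) \<le> E" for N
  proof -
    have "ennreal (\<Sum>i<N. h i) = (\<Sum>i<N. ennreal (h i))" by (rule sum_ennreal[symmetric]) (rule assms)
    also have "\<dots> \<le> (\<Sum>i. ennreal (h i))" by (rule sum_le_suminf) auto
    also have "\<dots> \<le> ennreal E" by (rule assms)
    finally show ?thesis using assms(2) by simp
  qed
  show s: "summable h" by (rule summableI_nonneg_bounded[OF assms(1) le])
  show "(\<Sum>i. h i) \<le> E" by (rule suminf_le_const[OF s le])
  have "h i \<le> (\<Sum>j<Suc i. h j)" using sum_nonneg[of "{..<i}" h] assms(1) by simp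
  with le[of "Suc i"] show "h i \<le> E" by linarith
qed

section \<open>Convergence to the Lifshitz-Slyozov equation without nucleation\<close>

theorem theorem3:
  fixes \<eta> :: real
    and \<alpha>e \<beta>e K me :: "real \<Rightarrow> real"
    and ae be :: "real \<Rightarrow> nat \<Rightarrow> real"
    and u :: "real \<Rightarrow> real \<Rightarrow> real"
    and c :: "real \<Rightarrow> nat \<Rightarrow> real \<Rightarrow> real"
    and f :: "real \<Rightarrow> real \<Rightarrow> real \<Rightarrow> real"
    and aeps beps :: "real \<Rightarrow> real \<Rightarrow> real"
    and \<alpha> \<beta> Ka Kb ra rb abar bbar \<rho> uin m :: real
    and a b :: "real \<Rightarrow> real"
    and \<mu>in :: "real measure"
    and e :: "nat \<Rightarrow> real"
  assumes eta: "\<eta> \<ge> 0"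
    \<comment> \<open>the rescaled system\<close>
    and rates_pos: "\<And>\<epsilon>. \<epsilon> > 0 \<Longrightarrow> \<alpha>e \<epsilon> > 0 \<and> \<beta>e \<epsilon> > 0 \<and> K \<epsilon> > 0"
    and ae_pos: "\<And>\<epsilon> i. \<epsilon> > 0 \<Longrightarrow> i \<ge> 2 \<Longrightarrow> ae \<epsilon> i > 0"
    and be_pos: "\<And>\<epsilon> i. \<epsilon> > 0 \<Longrightarrow> i \<ge> 3 \<Longrightarrow> be \<epsilon> i > 0"
    and ae_incr: "\<And>\<epsilon> i. \<epsilon> > 0 \<Longrightarrow> i \<ge> 2 \<Longrightarrow> ae \<epsilon> (i + 1) - ae \<epsilon> i \<le> K \<epsilon>"
    and be_decr: "\<And>\<epsilon> i. \<epsilon> > 0 \<Longrightarrow> i \<ge> 3 \<Longrightarrow> be \<epsilon> i - be \<epsilon> (i + 1) \<le> K \<epsilon>"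
    and sol: "\<And>\<epsilon>. \<epsilon> > 0 \<Longrightarrow> BD_solution \<eta> \<epsilon> (\<alpha>e \<epsilon>) (\<beta>e \<epsilon>) (ae \<epsilon>) (be \<epsilon>) (u \<epsilon>) (c \<epsilon>)"
    and mass: "\<And>\<epsilon>. \<epsilon> > 0 \<Longrightarrow> mass_balance \<epsilon> (u \<epsilon>) (c \<epsilon>) (me \<epsilon>)"
    and f_def: "f = (\<lambda>\<epsilon> t. step_fun 2 \<epsilon> (\<lambda>i. c \<epsilon> i t))"
    and aeps_def: "aeps = (\<lambda>\<epsilon>. step_fun 2 \<epsilon> (ae \<epsilon>))"
    and beps_def: "beps = (\<lambda>\<epsilon>. step_fun 3 \<epsilon> (be \<epsilon>))"
    \<comment> \<open>the rates\<close>
    and ab_pos: "\<alpha> > 0" "\<beta> > 0"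
    and a: "continuous_on {0..} a" "\<And>x. x \<ge> 0 \<Longrightarrow> a x \<ge> 0" "\<And>x. x > 0 \<Longrightarrow> a x > 0"
    and b: "continuous_on {0..} b" "\<And>x. x \<ge> 0 \<Longrightarrow> b x \<ge> 0" "\<And>x. x > 0 \<Longrightarrow> b x > 0"
    and lim_alpha: "(\<alpha>e \<longlongrightarrow> \<alpha>) (at_right 0)"
    and lim_beta: "(\<beta>e \<longlongrightarrow> \<beta>) (at_right 0)"
    and lim_a: "\<And>C. compact C \<Longrightarrow> C \<subseteq> {0..} \<Longrightarrow> uniform_limit C aeps a (at_right 0)"
    and lim_b: "\<And>C. compact C \<Longrightarrow> C \<subseteq> {0..} \<Longrightarrow> uniform_limit C beps b (at_right 0)"
    and Kab: "Ka > 0" "Kb > 0"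
    and bd_a: "\<And>\<epsilon> x. \<epsilon> > 0 \<Longrightarrow> x \<ge> 0 \<Longrightarrow> aeps \<epsilon> x \<le> Ka * (1 + x)"
    and bd_b: "\<And>\<epsilon> x. \<epsilon> > 0 \<Longrightarrow> x \<ge> 0 \<Longrightarrow> beps \<epsilon> x \<le> Kb * (1 + x)"
    and exponents: "0 \<le> ra" "ra < 1" "ra \<le> rb" "abar > 0" "bbar > 0"
    and equiv_a: "a \<sim>[at_right 0] (\<lambda>x. abar * x powr ra)"
    and equiv_b: "b \<sim>[at_right 0] (\<lambda>x. bbar * x powr rb)"
    and small_a: "(\<lambda>(\<epsilon>, i). aeps \<epsilon> (\<epsilon> * real i) - a (\<epsilon> * real i))
                    \<in> o[small_size 2](\<lambda>(\<epsilon>, i). (\<epsilon> * real i) powr ra)"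
    and small_b: "(\<lambda>(\<epsilon>, i). beps \<epsilon> (\<epsilon> * real i) - b (\<epsilon> * real i))
                    \<in> o[small_size 3](\<lambda>(\<epsilon>, i). (\<epsilon> * real i) powr rb)"
    and rho: "((\<lambda>x. b x / a x) \<longlongrightarrow> \<rho>) (at_right 0)"
    \<comment> \<open>the initial data\<close>
    and uin: "uin > \<rho>"
    and muin: "\<mu>in \<in> Mf"
    and lim_uin: "((\<lambda>\<epsilon>. u \<epsilon> 0) \<longlongrightarrow> uin) (at_right 0)"
    and lim_fin: "weak_star_Mf (\<lambda>\<epsilon>. density_measure (f \<epsilon> 0)) \<mu>in (at_right 0)"
    and Phi: "\<exists>\<Phi>\<in>U_class.
        (SUP \<epsilon>\<in>{0<..}. \<integral>\<^sup>+x\<in>{0..}. ennreal (\<Phi> x * f \<epsilon> 0 x) \<partial>lborel) < \<infinity>"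
    and init_exp: "\<And>z. 0 < z \<Longrightarrow> z < 1 \<Longrightarrow>
        (SUP \<epsilon>\<in>{0<..}. \<Sum>i. ennreal (\<epsilon> powr ra * c \<epsilon> (i + 2) 0 * exp (- real (i + 2) * z))) < \<infinity>"
    and m_def: "m = uin + (\<integral>x. x \<partial>\<mu>in)"
    \<comment> \<open>the regime and the sequence\<close>
    and eta_ra: "\<eta> < ra"
    and e_pos: "\<And>n. e n > 0"
    and e_lim: "e \<longlonglongrightarrow> 0"
  shows "\<exists>T>0. \<exists>r::nat \<Rightarrow> nat. \<exists>\<mu>.
           strict_mono r \<and>
           N_solution a b \<rho> uin \<mu>in m T (\<lambda>u. 0) \<mu> \<and>
           weak_star_Linf_Mf T (\<lambda>k t. density_measure (f (e (r k)) t)) \<mu>"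
proof -
  have rho0: "0 \<le> \<rho>"
  proof (rule tendsto_lowerbound[OF rho])
    show "\<forall>\<^sub>F x in at_right 0. 0 \<le> b x / a x"
      unfolding eventually_at_right_field by (intro exI[of _ 1]) (use a(2) b(2) in auto)
  qed simp
  have node_a: "aeps \<epsilon> (\<epsilon> * real i) = ae \<epsilon> i" if "0 < \<epsilon>" "2 \<le> i" for \<epsilon> i
    unfolding aeps_def by (rule step_fun_at_node[OF that])
  have node_b: "beps \<epsilon> (\<epsilon> * real i) = be \<epsilon> i" if "0 < \<epsilon>" "3 \<le> i" for \<epsilon> i
    unfolding beps_def by (rule step_fun_at_node[OF that])
  have sys: "bd_system \<eta> \<epsilon> (\<alpha>e \<epsilon>) (\<beta>e \<epsilon>) (ae \<epsilon>) (be \<epsilon>) (u \<epsilon>) (c \<epsilon>) (me \<epsilon>) Ka Kb" if e: "0 < \<epsilon>" for \<epsilon>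
  proof
    show "ae \<epsilon> i \<le> Ka * (1 + \<epsilon> * real i)" if "2 \<le> i" for i using bd_a[OF e, of "\<epsilon> * real i"] node_a[OF e that] e by simp
    show "be \<epsilon> i \<le> Kb * (1 + \<epsilon> * real i)" if "3 \<le> i" for i using bd_b[OF e, of "\<epsilon> * real i"] node_b[OF e that] e by simp
    show "0 \<le> ae \<epsilon> i" if "2 \<le> i" for i using ae_pos[OF e that] by simp
    show "0 \<le> be \<epsilon> i" if "3 \<le> i" for i using be_pos[OF e that] by simp
  qed (use e rates_pos[OF e] Kab sol[OF e] mass[OF e] in auto)
  have c0: "0 \<le> c \<epsilon> i t" if "0 < \<epsilon>" "2 \<le> i" "0 \<le> t" for \<epsilon> i t
    by (rule bd_system.c_nonneg[OF sys[OF that(1)] that(3) that(2)])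
  obtain \<Phi> where \<Phi>: "\<Phi> \<in> U_class" and PhiS: "(SUP \<epsilon>\<in>{0<..}. \<integral>\<^sup>+x\<in>{0..}. ennreal (\<Phi> x * f \<epsilon> 0 x) \<partial>lborel) < \<infinity>"
    using Phi by blast
  have \<Phi>0: "0 \<le> \<Phi> x" if "0 \<le> x" for x using \<Phi> that by (simp add: U_class_def)
  obtain S where S: "0 \<le> S" "\<And>\<epsilon>. \<epsilon> \<in> {0<..} \<Longrightarrow> (\<integral>\<^sup>+x\<in>{0..}. ennreal (\<Phi> x * f \<epsilon> 0 x) \<partial>lborel) \<le> ennreal S"
    using finite_SUP_bound[OF PhiS] by blast
  obtain C where C: "0 \<le> C" "\<And>y h. 0 < h \<Longrightarrow> 2 * h \<le> y \<Longrightarrow> (\<Phi> (y + h) - \<Phi> y) * (1 + y) \<le> C * h * (1 + \<Phi> y)"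
    using U_class_increment[OF \<Phi>] by blast
  obtain R0 where R0: "1 \<le> R0" "\<And>x. R0 \<le> x \<Longrightarrow> 1 * x \<le> \<Phi> x" using U_class_superlinear[OF \<Phi>, of 1] by blast
  have lin: "1 + x \<le> (R0 + 1) * (1 + \<Phi> x)" if "0 \<le> x" for x
  proof -
    have "x \<le> R0 + \<Phi> x" using R0(2)[of x] \<Phi>0[OF that] R0(1) by (cases "R0 \<le> x") auto
    moreover have "0 \<le> R0 * \<Phi> x" using R0(1) \<Phi>0[OF that] by simp
    ultimately show ?thesis by (simp add: algebra_simps)
  qed
  \<comment> \<open>With \<open>\<rho> < \<rho>' < v < uin\<close>, the value \<open>v\<close> is a lower bound for \<open>u\<close> on a short interval, and
    \<open>\<rho>'\<close> an upper bound for the ratio of the rates at small sizes. The exponent \<open>z\<close> is so small that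
    \<open>exp z * \<rho>' \<le> v\<close>, as \<open>exp_drift_le\<close> requires.\<close>
  define v where "v = (uin + \<rho>) / 2"
  have v: "\<rho> < v" "0 < v" "v < uin" using uin rho0 by (auto simp: v_def)
  define \<rho>' where "\<rho>' = (\<rho> + v) / 2"
  have \<rho>': "\<rho> < \<rho>'" "0 < \<rho>'" "\<rho>' < v" using v rho0 by (auto simp: \<rho>'_def)
  define z where "z = min (1 / 2) (ln (v / \<rho>'))"
  have z: "0 < z" "z < 1" "exp z * \<rho>' \<le> v"
  proof -
    have "1 < v / \<rho>'" using \<rho>' by simp
    thus "0 < z" "z < 1" by (auto simp: z_def)
    have "exp z \<le> exp (ln (v / \<rho>'))" by (simp add: z_def)
    also have "\<dots> = v / \<rho>'" using v \<rho>' by simp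
    finally show "exp z * \<rho>' \<le> v" using \<rho>' by (simp add: field_simps)
  qed
  obtain x0 where x0: "0 < x0" "\<And>\<epsilon> i. 0 < \<epsilon> \<Longrightarrow> 3 \<le> i \<Longrightarrow> \<epsilon> * real i \<le> x0 \<Longrightarrow> beps \<epsilon> (\<epsilon> * real i) \<le> \<rho>' * aeps \<epsilon> (\<epsilon> * real i)"
    using rate_ratio_bound[OF a(3) exponents(4,3) rho rho0 \<rho>'(1) equiv_a small_a small_b] by blast
  have small: "exp z * be \<epsilon> i \<le> v * ae \<epsilon> i" if e: "0 < \<epsilon>" and i: "3 \<le> i" "\<epsilon> * real i \<le> x0" for \<epsilon> i
  proof -
    have "be \<epsilon> i \<le> \<rho>' * ae \<epsilon> i" using x0(2)[OF e i] node_a[OF e, of i] node_b[OF e, of i] i by simp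
    hence "exp z * be \<epsilon> i \<le> exp z * (\<rho>' * ae \<epsilon> i)" by (intro mult_left_mono) auto
    also have "\<dots> \<le> v * ae \<epsilon> i" using z(3) ae_pos[OF e, of i] i by (simp add: mult.assoc[symmetric])
    finally show ?thesis .
  qed
  obtain E where E: "0 \<le> E" "\<And>\<epsilon>. \<epsilon> \<in> {0<..} \<Longrightarrow> (\<Sum>i. ennreal (\<epsilon> powr ra * c \<epsilon> (i + 2) 0 * exp (- real (i + 2) * z))) \<le> ennreal E"
    using finite_SUP_bound[OF init_exp[OF z(1,2)]] by blast
  have E0: "(\<Sum>i. \<epsilon> * exp (- real (i + 2) * z) * c \<epsilon> (i + 2) 0) \<le> \<epsilon> powr (1 - ra) * E"
    and c2_init: "\<epsilon> * c \<epsilon> 2 0 \<le> \<epsilon> powr (1 - ra) * (exp (2 * z) * E)" if e: "0 < \<epsilon>" for \<epsilon>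
  proof -
    define h where "h i = \<epsilon> powr ra * c \<epsilon> (i + 2) 0 * exp (- real (i + 2) * z)" for i
    have h0: "0 \<le> h i" for i unfolding h_def using c0[OF e, of "i+2" 0] by simp
    have hE: "(\<Sum>i. ennreal (h i)) \<le> ennreal E" using E(2)[of \<epsilon>] e by (simp add: h_def)
    note hs = suminf_le_of_ennreal[of h, OF h0 E(1) hE]
    have p: "\<epsilon> powr (1 - ra) * \<epsilon> powr ra = \<epsilon>" using e by (simp add: powr_add[symmetric])
    have "(\<Sum>i. \<epsilon> * exp (- real (i + 2) * z) * c \<epsilon> (i + 2) 0) = (\<Sum>i. \<epsilon> powr (1 - ra) * h i)"
    proof (rule suminf_cong)
      fix i
      have "\<epsilon> powr (1 - ra) * h i = (\<epsilon> powr (1 - ra) * \<epsilon> powr ra) * (c \<epsilon> (i + 2) 0 * exp (- real (i + 2) * z))" by (simp only: h_def mult.assoc)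
      thus "\<epsilon> * exp (- real (i + 2) * z) * c \<epsilon> (i + 2) 0 = \<epsilon> powr (1 - ra) * h i" unfolding p by (simp only: mult_ac)
    qed
    also have "\<dots> = \<epsilon> powr (1 - ra) * (\<Sum>i. h i)" by (rule suminf_mult[OF hs(1)])
    also have "\<dots> \<le> \<epsilon> powr (1 - ra) * E" by (intro mult_left_mono hs(2)) auto
    finally show "(\<Sum>i. \<epsilon> * exp (- real (i + 2) * z) * c \<epsilon> (i + 2) 0) \<le> \<epsilon> powr (1 - ra) * E" .
    have "h 0 \<le> E" by (rule hs(3))
    hence "exp (2 * z) * h 0 \<le> exp (2 * z) * E" by (intro mult_left_mono) auto
    moreover have "exp (2 * z) * h 0 = \<epsilon> powr ra * c \<epsilon> 2 0 * (exp (2 * z) * exp (- 2 * z))" by (simp add: h_def numeral_2_eq_2)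
    moreover have "exp (2 * z) * exp (- 2 * z) = 1" by (simp add: exp_add[symmetric])
    ultimately have "\<epsilon> powr ra * c \<epsilon> 2 0 \<le> exp (2 * z) * E" by (simp only: mult_1_right)
    hence "\<epsilon> powr (1 - ra) * (\<epsilon> powr ra * c \<epsilon> 2 0) \<le> \<epsilon> powr (1 - ra) * (exp (2 * z) * E)" by (intro mult_left_mono) auto
    thus "\<epsilon> * c \<epsilon> 2 0 \<le> \<epsilon> powr (1 - ra) * (exp (2 * z) * E)" unfolding mult.assoc[symmetric] p by (simp add: mult.assoc)
  qed
  \<comment> \<open>Bounds that hold for all small \<open>\<epsilon>\<close>, each depending only on earlier ones: \<open>H0\<close> and
    \<open>H1\<close> for the weighted number of clusters at time zero and up to time one, \<open>Mm\<close> for the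
    total mass, \<open>M\<close> for \<open>count_and_mass\<close>, and \<open>\<Lambda>\<close> for the slope of \<open>u\<close>. The interval \<open>[0, T]\<close> is
    so short that \<open>u\<close> cannot lose more than half of \<open>uin - v\<close>.\<close>
  define Z where "Z = (\<integral>x. ramp (R0 + 1) x \<partial>\<mu>in) + 1"
  define H0 where "H0 = Z + 4 * S"
  define Mm where "Mm = uin + 1 + (R0 + 1) * H0"
  define H1 where "H1 = (H0 + (1 + \<Phi> 2) * ((\<alpha> + 1) * Mm\<^sup>2)) * exp (Ka * Mm * C)"
  define M where "M = (R0 + 1) * H1 + 1"
  define \<Lambda> where "\<Lambda> = 2 * (\<alpha> + 1) * Mm\<^sup>2 + (Ka * Mm + Kb + 2 * (\<beta> + 1)) * M"
  define T where "T = min 1 ((uin - v) / (2 * (\<bar>\<Lambda>\<bar> + 1)))"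
  have T: "0 < T" "T \<le> 1" "\<Lambda> * T \<le> (uin - v) / 2"
  proof -
    show "0 < T" "T \<le> 1" using v by (auto simp: T_def)
    have "\<Lambda> * T \<le> (\<bar>\<Lambda>\<bar> + 1) * ((uin - v) / (2 * (\<bar>\<Lambda>\<bar> + 1)))"
      using v \<open>0 < T\<close> by (intro mult_mono) (auto simp: T_def)
    also have "\<dots> = (uin - v) / 2" by (simp add: field_simps)
    finally show "\<Lambda> * T \<le> (uin - v) / 2" .
  qed
  define Q where "Q \<epsilon> = exp z * Kb * exp (- z * x0 / \<epsilon>) * M / \<epsilon>" for \<epsilon>
  have Q_lim: "(Q \<longlongrightarrow> 0) (at_right 0)"
  proof -
    have "((\<lambda>\<epsilon>. exp (- k / \<epsilon>) / \<epsilon>) \<longlongrightarrow> 0) (at_right 0)" if "0 < k" for k :: real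
      using that by real_asymp
    from this[of "z * x0"] have "((\<lambda>\<epsilon>. exp (- (z * x0) / \<epsilon>) / \<epsilon>) \<longlongrightarrow> 0) (at_right 0)" using z x0 by simp
    from tendsto_mult_right_zero[OF this, of "exp z * Kb * M"] show ?thesis
      unfolding Q_def by (simp add: mult_ac)
  qed
  define good where "good \<epsilon> \<longleftrightarrow> 0 < \<epsilon> \<and> \<epsilon> < 1 \<and> (\<integral>x. ramp (R0 + 1) x \<partial>density_measure (f \<epsilon> 0)) < Z
     \<and> u \<epsilon> 0 < uin + 1 \<and> uin - (uin - v) / 2 < u \<epsilon> 0 \<and> \<alpha>e \<epsilon> < \<alpha> + 1 \<and> \<beta>e \<epsilon> < \<beta> + 1 \<and> \<beta> / 2 < \<beta>e \<epsilon> \<and> Q \<epsilon> < 1" for \<epsilon>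
  have good_ev: "eventually good (at_right 0)"
  proof -
    have "((\<lambda>\<epsilon>. \<integral>x. ramp (R0 + 1) x \<partial>density_measure (f \<epsilon> 0)) \<longlongrightarrow> (\<integral>x. ramp (R0 + 1) x \<partial>\<mu>in)) (at_right 0)"
      using lim_fin ramp_Cc(1) by (simp add: weak_star_Mf_def)
    hence 1: "\<forall>\<^sub>F \<epsilon> in at_right 0. (\<integral>x. ramp (R0 + 1) x \<partial>density_measure (f \<epsilon> 0)) < Z"
      by (rule order_tendstoD) (simp add: Z_def)
    have 2: "\<forall>\<^sub>F \<epsilon> in at_right 0. 0 < \<epsilon> \<and> \<epsilon> < (1::real)" unfolding eventually_at_right_field by (intro exI[of _ 1]) auto
    have 3: "\<forall>\<^sub>F \<epsilon> in at_right 0. u \<epsilon> 0 < uin + 1" by (rule order_tendstoD(2)[OF lim_uin]) simp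
    have 4: "\<forall>\<^sub>F \<epsilon> in at_right 0. uin - (uin - v) / 2 < u \<epsilon> 0" by (rule order_tendstoD(1)[OF lim_uin]) (use v in simp)
    have 5: "\<forall>\<^sub>F \<epsilon> in at_right 0. \<alpha>e \<epsilon> < \<alpha> + 1" by (rule order_tendstoD(2)[OF lim_alpha]) simp
    have 6: "\<forall>\<^sub>F \<epsilon> in at_right 0. \<beta>e \<epsilon> < \<beta> + 1" by (rule order_tendstoD(2)[OF lim_beta]) simp
    have 7: "\<forall>\<^sub>F \<epsilon> in at_right 0. \<beta> / 2 < \<beta>e \<epsilon>" by (rule order_tendstoD(1)[OF lim_beta]) (use ab_pos in simp)
    have 8: "\<forall>\<^sub>F \<epsilon> in at_right 0. Q \<epsilon> < 1" by (rule order_tendstoD(2)[OF Q_lim]) simp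
    show ?thesis unfolding good_def using 1 2 3 4 5 6 7 8 by eventually_elim auto
  qed
  have H0: "(\<Sum>i<N. \<epsilon> * (1 + \<Phi> (\<epsilon> * real (i + 2))) * c \<epsilon> (i + 2) 0) \<le> H0" if g: "good \<epsilon>" for \<epsilon> N
  proof -
    have e: "0 < \<epsilon>" "\<epsilon> \<le> 1" using g by (auto simp: good_def)
    have c: "0 \<le> c \<epsilon> i 0" if "2 \<le> i" for i by (rule c0[OF e(1) that]) simp
    have feq: "f \<epsilon> 0 = step_fun 2 \<epsilon> (\<lambda>i. c \<epsilon> i 0)" by (simp add: f_def)
    have w: "(\<Sum>i<N. \<epsilon> * \<Phi> (\<epsilon> * real (i + 2)) * c \<epsilon> (i + 2) 0) \<le> 2 * S"
      by (rule step_fun_weighted_sum_le[OF e(1) c \<Phi> _ S(1)]) (use S(2)[of \<epsilon>] e feq in auto)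
    have s: "(\<Sum>i<N. if \<epsilon> * real (i + 2) \<le> R0 then \<epsilon> * c \<epsilon> (i + 2) 0 else 0) \<le> Z"
    proof -
      have "(\<Sum>i<N. if \<epsilon> * real (i + 2) \<le> R0 then \<epsilon> * c \<epsilon> (i + 2) 0 else 0) \<le> (\<integral>x. ramp (R0 + 1) x \<partial>density_measure (f \<epsilon> 0))"
        unfolding feq by (rule step_fun_small_sizes_le[OF e]) (use c R0(1) in auto)
      moreover have "(\<integral>x. ramp (R0 + 1) x \<partial>density_measure (f \<epsilon> 0)) < Z" using g unfolding good_def by blast
      ultimately show ?thesis by linarith
    qed
    have "(\<Sum>i<N. \<epsilon> * (1 + \<Phi> (\<epsilon> * real (i + 2))) * c \<epsilon> (i + 2) 0) \<le>
      (\<Sum>i<N. (if \<epsilon> * real (i + 2) \<le> R0 then \<epsilon> * c \<epsilon> (i + 2) 0 else 0) + 2 * (\<epsilon> * \<Phi> (\<epsilon> * real (i + 2)) * c \<epsilon> (i + 2) 0))"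
    proof (rule sum_mono)
      fix i
      have x: "0 \<le> \<epsilon> * real (i + 2)" using e by simp
      have ec: "0 \<le> \<epsilon> * c \<epsilon> (i + 2) 0" using c[of "i+2"] e by simp
      have p: "0 \<le> \<epsilon> * c \<epsilon> (i + 2) 0 * \<Phi> (\<epsilon> * real (i + 2))" by (rule mult_nonneg_nonneg[OF ec \<Phi>0[OF x]])
      have eq: "\<epsilon> * (1 + \<Phi> (\<epsilon> * real (i + 2))) * c \<epsilon> (i + 2) 0 = \<epsilon> * c \<epsilon> (i + 2) 0 + \<epsilon> * c \<epsilon> (i + 2) 0 * \<Phi> (\<epsilon> * real (i + 2))"
        "\<epsilon> * \<Phi> (\<epsilon> * real (i + 2)) * c \<epsilon> (i + 2) 0 = \<epsilon> * c \<epsilon> (i + 2) 0 * \<Phi> (\<epsilon> * real (i + 2))" by (simp_all only: distrib_left distrib_right mult_1_right mult_ac)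
      show "\<epsilon> * (1 + \<Phi> (\<epsilon> * real (i + 2))) * c \<epsilon> (i + 2) 0 \<le>
        (if \<epsilon> * real (i + 2) \<le> R0 then \<epsilon> * c \<epsilon> (i + 2) 0 else 0) + 2 * (\<epsilon> * \<Phi> (\<epsilon> * real (i + 2)) * c \<epsilon> (i + 2) 0)"
      proof (cases "\<epsilon> * real (i + 2) \<le> R0")
        case True then show ?thesis using p unfolding eq by simp
      next
        case False
        have "1 \<le> \<Phi> (\<epsilon> * real (i + 2))" using R0(2)[of "\<epsilon> * real (i + 2)"] R0(1) False by linarith
        from mult_left_mono[OF this ec] show ?thesis using False p unfolding eq by simp
      qed
    qed
    also have "\<dots> \<le> H0" unfolding sum.distrib sum_distrib_left[symmetric] H0_def using s w by linarith
    finally show ?thesis .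
  qed
  have H0_nonneg: "0 \<le> H0"
  proof -
    obtain \<epsilon> where "good \<epsilon>" using eventually_happens[OF good_ev] by auto
    from H0[OF this, of 0] show ?thesis by simp
  qed
  have Mm0: "0 < Mm" using uin rho0 H0_nonneg R0(1) by (simp add: Mm_def add_pos_nonneg)
  have H1_nonneg: "0 \<le> H1" unfolding H1_def using H0_nonneg \<Phi>0[of 2] ab_pos by (intro mult_nonneg_nonneg add_nonneg_nonneg) auto
  have M0: "0 < M" using H1_nonneg R0(1) by (simp add: M_def add_nonneg_pos)
  have \<Lambda>0: "0 \<le> \<Lambda>" unfolding \<Lambda>_def using Mm0 M0 Kab ab_pos by (intro mult_nonneg_nonneg add_nonneg_nonneg) auto
  have me_le: "me \<epsilon> \<le> Mm" if g: "good \<epsilon>" for \<epsilon>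
  proof -
    have e: "0 < \<epsilon>" using g by (auto simp: good_def)
    interpret B: bd_system \<eta> \<epsilon> "\<alpha>e \<epsilon>" "\<beta>e \<epsilon>" "ae \<epsilon>" "be \<epsilon>" "u \<epsilon>" "c \<epsilon>" "me \<epsilon>" Ka Kb by (rule sys[OF e])
    have le: "B.count_and_mass 0 \<le> (R0 + 1) * H0"
      by (rule B.weighted_bound_consequences(1)[OF order_refl \<Phi>0 H0[OF g] lin]) (use R0 in auto)
    have "(\<Sum>i. \<epsilon>\<^sup>2 * real (i + 2) * c \<epsilon> (i + 2) 0) \<le> B.count_and_mass 0"
      unfolding B.count_and_mass_def
    proof (intro suminf_le B.mass_summable B.count_and_mass_summable order_refl)
      fix i
      show "\<epsilon>\<^sup>2 * real (i + 2) * c \<epsilon> (i + 2) 0 \<le> \<epsilon> * (1 + \<epsilon> * real (i + 2)) * c \<epsilon> (i + 2) 0"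
        using e B.c_nonneg[of 0 "i+2"] by (intro mult_right_mono) (auto simp: power2_eq_square algebra_simps)
    qed
    thus ?thesis using B.mass_eq[of 0] le g by (simp add: good_def Mm_def)
  qed
  have H1: "(\<Sum>i<N. \<epsilon> * (1 + \<Phi> (\<epsilon> * real (i + 2))) * c \<epsilon> (i + 2) t) \<le> H1" if g: "good \<epsilon>" and t: "t \<in> {0..T}" for \<epsilon> N t
  proof -
    have e: "0 < \<epsilon>" "\<epsilon> < 1" using g by (auto simp: good_def)
    interpret B: bd_system \<eta> \<epsilon> "\<alpha>e \<epsilon>" "\<beta>e \<epsilon>" "ae \<epsilon>" "be \<epsilon>" "u \<epsilon>" "c \<epsilon>" "me \<epsilon>" Ka Kb by (rule sys[OF e(1)])
    have t': "0 \<le> t" "t \<le> 1" using t T by auto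
    have "(\<Sum>i<N. \<epsilon> * (1 + \<Phi> (\<epsilon> * real (i + 2))) * c \<epsilon> (i + 2) t) \<le>
       (H0 + (1 + \<Phi> (\<epsilon> * real 2)) * (\<alpha>e \<epsilon> * (me \<epsilon>)\<^sup>2) * t) * exp (Ka * me \<epsilon> * C * t)"
    proof (rule B.lyapunov_bound[where W = "\<lambda>i. \<Phi> (\<epsilon> * real i)", OF _ _ _ C(1) H0[OF g] t'(1)])
      fix i :: nat assume i: "2 \<le> i"
      show "0 \<le> \<Phi> (\<epsilon> * real i)" by (rule \<Phi>0) (use e in simp)
      show "\<Phi> (\<epsilon> * real i) \<le> \<Phi> (\<epsilon> * real (i + 1))" by (rule U_class_mono[OF \<Phi>]) (use e in auto)
      have "2 * \<epsilon> \<le> \<epsilon> * real i" using i e by simp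
      from C(2)[OF e(1) this] show "(\<Phi> (\<epsilon> * real (i + 1)) - \<Phi> (\<epsilon> * real i)) * (1 + \<epsilon> * real i) \<le> C * \<epsilon> * (1 + \<Phi> (\<epsilon> * real i))"
        by (simp add: algebra_simps)
    qed
    also have "\<dots> \<le> H1" unfolding H1_def
    proof (rule mult_mono)
      have "\<Phi> (\<epsilon> * real 2) \<le> \<Phi> 2" by (rule U_class_mono[OF \<Phi>]) (use e in auto)
      moreover have "0 \<le> \<Phi> (\<epsilon> * real 2)" by (rule \<Phi>0) (use e in simp)
      moreover have "\<alpha>e \<epsilon> * (me \<epsilon>)\<^sup>2 \<le> (\<alpha> + 1) * Mm\<^sup>2"
        using g me_le[OF g] B.m_nonneg B.alpha_pos ab_pos by (intro mult_mono power_mono) (auto simp: good_def)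
      ultimately have le: "(1 + \<Phi> (\<epsilon> * real 2)) * (\<alpha>e \<epsilon> * (me \<epsilon>)\<^sup>2) \<le> (1 + \<Phi> 2) * ((\<alpha> + 1) * Mm\<^sup>2)"
        by - (rule mult_mono, use B.alpha_pos in auto)
      have "0 \<le> (1 + \<Phi> (\<epsilon> * real 2)) * (\<alpha>e \<epsilon> * (me \<epsilon>)\<^sup>2)"
        using \<Phi>0[of "\<epsilon> * real 2"] e B.alpha_pos by (intro mult_nonneg_nonneg add_nonneg_nonneg) auto
      hence "(1 + \<Phi> (\<epsilon> * real 2)) * (\<alpha>e \<epsilon> * (me \<epsilon>)\<^sup>2) * t \<le> (1 + \<Phi> 2) * ((\<alpha> + 1) * Mm\<^sup>2)"
        using le t' by (meson mult_left_le order_trans)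
      thus "H0 + (1 + \<Phi> (\<epsilon> * real 2)) * (\<alpha>e \<epsilon> * (me \<epsilon>)\<^sup>2) * t \<le> H0 + (1 + \<Phi> 2) * ((\<alpha> + 1) * Mm\<^sup>2)" by simp
      have "Ka * me \<epsilon> * C * t \<le> Ka * Mm * C * 1"
        using t' me_le[OF g] B.m_nonneg Kab C(1) Mm0 by (intro mult_mono) auto
      thus "exp (Ka * me \<epsilon> * C * t) \<le> exp (Ka * Mm * C)" by simp
      show "0 \<le> H0 + (1 + \<Phi> 2) * ((\<alpha> + 1) * Mm\<^sup>2)" using H0_nonneg \<Phi>0[of 2] ab_pos by (intro add_nonneg_nonneg mult_nonneg_nonneg) auto
    qed auto
    finally show ?thesis .
  qed
  have size: "bd_system.count_and_mass \<epsilon> (c \<epsilon>) t \<le> M" if g: "good \<epsilon>" and t: "t \<in> {0..T}" for \<epsilon> t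
  proof -
    have e: "0 < \<epsilon>" using g by (auto simp: good_def)
    interpret B: bd_system \<eta> \<epsilon> "\<alpha>e \<epsilon>" "\<beta>e \<epsilon>" "ae \<epsilon>" "be \<epsilon>" "u \<epsilon>" "c \<epsilon>" "me \<epsilon>" Ka Kb by (rule sys[OF e])
    have "B.count_and_mass t \<le> (R0 + 1) * H1"
      by (rule B.weighted_bound_consequences(1)[OF _ \<Phi>0 H1[OF g t] lin]) (use R0 t in auto)
    thus ?thesis by (simp add: M_def)
  qed
  have u_lip: "\<bar>u \<epsilon> t - u \<epsilon> s\<bar> \<le> \<Lambda> * \<bar>t - s\<bar>" if g: "good \<epsilon>" and st: "s \<in> {0..T}" "t \<in> {0..T}" for \<epsilon> s t
  proof -
    have e: "0 < \<epsilon>" "\<epsilon> \<le> 1" using g by (auto simp: good_def)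
    interpret B: bd_system \<eta> \<epsilon> "\<alpha>e \<epsilon>" "\<beta>e \<epsilon>" "ae \<epsilon>" "be \<epsilon>" "u \<epsilon>" "c \<epsilon>" "me \<epsilon>" Ka Kb by (rule sys[OF e(1)])
    have le: "2 * \<alpha>e \<epsilon> * (me \<epsilon>)\<^sup>2 + (Ka * me \<epsilon> + Kb + 2 * \<beta>e \<epsilon>) * M \<le> \<Lambda>" unfolding \<Lambda>_def
      using g me_le[OF g] B.m_nonneg B.alpha_pos B.beta_pos ab_pos Kab M0 Mm0
      by (intro add_mono mult_mono power_mono) (auto simp: good_def)
    have *: "\<bar>u \<epsilon> t - u \<epsilon> s\<bar> \<le> \<Lambda> * (t - s)" if "0 \<le> s" "s \<le> t" "t \<le> T" for s t
    proof -
      have "\<bar>u \<epsilon> t - u \<epsilon> s\<bar> \<le> (2 * \<alpha>e \<epsilon> * (me \<epsilon>)\<^sup>2 + (Ka * me \<epsilon> + Kb + 2 * \<beta>e \<epsilon>) * M) * (t - s)"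
        by (rule B.u_lipschitz[OF that(1,2) _ e(2) eta]) (use size[OF g] that in auto)
      also have "\<dots> \<le> \<Lambda> * (t - s)" using that by (intro mult_right_mono le) auto
      finally show ?thesis .
    qed
    show ?thesis
    proof (cases "s \<le> t")
      case True then show ?thesis using *[of s t] st by simp
    next
      case False then show ?thesis using *[of t s] st by (simp add: abs_minus_commute)
    qed
  qed
  have u_low: "v \<le> u \<epsilon> t" if g: "good \<epsilon>" and t: "t \<in> {0..T}" for \<epsilon> t
  proof -
    have "\<bar>u \<epsilon> t - u \<epsilon> 0\<bar> \<le> \<Lambda> * \<bar>t - 0\<bar>" by (rule u_lip[OF g]) (use t T in auto)
    also have "\<dots> \<le> \<Lambda> * T" using t \<Lambda>0 by (intro mult_left_mono) auto
    finally have "u \<epsilon> 0 - (uin - v) / 2 \<le> u \<epsilon> t" using T(3) by linarith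
    moreover have "uin - (uin - v) / 2 < u \<epsilon> 0" using g unfolding good_def by blast
    ultimately show ?thesis by (simp add: field_simps)
  qed
  define C3 where "C3 = 2 / \<beta> * (exp (2 * z) * (E + 1) + (\<alpha> + 1) * Mm\<^sup>2)"
  have I2: "\<epsilon> powr \<eta> * integral {0..T} (c \<epsilon> 2) \<le> C3"
    and entry_le: "integral {0..T} (bd_system.entry_flux (ae \<epsilon>) (be \<epsilon>) (u \<epsilon>) (c \<epsilon>))
       \<le> exp (3 * z) * (\<epsilon> powr (1 - ra) * E + Q \<epsilon>) + 2 * (ae \<epsilon> 2 * Mm * integral {0..T} (c \<epsilon> 2))"
    and I2_nonneg: "0 \<le> integral {0..T} (c \<epsilon> 2)" if g: "good \<epsilon>" for \<epsilon>
  proof -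
    have e: "0 < \<epsilon>" "\<epsilon> \<le> 1" using g by (auto simp: good_def)
    interpret B: bd_system \<eta> \<epsilon> "\<alpha>e \<epsilon>" "\<beta>e \<epsilon>" "ae \<epsilon>" "be \<epsilon>" "u \<epsilon>" "c \<epsilon>" "me \<epsilon>" Ka Kb by (rule sys[OF e(1)])
    have Ic: "c \<epsilon> 2 integrable_on {0..T}"
      by (rule integrable_continuous_real, rule continuous_on_subset[OF B.c_continuous]) auto
    show I0: "0 \<le> integral {0..T} (c \<epsilon> 2)" by (rule integral_nonneg[OF Ic]) (use B.c_nonneg in auto)
    have T0: "0 \<le> T" using T by simp
    have Q0: "0 \<le> Q \<epsilon>" unfolding Q_def using Kab M0 e by auto
    have TQ: "T * Q \<epsilon> \<le> Q \<epsilon>" using T Q0 by (simp add: mult_left_le_one_le)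
    have D1: "B.back_rate 2 * integral {0..T} (c \<epsilon> 2) \<le> exp (2 * z) * (\<epsilon> powr (1 - ra) * E + T * Q \<epsilon>) + T * (\<alpha>e \<epsilon> * (me \<epsilon>)\<^sup>2)"
      unfolding Q_def
      by (rule B.dimer_integral_bounds(1)[where v = v and ?x0.0 = x0, OF T0 z(1)]) (use u_low[OF g] size[OF g] small[OF e(1)] E0[OF e(1)] in auto)
    have D2: "integral {0..T} B.entry_flux \<le> exp (3 * z) * (\<epsilon> powr (1 - ra) * E + T * Q \<epsilon>) + 2 * (ae \<epsilon> 2 * me \<epsilon> * integral {0..T} (c \<epsilon> 2))"
      unfolding Q_def
      by (rule B.dimer_integral_bounds(2)[where v = v and ?x0.0 = x0, OF T0 z(1)]) (use u_low[OF g] size[OF g] small[OF e(1)] E0[OF e(1)] in auto)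
    have pw: "\<epsilon> powr (1 - ra) \<le> 1" using powr_mono2[of "1 - ra" \<epsilon> 1] e exponents by simp
    have "\<epsilon> powr (1 - ra) * E + T * Q \<epsilon> \<le> E + 1"
      using mult_right_mono[OF pw E(1)] TQ g unfolding good_def by simp
    hence 1: "exp (2 * z) * (\<epsilon> powr (1 - ra) * E + T * Q \<epsilon>) \<le> exp (2 * z) * (E + 1)" by (intro mult_left_mono) auto
    have "T * (\<alpha>e \<epsilon> * (me \<epsilon>)\<^sup>2) \<le> 1 * ((\<alpha> + 1) * Mm\<^sup>2)"
      using g me_le[OF g] B.m_nonneg B.alpha_pos ab_pos T by (intro mult_mono power_mono) (auto simp: good_def)
    with D1 1 have 2: "B.back_rate 2 * integral {0..T} (c \<epsilon> 2) \<le> exp (2 * z) * (E + 1) + (\<alpha> + 1) * Mm\<^sup>2" by linarith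
    have "\<beta> / 2 * (\<epsilon> powr \<eta> * integral {0..T} (c \<epsilon> 2)) \<le> \<beta>e \<epsilon> * (\<epsilon> powr \<eta> * integral {0..T} (c \<epsilon> 2))"
      using g I0 by (intro mult_right_mono) (auto simp: good_def)
    also have "\<dots> = B.back_rate 2 * integral {0..T} (c \<epsilon> 2)" by (simp add: B.back_rate_def)
    finally have "\<beta> / 2 * (\<epsilon> powr \<eta> * integral {0..T} (c \<epsilon> 2)) \<le> exp (2 * z) * (E + 1) + (\<alpha> + 1) * Mm\<^sup>2" using 2 by linarith
    thus "\<epsilon> powr \<eta> * integral {0..T} (c \<epsilon> 2) \<le> C3" using ab_pos by (simp add: C3_def field_simps)
    have "exp (3 * z) * (\<epsilon> powr (1 - ra) * E + T * Q \<epsilon>) \<le> exp (3 * z) * (\<epsilon> powr (1 - ra) * E + Q \<epsilon>)"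
      using TQ by (intro mult_left_mono) auto
    moreover have "ae \<epsilon> 2 * me \<epsilon> * integral {0..T} (c \<epsilon> 2) \<le> ae \<epsilon> 2 * Mm * integral {0..T} (c \<epsilon> 2)"
      using me_le[OF g] B.a_nonneg[of 2] I0 by (intro mult_right_mono mult_left_mono) auto
    ultimately show "integral {0..T} B.entry_flux \<le> exp (3 * z) * (\<epsilon> powr (1 - ra) * E + Q \<epsilon>) + 2 * (ae \<epsilon> 2 * Mm * integral {0..T} (c \<epsilon> 2))"
      using D2 by linarith
  qed
  have C3: "0 \<le> C3" unfolding C3_def using ab_pos E by (intro mult_nonneg_nonneg add_nonneg_nonneg) auto
  have powr_lim: "((\<lambda>\<epsilon>. \<epsilon> powr p) \<longlongrightarrow> 0) (at_right 0)" if "0 < p" for p :: real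
    using that by real_asymp
  obtain d5 where d5: "0 < d5" "\<And>\<epsilon> i. 0 < \<epsilon> \<Longrightarrow> 2 \<le> i \<Longrightarrow> \<epsilon> * real i < d5 \<Longrightarrow> \<bar>aeps \<epsilon> (\<epsilon> * real i) - a (\<epsilon> * real i)\<bar> \<le> 1 * (\<epsilon> * real i) powr ra"
    using small_size_bound[OF small_a zero_less_one] by blast
  obtain d6 where d6: "0 < d6" "\<And>x. 0 < x \<Longrightarrow> x < d6 \<Longrightarrow> abar / 2 * x powr ra \<le> a x \<and> a x \<le> 2 * abar * x powr ra"
    using asymp_power_bounds[OF equiv_a exponents(4)] by blast
  define C2 where "C2 = 2 * (2 * abar + 1)"
  have a2: "ae \<epsilon> 2 \<le> C2 * \<epsilon> powr ra" if e: "0 < \<epsilon>" "2 * \<epsilon> < min d5 d6" for \<epsilon>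
  proof -
    have "ae \<epsilon> 2 \<le> a (\<epsilon> * 2) + (\<epsilon> * 2) powr ra" using d5(2)[OF e(1), of 2] node_a[OF e(1), of 2] e by simp
    also have "\<dots> \<le> (2 * abar + 1) * (\<epsilon> * 2) powr ra" using d6(2)[of "\<epsilon> * 2"] e by (simp add: algebra_simps)
    also have "(\<epsilon> * 2) powr ra = \<epsilon> powr ra * 2 powr ra" using e by (simp add: powr_mult)
    also have "(2 * abar + 1) * (\<epsilon> powr ra * 2 powr ra) \<le> (2 * abar + 1) * (\<epsilon> powr ra * 2)"
    proof (intro mult_left_mono)
      show "(2::real) powr ra \<le> 2" using powr_mono[of ra 1 "2::real"] exponents by simp
    qed (use exponents in auto)
    also have "\<dots> = C2 * \<epsilon> powr ra" by (simp add: C2_def)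
    finally show ?thesis .
  qed
  \<comment> \<open>By \<open>I2\<close> the dimers are at most of order \<open>\<epsilon> powr (- \<eta>)\<close> in time average, and \<open>\<eta> < ra < 1\<close>.\<close>
  have dimer_lim: "((\<lambda>\<epsilon>. \<epsilon> * integral {0..T} (c \<epsilon> 2)) \<longlongrightarrow> 0) (at_right 0)"
  proof (rule Lim_null_comparison)
    show "((\<lambda>\<epsilon>. \<epsilon> powr (1 - \<eta>) * C3) \<longlongrightarrow> 0) (at_right 0)"
      by (rule tendsto_mult_left_zero[OF powr_lim]) (use eta_ra exponents in simp)
    show "\<forall>\<^sub>F \<epsilon> in at_right 0. norm (\<epsilon> * integral {0..T} (c \<epsilon> 2)) \<le> \<epsilon> powr (1 - \<eta>) * C3"
      using good_ev
    proof eventually_elim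
      case (elim \<epsilon>)
      have e: "0 < \<epsilon>" using elim by (simp add: good_def)
      have p: "\<epsilon> powr (1 - \<eta>) * \<epsilon> powr \<eta> = \<epsilon>" using e by (simp add: powr_add[symmetric])
      have "\<epsilon> powr (1 - \<eta>) * (\<epsilon> powr \<eta> * integral {0..T} (c \<epsilon> 2)) \<le> \<epsilon> powr (1 - \<eta>) * C3"
        by (intro mult_left_mono I2[OF elim]) auto
      thus ?case unfolding mult.assoc[symmetric] p using e I2_nonneg[OF elim] by simp
    qed
  qed
  \<comment> \<open>The dimers again cost \<open>\<epsilon> powr (- \<eta>)\<close>, but they grow at a rate of order \<open>\<epsilon> powr ra\<close>: this is
    where \<open>\<eta> < ra\<close> is decisive.\<close>
  have entry_lim: "((\<lambda>\<epsilon>. integral {0..T} (bd_system.entry_flux (ae \<epsilon>) (be \<epsilon>) (u \<epsilon>) (c \<epsilon>))) \<longlongrightarrow> 0) (at_right 0)"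
  proof (rule Lim_null_comparison)
    let ?B = "\<lambda>\<epsilon>. exp (3 * z) * (\<epsilon> powr (1 - ra) * E + Q \<epsilon>) + \<epsilon> powr (ra - \<eta>) * (2 * (C2 * Mm * C3))"
    have "(?B \<longlongrightarrow> exp (3 * z) * (0 * E + 0) + 0 * (2 * (C2 * Mm * C3))) (at_right 0)"
      by (intro tendsto_intros powr_lim Q_lim) (use eta_ra exponents in auto)
    thus "(?B \<longlongrightarrow> 0) (at_right 0)" by simp
    have ev: "\<forall>\<^sub>F \<epsilon> in at_right 0. 2 * \<epsilon> < min d5 d6"
      unfolding eventually_at_right_field using d5(1) d6(1) by (intro exI[of _ "min d5 d6 / 2"]) auto
    show "\<forall>\<^sub>F \<epsilon> in at_right 0. norm (integral {0..T} (bd_system.entry_flux (ae \<epsilon>) (be \<epsilon>) (u \<epsilon>) (c \<epsilon>))) \<le> ?B \<epsilon>"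
      using good_ev ev
    proof eventually_elim
      case (elim \<epsilon>)
      have e: "0 < \<epsilon>" using elim by (simp add: good_def)
      interpret B: bd_system \<eta> \<epsilon> "\<alpha>e \<epsilon>" "\<beta>e \<epsilon>" "ae \<epsilon>" "be \<epsilon>" "u \<epsilon>" "c \<epsilon>" "me \<epsilon>" Ka Kb by (rule sys[OF e])
      have nn: "0 \<le> integral {0..T} B.entry_flux"
        by (rule integral_nonneg[OF B.entry_flux_integrable]) (use B.entry_flux_nonneg in auto)
      have p: "\<epsilon> powr ra = \<epsilon> powr (ra - \<eta>) * \<epsilon> powr \<eta>" using e by (simp add: powr_add[symmetric])
      have "ae \<epsilon> 2 * Mm * integral {0..T} (c \<epsilon> 2) \<le> (C2 * \<epsilon> powr ra) * Mm * integral {0..T} (c \<epsilon> 2)"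
        by (intro mult_right_mono a2 e elim(2) I2_nonneg elim(1)) (use Mm0 in auto)
      also have "\<dots> = \<epsilon> powr (ra - \<eta>) * (C2 * Mm * (\<epsilon> powr \<eta> * integral {0..T} (c \<epsilon> 2)))" unfolding p by (simp only: mult_ac)
      also have "\<dots> \<le> \<epsilon> powr (ra - \<eta>) * (C2 * Mm * C3)"
        by (intro mult_left_mono I2 elim(1)) (use Mm0 exponents in \<open>auto simp: C2_def\<close>)
      finally show ?case using entry_le[OF elim(1)] nn by simp
    qed
  qed
  have e_filter: "filterlim e (at_right 0) sequentially"
    by (rule tendsto_imp_filterlim_at_right[OF e_lim]) (use e_pos in auto)
  have "\<forall>\<^sub>F n in sequentially. good (e n)" using e_filter good_ev unfolding filterlim_iff by blast
  then obtain n0 where n0: "\<And>n. n0 \<le> n \<Longrightarrow> good (e n)" unfolding eventually_sequentially by blast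
  define e0 where "e0 n = e (n + n0)" for n
  have e0_filter: "filterlim e0 (at_right 0) sequentially"
    unfolding e0_def by (rule filterlim_compose[OF e_filter filterlim_add_const_nat_at_top])
  have e0_good: "good (e0 n)" for n by (simp add: e0_def n0)
  have c2_int: "integrable (lebesgue_on {0..T}) (\<lambda>t. e0 n * c (e0 n) 2 t)"
    and c2_eq: "(\<integral>t. norm (e0 n * c (e0 n) 2 t) \<partial>lebesgue_on {0..T}) = e0 n * integral {0..T} (c (e0 n) 2)" for n
  proof -
    have e: "0 < e0 n" using e0_good[of n] by (simp add: good_def)
    interpret B: bd_system \<eta> "e0 n" "\<alpha>e (e0 n)" "\<beta>e (e0 n)" "ae (e0 n)" "be (e0 n)" "u (e0 n)" "c (e0 n)" "me (e0 n)" Ka Kb by (rule sys[OF e])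
    have "continuous_on {0..T} (\<lambda>t. e0 n * c (e0 n) 2 t)"
      by (intro continuous_intros continuous_on_subset[OF B.c_continuous]) auto
    thus I: "integrable (lebesgue_on {0..T}) (\<lambda>t. e0 n * c (e0 n) 2 t)" by (rule continuous_imp_integrable_real)
    have "(\<integral>t. norm (e0 n * c (e0 n) 2 t) \<partial>lebesgue_on {0..T}) = (\<integral>t. e0 n * c (e0 n) 2 t \<partial>lebesgue_on {0..T})"
      by (rule Bochner_Integration.integral_cong[OF refl]) (use e B.c_nonneg in \<open>auto simp: space_restrict_space abs_mult\<close>)
    also have "\<dots> = integral {0..T} (\<lambda>t. e0 n * c (e0 n) 2 t)" by (rule lebesgue_integral_eq_integral[OF I]) simp
    finally show "(\<integral>t. norm (e0 n * c (e0 n) 2 t) \<partial>lebesgue_on {0..T}) = e0 n * integral {0..T} (c (e0 n) 2)" by simp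
  qed
  \<comment> \<open>Convergence in the mean gives convergence for almost every time along a subsequence.\<close>
  have "(\<lambda>n. \<integral>t. norm (e0 n * c (e0 n) 2 t) \<partial>lebesgue_on {0..T}) \<longlonglongrightarrow> 0"
    unfolding c2_eq by (rule filterlim_compose[OF dimer_lim e0_filter])
  from tendsto_L1_AE_subseq[OF c2_int this] obtain r0 where r0: "strict_mono (r0 :: nat \<Rightarrow> nat)"
    and dimers: "AE t in lebesgue_on {0..T}. (\<lambda>n. e0 (r0 n) * c (e0 (r0 n)) 2 t) \<longlonglongrightarrow> 0" by blast
  define e1 where "e1 n = e0 (r0 n)" for n
  have e1_filter: "filterlim e1 (at_right 0) sequentially"
    unfolding e1_def by (rule filterlim_compose[OF e0_filter filterlim_subseq[OF r0]])
  have e1_lim: "e1 \<longlonglongrightarrow> 0" using e1_filter by (simp add: filterlim_at)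
  have e1_good: "good (e1 n)" for n by (simp add: e1_def e0_good)
  have e1: "0 < e1 n" "e1 n \<le> 1" for n using e1_good[of n] by (auto simp: good_def)
  have sup: "\<exists>R. \<forall>n t. t \<in> {0..T} \<longrightarrow> (\<Sum>i. if R < e1 n * real (i + 2) then e1 n * c (e1 n) (i + 2) t * (e1 n * real (i + 2)) else 0) \<le> \<delta>
     \<and> (\<Sum>i. if R < e1 n * real (i + 3) then e1 n * c (e1 n) (i + 3) t * (e1 n * real (i + 3)) else 0) \<le> \<delta>" if \<delta>: "0 < \<delta>" for \<delta>
  proof -
    define K where "K = (H1 + 1) / \<delta>"
    have K: "0 < K" using \<delta> H1_nonneg by (simp add: K_def)
    obtain R where R: "1 \<le> R" "\<And>x. R \<le> x \<Longrightarrow> K * x \<le> \<Phi> x" using U_class_superlinear[OF \<Phi>, of K] by blast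
    have le: "x \<le> 1 / K * (1 + \<Phi> x)" if "0 \<le> x" "R < x" for x
    proof -
      have "K * x \<le> 1 + \<Phi> x" using R(2)[of x] that by simp
      thus ?thesis using K by (simp add: field_simps)
    qed
    have K1: "0 \<le> 1 / K" "1 / K * H1 \<le> \<delta>" using K \<delta> H1_nonneg by (auto simp: K_def field_simps)
    show ?thesis
    proof (intro exI[of _ R] allI impI)
      fix n t assume t: "t \<in> {0..T}"
      interpret B: bd_system \<eta> "e1 n" "\<alpha>e (e1 n)" "\<beta>e (e1 n)" "ae (e1 n)" "be (e1 n)" "u (e1 n)" "c (e1 n)" "me (e1 n)" Ka Kb by (rule sys[OF e1(1)])
      have t0: "0 \<le> t" using t by auto
      note W = B.weighted_bound_consequences(2,3)[where \<delta> = "1 / K" and R = R, OF t0 \<Phi>0 H1[OF e1_good t] le K1(1)]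
      show "(\<Sum>i. if R < e1 n * real (i + 2) then e1 n * c (e1 n) (i + 2) t * (e1 n * real (i + 2)) else 0) \<le> \<delta>
       \<and> (\<Sum>i. if R < e1 n * real (i + 3) then e1 n * c (e1 n) (i + 3) t * (e1 n * real (i + 3)) else 0) \<le> \<delta>"
        using order_trans[OF W(1) K1(2)] order_trans[OF W(2) K1(2)] by blast
    qed
  qed
  have Mbound: "(\<Sum>i<N. e1 n * c (e1 n) (i + 2) 0) \<le> H0" for n N
  proof (rule order_trans[OF _ H0[OF e1_good, of n N]], rule sum_mono)
    fix i
    have "0 \<le> e1 n * c (e1 n) (i + 2) 0" using c0[OF e1(1), of "i+2" 0 n] e1(1)[of n] by simp
    moreover have "0 \<le> \<Phi> (e1 n * real (i + 2))" by (rule \<Phi>0) (use e1(1)[of n] in simp)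
    ultimately have "0 \<le> e1 n * c (e1 n) (i + 2) 0 * \<Phi> (e1 n * real (i + 2))" by (rule mult_nonneg_nonneg)
    thus "e1 n * c (e1 n) (i + 2) 0 \<le> e1 n * (1 + \<Phi> (e1 n * real (i + 2))) * c (e1 n) (i + 2) 0" by (simp add: algebra_simps)
  qed
  have init2: "(\<lambda>n. \<Sum>i. e1 n * c (e1 n) (i + 2) 0 * g (e1 n * real (i + 2))) \<longlonglongrightarrow> (\<integral>x. g x \<partial>\<mu>in)" if g: "g \<in> Cc" for g
  proof (rule atoms_limit_of_density_limit[where c = "\<lambda>n i. c (e1 n) i 0", OF e1 e1_lim _ Mbound g])
    show "0 \<le> c (e1 n) i 0" if "2 \<le> i" for n i by (rule c0[OF e1(1) that]) simp
    have "((\<lambda>\<epsilon>. \<integral>x. g x \<partial>density_measure (f \<epsilon> 0)) \<longlongrightarrow> (\<integral>x. g x \<partial>\<mu>in)) (at_right 0)"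
      using lim_fin g by (simp add: weak_star_Mf_def)
    from filterlim_compose[OF this e1_filter]
    show "(\<lambda>n. \<integral>x. g x \<partial>density_measure (step_fun 2 (e1 n) (\<lambda>i. c (e1 n) i 0))) \<longlonglongrightarrow> (\<integral>x. g x \<partial>\<mu>in)" by (simp add: f_def)
  qed
  have first: "(\<lambda>n. \<Sum>i. e1 n * c (e1 n) (i + 2) 0 * (e1 n * real (i + 2))) \<longlonglongrightarrow> (\<integral>x. x \<partial>\<mu>in)"
  proof (rule first_moment_limit(2)[where C = Mm, OF _ _ _ _ muin init2])
    show "0 \<le> e1 n * c (e1 n) (i + 2) 0" for n i using c0[OF e1(1), of "i+2" 0 n] e1(1)[of n] by simp
    show "0 \<le> e1 n * real (i + 2)" for n i using e1(1)[of n] by simp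
    fix n
    interpret B: bd_system \<eta> "e1 n" "\<alpha>e (e1 n)" "\<beta>e (e1 n)" "ae (e1 n)" "be (e1 n)" "u (e1 n)" "c (e1 n)" "me (e1 n)" Ka Kb by (rule sys[OF e1(1)])
    have eq: "e1 n * c (e1 n) (i + 2) 0 * (e1 n * real (i + 2)) = (e1 n)\<^sup>2 * real (i + 2) * c (e1 n) (i + 2) 0" for i
      by (simp add: power2_eq_square mult_ac)
    show "summable (\<lambda>i. e1 n * c (e1 n) (i + 2) 0 * (e1 n * real (i + 2)))" unfolding eq by (rule B.mass_summable) simp
    show "(\<Sum>i. e1 n * c (e1 n) (i + 2) 0 * (e1 n * real (i + 2))) \<le> Mm" unfolding eq
      using B.mass_le[of 0] me_le[OF e1_good[of n]] by simp
  next
    fix \<delta> :: real assume "0 < \<delta>"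
    from sup[OF this] show "\<exists>R. \<forall>n. (\<Sum>i. if R < e1 n * real (i + 2) then e1 n * c (e1 n) (i + 2) 0 * (e1 n * real (i + 2)) else 0) \<le> \<delta>"
      using T by force
  qed
  have m_lim: "(\<lambda>n. me (e1 n)) \<longlonglongrightarrow> m"
  proof -
    have "me (e1 n) = u (e1 n) 0 + (\<Sum>i. e1 n * c (e1 n) (i + 2) 0 * (e1 n * real (i + 2)))" for n
    proof -
      interpret B: bd_system \<eta> "e1 n" "\<alpha>e (e1 n)" "\<beta>e (e1 n)" "ae (e1 n)" "be (e1 n)" "u (e1 n)" "c (e1 n)" "me (e1 n)" Ka Kb by (rule sys[OF e1(1)])
      have "(\<Sum>i. e1 n * c (e1 n) (i + 2) 0 * (e1 n * real (i + 2))) = (\<Sum>i. (e1 n)\<^sup>2 * real (i + 2) * c (e1 n) (i + 2) 0)"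
        by (rule suminf_cong) (simp add: power2_eq_square mult_ac)
      thus ?thesis using B.mass_eq[of 0] by simp
    qed
    thus ?thesis unfolding m_def by (simp only:) (intro tendsto_add first filterlim_compose[OF lim_uin e1_filter])
  qed
  interpret L: bd_sequence \<eta> Ka Kb T M Mm \<Lambda> m uin v \<rho> e1 "\<lambda>n. \<alpha>e (e1 n)" "\<lambda>n. \<beta>e (e1 n)" "\<lambda>n. me (e1 n)"
    "\<lambda>n. ae (e1 n)" "\<lambda>n. be (e1 n)" "\<lambda>n. u (e1 n)" "\<lambda>n. c (e1 n)" a b \<mu>in
  proof (rule bd_sequence.intro)
    show "bd_system \<eta> (e1 n) (\<alpha>e (e1 n)) (\<beta>e (e1 n)) (ae (e1 n)) (be (e1 n)) (u (e1 n)) (c (e1 n)) (me (e1 n)) Ka Kb" for n by (rule sys[OF e1(1)])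
    show "bd_system.count_and_mass (e1 n) (c (e1 n)) t \<le> M" if "t \<in> {0..T}" for n t by (rule size[OF e1_good that])
    show "\<exists>R. \<forall>n. \<forall>t\<in>{0..T}. (\<Sum>i. if R < e1 n * real (i + 3) then e1 n * c (e1 n) (i + 3) t * (e1 n * real (i + 3)) else 0) \<le> \<delta>"
      if "0 < \<delta>" for \<delta> using sup[OF that] by blast
    show "(\<lambda>n. integral {0..T} (bd_system.entry_flux (ae (e1 n)) (be (e1 n)) (u (e1 n)) (c (e1 n)))) \<longlonglongrightarrow> 0"
      by (rule filterlim_compose[OF entry_lim e1_filter])
    show "AE t in lebesgue_on {0..T}. (\<lambda>n. e1 n * c (e1 n) 2 t) \<longlonglongrightarrow> 0" using dimers by (simp add: e1_def)
    show "\<forall>\<^sub>F n in sequentially. \<forall>i\<ge>3. e1 n * real i \<le> R \<longrightarrow> \<bar>ae (e1 n) i - a (e1 n * real i)\<bar> < \<delta>" if "0 < \<delta>" for R \<delta>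
    proof -
      have "uniform_limit {0..R} aeps a (at_right 0)" by (rule lim_a) auto
      hence "\<forall>\<^sub>F \<epsilon> in at_right 0. \<forall>x\<in>{0..R}. dist (aeps \<epsilon> x) (a x) < \<delta>" using that by (rule uniform_limitD)
      hence "\<forall>\<^sub>F n in sequentially. \<forall>x\<in>{0..R}. dist (aeps (e1 n) x) (a x) < \<delta>"
        by (rule eventually_compose_filterlim[OF _ e1_filter])
      thus ?thesis
      proof eventually_elim
        case (elim n)
        show ?case
        proof (intro allI impI)
          fix i :: nat assume i: "3 \<le> i" "e1 n * real i \<le> R"
          hence "dist (aeps (e1 n) (e1 n * real i)) (a (e1 n * real i)) < \<delta>" using elim e1(1)[of n] by auto
          thus "\<bar>ae (e1 n) i - a (e1 n * real i)\<bar> < \<delta>" using node_a[OF e1(1), of i n] i by (simp add: dist_real_def)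
        qed
      qed
    qed
    show "\<forall>\<^sub>F n in sequentially. \<forall>i\<ge>3. e1 n * real i \<le> R \<longrightarrow> \<bar>be (e1 n) i - b (e1 n * real i)\<bar> < \<delta>" if "0 < \<delta>" for R \<delta>
    proof -
      have "uniform_limit {0..R} beps b (at_right 0)" by (rule lim_b) auto
      hence "\<forall>\<^sub>F \<epsilon> in at_right 0. \<forall>x\<in>{0..R}. dist (beps \<epsilon> x) (b x) < \<delta>" using that by (rule uniform_limitD)
      hence "\<forall>\<^sub>F n in sequentially. \<forall>x\<in>{0..R}. dist (beps (e1 n) x) (b x) < \<delta>"
        by (rule eventually_compose_filterlim[OF _ e1_filter])
      thus ?thesis
      proof eventually_elim
        case (elim n)
        show ?case
        proof (intro allI impI)
          fix i :: nat assume i: "3 \<le> i" "e1 n * real i \<le> R"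
          hence "dist (beps (e1 n) (e1 n * real i)) (b (e1 n * real i)) < \<delta>" using elim e1(1)[of n] by auto
          thus "\<bar>be (e1 n) i - b (e1 n * real i)\<bar> < \<delta>" using node_b[OF e1(1), of i n] i by (simp add: dist_real_def)
        qed
      qed
    qed
    show "(\<lambda>n. bd_system.atoms (e1 n) (c (e1 n)) g 0) \<longlonglongrightarrow> (\<integral>x. g x \<partial>\<mu>in)" if g: "g \<in> Cc" for g
    proof -
      obtain B where B: "0 < B" "\<And>x. 0 \<le> x \<Longrightarrow> \<bar>g x\<bar> \<le> B" using Cc_bounded[OF g] by blast
      have nn: "0 \<le> e1 n * real i" for n i using e1(1)[of n] by simp
      have ecn: "0 \<le> e1 n * c (e1 n) (i + 2) 0" for n i using c0[OF e1(1), of "i+2" 0 n] e1(1)[of n] by simp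
      have eq: "bd_system.atoms (e1 n) (c (e1 n)) g 0 = (\<Sum>i. e1 n * c (e1 n) (i + 2) 0 * g (e1 n * real (i + 2))) - e1 n * c (e1 n) 2 0 * g (e1 n * 2)" for n
      proof -
        interpret B: bd_system \<eta> "e1 n" "\<alpha>e (e1 n)" "\<beta>e (e1 n)" "ae (e1 n)" "be (e1 n)" "u (e1 n)" "c (e1 n)" "me (e1 n)" Ka Kb by (rule sys[OF e1(1)])
        have "summable (\<lambda>i. e1 n * c (e1 n) (i + 2) 0)" by (rule summableI_nonneg_bounded[OF ecn Mbound])
        hence "summable (\<lambda>i. B * (e1 n * c (e1 n) (i + 2) 0))" by (rule summable_mult)
        hence "summable (\<lambda>i. e1 n * c (e1 n) (i + 2) 0 * g (e1 n * real (i + 2)))"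
        proof (rule summable_comparison_test')
          show "norm (e1 n * c (e1 n) (i + 2) 0 * g (e1 n * real (i + 2))) \<le> B * (e1 n * c (e1 n) (i + 2) 0)" for i
            using mult_left_mono[OF B(2)[OF nn] ecn[of n i], of n "i + 2"] ecn[of n i] by (simp add: abs_mult[of "_ * _" "g _"] mult.commute)
        qed
        from suminf_split_head[OF this] show ?thesis unfolding B.atoms_def by (simp add: numeral_eq_Suc)
      qed
      have "(\<lambda>n. e1 n * c (e1 n) 2 0 * g (e1 n * 2)) \<longlonglongrightarrow> 0"
      proof (rule Lim_null_comparison)
        have "((\<lambda>\<epsilon>. \<epsilon> powr (1 - ra)) \<longlongrightarrow> 0) (at_right 0)" by (rule powr_lim) (use exponents in simp)
        from tendsto_mult_left_zero[OF filterlim_compose[OF this e1_filter], of "exp (2 * z) * E * B"]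
        show "(\<lambda>n. e1 n powr (1 - ra) * (exp (2 * z) * E * B)) \<longlonglongrightarrow> 0" .
        show "\<forall>\<^sub>F n in sequentially. norm (e1 n * c (e1 n) 2 0 * g (e1 n * 2)) \<le> e1 n powr (1 - ra) * (exp (2 * z) * E * B)"
        proof (intro always_eventually allI)
          fix n
          have e2: "0 \<le> e1 n * c (e1 n) 2 0" using c0[OF e1(1), of 2 0 n] e1(1)[of n] by simp
          have "\<bar>e1 n * c (e1 n) 2 0\<bar> * \<bar>g (e1 n * 2)\<bar> \<le> (e1 n powr (1 - ra) * (exp (2 * z) * E)) * B"
            by (rule mult_mono) (use c2_init[OF e1(1)[of n]] e2 B(2)[of "e1 n * 2"] e1(1)[of n] E(1) in auto)
          thus "norm (e1 n * c (e1 n) 2 0 * g (e1 n * 2)) \<le> e1 n powr (1 - ra) * (exp (2 * z) * E * B)"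
            by (simp only: real_norm_def abs_mult[symmetric] mult.assoc)
        qed
      qed
      from tendsto_diff[OF init2[OF g] this] show ?thesis by (simp add: eq)
    qed
    show "(\<lambda>n. u (e1 n) 0) \<longlonglongrightarrow> uin" by (rule filterlim_compose[OF lim_uin e1_filter])
  qed (use e1_lim e1 T M0 me_le[OF e1_good] u_lip[OF e1_good] a(1) b(1) m_lim u_low[OF e1_good] v in auto)
  obtain r \<mu> where r: "strict_mono r" and sol': "N_solution a b \<rho> uin \<mu>in m T (\<lambda>u. 0) \<mu>"
    and ws: "weak_star_Linf_Mf T (\<lambda>k t. density_measure (step_fun 2 (e1 (r k)) (\<lambda>i. c (e1 (r k)) i t))) \<mu>"
    using L.limit_solution_exists by blast
  define s where "s k = r0 (r k) + n0" for k
  have "strict_mono s" using r r0 by (auto simp: s_def strict_mono_def)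
  moreover have "weak_star_Linf_Mf T (\<lambda>k t. density_measure (f (e (s k)) t)) \<mu>"
    using ws by (simp add: f_def e1_def e0_def s_def)
  ultimately show ?thesis using T(1) sol' by blast
qed

end
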